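(* Let $G$ be a split, connected, simply connected semisimple algebraic group of simply laced type over $\mathbf{R}$ with a fixed pinning, with simple roots indexed by $I$, and let $J\subset I$. If $P\in\mathcal{P}^J_{>0}$, then $\gamma_P=\{B\in\mathcal{B}_{>0}: B\subset P\}$ is homeomorphic to a (finite, possibly empty) product of copies of $\mathbf{R}_{>0}$.
   Context: Algebraic varieties over $\mathbf{R}$ are identified with their sets of $\mathbf{R}$-points, with the usual (real manifold) topology; subsets carry the subspace topology. Pinning: $B^+,B^-$ are opposed Borel subgroups of $G$ defined over $\mathbf{R}$ with unipotent radicals $U^+,U^-$; $T=B^+\cap B^-$ is a split maximal torus; $I$ is the finite set indexing the simple roots; for each $i\in I$ there are embeddings $x_i:\mathbf{R}\to U^+$, $y_i:\mathbf{R}\to U^-$ onto the root subgroups of the simple root and its negative, such that $\begin{pmatrix}1 & a \\ 0 & 1\end{pmatrix}\mapsto x_i(a)$, $\begin{pmatrix}1 & 0 \\ a & 1\end{pmatrix}\mapsto y_i(a)$, $\mathrm{diag}(c,c^{-1})\mapsto\alpha_i^\vee(c)$ (simple coroot) defines a homomorphism $SL_2(\mathbf{R})\to G$. Let $W$ be the Weyl group with simple reflections $s_i$ ($i\in I$) and longest element $w_0$, and fix a reduced expression $w_0=s_{i_1}\cdots s_{i_N}$. $U^-_{>0}=\{y_{i_1}(a_1)\cdots y_{i_N}(a_N): a_k\in\mathbf{R}_{>0}\}$ (independent of the reduced expression). $\mathcal{B}$ is the real flag manifold of $G$, i.e. the variety of Borel subgroups of $G$ defined over $\mathbf{R}$ (identified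 with $G/B^+$), and $\mathcal{B}_{>0}=\{u'B^+u'^{-1}: u'\in U^-_{>0}\}\subset\mathcal{B}$. $P_J^+$ is the subgroup of $G$ generated by $B^+$ and $\{y_j(a): j\in J, a\in\mathbf{R}\}$; $\mathcal{P}^J$ is the set of subgroups of $G$ that are $G$-conjugate to $P_J^+$; $\mathcal{P}^J_{>0}$ is the set of $P\in\mathcal{P}^J$ such that $\gamma_P$ is nonempty. *)

theory Defs
  imports
    "HOL-Analysis.Analysis"
    "HOL-Algebra.Solvable_Groups"
    "HOL-Algebra.Group_Action"
    "HOL-Computational_Algebra.Polynomial"
begin

text \<open>
  A linear algebraic group over the reals is a Zariski closed subgroup of some complex general
  linear group, cut out by polynomials with real coefficients; its set of real points consists of
  its elements with real entries. Geometric notions (connected, semisimple, torus, Borel subgroup,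
  root) refer to the complex points; everything concerning positivity and flag manifolds refers
  to the real points.
\<close>

section \<open>Linear algebraic groups\<close>

definition GL :: "(complex^'n^'n) monoid" where
  "GL = \<lparr>carrier = {A. invertible A}, mult = (**), one = mat 1\<rparr>"

abbreviation grp :: "(complex^'n^'n) set \<Rightarrow> (complex^'n^'n) monoid" where
  "grp H \<equiv> GL\<lparr>carrier := H\<rparr>"

lemma group_GL: "group GL"
proof (rule groupI)
  fix A :: "complex^'n^'n" assume "A \<in> carrier GL"
  then obtain B where "A ** B = mat 1" "B ** A = mat 1"
    by (auto simp: GL_def invertible_def)
  then show "\<exists>B\<in>carrier GL. B \<otimes>\<^bsub>GL\<^esub> A = \<one>\<^bsub>GL\<^esub>"
    by (auto simp: GL_def invertible_def)
qed (auto simp: GL_def invertible_mult matrix_mul_assoc invertible_def[of "mat 1"])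

definition conj_set :: "complex^'n^'n \<Rightarrow> (complex^'n^'n) set \<Rightarrow> (complex^'n^'n) set" where
  "conj_set g H = (\<lambda>h. g ** h ** matrix_inv g) ` H"

text \<open>Polynomial functions of the matrix entries, with coefficients in \<open>K\<close>.\<close>

inductive_set polyfun :: "complex set \<Rightarrow> (complex^'n^'n \<Rightarrow> complex) set" for K where
  const: "c \<in> K \<Longrightarrow> (\<lambda>_. c) \<in> polyfun K"
| coord: "(\<lambda>A. A $ i $ j) \<in> polyfun K"
| add: "p \<in> polyfun K \<Longrightarrow> q \<in> polyfun K \<Longrightarrow> (\<lambda>A. p A + q A) \<in> polyfun K"
| mult: "p \<in> polyfun K \<Longrightarrow> q \<in> polyfun K \<Longrightarrow> (\<lambda>A. p A * q A) \<in> polyfun K"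

text \<open>Closed subsets of the general linear group, not of the space of all matrices. With
  \<open>K = \<real>\<close> this says that the subset is defined over the reals.\<close>

definition zariski_closed :: "complex set \<Rightarrow> (complex^'n^'n) set \<Rightarrow> bool" where
  "zariski_closed K Z \<longleftrightarrow>
     (\<exists>S \<subseteq> polyfun K. Z = {A. invertible A \<and> (\<forall>p\<in>S. p A = 0)})"

definition zariski_connected :: "(complex^'n^'n) set \<Rightarrow> bool" where
  "zariski_connected H \<longleftrightarrow>
     \<not> (\<exists>Y Z. zariski_closed UNIV Y \<and> zariski_closed UNIV Z \<and>
            Y \<noteq> {} \<and> Z \<noteq> {} \<and> Y \<inter> Z = {} \<and> Y \<union> Z = H)"

definition closed_subgroup :: "(complex^'n^'n) set \<Rightarrow> bool" where
  "closed_subgroup H \<longleftrightarrow> subgroup H GL \<and> zariski_closed UNIV H"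

definition algebraic_group_over_reals :: "(complex^'n^'n) set \<Rightarrow> bool" where
  "algebraic_group_over_reals G \<longleftrightarrow> subgroup G GL \<and> zariski_closed \<real> G"

definition real_points :: "(complex^'n^'n) set \<Rightarrow> (complex^'n^'n) set" where
  "real_points H = {A\<in>H. \<forall>i j. A $ i $ j \<in> \<real>}"

definition regular_on :: "(complex^'n^'n) set \<Rightarrow> (complex^'n^'n \<Rightarrow> complex) \<Rightarrow> bool" where
  "regular_on H f \<longleftrightarrow> (\<exists>p\<in>polyfun UNIV. \<exists>k::nat. \<forall>A\<in>H. f A = p A / det A ^ k)"

text \<open>The power of a matrix is written as an iterate, since \<open>^\<close> on vectors is componentwise.\<close>

definition unipotent :: "complex^'n^'n \<Rightarrow> bool" where
  "unipotent A \<longleftrightarrow> (\<exists>k. (((**) (A - mat 1)) ^^ k) (mat 1) = 0)"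

definition semisimple :: "(complex^'n^'n) set \<Rightarrow> bool" where
  "semisimple G \<longleftrightarrow> closed_subgroup G \<and> zariski_connected G \<and>
     (\<forall>N. closed_subgroup N \<and> zariski_connected N \<and> N \<lhd> grp G \<and> solvable (grp N)
        \<longrightarrow> N = {mat 1})"

definition torus :: "(complex^'n^'n) set \<Rightarrow> bool" where
  "torus T \<longleftrightarrow> closed_subgroup T \<and> zariski_connected T \<and>
     (\<exists>g. invertible g \<and> (\<forall>A\<in>conj_set g T. \<forall>i j. i \<noteq> j \<longrightarrow> A $ i $ j = 0))"

definition split_torus :: "(complex^'n^'n) set \<Rightarrow> bool" where
  "split_torus T \<longleftrightarrow> torus T \<and> zariski_closed \<real> T \<and>
     (\<exists>g\<in>real_points {g. invertible g}. \<forall>A\<in>conj_set g T. \<forall>i j. i \<noteq> j \<longrightarrow> A $ i $ j = 0)"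

definition maximal_torus :: "(complex^'n^'n) set \<Rightarrow> (complex^'n^'n) set \<Rightarrow> bool" where
  "maximal_torus G T \<longleftrightarrow> torus T \<and> T \<subseteq> G \<and>
     (\<forall>T'. torus T' \<and> T \<subseteq> T' \<and> T' \<subseteq> G \<longrightarrow> T' = T)"

definition split_group :: "(complex^'n^'n) set \<Rightarrow> bool" where
  "split_group G \<longleftrightarrow> (\<exists>T. maximal_torus G T \<and> split_torus T)"

definition borel_subgroup :: "(complex^'n^'n) set \<Rightarrow> (complex^'n^'n) set \<Rightarrow> bool" where
  "borel_subgroup G B \<longleftrightarrow>
     (let csolv = (\<lambda>H. closed_subgroup H \<and> zariski_connected H \<and> solvable (grp H) \<and> H \<subseteq> G)
      in csolv B \<and> (\<forall>B'. csolv B' \<and> B \<subseteq> B' \<longrightarrow> B' = B))"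

text \<open>There is a largest connected closed normal unipotent subgroup; the union below is it.\<close>

definition unipotent_radical :: "(complex^'n^'n) set \<Rightarrow> (complex^'n^'n) set" where
  "unipotent_radical H =
     \<Union>{N. closed_subgroup N \<and> zariski_connected N \<and> N \<lhd> grp H \<and> (\<forall>A\<in>N. unipotent A)}"

text \<open>Tangent space at the identity: common kernel of the differentials of the polynomials
  vanishing on the group.\<close>

definition lie_algebra :: "(complex^'n^'n) set \<Rightarrow> (complex^'n^'n) set" where
  "lie_algebra H = {X. \<forall>p\<in>polyfun UNIV. (\<forall>A\<in>H. p A = 0) \<longrightarrow>
     frechet_derivative p (at (mat 1)) X = 0}"


section \<open>Roots and coroots\<close>

definition Gm :: "complex monoid" where
  "Gm = \<lparr>carrier = - {0}, mult = (*), one = 1\<rparr>"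

text \<open>Characters are made extensional so that equal characters are equal as functions. The group
  is written multiplicatively: the character usually denoted \<open>\<beta> - m\<alpha>\<close> is \<open>\<beta> \<otimes> \<alpha> [^] (- m)\<close>.\<close>

definition character_group :: "(complex^'n^'n) set \<Rightarrow> (complex^'n^'n \<Rightarrow> complex) monoid" where
  "character_group T =
     \<lparr>carrier = {\<psi> \<in> hom (grp T) Gm \<inter> extensional T. regular_on T \<psi>},
      mult = (\<lambda>\<phi> \<psi>. \<lambda>t\<in>T. \<phi> t * \<psi> t),
      one = (\<lambda>t\<in>T. 1)\<rparr>"

text \<open>Cocharacters have Laurent polynomials as matrix entries.\<close>

definition cocharacter_group :: "(complex^'n^'n) set \<Rightarrow> (complex \<Rightarrow> complex^'n^'n) monoid" where
  "cocharacter_group T =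
     \<lparr>carrier = {l \<in> hom Gm (grp T) \<inter> extensional (- {0}).
        \<forall>i j. \<exists>p::complex poly. \<exists>k::nat. \<forall>c. c \<noteq> 0 \<longrightarrow> l c $ i $ j = poly p c / c ^ k},
      mult = (\<lambda>l m. \<lambda>c\<in>- {0}. l c ** m c),
      one = (\<lambda>c\<in>- {0}. mat 1)\<rparr>"

definition pairing :: "(complex^'n^'n \<Rightarrow> complex) \<Rightarrow> (complex \<Rightarrow> complex^'n^'n) \<Rightarrow> int" where
  "pairing \<psi> l = (THE m::int. \<forall>c. c \<noteq> 0 \<longrightarrow> \<psi> (l c) = c powi m)"

definition root_space ::
  "(complex^'n^'n) set \<Rightarrow> (complex^'n^'n) set \<Rightarrow> (complex^'n^'n \<Rightarrow> complex) \<Rightarrow> (complex^'n^'n) set"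
  where
  "root_space G T \<alpha> =
     {X\<in>lie_algebra G. \<forall>t\<in>T. t ** X ** matrix_inv t = (\<chi> i j. \<alpha> t * X $ i $ j)}"

definition roots ::
  "(complex^'n^'n) set \<Rightarrow> (complex^'n^'n) set \<Rightarrow> (complex^'n^'n \<Rightarrow> complex) set" where
  "roots G T = {\<alpha>\<in>carrier (character_group T).
     \<alpha> \<noteq> \<one>\<^bsub>character_group T\<^esub> \<and> (\<exists>X\<in>root_space G T \<alpha>. X \<noteq> 0)}"

definition positive_roots ::
  "(complex^'n^'n) set \<Rightarrow> (complex^'n^'n) set \<Rightarrow> (complex^'n^'n) set \<Rightarrow> (complex^'n^'n \<Rightarrow> complex) set"
  where
  "positive_roots G T B = {\<alpha>\<in>roots G T. root_space G T \<alpha> \<subseteq> lie_algebra B}"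

definition simple_roots ::
  "(complex^'n^'n) set \<Rightarrow> (complex^'n^'n) set \<Rightarrow> (complex^'n^'n) set \<Rightarrow> (complex^'n^'n \<Rightarrow> complex) set"
  where
  "simple_roots G T B = {\<alpha>\<in>positive_roots G T B.
     \<not> (\<exists>\<beta>\<in>positive_roots G T B. \<exists>\<gamma>\<in>positive_roots G T B. \<alpha> = \<beta> \<otimes>\<^bsub>character_group T\<^esub> \<gamma>)}"

text \<open>For semisimple groups the roots span the character group up to finite index, so the coroot
  of a root is uniquely determined by the following conditions.\<close>

definition is_coroot ::
  "(complex^'n^'n) set \<Rightarrow> (complex^'n^'n) set \<Rightarrow> (complex^'n^'n \<Rightarrow> complex)
     \<Rightarrow> (complex \<Rightarrow> complex^'n^'n) \<Rightarrow> bool" where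
  "is_coroot G T \<alpha> l \<longleftrightarrow> l \<in> carrier (cocharacter_group T) \<and> pairing \<alpha> l = 2 \<and>
     (\<forall>\<beta>\<in>roots G T.
        \<beta> \<otimes>\<^bsub>character_group T\<^esub> (\<alpha> [^]\<^bsub>character_group T\<^esub> (- pairing \<beta> l)) \<in> roots G T)"

definition is_root_subgroup ::
  "(complex^'n^'n) set \<Rightarrow> (complex^'n^'n) set \<Rightarrow> (complex^'n^'n \<Rightarrow> complex)
     \<Rightarrow> (complex^'n^'n) set \<Rightarrow> bool" where
  "is_root_subgroup G T \<alpha> U \<longleftrightarrow> closed_subgroup U \<and> zariski_connected U \<and> U \<subseteq> G \<and>
     (\<forall>t\<in>T. conj_set t U = U) \<and> lie_algebra U = root_space G T \<alpha>"

definition simply_connected_group :: "(complex^'n^'n) set \<Rightarrow> (complex^'n^'n) set \<Rightarrow> bool" where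
  "simply_connected_group G T \<longleftrightarrow>
     generate (cocharacter_group T) {l. \<exists>\<alpha>\<in>roots G T. is_coroot G T \<alpha> l}
       = carrier (cocharacter_group T)"

definition simply_laced_group ::
  "(complex^'n^'n) set \<Rightarrow> (complex^'n^'n) set \<Rightarrow> (complex^'n^'n) set \<Rightarrow> bool" where
  "simply_laced_group G T B \<longleftrightarrow>
     (\<forall>\<alpha>\<in>simple_roots G T B. \<forall>\<beta>\<in>simple_roots G T B. \<forall>l.
        \<alpha> \<noteq> \<beta> \<and> is_coroot G T \<beta> l \<longrightarrow> pairing \<alpha> l \<in> {0, -1})"


section \<open>Pinnings\<close>

definition SL2R :: "(real^2^2) monoid" where
  "SL2R = \<lparr>carrier = {A. det A = 1}, mult = (**), one = mat 1\<rparr>"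

text \<open>\<open>\<alpha> i\<close> and \<open>\<alpha>v i\<close> are the simple root and the simple coroot with index \<open>i\<close>.
  \<open>x i\<close> and \<open>y i\<close> are polynomial parametrizations of the real points of the root subgroups; their
  additivity is part of the existence of the homomorphism from the special linear group.\<close>

locale pinning =
  fixes G Bp Bm T :: "(complex^'n^'n) set"
    and I :: "'i set"
    and \<alpha> :: "'i \<Rightarrow> complex^'n^'n \<Rightarrow> complex"
    and \<alpha>v :: "'i \<Rightarrow> complex \<Rightarrow> complex^'n^'n"
    and x y :: "'i \<Rightarrow> real \<Rightarrow> complex^'n^'n"
  assumes borel_Bp: "borel_subgroup G Bp" "zariski_closed \<real> Bp"
    and borel_Bm: "borel_subgroup G Bm" "zariski_closed \<real> Bm"
    and T_eq: "T = Bp \<inter> Bm"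
    and maximal_torus_T: "maximal_torus G T"
    and split_T: "split_torus T"
    and finite_I: "finite I"
    and simple_roots_index: "bij_betw \<alpha> I (simple_roots G T Bp)"
    and simple_coroots: "i \<in> I \<Longrightarrow> is_coroot G T (\<alpha> i) (\<alpha>v i)"
    and polynomial_x: "i \<in> I \<Longrightarrow> \<exists>p::real poly. \<forall>a. x i a $ j $ k = of_real (poly p a)"
    and polynomial_y: "i \<in> I \<Longrightarrow> \<exists>p::real poly. \<forall>a. y i a $ j $ k = of_real (poly p a)"
    and x_in_radical: "i \<in> I \<Longrightarrow> x i a \<in> real_points (unipotent_radical Bp)"
    and y_in_radical: "i \<in> I \<Longrightarrow> y i a \<in> real_points (unipotent_radical Bm)"
    and x_onto: "i \<in> I \<Longrightarrow>
      \<exists>U. is_root_subgroup G T (\<alpha> i) U \<and> bij_betw (x i) UNIV (real_points U)"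
    and y_onto: "i \<in> I \<Longrightarrow>
      \<exists>U. is_root_subgroup G T (inv\<^bsub>character_group T\<^esub> (\<alpha> i)) U \<and>
          bij_betw (y i) UNIV (real_points U)"
    and SL2_hom: "i \<in> I \<Longrightarrow>
      \<exists>\<phi>\<in>hom SL2R (grp (real_points G)).
        (\<forall>a. \<phi> (vector [vector [1, a], vector [0, 1]]) = x i a) \<and>
        (\<forall>a. \<phi> (vector [vector [1, 0], vector [a, 1]]) = y i a) \<and>
        (\<forall>c. c \<noteq> 0 \<longrightarrow> \<phi> (vector [vector [c, 0], vector [0, inverse c]]) = \<alpha>v i (of_real c))"


section \<open>The Weyl group\<close>

definition weyl_group :: "(complex^'n^'n) set \<Rightarrow> (complex^'n^'n) set \<Rightarrow> (complex^'n^'n) set monoid"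
  where
  "weyl_group G T = grp (normalizer (grp G) T) Mod T"

text \<open>The coset of \<open>T\<close> in its normalizer that acts on \<open>T\<close>, hence on its characters, as the
  reflection in the root \<open>\<alpha>\<close> with coroot \<open>l\<close>.\<close>

definition reflection ::
  "(complex^'n^'n) set \<Rightarrow> (complex^'n^'n) set \<Rightarrow> (complex^'n^'n \<Rightarrow> complex)
     \<Rightarrow> (complex \<Rightarrow> complex^'n^'n) \<Rightarrow> (complex^'n^'n) set" where
  "reflection G T \<alpha> l =
     {n\<in>normalizer (grp G) T. \<forall>t\<in>T. n ** t ** matrix_inv n = t ** l (inverse (\<alpha> t))}"

definition word_product :: "'w monoid \<Rightarrow> ('i \<Rightarrow> 'w) \<Rightarrow> 'i list \<Rightarrow> 'w" where
  "word_product W s ws = foldr (\<lambda>i w. s i \<otimes>\<^bsub>W\<^esub> w) ws \<one>\<^bsub>W\<^esub>"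

definition word_length :: "'w monoid \<Rightarrow> 'i set \<Rightarrow> ('i \<Rightarrow> 'w) \<Rightarrow> 'w \<Rightarrow> nat" where
  "word_length W I s w = (LEAST n. \<exists>ws\<in>lists I. length ws = n \<and> word_product W s ws = w)"

definition is_longest :: "'w monoid \<Rightarrow> 'i set \<Rightarrow> ('i \<Rightarrow> 'w) \<Rightarrow> 'w \<Rightarrow> bool" where
  "is_longest W I s w0 \<longleftrightarrow> w0 \<in> carrier W \<and>
     (\<forall>w\<in>carrier W. word_length W I s w \<le> word_length W I s w0)"

definition reduced_expression :: "'w monoid \<Rightarrow> 'i set \<Rightarrow> ('i \<Rightarrow> 'w) \<Rightarrow> 'w \<Rightarrow> 'i list \<Rightarrow> bool" where
  "reduced_expression W I s w ws \<longleftrightarrow>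
     ws \<in> lists I \<and> word_product W s ws = w \<and> length ws = word_length W I s w"


section \<open>Flag manifolds and total positivity\<close>

text \<open>A Borel subgroup defined over the reals is represented by its group of real points.\<close>

definition flag_manifold :: "(complex^'n^'n) set \<Rightarrow> (complex^'n^'n) set set" where
  "flag_manifold G = {real_points B | B. borel_subgroup G B \<and> zariski_closed \<real> B}"

text \<open>The topology of the quotient of \<open>G\<close> by \<open>Bp\<close> (real points), transported along
  the orbit map \<open>g \<mapsto> g Bp g\<^sup>-\<^sup>1\<close>.\<close>

definition flag_topology ::
  "(complex^'n^'n) set \<Rightarrow> (complex^'n^'n) set \<Rightarrow> (complex^'n^'n) set topology" where
  "flag_topology G Bp = topology (\<lambda>\<U>. \<U> \<subseteq> flag_manifold G \<and>
     openin (top_of_set (real_points G)) {g\<in>real_points G. conj_set g (real_points Bp) \<in> \<U>})"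

lemma openin_flag_topology:
  "openin (flag_topology G Bp) \<U> \<longleftrightarrow> \<U> \<subseteq> flag_manifold G \<and>
     openin (top_of_set (real_points G)) {g\<in>real_points G. conj_set g (real_points Bp) \<in> \<U>}"
proof -
  let ?pre = "\<lambda>\<U>. {g\<in>real_points G. conj_set g (real_points Bp) \<in> \<U>}"
  have inter: "?pre (\<U> \<inter> \<V>) = ?pre \<U> \<inter> ?pre \<V>" for \<U> \<V> by auto
  have union: "?pre (\<Union>\<K>) = \<Union>(?pre ` \<K>)" for \<K> by auto
  have "istopology (\<lambda>\<U>. \<U> \<subseteq> flag_manifold G \<and> openin (top_of_set (real_points G)) (?pre \<U>))"
    unfolding istopology_def inter union by (auto intro!: openin_Union)
  then show ?thesis
    by (simp add: flag_topology_def)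
qed

text \<open>The set of products of the \<open>y i a\<close>, with \<open>i\<close> running through the word \<open>ws\<close> and \<open>a > 0\<close>.\<close>

definition U_pos :: "('i \<Rightarrow> real \<Rightarrow> complex^'n^'n) \<Rightarrow> 'i list \<Rightarrow> (complex^'n^'n) set" where
  "U_pos y ws = {foldr (\<lambda>(i, a) A. y i a ** A) (zip ws as) (mat 1) | as.
     length as = length ws \<and> (\<forall>a\<in>set as. a > 0)}"

definition flag_pos ::
  "(complex^'n^'n) set \<Rightarrow> ('i \<Rightarrow> real \<Rightarrow> complex^'n^'n) \<Rightarrow> 'i list \<Rightarrow> (complex^'n^'n) set set" where
  "flag_pos Bp y ws = {conj_set u (real_points Bp) | u. u \<in> U_pos y ws}"

definition standard_parabolic ::
  "(complex^'n^'n) set \<Rightarrow> ('i \<Rightarrow> real \<Rightarrow> complex^'n^'n) \<Rightarrow> 'i set \<Rightarrow> (complex^'n^'n) set" where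
  "standard_parabolic Bp y J = generate GL (real_points Bp \<union> {y j a | j a. j \<in> J})"

definition partial_flag_manifold ::
  "(complex^'n^'n) set \<Rightarrow> (complex^'n^'n) set \<Rightarrow> ('i \<Rightarrow> real \<Rightarrow> complex^'n^'n) \<Rightarrow> 'i set
     \<Rightarrow> (complex^'n^'n) set set" where
  "partial_flag_manifold G Bp y J =
     {conj_set g (standard_parabolic Bp y J) | g. g \<in> real_points G}"

definition pos_fibre ::
  "(complex^'n^'n) set \<Rightarrow> ('i \<Rightarrow> real \<Rightarrow> complex^'n^'n) \<Rightarrow> 'i list \<Rightarrow> (complex^'n^'n) set
     \<Rightarrow> (complex^'n^'n) set set" where
  "pos_fibre Bp y ws P = {B\<in>flag_pos Bp y ws. B \<subseteq> P}"

definition partial_flag_pos ::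
  "(complex^'n^'n) set \<Rightarrow> (complex^'n^'n) set \<Rightarrow> ('i \<Rightarrow> real \<Rightarrow> complex^'n^'n) \<Rightarrow> 'i list \<Rightarrow> 'i set
     \<Rightarrow> (complex^'n^'n) set set" where
  "partial_flag_pos G Bp y ws J =
     {P\<in>partial_flag_manifold G Bp y J. pos_fibre Bp y ws P \<noteq> {}}"

end

(* Coordinates on the fibre.  A reduced word for w0 is sorted against J as us @ vs with vs the part that can
   be moved into P; the fibre is then a left translate of the positive cell of vs.  The parameters of the
   cell are continuous functions of the flag, since they are roots of ratios of generalized minors
   D us, where om is the coefficient of the big cell extracted by a dominant one-parameter subgroup.
   The Cartan integers, the commutation of distinct x i and y j, and the action of the simple reflections
   on root subgroups come from the trace form, sl2-theory and the Lie--Kolchin theorem. *)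
theory Submission
  imports Defs "HOL-Complex_Analysis.Cauchy_Integral_Formula" "HOL-Computational_Algebra.Fundamental_Theorem_Algebra"
begin

text \<open>\<open>P\<close> is an arbitrary conjugate, so the word is sorted against a set
  \<open>K\<close> read off from one fibre point \<open>u0\<close>: a letter \<open>i\<close>
  belongs to \<open>K\<close> if \<open>y i\<close> lies in \<open>P\<close> conjugated by the
  inverse of \<open>u0\<close>. This splits \<open>u0\<close> into a head \<open>a0\<close> and a
  tail, and every other fibre point has the same head: two heads differ by an element
  \<open>c\<close> of the parabolic subgroup of \<open>K\<close>, so disjointness of Bruhat cells
  forces \<open>c\<close> into the Borel subgroup, and being negative unipotent it is trivial.

  Coordinates are read from a flag, that is from a coset of the normalizer \<open>NR\<close> of the
  real Borel group. Hence the functions used must be multiplied by a scalar under \<open>NR\<close>,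
  so that their ratios descend. They come from the defining matrix representation: block
  determinants along the socle filtration of the real Borel group, which is canonical and thus
  preserved by \<open>NR\<close>. Their product \<open>om0\<close> has strictly positive exponents
  \<open>M\<close> on the simple coroots. This lets a positive parameter be recovered as a root, and
  it enters the positive definiteness of the Cartan form and the choice of \<open>rho\<close> as
  well.\<close>

abbreviation "minv == matrix_inv"

section \<open>Root lattice of a simply laced Cartan matrix: inversions, reduced words, braid
  moves\<close>

locale cartan =
 fixes I :: "'i set" and a :: "'i => 'i => int" assumes fin_I: "finite I" and a_diag: "i:I ==> a i i = 2" and a_off: "i:I ==> j:I ==> i~=j ==> a i j = 0 | a i j = -1"
  and a_sym: "i:I ==> j:I ==> a i j = a j i" and a_pos: "k:I ==> v k~=0 ==> 0 < (SUM i:I. v i * (SUM j:I. a i j * v j))"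
begin

definition pr :: "'i => ('i => int) => int" where
 "pr i v = (SUM j:I. a i j * v j)"

definition refl :: "'i => ('i => int) => 'i => int" where
 "refl i v = v(i := v i - pr i v)"

definition act :: "'i list => ('i => int) => 'i => int" where
 "act ws v = foldr refl ws v"

definition form :: "('i => int) => ('i => int) => int" where
 "form u v = (SUM i:I. u i * pr i v)"

definition eps :: "'i => 'i => int" where
 "eps i = (%j. if j = i then 1 else 0)"

text \<open>In a simply laced root lattice the roots are exactly the vectors of norm 2. Taking this
  as the definition makes stability under reflections immediate and turns statements about roots
  into arithmetic of an even lattice.\<close>

definition rts :: "('i => int) set" where
 "rts = {v. (ALL i. i ~: I --> v i = 0) & form v v = 2}"

definition pos :: "('i => int) => bool" where "pos v \<longleftrightarrow> (ALL i. 0<=v i)"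
definition neg :: "('i => int) => bool" where "neg v \<longleftrightarrow> (ALL i. v i<=0)"

lemma act_Nil [simp]: "act [] v = v" by (simp add: act_def)
lemma act_Cons [simp]: "act (i # ws) v = refl i (act ws v)" by (simp add: act_def)
lemma act_append [simp]: "act (us @ vs) v = act us (act vs v)" by (simp add: act_def)

lemma pr_lin: "pr i (%k. c * u k + d * v k) = c * pr i u + d * pr i v" by (simp add: pr_def sum.distrib sum_distrib_left algebra_simps)

lemma refl_lin: "refl i (%k. c * u k + d * v k) = (%k. c * refl i u k + d * refl i v k)" by (auto simp: refl_def pr_lin algebra_simps)

lemma act_lin: "act ws (%k. c * u k + d * v k) = (%k. c * act ws u k + d * act ws v k)" by (induction ws) (simp_all add: refl_lin)

lemma act_add: "act ws (%k. u k + v k) = (%k. act ws u k + act ws v k)" using act_lin[of ws 1 u 1 v] by simp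

lemma act_uminus: "act ws (%k. - v k) = (%k. - act ws v k)" using act_lin[of ws "-1" v 0 v] by simp

lemma act_zero: "act ws (%k. 0) = (%k. 0)" using act_lin[of ws 0 "%_. 0" 0 "%_. 0"] by simp

lemma pr_eps: "i:I ==> j:I ==> pr i (eps j) = a i j" using fin_I by (simp add: pr_def eps_def if_distrib cong: if_cong)

lemma refl_eq: "refl i v = (%k. v k + (- pr i v) * eps i k)" by (auto simp: refl_def eps_def)

lemma form_sym: "form u v = form v u"
proof -
 have "form u v = (SUM i:I. SUM j:I. u i * (a i j * v j))" by (simp add: form_def pr_def sum_distrib_left)
 also have "... = (SUM j:I. SUM i:I. v j * (a j i * u i))" by (subst sum.swap) (auto intro!: sum.cong simp: a_sym algebra_simps)
 finally show ?thesis by (simp add: form_def pr_def sum_distrib_left)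
qed

lemma form_lin1: "form (%k. c * u k + d * v k) w = c * form u w + d * form v w" by (simp add: form_def sum.distrib sum_distrib_left algebra_simps)

lemma form_lin2: "form w (%k. c * u k + d * v k) = c * form w u + d * form w v" by (simp add: form_sym[of w] form_lin1)

lemma form_eps: "i:I ==> form (eps i) v = pr i v" using fin_I by (simp add: form_def eps_def if_distrib[of "%x. x * _"] cong: if_cong)

lemma form_refl: assumes "i:I" shows "form (refl i u) (refl i v) = form u v"
proof -
 have e: "form (eps i) (eps i) = 2" using assms by (simp add: form_eps pr_eps a_diag)
 have "form (refl i u) (refl i v)
   = form (%k. 1 * u k + (- pr i u) * eps i k) (%k. 1 * v k + (- pr i v) * eps i k)" by (simp add: refl_eq)
 also have "... = form u v" unfolding form_lin1 form_lin2 using assms e by (simp add: form_eps form_sym[of u "eps i"] algebra_simps)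
 finally show ?thesis .
qed

lemma form_act: "ws:lists I ==> form (act ws u) (act ws v) = form u v" by (induction ws) (auto simp: form_refl)

lemma pr_refl: "i:I ==> pr i (refl i v) = - pr i v" using pr_lin[of i 1 v "- pr i v" "eps i"] by (simp add: refl_eq pr_eps a_diag)

lemma pr_refl_gen: "i:I ==> j:I ==> pr j (refl i v) = pr j v - pr i v * a j i" using pr_lin[of j 1 v "- pr i v" "eps i"] by (simp add: refl_eq pr_eps)

lemma refl_app: "refl i v k = (if k = i then v i - pr i v else v k)" by (simp add: refl_def)

lemma refl_comm:
 "i:I ==> j:I ==> i~=j ==> a i j = 0 ==> refl i (refl j v) = refl j (refl i v)" using a_sym[of i j] by (simp add: fun_eq_iff refl_app pr_refl_gen)

lemma refl_triple: assumes "i:I" "j:I" "i~=j" "a i j = -1" shows "refl i (refl j (refl i v)) = refl j (refl i (refl j v))"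
 using assms a_sym[of i j] by (simp add: fun_eq_iff refl_app pr_refl_gen a_diag)

lemma refl_refl: "i:I ==> refl i (refl i v) = v" by (subst refl_def, subst pr_refl) (auto simp: refl_def)

lemma act_rev: "ws:lists I ==> act (rev ws) (act ws v) = v" by (induction ws arbitrary: v) (auto simp: refl_refl)

lemma act_rev': "ws:lists I ==> act ws (act (rev ws) v) = v" using act_rev[of "rev ws" v] by (simp add: in_lists_conv_set)

lemma act_rev_cong: assumes "us:lists I" "vs:lists I" "act us = act vs" shows "act (rev us) = act (rev vs)"
proof
 fix v
 have "act (rev us) v = act (rev us) (act vs (act (rev vs) v))" using assms(2) by (simp add: act_rev')
 thus "act (rev us) v = act (rev vs) v" using act_rev[OF assms(1), of "act (rev vs) v"] assms(3) by simp
qed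

lemma form_pos: "k:I ==> v k~=0 ==> 0 < form v v" using a_pos[of k v] by (simp add: form_def pr_def)

lemma even_sym_sum:
 fixes b :: "'i => 'i => int" assumes "finite S" "!!i j. i:S ==> j:S ==> b i j = b j i" "!!i. i:S ==> even (b i i)" shows "even (SUM i:S. SUM j:S. b i j)" using assms
proof (induction S rule: finite_induct)
 case (insert x F)
 have "(SUM i:F. b i x) = (SUM j:F. b x j)" using insert by (intro sum.cong) auto
 hence "(SUM i:insert x F. SUM j:insert x F. b i j)
   = b x x + 2 * (SUM j:F. b x j) + (SUM i:F. SUM j:F. b i j)" using insert by (simp add: sum.distrib)
 thus ?case using insert by simp
qed simp

text \<open>Off-diagonal terms occur twice by symmetry and diagonal ones carry the factor 2.
  Together with positivity this gives every nonzero vector norm at least 2, the gap on which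
  \<open>root_cases\<close> rests.\<close>

lemma form_even: "even (form v v)"
proof -
 have "form v v = (SUM i:I. SUM j:I. v i * (a i j * v j))" by (simp add: form_def pr_def sum_distrib_left)
 thus ?thesis using even_sym_sum[OF fin_I, of "%i j. v i * (a i j * v j)"] by (simp add: a_sym a_diag)
qed

text \<open>If the positive and the negative part of a root were both nonzero, the root would have
 norm at least \<open>2 + 2\<close>.\<close>

lemma root_cases: assumes "v:rts" shows "pos v | neg v"
proof (rule ccontr)
 assume "~ ?thesis"
 then obtain i j where ij: "v i < 0" "v j > 0" by (auto simp: pos_def neg_def not_le)
 hence iI: "i:I" "j:I" using assms by (auto simp: rts_def)
 define p where "p = (%k. max (v k) 0)"
 define q where "q = (%k. max (- v k) 0)"
 have v: "v = (%k. 1 * p k + (-1) * q k)" by (auto simp: p_def q_def max_def)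
 have "form p p >= 2" using ij iI form_pos[of j p] by (intro zdvd_imp_le form_even) (simp add: p_def)
 moreover have "form q q >= 2" using ij iI form_pos[of i q] by (intro zdvd_imp_le form_even) (simp add: q_def)
 moreover have "form p q<=0"
 proof -
  have "p k * (a k l * q l)<=0" if "k:I" "l:I" for k l
  proof (cases "k = l")
   case True thus ?thesis by (auto simp: p_def q_def max_def)
  next
   case False
   hence "a k l<=0" using a_off[OF that] by auto
   moreover have "0<=p k" "0<=q l" by (auto simp: p_def q_def)
   ultimately show ?thesis by (simp add: mult_nonneg_nonpos mult_nonpos_nonneg)
  qed
  thus ?thesis by (simp add: form_def pr_def sum_distrib_left sum_nonpos)
 qed
 moreover have "form v v = form p p + form q q - 2 * form p q" by (subst (1 2) v, unfold form_lin1 form_lin2) (simp add: form_sym[of q p])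
 moreover have "form v v = 2" using assms by (simp add: rts_def)
 ultimately show False by linarith
qed

lemma rts_nonzero: "v:rts ==> ~ (pos v & neg v)"
proof
 assume v: "v:rts" and pn: "pos v & neg v"
 have "v = (%_. 0)" using pn by (auto simp: pos_def neg_def fun_eq_iff antisym)
 thus False using v by (simp add: rts_def form_def)
qed

lemma not_pos: "v:rts ==> ~ pos v \<longleftrightarrow> neg v" using root_cases rts_nonzero by blast

lemma eps_rts: "i:I ==> eps i:rts" by (auto simp: rts_def form_eps pr_eps a_diag) (auto simp: eps_def)

lemma eps_pos: "pos (eps i)" by (simp add: pos_def eps_def)

lemma refl_rts: "i:I ==> v:rts ==> refl i v:rts" using form_refl[of i v v] by (auto simp: rts_def refl_app)

lemma act_rts: "ws:lists I ==> v:rts ==> act ws v:rts" by (induction ws) (auto simp: refl_rts)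

lemma uminus_rts: "v:rts ==> (%k. - v k):rts" using form_lin1[of "-1" v 0 v "%k. - v k"] form_lin2[of v "-1" v 0 v] by (auto simp: rts_def)

lemma pos_uminus [simp]: "pos (%k. - v k) = neg v" "neg (%k. - v k) = pos v" by (auto simp: pos_def neg_def)

text \<open>The reflection changes only coordinate \<open>i\<close>, so a positive coordinate
  elsewhere survives and decides the sign of the image. A positive root supported on
  \<open>i\<close> alone has norm twice the square of its coefficient, hence is
  \<open>eps i\<close>.\<close>

lemma refl_pos: assumes "i:I" "v:rts" "pos v" "v~=eps i" shows "pos (refl i v)"
proof -
 have "EX j. j~=i & v j > 0"
 proof (rule ccontr)
  assume "~ ?thesis"
  hence z: "v j = 0" if "j~=i" for j using that assms(3) unfolding pos_def by (metis antisym not_le)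
  hence v: "v = (%k. v i * eps i k + 0 * eps i k)" by (auto simp: eps_def)
  have "form v v = v i * (v i * 2)" by (subst (1 2) v, unfold form_lin1 form_lin2)
    (use assms(1) in \<open>simp add: form_eps pr_eps a_diag\<close>)
  hence "v i * v i = 1" using assms(2) by (simp add: rts_def)
  moreover have "v i >= 0" using assms(3) by (simp add: pos_def)
  ultimately have "v i = 1" by (smt (verit) zmult_eq_1_iff)
  thus False using v assms(4) by simp
 qed
 then obtain j where "j~=i" "v j > 0" by auto
 hence "~ neg (refl i v)" by (auto simp: neg_def refl_def not_le)
 thus ?thesis using root_cases refl_rts assms by blast
qed

lemma refl_eps: "i:I ==> refl i (eps i) = (%k. - eps i k)" by (auto simp: refl_eq pr_eps a_diag)

definition inver :: "'i list => ('i => int) set" where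
 "inver ws = {v:rts. pos v & neg (act ws v)}"

text \<open>Since \<open>refl i\<close> permutes the positive roots other than \<open>eps i\<close>,
  a further letter \<open>i\<close> only transports the old inversions and decides about
  \<open>eps i\<close>.\<close>

lemma inver_snoc_pos: assumes "i:I" "ws:lists I" "pos (act ws (eps i))" shows "inver (ws @ [i]) = insert (eps i) (refl i ` inver ws)"
proof (intro equalityI subsetI)
 fix v assume v: "v:inver (ws @ [i])"
 show "v:insert (eps i) (refl i ` inver ws)"
 proof (cases "v = eps i")
  case False
  hence "refl i v:inver ws" using v assms refl_pos refl_rts by (auto simp: inver_def)
  thus ?thesis using refl_refl[OF assms(1), of v] by (metis image_eqI insertI2)
 qed simp
next
 fix v assume "v:insert (eps i) (refl i ` inver ws)"
 then consider "v = eps i" | u where "u:inver ws" "v = refl i u" by auto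
 thus "v:inver (ws @ [i])"
 proof cases
  case 1
  thus ?thesis using assms by (auto simp: inver_def eps_rts eps_pos refl_eps act_uminus)
 next
  case 2
  hence "u~=eps i" using assms rts_nonzero[of "act ws (eps i)"] act_rts eps_rts by (auto simp: inver_def)
  thus ?thesis using 2 assms by (auto simp: inver_def refl_rts refl_pos refl_refl)
 qed
qed

lemma inver_snoc_neg: assumes "i:I" "ws:lists I" "neg (act ws (eps i))" shows "inver (ws @ [i]) = refl i ` (inver ws - {eps i})" "eps i:inver ws"
proof -
 show "eps i:inver ws" using assms by (simp add: inver_def eps_rts eps_pos)
 show "inver (ws @ [i]) = refl i ` (inver ws - {eps i})"
 proof (intro equalityI subsetI)
  fix v assume v: "v:inver (ws @ [i])"
  have ne: "v~=eps i"
  proof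
   assume "v = eps i"
   hence "neg (%k. - act ws (eps i) k)" using v assms(1) by (auto simp: inver_def refl_eps act_uminus)
   thus False using assms rts_nonzero act_rts eps_rts by auto
  qed
  hence "refl i v:inver ws" using v assms refl_pos refl_rts by (auto simp: inver_def)
  moreover have "refl i v~=eps i"
  proof
   assume "refl i v = eps i"
   hence "v = (%k. - eps i k)" using refl_refl[OF assms(1), of v] refl_eps[OF assms(1)] by simp
   thus False using v eps_pos rts_nonzero[of v] by (auto simp: inver_def)
  qed
  ultimately show "v:refl i ` (inver ws - {eps i})" using refl_refl[OF assms(1), of v] by (metis Diff_iff image_eqI singletonD)
 next
  fix v assume "v:refl i ` (inver ws - {eps i})"
  thus "v:inver (ws @ [i])" using assms by (auto simp: inver_def refl_rts refl_pos refl_refl)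
 qed
qed

lemma refl_inj: "i:I ==> inj_on (refl i) S" by (metis inj_onI refl_refl)

lemma fin_inver: "ws:lists I ==> finite (inver ws)"
proof (induction ws rule: rev_induct)
 case Nil
 have "inver [] = {}" using rts_nonzero by (auto simp: inver_def)
 thus ?case by simp
next
 case (snoc i ws)
 hence i: "i:I" "ws:lists I" by auto
 thus ?case using snoc inver_snoc_pos[OF i] inver_snoc_neg[OF i] root_cases[OF act_rts[OF i(2) eps_rts[OF i(1)]]] by auto
qed

lemma card_inver_snoc: assumes "i:I" "ws:lists I" shows "pos (act ws (eps i)) ==> card (inver (ws @ [i])) = Suc (card (inver ws))"
  and "neg (act ws (eps i)) ==> Suc (card (inver (ws @ [i]))) = card (inver ws)"
proof -
 assume p: "pos (act ws (eps i))"
 have "eps i ~: refl i ` inver ws"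
 proof
  assume "eps i:refl i ` inver ws"
  then obtain u where "u:inver ws" "refl i u = eps i" by auto
  moreover from this have "u = (%k. - eps i k)" using refl_refl[OF assms(1), of u] refl_eps[OF assms(1)] by simp
  ultimately show False using eps_pos rts_nonzero[of u] by (auto simp: inver_def)
 qed
 thus "card (inver (ws @ [i])) = Suc (card (inver ws))" using inver_snoc_pos[OF assms p] fin_inver[OF assms(2)] refl_inj[OF assms(1)] by (simp add: card_image)
next
 assume n: "neg (act ws (eps i))"
 show "Suc (card (inver (ws @ [i]))) = card (inver ws)" using inver_snoc_neg[OF assms n] fin_inver[OF assms(2)] refl_inj[OF assms(1)] by (metis card_Suc_Diff1 card_image)
qed

text \<open>Length is measured by counting inversions, so reducedness depends on a word only through
  its action and its number of letters. The link with minimality among words is made in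
  \<open>longest_reduced\<close>.\<close>

definition red :: "'i list => bool" where
 "red ws \<longleftrightarrow> ws:lists I & card (inver ws) = length ws"

lemma card_inver_le: "ws:lists I ==> card (inver ws)<=length ws"
proof (induction ws rule: rev_induct)
 case Nil
 have "inver [] = {}" using rts_nonzero by (auto simp: inver_def)
 thus ?case by simp
next
 case (snoc i ws)
 hence i: "i:I" "ws:lists I" by auto
 thus ?case using snoc card_inver_snoc[OF i] root_cases[OF act_rts[OF i(2) eps_rts[OF i(1)]]] by fastforce
qed

lemma red_lists: "red ws ==> ws:lists I" by (simp add: red_def)

lemma red_Nil [simp]: "red []"
proof -
 have "inver [] = {}" using rts_nonzero by (auto simp: inver_def)
 thus ?thesis by (simp add: red_def)
qed

lemma red_snoc: "red (ws @ [i]) \<longleftrightarrow> red ws & i:I & pos (act ws (eps i))"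
proof (cases "i:I & ws:lists I")
 case True
 thus ?thesis using card_inver_snoc[of i ws] card_inver_le[of ws] root_cases[OF act_rts[OF _ eps_rts], of ws i] by (fastforce simp: red_def)
qed (auto simp: red_def)

lemma inver_cong: "act us = act vs ==> inver us = inver vs" by (simp add: inver_def)

lemma red_cong: "red us ==> act us = act vs ==> length us = length vs ==> vs:lists I ==> red vs" by (metis inver_cong red_def)

lemma red_length_eq: "red us ==> red vs ==> act us = act vs ==> length us = length vs" by (metis inver_cong red_def)

text \<open>Letters act from the right. Where a letter \<open>i\<close> turns the root from positive
  to negative, the root just before it must be \<open>eps i\<close>, because \<open>refl i\<close>
  keeps every other positive root positive.\<close>

lemma pos_neg_split: assumes "us:lists I" "v:rts" "pos v" "neg (act us v)" shows "EX p i q. us = p @ i # q & act q v = eps i" using assms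
proof (induction us)
 case Nil thus ?case using rts_nonzero by auto
next
 case (Cons i us)
 show ?case
 proof (cases "neg (act us v)")
  case True
  then obtain p k q where "us = p @ k # q" "act q v = eps k" using Cons by auto
  thus ?thesis by (metis append_Cons)
 next
  case False
  have r: "act us v:rts" using Cons act_rts by auto
  hence "pos (act us v)" using False root_cases by blast
  moreover have "i:I" "neg (refl i (act us v))" using Cons by simp_all
  ultimately have "act us v = eps i" using refl_pos[of i "act us v"] r rts_nonzero[of "refl i (act us v)"] refl_rts[of i] by blast
  thus ?thesis by (metis append_Nil)
 qed
qed

text \<open>At the split \<open>us = p @ i # q\<close> the action of \<open>q\<close> carries the
  simple root \<open>j\<close> to the simple root \<open>i\<close> and so conjugates
  \<open>refl j\<close> into \<open>refl i\<close>. Hence \<open>i\<close> may be deleted at its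
  place and \<open>j\<close> appended at the end.\<close>

lemma exchange: assumes "red us" "j:I" "neg (act us (eps j))"
 obtains zs where "red (zs @ [j])" "Suc (length zs) = length us" "act (zs @ [j]) = act us"
  "set zs<=set us"
proof -
 have us: "us:lists I" using assms red_lists by blast obtain p i q where piq: "us = p @ i # q" "act q (eps j) = eps i"
  using pos_neg_split[OF us eps_rts[OF assms(2)] eps_pos assms(3)] by blast
 have iq: "i:I" "q:lists I" "p:lists I" using us piq by auto
 have "act q (refl j v) = refl i (act q v)" for v
 proof -
  have "pr j v = pr i (act q v)" using form_act[OF iq(2), of "eps j" v] piq iq assms(2) by (simp add: form_eps)
  thus ?thesis using act_lin[of q 1 v "- pr j v" "eps j"] by (simp add: refl_eq piq)
 qed
 hence eq: "act ((p @ q) @ [j]) = act us" by (auto simp: piq)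
 have "red ((p @ q) @ [j])" by (rule red_cong[OF assms(1) eq[symmetric]]) (use piq iq assms in auto)
 thus ?thesis using that[of "p @ q"] eq piq by auto
qed

text \<open>The map sending \<open>v\<close> to \<open>- act ws v\<close> embeds the inversions of a
  word into those of the reversed word, which acts as the inverse.\<close>

lemma red_rev: "red ws ==> red (rev ws)"
proof -
 have le: "card (inver ws)<=card (inver (rev ws))" if "ws:lists I" for ws
 proof (rule card_inj_on_le)
  show "inj_on (%v k. - act ws v k) (inver ws)"
  proof (rule inj_onI)
   fix u v assume "(%k. - act ws u k) = (%k. - act ws v k)"
   hence "act ws u = act ws v" by (auto simp: fun_eq_iff)
   thus "u = v" using act_rev[OF that] by metis
  qed
  show "(%v k. - act ws v k) ` inver ws<=inver (rev ws)" using that by (auto simp: inver_def act_uminus act_rev act_rts uminus_rts in_lists_conv_set)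
  show "finite (inver (rev ws))" using that by (intro fin_inver) (simp add: in_lists_conv_set)
 qed
 assume "red ws"
 thus ?thesis using le[of ws] card_inver_le[of "rev ws"] by (simp add: red_def in_lists_conv_set)
qed

lemma red_Cons: "red (i # ws) \<longleftrightarrow> red ws & i:I & pos (act (rev ws) (eps i))" by (metis red_rev red_snoc rev.simps(2) rev_rev_ident)

lemma exchange_left: assumes "red us" "j:I" "neg (act (rev us) (eps j))"
 obtains zs where "red (j # zs)" "Suc (length zs) = length us" "act (j # zs) = act us"
  "set zs<=set us"
proof -
 obtain zs where zs: "red (zs @ [j])" "Suc (length zs) = length (rev us)"
  "act (zs @ [j]) = act (rev us)" "set zs<=set (rev us)" using exchange[OF red_rev[OF assms(1)] assms(2,3)] by blast
 have "act (rev (zs @ [j])) = act (rev (rev us))" using zs assms by (intro act_rev_cong) (auto simp: red_def)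
 thus ?thesis using that[of "rev zs"] zs red_rev[OF zs(1)] by simp
qed

text \<open>There is no symmetry rule: the matrix being symmetric, exchanging \<open>i\<close> and
  \<open>j\<close> turns each move into its inverse, which gives \<open>braid_sym\<close>.\<close>

inductive braid :: "'i list => 'i list => bool" where
 refl: "braid ws ws"
| trans: "braid us vs ==> braid vs ws ==> braid us ws"
| comm: "i:I ==> j:I ==> i~=j ==> a i j = 0 ==> braid (p @ [i, j] @ q) (p @ [j, i] @ q)"
| triple: "i:I ==> j:I ==> i~=j ==> a i j = -1 ==>
  braid (p @ [i, j, i] @ q) (p @ [j, i, j] @ q)"

lemma braid_append: "braid us vs ==> braid (p @ us @ q) (p @ vs @ q)"
proof (induction rule: braid.induct)
 case (comm i j p' q')
 thus ?case using braid.comm[of i j "p @ p'" "q' @ q"] by simp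
next
 case (triple i j p' q')
 thus ?case using braid.triple[of i j "p @ p'" "q' @ q"] by simp
qed (auto intro: braid.intros)

lemma braid_length: "braid us vs ==> length us = length vs" by (induction rule: braid.induct) auto

lemma braid_snoc: "braid us vs ==> braid (us @ ws) (vs @ ws)" using braid_append[of us vs "[]" ws] by simp

lemma refl_eps_0: "i:I ==> j:I ==> a i j = 0 ==> refl i (eps j) = eps j" by (simp add: refl_eq pr_eps)

lemma refl_eps_1: "i:I ==> j:I ==> a i j = -1 ==> refl i (eps j) = (%k. eps i k + eps j k)" by (auto simp: refl_eq pr_eps)

lemma refl_eps_2: "i:I ==> j:I ==> a i j = -1 ==> refl i (%k. eps i k + eps j k) = eps j" using refl_lin[of i 1 "eps i" 1 "eps j"] by (auto simp: refl_eps refl_eps_1)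

lemma neg_add: "neg u ==> neg v ==> neg (%k. u k + v k)" by (auto simp: neg_def intro: add_nonpos_nonpos)

text \<open>Two reduced words ending in different letters both represent an element having the longest
 word in these two letters as a right factor.\<close>

theorem matsumoto: assumes "red us" "red vs" "act us = act vs" shows "braid us vs" using assms
proof (induction "length us" arbitrary: us vs rule: less_induct)
 case less
 have len: "length us = length vs" using red_length_eq less.prems by blast
 show ?case
 proof (cases us rule: rev_cases)
  case Nil thus ?thesis using len braid.refl by simp
 next
  case us: (snoc u i)
  with len obtain v j where vs: "vs = v @ [j]" by (cases vs rule: rev_cases) auto
  have ru: "red u" "i:I" "pos (act u (eps i))" and rv: "red v" "j:I" "pos (act v (eps j))" using less.prems us vs red_snoc by auto
  have u: "act u x = act us (refl i x)" for x by (simp add: us refl_refl ru)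
  have v: "act v x = act us (refl j x)" for x by (simp add: less.prems vs refl_refl rv)
  have Ni: "neg (act us (eps i))" using ru by (simp add: us refl_eps act_uminus)
  have Nj: "neg (act us (eps j))" using rv by (simp add: less.prems vs refl_eps act_uminus)
  have lu: "length u < length us" "length v < length us" using us vs len by auto
  show ?thesis
  proof (cases "i = j")
   case True
   hence "act u = act v" using u v by auto
   hence "braid u v" using less.hyps[OF lu(1) ru(1) rv(1)] by simp
   thus ?thesis using us vs True braid_snoc by simp
  next
   case False
   then consider "a i j = 0" "a j i = 0" | "a i j = -1" "a j i = -1" using a_off[of i j] a_sym[of i j] ru rv by auto
   thus ?thesis
   proof cases
    case 1
    have nu: "neg (act u (eps j))" using u Nj 1 ru rv by (simp add: refl_eps_0) obtain zs where zs: "red (zs @ [j])" "Suc (length zs) = length u" "act (zs @ [j]) = act u"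
     "set zs<=set u" by (rule exchange[OF ru(1) rv(2) nu]) (rule that)
    have zI: "zs:lists I" "red zs" using zs red_snoc red_lists by auto
    have bu: "braid u (zs @ [j])" by (rule less.hyps[OF lu(1) ru(1) zs(1) zs(3)[symmetric]])
    have com: "refl i (refl j x) = refl j (refl i x)" for x using 1 ru rv False refl_comm by blast
    have az: "act zs x = act us (refl i (refl j x))" for x using zs(3) u refl_refl[OF rv(2)] by (metis act_Cons act_Nil act_append)
    have "act (zs @ [i]) = act v" by (rule ext) (simp add: v az com refl_refl[OF ru(2)])
    hence "red (zs @ [i])" "act v = act (zs @ [i])" using red_cong[OF rv(1), of "zs @ [i]"] zs(2) us vs len zI(1) ru(2) by simp_all
    note zi = this
    have "braid us (zs @ [j, i])" using braid_snoc[OF bu, of "[i]"] us by simp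
    moreover have "braid (zs @ [j, i]) (zs @ [i, j])" using braid.comm[of j i zs "[]"] ru rv False 1 by simp
    moreover have "braid (zs @ [i, j]) vs"
    proof -
     have "braid (zs @ [i]) v" by (rule less.hyps[OF _ zi(1) rv(1) zi(2)[symmetric]]) (use zs us in simp)
     from braid_snoc[OF this, of "[j]"] show ?thesis using vs by simp
    qed
    ultimately show ?thesis by (meson braid.trans)
   next
    case 2
    \<comment> \<open>\<open>refl i\<close> sends \<open>eps j\<close> to
      \<open>eps i + eps j\<close>, an inversion of \<open>us\<close> as a sum of two inversions. So
      \<open>u\<close> can be made to end in \<open>j\<close>, and what precedes \<open>j\<close>
      can in turn be made to end in \<open>i\<close>; both words then end in the longest word of the
      two letters.\<close>
    have nu: "neg (act u (eps j))" using u 2 ru rv act_add[of us "eps i" "eps j"] Ni Nj by (simp add: refl_eps_1 neg_add)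
    obtain zs where zs: "red (zs @ [j])" "Suc (length zs) = length u" "act (zs @ [j]) = act u"
     "set zs<=set u" by (rule exchange[OF ru(1) rv(2) nu]) (rule that)
    have zI: "zs:lists I" "red zs" using zs red_snoc red_lists by auto
    have bu: "braid u (zs @ [j])" by (rule less.hyps[OF lu(1) ru(1) zs(1) zs(3)[symmetric]])
    have az: "act zs x = act us (refl i (refl j x))" for x using zs(3) u refl_refl[OF rv(2)] by (metis act_Cons act_Nil act_append)
    have ji: "refl j (eps i) = (%k. eps i k + eps j k)" using refl_eps_1[of j i] ru rv 2 by (simp add: add.commute)
    have nz: "neg (act zs (eps i))" using Nj ru rv 2 by (simp add: az ji refl_eps_2) obtain ts where ts: "red (ts @ [i])" "Suc (length ts) = length zs" "act (ts @ [i]) = act zs"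
     "set ts<=set zs" by (rule exchange[OF zI(2) ru(2) nz]) (rule that)
    have tI: "ts:lists I" using ts red_snoc red_lists by auto
    have bz: "braid zs (ts @ [i])" by (rule less.hyps[OF _ zI(2) ts(1) ts(3)[symmetric]]) (use zs us in simp)
    have at: "act ts x = act us (refl i (refl j (refl i x)))" for x using ts(3) az refl_refl[OF ru(2)] by (metis act_Cons act_Nil act_append)
    have com: "refl i (refl j (refl i x)) = refl j (refl i (refl j x))" for x using 2 ru rv False refl_triple by blast
    have "act (ts @ [j, i]) = act v" by (rule ext) (simp add: v at com refl_refl[OF ru(2)] refl_refl[OF rv(2)])
    hence rji: "red (ts @ [j, i])" "act v = act (ts @ [j, i])" using red_cong[OF rv(1), of "ts @ [j, i]"] zs(2) ts(2) us vs len tI ru(2) rv(2) by simp_all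
    have "braid u (ts @ [i, j])" using braid.trans[OF bu] braid_snoc[OF bz, of "[j]"] by simp
    hence "braid us (ts @ [i, j, i])" using braid_snoc[of u _ "[i]"] us by fastforce
    moreover have "braid (ts @ [i, j, i]) (ts @ [j, i, j])" using braid.triple[of i j ts "[]"] ru rv False 2 by simp
    moreover have "braid (ts @ [j, i, j]) vs"
    proof -
     have "braid (ts @ [j, i]) v" by (rule less.hyps[OF _ rji(1) rv(1) rji(2)[symmetric]]) (use ts zs us in simp)
     from braid_snoc[OF this, of "[j]"] show ?thesis using vs by simp
    qed
    ultimately show ?thesis by (meson braid.trans)
   qed
  qed
 qed
qed

lemma braid_act: "braid us vs ==> act us = act vs"
proof (induction rule: braid.induct)
 case (comm i j p q)
 thus ?case by (intro ext) (simp add: refl_comm[OF comm])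
next
 case (triple i j p q)
 thus ?case by (intro ext) (simp add: refl_triple[OF triple])
qed auto

lemma braid_lists: "braid us vs ==> us:lists I \<longleftrightarrow> vs:lists I" by (induction rule: braid.induct) auto

lemma braid_red: "braid us vs ==> red us ==> red vs" using braid_act braid_length braid_lists red_cong red_lists by metis

text \<open>Among braid-equivalent words take one with the longest tail in \<open>K\<close>. If
  \<open>act us (eps k)\<close> were negative, the exchange property would move \<open>k\<close> to
  the end of \<open>us\<close> and lengthen the tail. Thus \<open>us\<close> represents the shortest
  element of its coset modulo the reflections in \<open>K\<close>.\<close>

lemma factor_out: assumes "red ws" "K<=I"
 obtains us vs where "braid ws (us @ vs)" "red (us @ vs)" "vs:lists K"
  "!!k. k:K ==> pos (act us (eps k))"
proof -
 define P where "P = (%(us, vs). braid ws (us @ vs) & vs:lists K)"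
 have "P (ws, [])" by (simp add: P_def braid.refl)
 moreover have "ALL p. P p --> length (snd p)<=length ws" by (auto simp: P_def dest!: braid_length)
 ultimately obtain p where p: "P p" "!!q. P q ==> length (snd q)<=length (snd p)" using ex_has_greatest_nat[of P "(ws, [])" "%p. length (snd p)" "Suc (length ws)"]
  by (auto simp: less_Suc_eq_le) obtain us vs where uv: "p = (us, vs)" by (cases p)
 have b: "braid ws (us @ vs)" "vs:lists K" using p uv by (auto simp: P_def)
 have r: "red (us @ vs)" using braid_red b assms by blast
 have ru: "red us"
 proof -
  have "red (us @ xs) ==> red us" for xs by (induction xs rule: rev_induct) (auto simp: red_snoc simp flip: append_assoc)
  thus ?thesis using r by blast
 qed
 have "pos (act us (eps k))" if k: "k:K" for k
 proof (rule ccontr)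
  assume "~ ?thesis"
  hence "neg (act us (eps k))" using root_cases act_rts eps_rts assms k red_lists[OF ru] by blast
  then obtain zs where zs: "red (zs @ [k])" "act (zs @ [k]) = act us" using exchange[OF ru] assms k by (metis subsetD)
  have "braid us (zs @ [k])" by (rule matsumoto[OF ru zs(1) zs(2)[symmetric]])
  hence "braid (us @ vs) (zs @ k # vs)" using braid_snoc[of us "zs @ [k]" vs] by simp
  hence "braid ws (zs @ k # vs)" using b braid.trans by blast
  hence "P (zs, k # vs)" using b k by (simp add: P_def)
  thus False using p(2) uv by fastforce
 qed
 thus ?thesis using that b r by blast
qed

lemma act_sum: assumes "finite S" "!!k. k ~: S ==> v k = 0" shows "act ws v = (%i. SUM k:S. v k * act ws (eps k) i)" using assms
proof (induction S arbitrary: v rule: finite_induct)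
 case empty
 hence "v = (%_. 0)" by auto
 thus ?case using act_zero by simp
next
 case (insert x F)
 define u where "u = v(x := 0)"
 have v: "v = (%k. 1 * u k + v x * eps x k)" by (auto simp: u_def eps_def)
 have "act ws u = (%i. SUM k:F. u k * act ws (eps k) i)" using insert by (intro insert.IH) (auto simp: u_def)
 also have "... = (%i. SUM k:F. v k * act ws (eps k) i)" using insert by (intro ext sum.cong) (auto simp: u_def)
 finally show ?case using insert by (subst v, subst act_lin) auto
qed

lemma act_supp: "z:lists K ==> (!!i. i ~: K ==> v i = 0) ==> i ~: K ==> act z v i = 0" by (induction z) (auto simp: refl_def)

lemma act_pos_K: assumes "K<=I" "!!k. k:K ==> pos (act us (eps k))" "pos v" "!!i. i ~: K ==> v i = 0" shows "pos (act us v)"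
proof -
 have "act us v = (%i. SUM k:K. v k * act us (eps k) i)" using assms fin_I finite_subset by (intro act_sum) auto
 thus ?thesis using assms by (auto simp: pos_def intro!: sum_nonneg)
qed

text \<open>Lengths add behind a shortest coset representative: a positive root supported in
  \<open>K\<close> is a nonnegative combination of simple roots in \<open>K\<close>, which
  \<open>us\<close> keeps positive. This preserves the condition of \<open>red_snoc\<close> for each
  letter of \<open>z\<close>.\<close>

lemma red_append: assumes "red us" "K<=I" "!!k. k:K ==> pos (act us (eps k))" "z:lists K" "red z" shows "red (us @ z)" using assms(4,5)
proof (induction z rule: rev_induct)
 case Nil thus ?case using assms by simp
next
 case (snoc k z)
 hence "red z" "k:K" "z:lists K" "pos (act z (eps k))" by (auto simp: red_snoc)
 note k = this
 have "act z (eps k) i = 0" if "i ~: K" for i by (rule act_supp[OF k(3) _ that]) (use k(2) in \<open>auto simp: eps_def\<close>)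
 hence "pos (act us (act z (eps k)))" using act_pos_K[OF assms(2,3) k(4)] by blast
 moreover have "red (us @ z)" by (rule snoc.IH[OF k(3,1)])
 ultimately have "red ((us @ z) @ [k])" using k(2) assms(2) by (auto simp only: red_snoc act_append)
 thus ?case by simp
qed

end

section \<open>Conjugation, generated subgroups and lifts of reflections in a group written
  additively\<close>

text \<open>The class \<open>group_add\<close> does not demand commutativity, so it serves as the
  class of all groups. The additive notation is kept until invertible matrices enter through the
  type \<open>gl\<close>.\<close>

definition cj :: "'g::group_add => 'g => 'g" where "cj g u = g + u + - g"

lemma cj_add: "cj g (u + v) = cj g u + cj g v" by (simp add: cj_def add.assoc del: add_uminus_conv_diff)
lemma cj_uminus: "cj g (- u) = - cj g u" by (simp add: cj_def add.assoc minus_add del: add_uminus_conv_diff)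
lemma cj_cj: "cj g (cj h u) = cj (g + h) u" by (simp add: cj_def add.assoc minus_add del: add_uminus_conv_diff)
lemma cj_0 [simp]: "cj 0 u = u" "cj g 0 = 0" by (simp_all add: cj_def)
lemma cj_inv [simp]: "cj (- g) (cj g u) = u" "cj g (cj (- g) u) = u" by (simp_all add: cj_cj)
lemma cj_eqI: "g + u = v + g ==> cj g u = v" by (simp add: cj_def add.assoc del: add_uminus_conv_diff)
lemma cj_comm: "g + u = cj g u + g" by (simp add: cj_def add.assoc del: add_uminus_conv_diff)
inductive_set ggen :: "'g::group_add set => 'g set" for S where
 zero: "0:ggen S"
| plus: "s:S ==> g:ggen S ==> s + g:ggen S"
| minus: "s:S ==> g:ggen S ==> - s + g:ggen S"

lemma ggen_base: "s:S ==> s:ggen S" using ggen.plus[OF _ ggen.zero] by fastforce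

lemma ggen_add: "g:ggen S ==> k:ggen S ==> g + k:ggen S" by (induction rule: ggen.induct) (auto simp: add.assoc intro: ggen.intros)

lemma ggen_uminus: "g:ggen S ==> - g:ggen S"
proof (induction rule: ggen.induct)
 case (plus s g)
 have "- g + (- s + 0):ggen S" using plus by (intro ggen_add ggen.minus ggen.zero)
 thus ?case by (simp add: minus_add del: add_uminus_conv_diff)
next
 case (minus s g)
 have "- g + (s + 0):ggen S" using minus by (intro ggen_add ggen.plus ggen.zero)
 thus ?case by (simp add: minus_add del: add_uminus_conv_diff)
qed (simp add: ggen.zero)

lemma ggen_least: assumes "S<=P" "0:P" "!!a b. a:P ==> b:P ==> a + b:P" "!!a. a:P ==> - a:P" shows "ggen S<=P"
proof
 fix g assume "g:ggen S" thus "g:P" by induction (use assms in auto)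
qed

lemma ggen_mono: "S<=ggen S' ==> ggen S<=ggen S'" by (rule ggen_least) (auto intro: ggen.zero ggen_add ggen_uminus)

lemma ggen_cj: assumes "u:ggen S" "!!s. s:S ==> cj g s:ggen S'" shows "cj g u:ggen S'" using assms(1) by induction
  (auto simp only: cj_add cj_uminus cj_0 intro!: ggen.zero ggen_add ggen_uminus assms(2))

text \<open>Root subgroups \<open>z j\<close> permuted by lifts \<open>n i\<close> of the simple reflections.\<close>

locale root_lift = cartan I a for I :: "'i set" and a +
 fixes z :: "'i => real => 'g::group_add" and n :: "'i => 'g" assumes lift0: "i:I ==> j:I ==> i~=j ==> a i j = 0 ==> cj (n i) (z j b) = z j b"
  and lift1: "i:I ==> j:I ==> i~=j ==> a i j = -1 ==>
   cj (n i) (z j b):ggen {z k c |k c. k = i | k = j}" and lift2: "i:I ==> j:I ==> i~=j ==> a i j = -1 ==> cj (n j + n i) (z j b) = z i b"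
  and nn0: "i:I ==> j:I ==> i~=j ==> a i j = 0 ==> n i + n j = n j + n i" and nn1: "i:I ==> j:I ==> i~=j ==> a i j = -1 ==> n i + n j + n i = n j + n i + n j"
begin

definition nw :: "'i list => 'g" where "nw ws = foldr (%i g. n i + g) ws 0"

lemma nw_Nil [simp]: "nw [] = 0" by (simp add: nw_def)
lemma nw_Cons [simp]: "nw (i # ws) = n i + nw ws" by (simp add: nw_def)
lemma nw_append: "nw (us @ vs) = nw us + nw vs" by (induction us) (simp_all add: add.assoc)

lemma nw_braid: "braid us vs ==> nw us = nw vs"
proof (induction rule: braid.induct)
 case (comm i j p q)
 thus ?case using nn0[OF comm] by (simp add: nw_append flip: add.assoc)
next
 case (triple i j p q)
 thus ?case using nn1[OF triple] by (simp add: nw_append flip: add.assoc)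
qed auto

text \<open>Let \<open>i\<close> be the last letter. If the shorter word keeps \<open>eps j\<close>
  positive, \<open>lift1\<close> reduces the claim to the root groups of \<open>i\<close> and
  \<open>j\<close> for that word. Otherwise the shorter word can be rewritten to end in
  \<open>j\<close>, and \<open>lift2\<close> turns the last two lifts applied to \<open>z j\<close>
  into \<open>z i\<close>.\<close>

lemma conj_pos: assumes "red ws" "j:I" "pos (act ws (eps j))" shows "cj (nw ws) (z j b):ggen {z k c |k c. k:I}" using assms
proof (induction "length ws" arbitrary: ws j b rule: less_induct)
 case less
 let ?U = "ggen {z k c |k c. k:I}"
 show ?case
 proof (cases ws rule: rev_cases)
  case Nil
  thus ?thesis using less by (auto intro!: ggen_base)
 next
  case (snoc us i)
  have us: "red us" "i:I" "pos (act us (eps i))" using less.prems snoc red_snoc by auto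
  have len: "length us < length ws" using snoc by simp
  have "i~=j"
  proof
   assume "i = j"
   hence "neg (act ws (eps j))" using us by (simp add: snoc refl_eps act_uminus)
   thus False using less.prems rts_nonzero act_rts eps_rts red_lists by blast
  qed
  then consider "a i j = 0" | "a i j = -1" using a_off us less.prems by blast
  thus ?thesis
  proof cases
   case 1
   have p: "pos (act us (eps j))" using less.prems 1 us by (simp add: snoc refl_eps_0)
   have "cj (nw ws) (z j b) = cj (nw us) (z j b)" using lift0[OF us(2) less.prems(2) `i~=j` 1] by (simp add: snoc nw_append flip: cj_cj)
   thus ?thesis using less.hyps[OF len us(1) less.prems(2) p] by simp
  next
   case 2
   have ji: "a j i = -1" using 2 a_sym us less.prems by simp
   show ?thesis
   proof (cases "pos (act us (eps j))")
    case True
    have "cj (nw us) (cj (n i) (z j b)):?U"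
    proof (rule ggen_cj[OF lift1[OF us(2) less.prems(2) `i~=j` 2]])
     fix s assume "s:{z k c |k c. k = i | k = j}"
     thus "cj (nw us) s:?U" using less.hyps[OF len us(1) us(2) us(3)] less.hyps[OF len us(1) less.prems(2) True] by auto
    qed
    thus ?thesis by (simp add: snoc nw_append cj_cj)
   next
    case False
    hence ng: "neg (act us (eps j))" using not_pos[OF act_rts[OF red_lists[OF us(1)] eps_rts[OF less.prems(2)]]] by simp
    obtain zs where zs: "red (zs @ [j])" "Suc (length zs) = length us" "act (zs @ [j]) = act us"
     "set zs<=set us" by (rule exchange[OF us(1) less.prems(2) ng]) (rule that)
    have nu: "nw us = nw zs + n j" using nw_braid[OF matsumoto[OF us(1) zs(1) zs(3)[symmetric]]] by (simp add: nw_append)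
    have rz: "red zs" using zs red_snoc by blast
    have "act zs (eps i) = act us (refl j (eps i))" using fun_cong[OF zs(3), of "refl j (eps i)"] by (simp add: refl_refl less.prems(2))
    also have "refl j (eps i) = refl i (eps j)" using refl_eps_1[OF us(2) less.prems(2) 2] refl_eps_1[OF less.prems(2) us(2) ji] by (simp add: add.commute)
    also have "act us (refl i (eps j)) = act ws (eps j)" by (simp add: snoc)
    finally have p: "pos (act zs (eps i))" using less.prems by simp
    have "cj (nw ws) (z j b) = cj (nw zs) (z i b)" using lift2[OF us(2) less.prems(2) `i~=j` 2] by (simp add: snoc nw_append nu add.assoc flip: cj_cj)
    moreover have "cj (nw zs) (z i b):?U" by (rule less.hyps[OF _ rz us(2) p]) (use zs(2) len in simp)
    ultimately show ?thesis by (simp only:)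
   qed
  qed
 qed
qed

end

section \<open>An abstract pinned group given by rank one and rank two relations\<close>

text \<open>\<open>om\<close> models a highest weight coefficient on the big cell: insensitive to a
  negative unipotent factor on the left, multiplicative on the Borel group, trivial on positive root
  groups. \<open>M_pos\<close> says that its weight is dominant and regular. \<open>opposite\<close>
  is the transversality of the two sides.\<close>

locale chev = cartan I a for I :: "'i set" and a +
 fixes x y h :: "'i => real => 'g::group_add" and n :: "'i => 'g" and om :: "'g => complex" and M :: "'i => nat" assumes n_def: "i:I ==> n i = y i 1 + x i (-1) + y i 1"
  and x_add: "i:I ==> x i (s + t) = x i s + x i t" and y_add: "i:I ==> y i (s + t) = y i s + y i t" and h_mult: "i:I ==> c~=0 ==> d~=0 ==> h i (c * d) = h i c + h i d"
  and h_comm: "i:I ==> j:I ==> c~=0 ==> d~=0 ==> h i c + h j d = h j d + h i c" and hx: "i:I ==> j:I ==> c~=0 ==> cj (h i c) (x j b) = x j (c powi a i j * b)"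
  and hy: "i:I ==> j:I ==> c~=0 ==> cj (h i c) (y j b) = y j (c powi (- a i j) * b)" and nh: "i:I ==> j:I ==> c~=0 ==> cj (n i) (h j c) = h j c + h i (c powi (- a j i))"
  and y_n: "i:I ==> t~=0 ==> y i t = x i (1 / t) + n i + h i t + x i (1 / t)" and n_x: "i:I ==> t~=0 ==> n i + x i t = x i (- 1 / t) + h i (1 / t) + y i (1 / t)"
  and n_y: "i:I ==> t~=0 ==> - n i + y i t = y i (- 1 / t) + h i t + x i (1 / t)" and nx: "i:I ==> cj (n i) (x i b) = y i (- b)" and n2: "i:I ==> n i + n i = h i (-1)"
  and xy_comm: "i:I ==> j:I ==> i~=j ==> x i s + y j t = y j t + x i s" and xx0: "i:I ==> j:I ==> i~=j ==> a i j = 0 ==> x i s + x j t = x j t + x i s"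
  and yy0: "i:I ==> j:I ==> i~=j ==> a i j = 0 ==> y i s + y j t = y j t + y i s" and nx1: "i:I ==> j:I ==> i~=j ==> a i j = -1 ==>
   cj (n i) (x j b) = - x j b + x i (-1) + x j b + x i 1" and ny1: "i:I ==> j:I ==> i~=j ==> a i j = -1 ==>
   cj (n i) (y j b) = - y j b + y i 1 + y j b + y i (-1)" and nnx: "i:I ==> j:I ==> i~=j ==> a i j = -1 ==> cj (n j + n i) (x j b) = x i b"
  and nny: "i:I ==> j:I ==> i~=j ==> a i j = -1 ==> cj (n j + n i) (y j b) = y i b" and yyy: "i:I ==> j:I ==> i~=j ==> a i j = -1 ==> 0 < p ==> 0 < r ==>
   y i p + y j q + y i r = y j (q * r / (p + r)) + y i (p + r) + y j (p * q / (p + r))" and x_inj: "i:I ==> x i s = x i t ==> s = t" and opposite: "ggen {y i t |i t. i:I} Int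
   ggen ({x i t |i t. i:I} Un {h i c |i c. i:I & c~=0}) = {0}" and om_y: "v:ggen {y i t |i t. i:I} ==>
   u:ggen ({x i t |i t. i:I} Un {h i c |i c. i:I & c~=0}) ==> om (v + u) = om u" and om_mult: "u:ggen ({x i t |i t. i:I} Un {h i c |i c. i:I & c~=0}) ==>
   v:ggen ({x i t |i t. i:I} Un {h i c |i c. i:I & c~=0}) ==> om (u + v) = om u * om v" and om_0: "om 0 = 1" and om_x: "i:I ==> om (x i t) = 1"
  and om_h: "i:I ==> c~=0 ==> om (h i c) = of_real (c ^ M i)" and M_pos: "i:I ==> 0 < M i"
begin

definition "Um = ggen {y i t |i t. i:I}"
definition "Up = ggen {x i t |i t. i:I}"
definition "HH = ggen {h i c |i c. i:I & c~=0}"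
definition "BB = ggen ({x i t |i t. i:I} Un {h i c |i c. i:I & c~=0})"

lemma h_1: "i:I ==> h i 1 = 0" using h_mult[of i 1 1] by (metis add_left_imp_eq add.right_neutral mult_1 one_neq_zero)
lemma x_0: "i:I ==> x i 0 = 0" using x_add[of i 0 0] by (metis add_left_imp_eq add.right_neutral)
lemma y_0: "i:I ==> y i 0 = 0" using y_add[of i 0 0] by (metis add_left_imp_eq add.right_neutral)
lemma x_uminus: "i:I ==> x i (- t) = - x i t" using x_add[of i t "- t"] minus_unique[of "x i t" "x i (- t)"] by (simp add: x_0)
lemma y_uminus: "i:I ==> y i (- t) = - y i t" using y_add[of i t "- t"] minus_unique[of "y i t" "y i (- t)"] by (simp add: y_0)
lemma h_inverse: "i:I ==> c~=0 ==> h i (1 / c) = - h i c" using h_mult[of i c "1 / c"] minus_unique[of "h i c" "h i (1 / c)"] by (simp add: h_1)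

lemma Um: "0:Um" "u:Um ==> v:Um ==> u + v:Um" "u:Um ==> - u:Um" "i:I ==> y i t:Um" unfolding Um_def by (auto intro: ggen.zero ggen_add ggen_uminus ggen_base)
lemma Up: "0:Up" "u:Up ==> v:Up ==> u + v:Up" "u:Up ==> - u:Up" "i:I ==> x i t:Up" unfolding Up_def by (auto intro: ggen.zero ggen_add ggen_uminus ggen_base)
lemma HH: "0:HH" "u:HH ==> v:HH ==> u + v:HH" "u:HH ==> - u:HH"
 "i:I ==> c~=0 ==> h i c:HH" unfolding HH_def by (auto intro: ggen.zero ggen_add ggen_uminus ggen_base)
lemma BB: "0:BB" "u:BB ==> v:BB ==> u + v:BB" "u:BB ==> - u:BB" unfolding BB_def by (auto intro: ggen.zero ggen_add ggen_uminus ggen_base)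
lemma Up_BB: "Up<=BB" unfolding Up_def BB_def by (rule ggen_mono) (blast intro: ggen_base)
lemma HH_BB: "HH<=BB" unfolding HH_def BB_def by (rule ggen_mono) (blast intro: ggen_base)

lemma HH_x: "t:HH ==> j:I ==> EX c. cj t (x j b) = x j c" unfolding HH_def
proof (induction arbitrary: b rule: ggen.induct)
 case zero thus ?case by auto
next
 case (plus s g)
 then obtain c i d where "cj g (x j b) = x j c" "s = h i d" "i:I" "d~=0" by blast
 thus ?case using hx[of i j d c] plus.prems by (auto simp flip: cj_cj)
next
 case (minus s g)
 then obtain c i d where "cj g (x j b) = x j c" "s = h i d" "i:I" "d~=0" by blast
 thus ?case using hx[of i j "1 / d" c] h_inverse[of i d] minus.prems by (auto simp flip: cj_cj)
qed

lemma HH_y: "t:HH ==> j:I ==> EX c. cj t (y j b) = y j c" unfolding HH_def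
proof (induction arbitrary: b rule: ggen.induct)
 case zero thus ?case by auto
next
 case (plus s g)
 then obtain c i d where "cj g (y j b) = y j c" "s = h i d" "i:I" "d~=0" by blast
 thus ?case using hy[of i j d c] plus.prems by (auto simp flip: cj_cj)
next
 case (minus s g)
 then obtain c i d where "cj g (y j b) = y j c" "s = h i d" "i:I" "d~=0" by blast
 thus ?case using hy[of i j "1 / d" c] h_inverse[of i d] minus.prems by (auto simp flip: cj_cj)
qed

lemma HH_Up: "t:HH ==> u:Up ==> cj t u:Up" unfolding Up_def by (erule ggen_cj) (use HH_x in \<open>fastforce intro: ggen_base\<close>)

lemma HH_Um: "t:HH ==> u:Um ==> cj t u:Um" unfolding Um_def by (erule ggen_cj) (use HH_y in \<open>fastforce intro: ggen_base\<close>)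

lemma BB_split: "b:BB \<longleftrightarrow> (EX u:Up. EX t:HH. b = u + t)"
proof
 have "BB<={u + t |u t. u:Up & t:HH}" (is "_<=?P") unfolding BB_def
 proof (rule ggen_least)
  show "{x i t |i t. i:I} Un {h i c |i c. i:I & c~=0}<=?P" using Up(1,4) HH(1,4) by (auto, metis add.right_neutral, metis add.left_neutral)
  show "0:?P" using Up(1) HH(1) by (auto, metis add.right_neutral)
 next
  fix a b assume "a:?P" "b:?P"
  then obtain u t u' t' where "a = u + t" "b = u' + t'" "u:Up" "u':Up" "t:HH" "t':HH" by auto
  moreover from this have "a + b = (u + cj t u') + (t + t')" by (simp add: cj_def add.assoc del: add_uminus_conv_diff)
  ultimately show "a + b:?P" using Up(2) HH(2) HH_Up by blast
 next
  fix a assume "a:?P"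
  then obtain u t where "a = u + t" "u:Up" "t:HH" by auto
  moreover from this have "- a = cj (- t) (- u) + - t" by (simp add: cj_def add.assoc minus_add del: add_uminus_conv_diff)
  ultimately show "- a:?P" using Up(3) HH(3) HH_Up by blast
 qed
 thus "b:BB ==> EX u:Up. EX t:HH. b = u + t" by blast
qed (use Up_BB HH_BB BB(2) in blast)

lemma n_inv: "i:I ==> - n i = n i + h i (-1)"
proof -
 assume i: "i:I"
 have "n i + (n i + h i (-1)) = h i (-1) + h i (-1)" using n2[OF i] by (simp flip: add.assoc)
 also have "... = 0" using h_mult[OF i, of "-1" "-1"] h_1[OF i] by simp
 finally show ?thesis by (simp add: neg_eq_iff_add_eq_0)
qed

lemma n_HH: "i:I ==> t:HH ==> cj (n i) t:HH" unfolding HH_def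
proof (erule ggen_cj)
 fix s assume i: "i:I" and "s:{h i c |i c. i:I & c~=0}"
 then obtain j c where "s = h j c" "j:I" "c~=0" by auto
 moreover from this have "h j c + h i (c powi (- a j i)):HH" using i by (intro HH) auto
 ultimately show "cj (n i) s:ggen {h i c |i c. i:I & c~=0}" using nh[OF i, of j c] by (simp add: HH_def)
qed

lemma HH_HH: "t:HH ==> u:HH ==> cj t u:HH" by (simp add: cj_def HH del: add_uminus_conv_diff)

lemma ninv_HH: "i:I ==> t:HH ==> cj (- n i) t:HH" by (simp add: n_inv HH_HH n_HH HH flip: cj_cj)

lemma cj_fix: "g + u = u + g ==> cj g u = u" for g :: 'g by (rule cj_eqI)

lemma comm_add3: "p + u = u + p ==> q + u = u + q ==> r + u = u + r ==>
  (p + q + r) + u = u + (p + q + r)" for p :: 'g by (metis add.assoc)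

lemma lift0_x: "i:I ==> j:I ==> i~=j ==> a i j = 0 ==> cj (n i) (x j b) = x j b" by (rule cj_fix, simp only: n_def, rule comm_add3) (blast intro: xx0 xy_comm[symmetric])+

lemma lift0_y: "i:I ==> j:I ==> i~=j ==> a i j = 0 ==> cj (n i) (y j b) = y j b" by (rule cj_fix, simp only: n_def, rule comm_add3) (blast intro: yy0 xy_comm)+

lemma nn0: "i:I ==> j:I ==> i~=j ==> a i j = 0 ==> n i + n j = n j + n i" using cj_comm[of "n i" "n j"] by (simp add: n_def[of j] cj_add lift0_x lift0_y)

lemma nn1: assumes "i:I" "j:I" "i~=j" "a i j = -1" shows "n i + n j + n i = n j + n i + n j"
proof -
 have "cj (n j + n i) (n j) = cj (n j + n i) (y j 1 + x j (-1) + y j 1)" by (rule arg_cong[OF n_def[OF assms(2)]])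
 also have "... = n i" unfolding cj_add nnx[OF assms] nny[OF assms] by (rule n_def[OF assms(1), symmetric])
 finally show ?thesis using cj_comm[of "n j + n i" "n j"] by (simp add: add.assoc)
qed

sublocale lx: root_lift I a x n
proof
 fix i j b assume ij: "i:I" "j:I" "i~=j" "a i j = -1"
 show "cj (n i) (x j b):ggen {x k c |k c. k = i | k = j}" unfolding nx1[OF ij] by (intro ggen_add ggen_uminus ggen_base) auto
qed (rule lift0_x nnx nn0 nn1; assumption)+

sublocale ly: root_lift I a y n
proof
 fix i j b assume ij: "i:I" "j:I" "i~=j" "a i j = -1"
 show "cj (n i) (y j b):ggen {y k c |k c. k = i | k = j}" unfolding ny1[OF ij] by (intro ggen_add ggen_uminus ggen_base) auto
qed (rule lift0_y nny nn0 nn1; assumption)+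

abbreviation "nw \<equiv> lx.nw"

lemma nwinv_HH: "ws:lists I ==> t:HH ==> cj (- nw ws) t:HH" by (induction ws arbitrary: t) (auto simp: minus_add ninv_HH simp flip: cj_cj simp del: add_uminus_conv_diff)

lemma nw_rev: "ws:lists I ==> EX t:HH. - nw ws = nw (rev ws) + t"
proof (induction ws)
 case Nil thus ?case using HH(1) by auto
next
 case (Cons i ws)
 then obtain t where t: "t:HH" "- nw ws = nw (rev ws) + t" and i: "i:I" by auto
 have "- nw (i # ws) = nw (rev ws) + t + (n i + h i (-1))" using t n_inv[OF i] by (simp add: minus_add del: add_uminus_conv_diff)
 also have "... = nw (rev ws) + n i + (cj (- n i) t + h i (-1))" by (simp add: cj_def add.assoc del: add_uminus_conv_diff)
 finally have "- nw (i # ws) = nw (rev (i # ws)) + (cj (- n i) t + h i (-1))" by (simp add: lx.nw_append)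
 moreover have "cj (- n i) t + h i (-1):HH" using t i by (simp add: ninv_HH HH)
 ultimately show ?case by blast
qed

lemma conj_x: "red ws ==> j:I ==> pos (act ws (eps j)) ==> cj (nw ws) (x j b):Up" unfolding Up_def by (rule lx.conj_pos)

lemma conj_y: "red ws ==> j:I ==> pos (act ws (eps j)) ==> cj (nw ws) (y j b):Um" unfolding Um_def by (rule ly.conj_pos)

lemma conj_x_inv: assumes "red ws" "j:I" "pos (act (rev ws) (eps j))" shows "cj (- nw ws) (x j b):Up"
proof -
 obtain t where t: "t:HH" "- nw ws = nw (rev ws) + t" using nw_rev red_lists assms by blast obtain c where "cj t (x j b) = x j c" using HH_x[OF t(1) assms(2)] by blast
 thus ?thesis using conj_x[OF red_rev[OF assms(1)] assms(2,3)] t by (simp flip: cj_cj)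
qed

lemma conj_y_inv: assumes "red ws" "j:I" "pos (act (rev ws) (eps j))" shows "cj (- nw ws) (y j b):Um"
proof -
 obtain t where t: "t:HH" "- nw ws = nw (rev ws) + t" using nw_rev red_lists assms by blast obtain c where "cj t (y j b) = y j c" using HH_y[OF t(1) assms(2)] by blast
 thus ?thesis using conj_y[OF red_rev[OF assms(1)] assms(2,3)] t by (simp flip: cj_cj)
qed

text \<open>The unipotent radical of the minimal parabolic group of \<open>k\<close>, described by
  simple root groups alone: the conjugates under \<open>x k\<close> of all the others.\<close>

definition "Uk k = ggen {cj (x k t) (x j b) |t j b. j:I & j~=k}"

lemma Uk_x: "k:I ==> u:Uk k ==> cj (x k s) u:Uk k" unfolding Uk_def
proof (erule ggen_cj)
 fix g assume "k:I" "g:{cj (x k t) (x j b) |t j b. j:I & j~=k}"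
 thus "cj (x k s) g:ggen {cj (x k t) (x j b) |t j b. j:I & j~=k}" by (auto simp: cj_cj simp flip: x_add intro!: ggen_base) blast
qed

lemma Up_split: "k:I ==> u:Up ==> EX c. EX v:Uk k. u = v + x k c"
proof -
 assume k: "k:I"
 have "Up<={v + x k c |v c. v:Uk k}" (is "_<=?P") unfolding Up_def
 proof (rule ggen_least)
  have z: "0:Uk k" by (simp add: Uk_def ggen.zero)
  have xj: "x j b:Uk k" if "j:I" "j~=k" for j b
  proof -
   have "x j b = cj (x k 0) (x j b)" by (simp add: x_0 k)
   thus ?thesis unfolding Uk_def using that by (intro ggen_base) blast
  qed
  have "EX v c. x i t = v + x k c & v:Uk k" if "i:I" for i t
  proof (cases "i = k")
   case True thus ?thesis using z by (intro exI[of _ 0] exI[of _ t]) simp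
  next
   case False
   thus ?thesis using xj[OF that] x_0[OF k] by (intro exI[of _ "x i t"] exI[of _ 0]) simp
  qed
  thus "{x i t |i t. i:I}<=?P" by blast
  show "0:?P" using z x_0[OF k] by (auto, metis add.right_neutral)
 next
  fix a b assume "a:?P" "b:?P"
  then obtain u t u' t' where "a = u + x k t" "b = u' + x k t'" "u:Uk k" "u':Uk k" by auto
  moreover from this have "a + b = (u + cj (x k t) u') + x k (t + t')" by (simp add: cj_def add.assoc x_add k del: add_uminus_conv_diff)
  ultimately show "a + b:?P" using Uk_x[OF k] ggen_add unfolding Uk_def by blast
 next
  fix a assume "a:?P"
  then obtain u t where "a = u + x k t" "u:Uk k" by auto
  moreover from this have "- a = cj (x k (- t)) (- u) + x k (- t)" by (simp add: cj_def add.assoc minus_add x_uminus k del: add_uminus_conv_diff)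
  ultimately show "- a:?P" using Uk_x[OF k] ggen_uminus unfolding Uk_def by blast
 qed
 thus "u:Up ==> EX c. EX v:Uk k. u = v + x k c" by blast
qed

text \<open>For \<open>t ~= 0\<close> the rank one identity \<open>n_x\<close> rewrites
  \<open>n k + x k t\<close> as a product ending in \<open>y k\<close>, which commutes with
  \<open>x j\<close> and drops out of the conjugation. For \<open>t = 0\<close> the rank two
  relation between \<open>k\<close> and \<open>j\<close> applies directly.\<close>

lemma n_Uk: assumes k: "k:I" and u: "u:Uk k" shows "cj (n k) u:Up" "cj (- n k) u:Up"
proof -
 have gen: "cj (n k) (cj (x k t) (x j b)):Up" if j: "j:I" "j~=k" for t j b
 proof (cases "t = 0")
  case True
  consider "a k j = 0" | "a k j = -1" using a_off k j by blast
  thus ?thesis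
  proof cases
   case 1 thus ?thesis using True k j lift0_x[of k j] by (simp add: x_0 Up)
  next
   case 2
   thus ?thesis using True k j nx1[OF k j(1) _ 2] by (simp add: x_0 Up)
  qed
 next
  case False
  have "cj (n k) (cj (x k t) (x j b)) = cj (x k (- 1 / t) + h k (1 / t) + y k (1 / t)) (x j b)" by (simp only: cj_cj n_x[OF k False])
  also have "... = cj (x k (- 1 / t)) (x j ((1 / t) powi a k j * b))" using j k False xy_comm[of j k b "1 / t"] cj_fix[of "y k (1 / t)" "x j b"] by (simp add: hx flip: cj_cj)
  also have "...:Up" unfolding cj_def by (intro Up(2,3,4) k j)
  finally show ?thesis .
 qed
 show "cj (n k) u:Up" using u unfolding Uk_def Up_def by (rule ggen_cj) (use gen in \<open>auto simp: Up_def\<close>)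
 have "cj (h k (-1)) u:Uk k" using u unfolding Uk_def
 proof (rule ggen_cj)
  fix s assume "s:{cj (x k t) (x j b) |t j b. j:I & j~=k}"
  then obtain t j b where s: "s = cj (x k t) (x j b)" "j:I" "j~=k" by auto
  have "cj (h k (-1)) s = cj (cj (h k (-1)) (x k t)) (cj (h k (-1)) (x j b))" by (simp add: s cj_def add.assoc minus_add del: add_uminus_conv_diff)
  thus "cj (h k (-1)) s:ggen {cj (x k t) (x j b) |t j b. j:I & j~=k}" using s k by (auto simp: hx intro!: ggen_base)
 qed
 hence "cj (n k) (cj (h k (-1)) u):Up" unfolding Uk_def Up_def by (rule ggen_cj) (use gen in \<open>auto simp: Up_def\<close>)
 thus "cj (- n k) u:Up" by (simp add: n_inv k cj_cj)
qed

section \<open>Bruhat cells and the parabolic subgroups built from them\<close>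

definition "cell ws = {b + nw ws + b' |b b'. b:BB & b':BB}"

lemma cell_left: "b:BB ==> g:cell ws ==> b + g:cell ws" unfolding cell_def using BB(2) by (force simp: add.assoc)

lemma cell_right: "b:BB ==> g:cell ws ==> g + b:cell ws" unfolding cell_def using BB(2) by (force simp: add.assoc)

lemma cell_x: "i:I ==> g:cell ws ==> x i t + g:cell ws" by (rule cell_left[OF subsetD[OF Up_BB Up(4)]])

lemma cell_h: "i:I ==> t~=0 ==> g:cell ws ==> h i t + g:cell ws" by (rule cell_left[OF subsetD[OF HH_BB HH(4)]])

lemma cellI: "nw ws:cell ws" unfolding cell_def using BB(1) by force

lemma cell_nf: assumes "ws:lists I" "g:cell ws" shows "EX u:Up. EX b:BB. g = u + nw ws + b"
proof -
 obtain b b' where b: "g = b + nw ws + b'" "b:BB" "b':BB" using assms by (auto simp: cell_def) obtain u t where u: "b = u + t" "u:Up" "t:HH" using b BB_split by auto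
 have "g = u + nw ws + (cj (- nw ws) t + b')" by (simp add: b u cj_def add.assoc del: add_uminus_conv_diff)
 thus ?thesis using u b nwinv_HH[OF assms(1) u(3)] HH_BB BB(2) by blast
qed

text \<open>Split the unipotent part as \<open>v + x i c\<close>. The factor \<open>v\<close> in
  \<open>Uk i\<close> passes through \<open>n i\<close> to the left, while \<open>x i c\<close>
  passes to the right through \<open>nw ws\<close>, where it stays positive because
  \<open>i # ws\<close> is reduced.\<close>

lemma n_cell: assumes "red (i # ws)" "g:cell ws" shows "n i + g:cell (i # ws)"
proof -
 have r: "red ws" "i:I" "pos (act (rev ws) (eps i))" using assms red_Cons by auto obtain u b where u: "u:Up" "b:BB" "g = u + nw ws + b" using cell_nf[OF red_lists[OF r(1)] assms(2)] by auto
 obtain v c where v: "v:Uk i" "u = v + x i c" using Up_split[OF r(2) u(1)] by auto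
 have "n i + g = cj (n i) v + (n i + nw ws) + (cj (- nw ws) (x i c) + b)" by (simp add: u v cj_def add.assoc del: add_uminus_conv_diff)
 moreover have "cj (n i) v:BB" using n_Uk[OF r(2) v(1)] Up_BB by blast
 moreover have "cj (- nw ws) (x i c) + b:BB" using conj_x_inv[OF r(1-3)] Up_BB u(2) BB(2) by blast
 ultimately show ?thesis unfolding cell_def by auto
qed

lemma y_cell: assumes "red (i # ws)" "g:cell ws" "t~=0" shows "y i t + g:cell (i # ws)"
proof -
 have i: "i:I" using assms red_Cons by auto
 have "h i t + (x i (1 / t) + g):cell ws" by (rule cell_h[OF i assms(3) cell_x[OF i assms(2)]])
 from cell_x[OF i n_cell[OF assms(1) this]]
 have "x i (1 / t) + (n i + (h i t + (x i (1 / t) + g))):cell (i # ws)" .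
 thus ?thesis by (simp add: y_n[OF i assms(3)] add.assoc)
qed

lemma cell_braid: assumes "red us" "red vs" "act us = act vs" shows "cell us = cell vs" unfolding cell_def lx.nw_braid[OF matsumoto[OF assms]] ..

definition "parab K = (UN ws:{ws:lists K. red ws}. cell ws)"

lemma parabI: "ws:lists K ==> red ws ==> g:cell ws ==> g:parab K" unfolding parab_def by (rule UN_I) auto

lemma parab_left: "b:BB ==> g:parab K ==> b + g:parab K" using cell_left by (auto simp: parab_def)

text \<open>If prefixing \<open>k\<close> is not reduced, a braid move makes the word begin with
  \<open>k\<close>, and the question becomes one about \<open>n k + x k c + n k\<close>: it lies in
  the torus for \<open>c = 0\<close>, and otherwise in the cell of \<open>k\<close> by
  \<open>n_x\<close>.\<close>

lemma n_parab: assumes K: "K<=I" and k: "k:K" and g: "g:parab K" shows "n k + g:parab K"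
proof -
 have kI: "k:I" using K k by auto obtain ws where ws: "ws:lists K" "red ws" "g:cell ws" using g by (auto simp: parab_def)
 show ?thesis
 proof (cases "pos (act (rev ws) (eps k))")
  case True
  hence rk: "red (k # ws)" using ws kI red_Cons by blast
  show ?thesis by (rule parabI[OF _ rk n_cell[OF rk ws(3)]]) (use ws k in simp)
 next
  case False
  have "rev ws:lists I" using red_lists[OF red_rev[OF ws(2)]] .
  hence ng: "neg (act (rev ws) (eps k))" using False not_pos act_rts eps_rts kI by blast obtain zs where zs: "red (k # zs)" "Suc (length zs) = length ws" "act (k # zs) = act ws"
   "set zs<=set ws" by (rule exchange_left[OF ws(2) kI ng]) (rule that)
  have rz: "red zs" using zs red_Cons by blast
  have zK: "zs:lists K" using zs(4) ws(1) by auto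
  have "g:cell (k # zs)" using cell_braid[OF ws(2) zs(1) zs(3)[symmetric]] ws by simp
  then obtain u b where u: "u:Up" "b:BB" "g = u + nw (k # zs) + b" using cell_nf[OF red_lists[OF zs(1)]] by blast
  obtain v c where v: "v:Uk k" "u = v + x k c" using Up_split[OF kI u(1)] by auto
  define g' where "g' = n k + x k c + n k + nw zs + b"
  have g1: "n k + g = cj (n k) v + g'" by (simp add: g'_def u v cj_def add.assoc del: add_uminus_conv_diff)
  have zb: "nw zs + b:cell zs" using cellI cell_right u by blast
  have "g':parab K"
  proof (cases "c = 0")
   case True
   have "g' = h k (-1) + (nw zs + b)" by (simp add: g'_def True x_0 kI add.assoc flip: n2[OF kI])
   moreover have "h k (-1) + (nw zs + b):cell zs" by (rule cell_h[OF kI _ zb]) simp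
   ultimately show ?thesis using parabI[OF zK rz] by simp
  next
   case False
   have "g' = x k (- 1 / c) + (h k (1 / c) + (y k (1 / c) + n k + nw zs + b))" by (simp add: g'_def n_x[OF kI False] add.assoc)
   also have "y k (1 / c) + n k = n k + x k (- 1 / c)" using cj_comm[of "n k" "x k (- 1 / c)"] nx[OF kI, of "- 1 / c"] by simp
   finally have g': "g' = x k (- 1 / c) + (h k (1 / c) + (n k + (x k (- 1 / c) + (nw zs + b))))" by (simp add: add.assoc)
   have "g':cell (k # zs)" unfolding g' by (rule cell_x[OF kI cell_h[OF kI _ n_cell[OF zs(1) cell_x[OF kI zb]]]]) (use False in simp)
   thus ?thesis by (rule parabI[rotated 2, OF _ _ zs(1)]) (use zK k in simp)
  qed
  thus ?thesis unfolding g1 by (rule parab_left[OF subsetD[OF Up_BB n_Uk(1)[OF kI v(1)]]])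
 qed
qed

lemma y_parab: assumes K: "K<=I" and k: "k:K" and g: "g:parab K" shows "y k t + g:parab K"
proof (cases "t = 0")
 case True thus ?thesis using K k g y_0[of k] by auto
next
 case False
 have kI: "k:I" using K k by auto
 have "x k (1 / t) + (n k + (h k t + (x k (1 / t) + g))):parab K" using Up(4)[OF kI] Up_BB HH(4)[OF kI False] HH_BB by (intro parab_left n_parab[OF K k] g) auto
 thus ?thesis by (simp add: y_n[OF kI False] add.assoc)
qed

lemma parab_0: "0:parab K" using parabI[of "[]", OF _ red_Nil cellI] by simp

lemma parab_add: assumes K: "K<=I" and g: "g:parab K" and k: "k:parab K" shows "g + k:parab K"
proof -
 obtain ws b b' where ws: "ws:lists K" "g = b + nw ws + b'" "b:BB" "b':BB" using g by (auto simp: parab_def cell_def)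
 have "nw ws + (b' + k):parab K" using ws(1) by (induction ws) (auto simp: add.assoc intro: parab_left[OF ws(4) k] n_parab[OF K])
 from parab_left[OF ws(3) this] show ?thesis using ws by (simp add: add.assoc)
qed

lemma Um_parab: "v:ggen {y k t |k t. k:K} ==> K<=I ==> v:parab K"
proof (induction rule: ggen.induct)
 case (minus s g)
 then obtain k t where "s = y k t" "k:K" by auto
 thus ?case using minus y_parab[of K k g "- t"] y_uminus[of k t] by auto
qed (auto simp: parab_0 intro: y_parab)

lemma BB_Um: "b:BB ==> b:Um ==> b = 0" using opposite by (auto simp: BB_def Um_def)

text \<open>The last letter \<open>j\<close> is an inversion, so conjugation by \<open>nw ws\<close>
  carries \<open>x j 1\<close> to the negative side; if \<open>nw ws\<close> were in the Borel group
  the image would lie on both sides and vanish, against injectivity of \<open>x j\<close>.\<close>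

lemma n_word_BB: assumes "red ws" "nw ws:BB" shows "ws = []"
proof (cases ws rule: rev_cases)
 case (snoc us j)
 have us: "red us" "j:I" "pos (act us (eps j))" using assms snoc red_snoc by auto
 have "cj (nw ws) (x j 1) = cj (nw us) (y j (-1))" by (simp add: snoc lx.nw_append nx us flip: cj_cj)
 hence "cj (nw ws) (x j 1):Um" using conj_y[OF us] by simp
 moreover have "cj (nw ws) (x j 1):BB" unfolding cj_def using assms Up(4)[OF us(2)] Up_BB by (intro BB) auto
 ultimately have "cj (nw ws) (x j 1) = 0" using BB_Um by blast
 hence "cj (- nw ws) (cj (nw ws) (x j 1)) = 0" by simp
 hence "x j 1 = x j 0" by (simp add: x_0 us)
 thus ?thesis using x_inj us by fastforce
qed

text \<open>Induction on the shorter word. Removing its first letter \<open>i\<close> multiplies the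
  other cell by the inverse of \<open>n i\<close>, which lands in the cell of \<open>i # vs\<close>
  or, if \<open>vs\<close> can be rewritten as \<open>i # zs\<close>, in the cell of
  \<open>zs\<close> or of \<open>i # zs\<close>. Comparing lengths leaves only
  \<open>zs\<close>.\<close>

lemma cells_disjoint: assumes "red us" "red vs" "cell us Int cell vs~={}" shows "act us = act vs"
proof -
 have "act us = act vs"
  if "red us" "red vs" "cell us Int cell vs~={}" "length us<=length vs" for us vs using that
 proof (induction us arbitrary: vs)
  case Nil
  then obtain b b' c c' where b: "b:BB" "b':BB" "c:BB" "c':BB" "b + b' = c + nw vs + c'" by (auto simp: cell_def)
  have "nw vs = - c + (b + b') + - c'" using b(5) by (simp add: add.assoc del: add_uminus_conv_diff)
  hence "nw vs:BB" using b BB by metis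
  thus ?case using n_word_BB Nil by blast
 next
  case (Cons i us)
  have i: "red us" "i:I" using Cons.prems red_Cons by auto obtain b b' where b: "b:BB" "b':BB" "b + nw (i # us) + b':cell vs" using Cons.prems by (auto simp: cell_def)
  have "- b + (b + nw (i # us) + b') + - b':cell vs" by (rule cell_right[OF BB(3)[OF b(2)] cell_left[OF BB(3)[OF b(1)] b(3)]])
  hence nv: "n i + nw us:cell vs" by (simp add: add.assoc del: add_uminus_conv_diff)
  have nus: "nw us = n i + (h i (-1) + (n i + nw us))"
  proof -
   have "nw us = - n i + (n i + nw us)" by simp
   thus ?thesis unfolding n_inv[OF i(2)] by (simp only: add.assoc)
  qed
  have hv: "h i (-1) + (n i + nw us):cell vs" by (rule cell_h[OF i(2) _ nv]) simp
  have len: "length us < length vs" using Cons.prems by simp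
  show ?case
  proof (cases "pos (act (rev vs) (eps i))")
   case True
   hence r: "red (i # vs)" using Cons.prems i red_Cons by blast
   have "nw us:cell (i # vs)" using n_cell[OF r hv] nus by (simp only:)
   hence "act us = act (i # vs)" by (intro Cons.IH[OF i(1) r]) (use cellI[of us] len in auto)
   hence "length us = length (i # vs)" using red_length_eq[OF i(1) r] by blast
   thus ?thesis using len by simp
  next
   case False
   have "rev vs:lists I" using red_lists[OF red_rev[OF Cons.prems(2)]] .
   hence ng: "neg (act (rev vs) (eps i))" using False not_pos act_rts eps_rts i by blast obtain zs where zs: "red (i # zs)" "Suc (length zs) = length vs" "act (i # zs) = act vs"
    "set zs<=set vs" by (rule exchange_left[OF Cons.prems(2) i(2) ng]) (rule that)
   have rz: "red zs" using zs red_Cons by blast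
   have "n i + nw us:cell (i # zs)" using cell_braid[OF Cons.prems(2) zs(1) zs(3)[symmetric]] nv by simp
   then obtain u b where u: "u:Up" "b:BB" "n i + nw us = u + nw (i # zs) + b" using cell_nf[OF red_lists[OF zs(1)]] by blast
   obtain v c where v: "v:Uk i" "u = v + x i c" using Up_split[OF i(2) u(1)] by auto
   have "nw us = - n i + (n i + nw us)" by simp
   also have "... = cj (- n i) v + (- n i + x i c + n i + nw zs + b)" unfolding u(3) v(2) by (simp add: cj_def add.assoc del: add_uminus_conv_diff)
   finally have nu: "nw us = cj (- n i) v + (- n i + x i c + n i + nw zs + b)" .
   have cv: "- cj (- n i) v:BB" using n_Uk(2)[OF i(2) v(1)] Up_BB BB(3) by blast
   show ?thesis
   proof (cases "c = 0")
    case True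
    have "nw us = cj (- n i) v + (nw zs + b)" using nu by (simp add: True x_0 i add.assoc)
    moreover have "cj (- n i) v + (nw zs + b):cell zs" using n_Uk(2)[OF i(2) v(1)] Up_BB u(2) cellI by (intro cell_left cell_right) auto
    ultimately have "cell us Int cell zs~={}" using cellI by force
    hence "act us = act zs" by (intro Cons.IH[OF i(1) rz]) (use zs(2) len in auto)
    hence "act (i # us) = act (i # zs)" by (intro ext) (simp only: act_Cons)
    thus ?thesis using zs(3) by simp
   next
    case False
    have hi: "- n i = h i (-1) + n i" using n_inv[OF i(2)] n2[OF i(2)] by (metis add.assoc)
    have "- n i + x i c + n i + nw zs + b
      = h i (-1) + (x i (- 1 / c) + (h i (1 / c) + (n i + (x i (- 1 / c) + (nw zs + b)))))"
    proof -
     have "y i (1 / c) + n i = n i + x i (- 1 / c)" using cj_comm[of "n i" "x i (- 1 / c)"] nx[OF i(2), of "- 1 / c"] by simp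
     hence "n i + x i c + n i = x i (- 1 / c) + (h i (1 / c) + (n i + x i (- 1 / c)))" by (simp add: n_x[OF i(2) False] add.assoc)
     hence "h i (-1) + (n i + x i c + n i) + (nw zs + b)
       = h i (-1) + (x i (- 1 / c) + (h i (1 / c) + (n i + x i (- 1 / c)))) + (nw zs + b)" by (simp only:)
     thus ?thesis unfolding hi by (simp only: add.assoc)
    qed
    moreover have "nw zs + b:cell zs" using cellI u(2) by (rule cell_right[rotated])
    ultimately have *: "- n i + x i c + n i + nw zs + b:cell (i # zs)" using cell_h[OF i(2) _ cell_x[OF i(2) cell_h[OF i(2) _ n_cell[OF zs(1) cell_x[OF i(2)]]]],
       of "-1" "1 / c"] False by (simp only:) simp
    have "nw us:cell (i # zs)" unfolding nu by (rule cell_left[OF subsetD[OF Up_BB n_Uk(2)[OF i(2) v(1)]] *])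
    hence "cell us Int cell (i # zs)~={}" using cellI by force
    hence "act us = act (i # zs)" by (intro Cons.IH[OF i(1) zs(1)]) (use zs(2) len in auto)
    hence "length us = length (i # zs)" using red_length_eq[OF i(1) zs(1)] by blast
    thus ?thesis using len zs(2) by simp
   qed
  qed
 qed
 thus ?thesis using assms by (metis inf_commute nle_le)
qed

section \<open>Positive cells and the description of the fibre\<close>

definition "ypr ws ps = foldr (%(i, p) g. y i p + g) (zip ws ps) 0"

definition "Upos ws = {ypr ws ps |ps. length ps = length ws & (ALL p:set ps. 0 < p)}"

lemma Upos_Nil: "Upos [] = {0}" by (simp add: Upos_def ypr_def)

lemma Upos_Cons: "Upos (i # ws) = {y i p + g |p g. 0 < p & g:Upos ws}"
proof (intro equalityI subsetI)
 fix u assume "u:Upos (i # ws)"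
 then obtain ps where ps: "u = ypr (i # ws) ps" "length ps = Suc (length ws)" "ALL p:set ps. 0 < p" by (auto simp: Upos_def)
 then obtain p qs where "ps = p # qs" by (cases ps) auto
 thus "u:{y i p + g |p g. 0 < p & g:Upos ws}" using ps by (auto simp: Upos_def ypr_def)
next
 fix u assume "u:{y i p + g |p g. 0 < p & g:Upos ws}"
 then obtain p ps where "u = y i p + ypr ws ps" "0 < p" "length ps = length ws" "ALL p:set ps. 0 < p" by (auto simp: Upos_def)
 thus "u:Upos (i # ws)" by (auto simp: Upos_def ypr_def intro!: exI[of _ "p # ps"])
qed

lemma Upos_append: "Upos (us @ vs) = {g + k |g k. g:Upos us & k:Upos vs}"
proof (induction us)
 case Nil thus ?case by (simp add: Upos_Nil)
next
 case (Cons i us)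
 show ?case unfolding append_Cons Upos_Cons Cons by (auto simp: add.assoc) (metis add.assoc)+
qed

lemma Upos_single: "Upos [i] = {y i p |p. 0 < p}" by (auto simp: Upos_Cons Upos_Nil)

text \<open>The new parameters of a triple move are subtraction-free rational functions of the old
  ones, so positivity survives.\<close>

lemma Upos_braid: "braid us vs ==> Upos us<=Upos vs"
proof (induction rule: braid.induct)
 case (comm i j p q)
 have "Upos [i, j]<=Upos [j, i]" unfolding Upos_Cons[of _ "[_]"] Upos_single using yy0[OF comm] by fastforce
 thus ?case unfolding Upos_append by blast
next
 case (triple i j p q)
 have "Upos [i, j, i]<=Upos [j, i, j]"
 proof
  fix u assume "u:Upos [i, j, i]"
  then obtain s t r where p: "0 < s" "0 < t" "0 < r" and u: "u = y i s + (y j t + y i r)" by (auto simp: Upos_Cons Upos_Nil)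
  have "u = y j (t * r / (s + r)) + (y i (s + r) + y j (s * t / (s + r)))" using yyy[OF triple p(1,3), of t] by (simp add: u add.assoc)
  moreover have "0 < t * r / (s + r)" "0 < s + r" "0 < s * t / (s + r)" using p by auto
  ultimately show "u:Upos [j, i, j]" unfolding Upos_Cons[of _ "_ # _"] Upos_single by blast
 qed
 thus ?case unfolding Upos_append by blast
qed auto

lemma braid_sym: "braid us vs ==> braid vs us"
proof (induction rule: braid.induct)
 case (comm i j p q)
 thus ?case using braid.comm[of j i p q] a_sym[of i j] by simp
next
 case (triple i j p q)
 thus ?case using braid.triple[of j i p q] a_sym[of i j] by simp
qed (auto intro: braid.intros)

lemma Upos_cell: "red ws ==> g:Upos ws ==> g:cell ws"
proof (induction ws arbitrary: g)
 case Nil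
 hence "g = nw []" by (simp add: Upos_Nil)
 thus ?case using cellI by (simp only:)
next
 case (Cons i ws)
 then obtain p k where "g = y i p + k" "0 < p" "k:Upos ws" by (auto simp: Upos_Cons)
 thus ?case using Cons y_cell[OF Cons.prems(1), of k p] red_Cons by auto
qed

lemma Upos_gen: "ws:lists K ==> g:Upos ws ==> g:ggen {y k t |k t. k:K}"
proof (induction ws arbitrary: g)
 case (Cons i ws)
 then obtain p k where g: "g = y i p + k" "0 < p" "k:Upos ws" by (auto simp: Upos_Cons)
 show ?case unfolding g(1) using Cons g by (intro ggen.plus) auto
qed (auto simp: Upos_Nil ggen.zero)

lemma Upos_Um: "ws:lists I ==> g:Upos ws ==> g:Um" unfolding Um_def by (rule Upos_gen)

lemma cell_add: assumes "red (us @ z)" "g:cell us" "c:cell z" shows "g + c:cell (us @ z)"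
proof -
 obtain b b' where b: "b:BB" "b':BB" "g = b + nw us + b'" using assms by (auto simp: cell_def)
 have "b' + c:cell z" by (rule cell_left[OF b(2) assms(3)])
 hence "nw us + (b' + c):cell (us @ z)" using assms(1)
 proof (induction us)
  case (Cons i us)
  hence "red (us @ z)" using red_Cons by simp
  thus ?case using Cons n_cell[of i "us @ z"] by (simp add: add.assoc)
 qed simp
 from cell_left[OF b(1) this] show ?thesis by (simp add: b add.assoc)
qed

text \<open>The Borel group contains the conjugate of \<open>x k\<close> by the inverse of the rest
  of the word. Conjugated by the whole word it becomes \<open>y k\<close>, so \<open>Q\<close>
  contains \<open>y k\<close> and hence \<open>n k\<close>. Conjugating back by \<open>n k\<close>
  gives the hypothesis for the rest of the word.\<close>

lemma word_in: assumes Q: "!!g k. g:Q ==> k:Q ==> g + k:Q" "!!g. g:Q ==> - g:Q" "BB<=Q" and z: "red z" "!!b. b:BB ==> cj (nw z) b:Q" and i: "i:set z" shows "y i t:Q" using z i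
proof (induction z arbitrary: i t)
 case (Cons k z)
 have k: "red z" "k:I" "pos (act (rev z) (eps k))" using Cons.prems red_Cons by auto
 have yk: "y k t:Q" for t
 proof -
  have "cj (nw (k # z)) (cj (- nw z) (x k (- t))) = y k t" using nx[OF k(2), of "- t"] by (simp flip: cj_cj)
  moreover have "cj (- nw z) (x k (- t)):BB" using conj_x_inv[OF k] Up_BB by blast
  ultimately show ?thesis using Cons.prems(2) by metis
 qed
 have "n k:Q" unfolding n_def[OF k(2)] using Up(4)[OF k(2)] Up_BB Q(3) by (intro Q(1) yk) blast
 have "cj (nw z) b:Q" if "b:BB" for b
 proof -
  have "cj (nw z) b = cj (- n k) (cj (nw (k # z)) b)" by (simp flip: cj_cj)
  also have "... = - n k + cj (nw (k # z)) b + n k" unfolding cj_def[of "- n k"] by simp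
  finally show ?thesis using Q(1,2) `n k:Q` Cons.prems(2)[OF that] by metis
 qed
 thus ?case using Cons.IH[OF k(1)] Cons.prems(3) yk by auto
qed simp

text \<open>\<open>BR\<close> stands for the full real Borel group, of which only the inclusion of
  the generated group \<open>BB\<close> is known here. A second fibre point \<open>u0 + v\<close>
  conjugates the Borel group into \<open>Q\<close>; decomposing \<open>v\<close> by Bruhat cells and
  applying \<open>word_in\<close> shows that the letters of its cell lie in
  \<open>K\<close>.\<close>

theorem fibre_description: assumes ws: "red ws" and P: "0:P" "!!g k. g:P ==> k:P ==> g + k:P" "!!g. g:P ==> - g:P" and BR: "BB<=BR" and u0: "u0:Upos ws" "!!b. b:BR ==> cj u0 b:P"
 obtains us vs a0 where "braid ws (us @ vs)" "a0:Upos us"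
  "{u:Upos ws. ALL b:BR. cj u b:P} = {a0 + b |b. b:Upos vs}"
proof -
 define Q where "Q = {g. cj u0 g:P}"
 have Q: "0:Q" "!!g k. g:Q ==> k:Q ==> g + k:Q" "!!g. g:Q ==> - g:Q" by (auto simp: Q_def cj_add cj_uminus P)
 have BQ: "BR<=Q" "BB<=Q" using u0 BR by (auto simp: Q_def)
 define K where "K = {i:I. ALL t. y i t:Q}"
 have K: "K<=I" by (auto simp: K_def) obtain us vs where uv: "braid ws (us @ vs)" "red (us @ vs)" "vs:lists K" and usK: "!!k. k:K ==> pos (act us (eps k))" using factor_out[OF ws K] by blast
 have uI: "us:lists I" "vs:lists I" using red_lists[OF uv(2)] by auto
 have rus: "red us"
 proof -
  have "red (us @ xs) ==> red us" for xs by (induction xs rule: rev_induct) (auto simp: red_snoc simp flip: append_assoc)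
  thus ?thesis using uv(2) by blast
 qed
 have U: "Upos ws = Upos (us @ vs)" using Upos_braid[OF uv(1)] Upos_braid[OF braid_sym[OF uv(1)]] by blast obtain a0 b0 where ab: "a0:Upos us" "b0:Upos vs" "u0 = a0 + b0"
  using u0(1) U Upos_append by auto
 have gK: "ggen {y k t |k t. k:K}<=Q" by (rule ggen_least) (use Q in \<open>auto simp: K_def\<close>)
 have "{u:Upos ws. ALL b:BR. cj u b:P} = {a0 + b |b. b:Upos vs}"
 proof (intro equalityI subsetI)
  fix u assume "u:{a0 + b |b. b:Upos vs}"
  then obtain b where b: "b:Upos vs" "u = a0 + b" by auto
  define z where "z = - b0 + b"
  have "z:ggen {y k t |k t. k:K}" unfolding z_def using Upos_gen[OF uv(3)] ab b by (intro ggen_add ggen_uminus)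
  hence zQ: "z:Q" using gK by blast
  have uz: "u = u0 + z" by (simp add: b ab z_def add.assoc del: add_uminus_conv_diff)
  have "cj u c:P" if "c:BR" for c
  proof -
   have "cj z c:Q" unfolding cj_def using that BQ zQ by (intro Q) auto
   thus ?thesis by (simp add: uz Q_def flip: cj_cj)
  qed
  thus "u:{u:Upos ws. ALL b:BR. cj u b:P}" using b ab U Upos_append by auto
 next
  fix u assume u: "u:{u:Upos ws. ALL b:BR. cj u b:P}"
  then obtain a' b' where ab': "a':Upos us" "b':Upos vs" "u = a' + b'" using U Upos_append by auto
  define v where "v = - u0 + u"
  have "v:Um" unfolding v_def using u u0 Upos_Um[OF red_lists[OF ws]] by (intro Um) auto
  hence "v:parab I" using Um_parab[of v I] by (simp add: Um_def)
  then obtain z b1 b2 where z: "red z" "b1:BB" "b2:BB" "v = b1 + nw z + b2" by (auto simp: parab_def cell_def)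
  have uv': "u = u0 + v" by (simp add: v_def)
  have vQ: "cj v b:Q" if "b:BB" for b using u that BR by (auto simp: Q_def uv' cj_cj)
  have zQ: "cj (nw z) b:Q" if "b:BB" for b
  proof -
   have "cj v (cj (- b2) b):Q" using that z(3) by (intro vQ) (simp add: cj_def BB)
   hence "cj b1 (cj (nw z) b):Q" by (simp add: z(4) flip: cj_cj)
   hence "- b1 + cj b1 (cj (nw z) b) + b1:Q" using z BQ by (intro Q) auto
   thus ?thesis by (simp add: cj_def add.assoc del: add_uminus_conv_diff)
  qed
  have "set z<=K"
  proof
   fix i assume i: "i:set z"
   hence "i:I" using red_lists[OF z(1)] by auto
   thus "i:K" using word_in[OF Q(2,3) BQ(2) z(1) zQ i] by (simp add: K_def)
  qed
  hence zK: "z:lists K" by auto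
  have "nw z + b2:cell z" by (rule cell_right[OF z(3) cellI])
  from cell_left[OF z(2) this] have "v:cell z" by (simp add: z(4) add.assoc)
  hence vK: "v:parab K" by (rule parabI[OF zK z(1)])
  \<comment> \<open>The difference of the two heads. It lies in the parabolic group of
    \<open>K\<close>, and since lengths add behind \<open>us\<close>, the cell of a nonempty word in
    \<open>K\<close> would carry \<open>a0\<close> away from the cell of \<open>us\<close>, which
    also contains \<open>a'\<close>.\<close>
  define c where "c = - a0 + a'"
  have c: "c = b0 + (v + - b')" by (simp add: c_def v_def ab ab' minus_add add.assoc del: add_uminus_conv_diff)
  have "b0:parab K" "- b':parab K" using Um_parab[OF _ K] Upos_gen[OF uv(3)] ab ab' ggen_uminus by blast+
  hence "c:parab K" unfolding c using vK by (intro parab_add[OF K])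
  then obtain w where w: "w:lists K" "red w" "c:cell w" by (auto simp: parab_def)
  have ac: "a' = a0 + c" by (simp add: c_def)
  have rw: "red (us @ w)" by (rule red_append[OF rus K usK w(1,2)])
  have "a':cell (us @ w)" unfolding ac by (rule cell_add[OF rw Upos_cell[OF rus ab(1)] w(3)])
  moreover have "a':cell us" by (rule Upos_cell[OF rus ab'(1)])
  ultimately have "act us = act (us @ w)" by (intro cells_disjoint[OF rus rw]) auto
  hence "length us = length (us @ w)" by (rule red_length_eq[OF rus rw])
  hence "c:BB" using w(3) BB(1,2) by (auto simp: cell_def)
  moreover have "c:Um" unfolding c_def using ab(1) ab'(1) Upos_Um[OF uI(1)] by (intro Um)
  ultimately have "c = 0" by (rule BB_Um)
  hence "u = a0 + b'" using ab' ac by simp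
  thus "u:{a0 + b |b. b:Upos vs}" using ab' by blast
 qed
 thus ?thesis using that uv ab by blast
qed

section \<open>Generalized minors on Bruhat cells\<close>

lemma om_Up: "u:Up ==> om u = 1" unfolding Up_def
proof (induction rule: ggen.induct)
 case (plus s g)
 hence "s:BB" "g:BB" "om s = 1" using Up_BB Up om_x by (auto simp: Up_def) 
 thus ?case using om_mult[of s g] plus by (simp add: BB_def)
next
 case (minus s g)
 hence "s:BB" "g:BB" "om (- s) = 1" using Up_BB Up om_x by (auto simp: Up_def simp flip: x_uminus)
 thus ?case using om_mult[of "- s" g] minus BB(3)[of s] by (simp add: BB_def)
qed (simp add: om_0)

lemma om_BB: "u:BB ==> v:BB ==> om (u + v) = om u * om v" using om_mult by (simp add: BB_def)

lemma om_nz: "b:BB ==> om b~=0" using om_BB[of b "- b"] BB(3)[of b] om_0 by auto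

lemma om_Um: "v:Um ==> b:BB ==> om (v + b) = om b" using om_y by (simp add: Um_def BB_def)

lemma ninv_x: "i:I ==> cj (- n i) (x i c) = y i (- c)" by (simp add: n_inv hx a_diag nx flip: cj_cj)

text \<open>Removing the letter \<open>i\<close> splits off the factor \<open>x i c\<close>, which
  \<open>n i\<close> turns into \<open>y i (- c)\<close>. As \<open>i # ws\<close> is reduced, this
  factor stays negative under the remaining letters; the rest of \<open>u\<close> stays positive and
  is treated by induction.\<close>

lemma conj_Up: "red ws ==> u:Up ==> EX v:Um. EX w:Up. cj (- nw ws) u = v + w"
proof (induction ws arbitrary: u)
 case Nil thus ?case using Um(1) by (intro bexI[of _ 0] bexI[of _ u]) auto
next
 case (Cons i ws)
 have i: "red ws" "i:I" "pos (act (rev ws) (eps i))" using Cons.prems red_Cons by auto obtain v c where v: "v:Uk i" "u = v + x i c" using Up_split[OF i(2) Cons.prems(2)] by auto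
 define v' where "v' = cj (x i (- c)) v"
 have u: "u = x i c + v'"  by (simp add: v v'_def x_uminus i cj_def add.assoc del: add_uminus_conv_diff)
 have "cj (- n i) v':Up" unfolding v'_def by (rule n_Uk(2)[OF i(2) Uk_x[OF i(2) v(1)]])
 then obtain v1 w where vw: "v1:Um" "w:Up" "cj (- nw ws) (cj (- n i) v') = v1 + w" using Cons.IH[OF i(1)] by blast
 have "cj (- nw (i # ws)) u = cj (- nw ws) (y i (- c)) + (v1 + w)" unfolding u by (simp add: minus_add cj_add ninv_x i vw(3) flip: cj_cj del: add_uminus_conv_diff)
 hence "cj (- nw (i # ws)) u = (cj (- nw ws) (y i (- c)) + v1) + w" by (simp add: add.assoc)
 thus ?case using conj_y_inv[OF i] vw Um(2) by blast
qed

definition "Dm ws g = om (- nw ws + g)"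

lemma Dm_nf: assumes "red ws" "u:Up" "b:BB" shows "Dm ws (u + nw ws + b) = om b"
proof -
 obtain v w where v: "v:Um" "w:Up" "cj (- nw ws) u = v + w" using conj_Up assms by blast
 have "- nw ws + (u + nw ws + b) = v + (w + b)" using v(3) by (simp add: cj_def add.assoc[symmetric] del: add_uminus_conv_diff)
 moreover have "w:BB" "w + b:BB" using v Up_BB assms BB(2) by auto
 ultimately show ?thesis using om_Um[OF v(1)] om_BB[of w b] om_Up[OF v(2)] assms by (simp add: Dm_def)
qed

text \<open>\<open>tor c v t\<close>: \<open>t\<close> is the value at \<open>c\<close> of the cocharacter with coordinates \<open>v\<close> in the
 basis of simple coroots.\<close>

inductive tor :: "real => ('i => int) => 'g => bool" for c where
 zero: "tor c (%_. 0) 0"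
| step: "tor c v t ==> i:I ==> tor c (%k. v k + e * eps i k) (h i (c powi e) + t)"

lemma tor_h: "c~=0 ==> i:I ==> tor c (eps i) (h i c)" using tor.step[where c = c and e = 1 and i = i, OF tor.zero] by simp

lemma tor_HH: "tor c v t ==> c~=0 ==> t:HH" by (induction rule: tor.induct) (auto intro!: HH(1,2,4))

lemma ninv_h: "i:I ==> j:I ==> c~=0 ==> cj (- n i) (h j c) = h j c + h i (c powi (- a j i))" using cj_fix[OF h_comm, of i j "-1" c] by (simp add: n_inv nh flip: cj_cj)

lemma tor_refl: "tor c v t ==> c~=0 ==> i:I ==> tor c (refl i v) (cj (- n i) t)"
proof (induction rule: tor.induct)
 case zero
 have "refl i (%_. 0) = (%_. 0)" by (auto simp: refl_def pr_def)
 thus ?case by (simp add: tor.zero)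
next
 case (step v t j e)
 have "tor c (%k. (refl i v k + (- a i j * e) * eps i k) + e * eps j k)
   (h j (c powi e) + (h i (c powi (- a i j * e)) + cj (- n i) t))" using step by (intro tor.step) auto
 moreover have "(%k. (refl i v k + (- a i j * e) * eps i k) + e * eps j k)
   = refl i (%k. v k + e * eps j k)" using refl_lin[of i 1 v e "eps j"] step by (auto simp: refl_eq[of i "eps j"] pr_eps algebra_simps fun_eq_iff)
 moreover have "cj (- n i) (h j (c powi e) + t)
   = h j (c powi e) + (h i (c powi (- a i j * e)) + cj (- n i) t)" using step by (simp add: cj_add ninv_h a_sym[of j i] add.assoc power_int_mult[symmetric] mult.commute)
 ultimately show ?case by simp
qed

lemma tor_nw: "ws:lists I ==> tor c v t ==> c~=0 ==> tor c (act (rev ws) v) (cj (- nw ws) t)"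
proof (induction ws arbitrary: v t)
 case (Cons i ws)
 have "tor c (act (rev ws) (refl i v)) (cj (- nw ws) (cj (- n i) t))" using Cons tor_refl by auto
 thus ?case by (simp add: minus_add cj_cj del: add_uminus_conv_diff)
qed simp

lemma tor_om: "tor c v t ==> c~=0 ==> om t = of_real (c powi (SUM k:I. v k * int (M k)))"
proof (induction rule: tor.induct)
 case (step v t i e)
 have "om (h i (c powi e) + t) = om (h i (c powi e)) * om t" using step tor_HH HH(4)[of i "c powi e"] HH_BB by (intro om_BB) auto
 also have "... = of_real ((c powi e) ^ M i * c powi (SUM k:I. v k * int (M k)))" using step by (simp add: om_h)
 also have "(c powi e) ^ M i = c powi (e * int (M i))" by (simp add: power_int_mult)
 also have "c powi (e * int (M i)) * c powi (SUM k:I. v k * int (M k))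
   = c powi (SUM k:I. (v k + e * eps i k) * int (M k))"
 proof -
  have "(SUM k:I. e * eps i k * int (M k)) = e * int (M i)" using fin_I step by (simp add: eps_def if_distrib[of "%x. _ * x"] if_distrib[of "%x. x * _"] cong: if_cong)
  thus ?thesis using step by (simp add: power_int_add[symmetric] distrib_right sum.distrib add.commute)
 qed
 finally show ?case .
qed (simp add: om_0)

text \<open>The weight with coordinates \<open>M\<close> evaluated at the coroot
  \<open>act (rev ws) (eps i)\<close>. By \<open>wt_pos\<close> the sum is positive for a reduced
  word \<open>i # ws\<close>, so \<open>nat\<close> then loses nothing.\<close>

definition "wt i ws = nat (SUM k:I. act (rev ws) (eps i) k * int (M k))"

lemma wt_pos: assumes "red (i # ws)" shows "0 < (SUM k:I. act (rev ws) (eps i) k * int (M k))"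
proof -
 have i: "red ws" "i:I" "pos (act (rev ws) (eps i))" using assms red_Cons by auto
 have rt: "act (rev ws) (eps i):rts" using act_rts eps_rts red_lists[OF red_rev[OF i(1)]] i by blast
 hence "~ neg (act (rev ws) (eps i))" using rts_nonzero i by blast
 then obtain k where k: "act (rev ws) (eps i) k > 0" by (auto simp: neg_def not_le)
 hence "k:I" using rt by (auto simp: rts_def)
 thus ?thesis using k i(3) M_pos fin_I by (intro sum_pos2[of I k]) (auto simp: pos_def)
qed

text \<open>By \<open>n_y\<close> a torus factor \<open>h i p\<close> splits off from
  \<open>- n i + y i p\<close>. Moved through \<open>nw ws\<close> it becomes the value at
  \<open>p\<close> of a positive coroot, whose \<open>om\<close> is the stated power. All remaining
  factors are negative on the left or positive unipotent, so \<open>om\<close> does not see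
  them.\<close>

lemma Dm_step: assumes "red (i # ws)" "p~=0" "g:cell ws" shows "Dm ws (y i p + g) = Dm ws g" "Dm ws g~=0"
  "Dm (i # ws) (y i p + g) = of_real (p ^ wt i ws) * Dm ws g" "0 < wt i ws"
proof -
 have i: "red ws" "i:I" "pos (act (rev ws) (eps i))" using assms red_Cons by auto obtain u b where g: "u:Up" "b:BB" "g = u + nw ws + b" using cell_nf[OF red_lists[OF i(1)] assms(3)] by auto
 have Dg: "Dm ws g = om b" using Dm_nf[OF i(1) g(1,2)] g(3) by simp
 thus "Dm ws g~=0" using om_nz g by simp obtain v w where v: "v:Um" "w:Up" "cj (- nw ws) u = v + w" using conj_Up[OF i(1) g(1)] by blast
 have wb: "w:BB" "w + b:BB" using v Up_BB g BB(2) by auto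
 have "- nw ws + (y i p + g) = cj (- nw ws) (y i p) + cj (- nw ws) u + b" unfolding g(3) by (simp add: cj_def add.assoc del: add_uminus_conv_diff)
 hence "- nw ws + (y i p + g) = (cj (- nw ws) (y i p) + v) + (w + b)" unfolding v(3) by (simp only: add.assoc)
 thus "Dm ws (y i p + g) = Dm ws g" using om_Um[OF Um(2)[OF conj_y_inv[OF i, of p] v(1)] wb(2)] om_BB[OF wb(1) g(2)] om_Up[OF v(2)] by (simp add: Dm_def[of ws "y i p + g"] Dg)
 have xu: "x i (1 / p) + u:Up" using Up i g by auto obtain v2 w2 where v2: "v2:Um" "w2:Up" "cj (- nw ws) (x i (1 / p) + u) = v2 + w2" using conj_Up[OF i(1) xu] by blast
 define t where "t = cj (- nw ws) (h i p)"
 have tor: "tor p (act (rev ws) (eps i)) t" unfolding t_def using tor_nw[OF red_lists[OF i(1)] tor_h[OF assms(2) i(2)] assms(2)] .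
 have tH: "t:HH" using tor_HH[OF tor assms(2)] .
 have "- nw (i # ws) + (y i p + g) = - nw ws + ((- n i + y i p) + g)" by (simp add: minus_add add.assoc del: add_uminus_conv_diff)
 also have "... = cj (- nw ws) (y i (- 1 / p)) + t + cj (- nw ws) (x i (1 / p) + u) + b" unfolding n_y[OF i(2) assms(2)] g(3) t_def cj_def by (simp add: add.assoc del: add_uminus_conv_diff)
 also have "... = (cj (- nw ws) (y i (- 1 / p)) + cj t v2) + (t + (w2 + b))" unfolding v2(3) by (simp add: cj_def add.assoc del: add_uminus_conv_diff)
 finally have e: "- nw (i # ws) + (y i p + g)
   = (cj (- nw ws) (y i (- 1 / p)) + cj t v2) + (t + (w2 + b))" .
 have m: "t:BB" "w2:BB" "w2 + b:BB" using tH HH_BB v2 Up_BB g BB(2) by auto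
 have "Dm (i # ws) (y i p + g) = om t * om b" using om_Um[OF Um(2)[OF conj_y_inv[OF i, of "- 1 / p"] HH_Um[OF tH v2(1)]] BB(2)[OF m(1,3)]]
   om_BB[OF m(1,3)] om_BB[OF m(2) g(2)] om_Up[OF v2(2)] unfolding Dm_def e by simp
 moreover have "om t = of_real (p ^ wt i ws)" using tor_om[OF tor assms(2)] wt_pos[OF assms(1)] by (simp add: wt_def power_int_def)
 ultimately show "Dm (i # ws) (y i p + g) = of_real (p ^ wt i ws) * Dm ws g" using Dg by simp
 show "0 < wt i ws" using wt_pos[OF assms(1)] by (simp add: wt_def)
qed

text \<open>At the first nonreduced prefix the exchange property produces two equal adjacent
  letters, whose lifts multiply into the torus. Deleting both shortens the word modulo
  \<open>T0\<close>. The group \<open>T0\<close> leaves room for a torus larger than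
  \<open>HH\<close>, such as the complex one.\<close>

theorem longest_reduced: assumes ws: "ws:lists I" and T0: "HH<=T0" and short: "!!us t. us:lists I ==> t:T0 ==> nw us = nw ws + t ==> length ws<=length us" shows "red ws"
proof -
 have pre: "red p" if "ws = p @ q" for p q using that
 proof (induction p arbitrary: q rule: rev_induct)
  case (snoc j p)
  hence rp: "red p" by simp
  have jI: "j:I" "p:lists I" "q:lists I" using snoc.prems ws by auto
  have "pos (act p (eps j))"
  proof (rule ccontr)
   assume "~ ?thesis"
   hence ng: "neg (act p (eps j))" using not_pos act_rts eps_rts jI by blast obtain zs where zs: "red (zs @ [j])" "Suc (length zs) = length p" "act (zs @ [j]) = act p"
    "set zs<=set p" by (rule exchange[OF rp jI(1) ng]) (rule that)
   have np: "nw p = nw zs + n j" using lx.nw_braid[OF matsumoto[OF rp zs(1) zs(3)[symmetric]]] by (simp add: lx.nw_append)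
   have "nw ws = nw zs + (n j + n j) + nw q" by (simp add: snoc.prems lx.nw_append np add.assoc)
   also have "... = nw zs + nw q + cj (- nw q) (h j (-1))" by (simp add: n2 jI cj_def add.assoc del: add_uminus_conv_diff)
   finally have e: "nw (zs @ q) = nw ws + - cj (- nw q) (h j (-1))" by (simp add: lx.nw_append add.assoc del: add_uminus_conv_diff)
   have "- cj (- nw q) (h j (-1)):HH" by (intro HH(3) nwinv_HH jI HH(4)) simp
   hence "length ws<=length (zs @ q)" using zs(4) jI T0 by (intro short[OF _ _ e]) auto
   thus False using snoc.prems zs(2) by simp
  qed
  thus ?case using rp jI red_snoc by blast
 qed simp
 show ?thesis using pre[of ws "[]"] by simp
qed

end

subsection \<open>Matrices\<close>

definition msc :: "complex => complex^'n^'n => complex^'n^'n" where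
 "msc c X = (\<chi> i j. c * X$i$j)"

lemma msc_nth [simp]: "msc c X$i$j = c * X$i$j" by (simp add: msc_def)

lemma mat_eqI: "(!!i j. A$i$j = B$i$j) ==> A = B" for A :: "complex^'n^'n" by (simp add: vec_eq_iff)

lemma mm_nth: "(A**B)$i$j = (SUM k:UNIV. A$i$k * B$k$j)" by (simp add: matrix_matrix_mult_def)

lemma msc_mult [simp]: "msc c X**Y = msc c (X**Y)" "X**msc c Y = msc c (X**Y)" by (auto intro!: mat_eqI simp: mm_nth sum_distrib_left algebra_simps)

lemma msc_simps [simp]: "msc 1 X = X" "msc 0 X = 0" "msc c 0 = 0" "msc c (msc d X) = msc (c * d) X"
 "msc (- 1) X = - X" "msc (- c) X = - msc c X" by (auto intro!: mat_eqI)

lemma msc_add: "msc c (X + Y) = msc c X + msc c Y" "msc (c + d) X = msc c X + msc d X"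
 "msc c (X - Y) = msc c X - msc c Y" "msc c (- X) = - msc c X" by (auto intro!: mat_eqI simp: algebra_simps)

lemma mm_add:
 fixes A B C :: "complex^'n^'n" shows "A**(B + C) = A**B + A**C" "(B + C)**A = B**A + C**A"
  "A**(B - C) = A**B - A**C" "(B - C)**A = B**A - C**A"
  "A**(- B) = - (A**B)" "(- A)**B = - (A**B)" "A**0 = 0" "0**A = 0" by (simp_all add: vec_eq_iff mm_nth distrib_left distrib_right right_diff_distrib left_diff_distrib
   sum.distrib sum_subtractf sum_negf)

lemma mm_assoc: "(A**B)**C = A**(B**C)" for A B C :: "complex^'n^'n" by (simp add: matrix_mul_assoc)

lemma minv: "invertible A ==> A**minv A = mat 1" "invertible A ==> minv A**A = mat 1"
 for A :: "complex^'n^'n" unfolding invertible_def matrix_inv_def by (metis (mono_tags, lifting) someI_ex)+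

lemma minv_unique: "A**B = mat 1 ==> minv A = B" for A B :: "complex^'n^'n"
proof -
 assume AB: "A**B = mat 1"
 hence "invertible A" by (metis invertible_def matrix_left_right_inverse)
 thus ?thesis using AB by (metis minv(2) matrix_mul_assoc matrix_mul_lid matrix_mul_rid)
qed

lemma invertible_minv: "invertible A ==> invertible (minv A)" for A :: "complex^'n^'n" using minv invertible_def by blast

lemma minv_minv: "invertible A ==> minv (minv A) = A" for A :: "complex^'n^'n" by (rule minv_unique) (rule minv)

lemma minv_cancel: "invertible A ==> minv A**(A**B) = B" "invertible A ==> A**(minv A**B) = B"
 for A B :: "complex^'n^'n" by (simp_all add: matrix_mul_assoc minv)

lemma minv_mult: "invertible A ==> invertible B ==> minv (A**B) = minv B**minv A"
 for A B :: "complex^'n^'n" by (rule minv_unique) (simp add: mm_assoc minv_cancel minv)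

lemma invertible_1: "invertible (mat 1 :: complex^'n^'n)" using invertible_def matrix_mul_lid by blast

lemma minv_1 [simp]: "minv (mat 1) = (mat 1 :: complex^'n^'n)" by (rule minv_unique) simp

lemma minv_vec: "invertible A ==> minv A *v (A *v v) = v" "invertible A ==> A *v (minv A *v v) = v"
 for A :: "complex^'n^'n" by (simp_all add: matrix_vector_mul_assoc minv)

lemma subgroupD: assumes "subgroup H GL" shows "A:H ==> invertible A" "mat 1:H" "A:H ==> B:H ==> A**B:H"
  "A:H ==> minv A:H"
proof -
 show i: "A:H ==> invertible A" for A using subgroup.subset[OF assms] by (auto simp: GL_def)
 show "mat 1:H" using subgroup.one_closed[OF assms] by (simp add: GL_def)
 show "A:H ==> B:H ==> A**B:H" using subgroup.m_closed[OF assms] by (simp add: GL_def)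
 assume A: "A:H"
 have "inv\<^bsub>GL\<^esub> A = minv A" by (rule group.inv_equality[OF group_GL])
   (use i[OF A] in \<open>auto simp: GL_def minv invertible_minv\<close>)
 thus "minv A:H" using subgroup.m_inv_closed[OF assms A] by simp
qed

lemma subgroupI: assumes "!!A. A:H ==> invertible A" "mat 1:H" "!!A B. A:H ==> B:H ==> A**B:H"
  "!!A. A:H ==> minv A:H" shows "subgroup H GL"
proof (rule group.subgroupI[OF group_GL])
 fix A assume A: "A:H"
 have "inv\<^bsub>GL\<^esub> A = minv A" by (rule group.inv_equality[OF group_GL])
   (use assms(1)[OF A] in \<open>auto simp: GL_def minv invertible_minv\<close>)
 thus "inv\<^bsub>GL\<^esub> A:H" using assms(4)[OF A] by simp
qed (use assms in \<open>auto simp: GL_def\<close>)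

lemma inv_GL: "invertible A ==> inv\<^bsub>GL\<^esub> A = minv A" by (rule group.inv_equality[OF group_GL]) (auto simp: GL_def minv invertible_minv)

lemma generate_GL_induct [consumes 1, case_names one incl inv mult]: assumes "A:generate GL S" "P (mat 1)" "!!h. h:S ==> P h" "!!h. h:S ==> P (inv\<^bsub>GL\<^esub> h)"
  "!!h k. h:generate GL S ==> P h ==> k:generate GL S ==> P k ==> P (h**k)" shows "P A" using assms(1)
proof (induction rule: generate.induct)
 case (eng h1 h2) thus ?case using assms(5)[of h1 h2] by (simp add: GL_def)
qed (use assms in \<open>auto simp: GL_def\<close>)

subsection \<open>The Zariski topology\<close>

abbreviation "PF \<equiv> polyfun UNIV"

lemmas pf_intros = polyfun.add polyfun.mult polyfun.coord

lemma pf_const [simp, intro]: "(%_. c):PF" by (rule polyfun.const) simp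

lemma pf_sum: "finite S ==> (!!s. s:S ==> f s:polyfun K) ==> 0:K ==> (%A. SUM s:S. f s A):polyfun K" by (induction S rule: finite_induct) (auto intro: polyfun.intros)

lemma pf_prod: "finite S ==> (!!s. s:S ==> f s:polyfun K) ==> 1:K ==> (%A. PROD s:S. f s A):polyfun K" by (induction S rule: finite_induct) (auto intro: polyfun.intros)

lemma pf_power: "p:PF ==> (%A. p A ^ k):PF" by (induction k) (auto intro: polyfun.intros)

lemma pf_det_gen: "(!!i j. (%A. M A$i$j):PF) ==> (%A. det (M A)):PF"
 for M :: "complex^'n^'n => complex^'m^'m" unfolding det_def by (intro pf_sum pf_prod polyfun.mult) auto

lemma pf_det: "(%A. det A):PF" by (rule pf_det_gen) (rule polyfun.coord)

text \<open>Regular functions on the general linear group: polynomial after multiplication by a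
  power of the determinant, with arbitrary values at singular matrices.\<close>

definition reg :: "(complex^'n^'n => complex) => bool" where
 "reg f \<longleftrightarrow> (EX q:PF. EX k. ALL A. invertible A --> f A * det A ^ k = q A)"

lemma reg_pf: "p:PF ==> reg p" unfolding reg_def by (rule bexI[of _ p], rule exI[of _ 0]) auto

lemma reg_mult: "reg f ==> reg g ==> reg (%A. f A * g A)"
proof -
 assume "reg f" "reg g"
 then obtain p k q l where p: "p:PF" "!!A. invertible A ==> f A * det A ^ k = p A"
  "q:PF" "!!A. invertible A ==> g A * det A ^ l = q A" unfolding reg_def by blast
 thus ?thesis unfolding reg_def by (intro bexI[of _ "%A. p A * q A"] exI[of _ "k + l"] allI impI polyfun.mult)
   (simp_all add: power_add algebra_simps flip: p(2,4))
qed

lemma reg_add: "reg f ==> reg g ==> reg (%A. f A + g A)"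
proof -
 assume "reg f" "reg g"
 then obtain p k q l where p: "p:PF" "!!A. invertible A ==> f A * det A ^ k = p A"
  "q:PF" "!!A. invertible A ==> g A * det A ^ l = q A" unfolding reg_def by blast
 thus ?thesis unfolding reg_def by (intro bexI[of _ "%A. p A * det A ^ l + q A * det A ^ k"] exI[of _ "k + l"] allI impI
    polyfun.mult polyfun.add pf_power pf_det)
   (simp_all add: power_add algebra_simps flip: p(2,4))
qed

lemma reg_sum: "finite S ==> (!!s. s:S ==> reg (f s)) ==> reg (%A. SUM s:S. f s A)" by (induction S rule: finite_induct) (auto intro: reg_add reg_pf)

lemma reg_subst: "p:PF ==> (!!i j. reg (%A. M A$i$j)) ==> reg (%A. p (M A))"
 for M :: "complex^'n^'n => complex^'m^'m" by (induction rule: polyfun.induct) (auto intro: reg_add reg_mult reg_pf)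

lemma minv_entry:
 fixes A :: "complex^'n^'n" assumes "invertible A" shows "minv A$k$l = det (\<chi> i j. if j = k then axis l 1$i else A$i$j) / det A"
proof -
 have "A *v (minv A *v axis l 1) = axis l 1" by (rule minv_vec(2)[OF assms])
 moreover have "det A~=0" using assms by (simp add: invertible_det_nz)
 ultimately have "minv A *v axis l 1
   = (\<chi> k. det (\<chi> i j. if j = k then axis l 1$i else A$i$j) / det A)" using cramer by blast
 moreover have "(minv A *v axis l 1)$k = minv A$k$l" by (simp add: matrix_vector_mult_def axis_def if_distrib[of "%x. _ * x"] cong: if_cong)
 ultimately show ?thesis by simp
qed

lemma reg_minv: "reg (%A::complex^'n^'n. minv A$k$l)" unfolding reg_def
proof (rule bexI[of _ "%A::complex^'n^'n. det (\<chi> i j. if j = k then axis l 1$i else A$i$j)"],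
  rule exI[of _ 1], intro allI impI)
 fix A :: "complex^'n^'n" assume "invertible A"
 thus "minv A$k$l * det A ^ 1 = det (\<chi> i j. if j = k then axis l 1$i else A$i$j)" using minv_entry[of A k l] by (simp add: invertible_det_nz)
next
 have "(%A::complex^'n^'n. (\<chi> i j. if j = k then axis l 1$i else A$i$j)$i$j):PF" for i j by (cases "j = k") (auto intro: polyfun.coord)
 thus "(%A::complex^'n^'n. det (\<chi> i j. if j = k then axis l 1$i else A$i$j)):PF" by (rule pf_det_gen)
qed

lemma reg_mm: "(!!i j. reg (%A. M A$i$j)) ==> (!!i j. reg (%A. N A$i$j)) ==>
  reg (%A. (M A**N A)$i$j)" unfolding mm_nth by (intro reg_sum reg_mult) auto

lemma reg_coord: "reg (%A. A$i$j)" by (intro reg_pf polyfun.coord)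
lemma reg_const: "reg (%A. c)" by (intro reg_pf) auto

abbreviation "zclosed \<equiv> zariski_closed UNIV"

lemma zclosedE: assumes "zclosed Z"
 obtains S where "S<=PF" "Z = {A. invertible A & (ALL p:S. p A = 0)}" using assms unfolding zariski_closed_def by blast

lemma zclosedI: assumes "!!p. p:S ==> reg p" "Z = {A. invertible A & (ALL p:S. p A = 0)}" shows "zclosed Z"
proof -
 have "EX q k. q:PF & (ALL A. invertible A --> p A * det A ^ k = q A)" if "p:S" for p using assms(1)[OF that] unfolding reg_def by blast
 then obtain q k where q: "!!p. p:S ==> q p:PF"
  "!!p A. p:S ==> invertible A ==> p A * det A ^ k p = q p A" by metis
 have "Z = {A. invertible A & (ALL p:q ` S. p A = 0)}" unfolding assms(2) using q(2)[symmetric] by (auto simp: invertible_det_nz)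
 thus ?thesis unfolding zariski_closed_def using q(1) by blast
qed

lemma zclosed_vimage: assumes "zclosed Z" "!!i j. reg (%A. M A$i$j)" "!!A. invertible A ==> invertible (M A)" shows "zclosed {A. invertible A & M A:Z}"
proof -
 obtain S where S: "S<=PF" "Z = {A. invertible A & (ALL p:S. p A = 0)}" using assms by (auto simp: zariski_closed_def)
 show ?thesis by (rule zclosedI[of "(%p A. p (M A)) ` S"]) (use S assms in \<open>auto intro: reg_subst\<close>)
qed

lemma zclosed_reg: "reg f ==> zclosed {A. invertible A & f A = 0}" by (rule zclosedI[of "{f}"]) auto

lemma zclosed_Int: "zclosed Y ==> zclosed Z ==> zclosed (Y Int Z)"
proof -
 assume "zclosed Y" "zclosed Z"
 then obtain S S' where "S<=PF" "Y = {A. invertible A & (ALL p:S. p A = 0)}"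
  "S'<=PF" "Z = {A. invertible A & (ALL p:S'. p A = 0)}" by (auto simp: zariski_closed_def)
 thus ?thesis unfolding zariski_closed_def by (intro exI[of _ "S Un S'"]) auto
qed

lemma zclosed_Un: "zclosed Y ==> zclosed Z ==> zclosed (Y Un Z)"
proof -
 assume "zclosed Y" "zclosed Z"
 then obtain S S' where S: "S<=PF" "Y = {A. invertible A & (ALL p:S. p A = 0)}"
  "S'<=PF" "Z = {A. invertible A & (ALL p:S'. p A = 0)}" by (auto simp: zariski_closed_def)
 have "Y Un Z = {A. invertible A & (ALL p:{%A. p A * q A |p q. p:S & q:S'}. p A = 0)}" unfolding S by auto fastforce
 moreover have "{%A. p A * q A |p q. p:S & q:S'}<=PF" using S by (auto intro: polyfun.mult)
 ultimately show ?thesis unfolding zariski_closed_def by blast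
qed

lemma zclosed_empty: "zclosed {}" by (rule zclosedI[of "{%_. 1}"]) (auto intro: reg_const)

lemma zclosed_UN: "finite C ==> (!!c. c:C ==> zclosed (F c)) ==> zclosed (UN c:C. F c)" by (induction C rule: finite_induct) (auto intro: zclosed_Un zclosed_empty)

text \<open>Zariski connectedness for arbitrary sets, closed or not, so that images, translates and
  generated groups can be treated before a closure is taken. For closed sets it agrees with
  \<open>zariski_connected\<close>.\<close>

definition zconn :: "(complex^'n^'n) set => bool" where
 "zconn S \<longleftrightarrow> (ALL Y Z. zclosed Y & zclosed Z & S<=Y Un Z & S Int Y Int Z = {} --> S<=Y | S<=Z)"

lemma zconnE: "zconn S ==> zclosed Y ==> zclosed Z ==> S<=Y Un Z ==> S Int Y Int Z = {} ==> S<=Y | S<=Z" unfolding zconn_def by blast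

lemma zconnD: "zconn S ==> zclosed Y ==> zclosed Z ==> S<=Y Un Z ==> S Int Y Int Z = {} ==> a:S ==> a:Y ==> S<=Y" unfolding zconn_def by blast

lemma zconn_closed: "zclosed H ==> zariski_connected H \<longleftrightarrow> zconn H"
proof
 assume H: "zclosed H" "zariski_connected H"
 show "zconn H" unfolding zconn_def
 proof (intro allI impI)
  fix Y Z assume *: "zclosed Y & zclosed Z & H<=Y Un Z & H Int Y Int Z = {}"
  have "zclosed (H Int Y)" "zclosed (H Int Z)" using * H zclosed_Int by auto
  moreover have "(H Int Y) Un (H Int Z) = H" "(H Int Y) Int (H Int Z) = {}" using * by blast+
  ultimately have "H Int Y = {} | H Int Z = {}" using H(2) unfolding zariski_connected_def by blast
  thus "H<=Y | H<=Z" using * by blast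
 qed
next
 assume "zclosed H" "zconn H"
 thus "zariski_connected H" unfolding zariski_connected_def zconn_def by blast
qed

text \<open>The form in which connectedness is applied: a quantity such as an eigenvalue or a root
  of unity that ranges over a finite set and depends algebraically on the group element is
  constant.\<close>

lemma zconn_const: assumes "zconn S" "finite C" "!!c. c:C ==> zclosed (F c)" "S<=(UN c:C. F c)"
  "!!c d. c:C ==> d:C ==> c~=d ==> S Int F c Int F d = {}" "a:S" "a:F c" "c:C" shows "S<=F c"
proof (rule zconnD[OF assms(1) _ _ _ _ assms(6,7)])
 show "zclosed (F c)" using assms by auto
 show "zclosed (UN d:C - {c}. F d)" using assms by (intro zclosed_UN) auto
 show "S<=F c Un (UN d:C - {c}. F d)" using assms by blast
 show "S Int F c Int (UN d:C - {c}. F d) = {}" using assms by blast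
qed

lemma zconn_image: assumes "zconn S" "!!A. A:S ==> invertible A"
  "!!i j. reg (%A. M A$i$j)" "!!A. invertible A ==> invertible (M A)" shows "zconn (M ` S)" unfolding zconn_def
proof (intro allI impI)
 fix Y Z assume *: "zclosed Y & zclosed Z & M ` S<=Y Un Z & M ` S Int Y Int Z = {}"
 have "zclosed {A. invertible A & M A:Y}" "zclosed {A. invertible A & M A:Z}" using * by (auto intro!: zclosed_vimage assms(3,4))
 moreover have "S<={A. invertible A & M A:Y} Un {A. invertible A & M A:Z}"
  "S Int {A. invertible A & M A:Y} Int {A. invertible A & M A:Z} = {}" using * assms(2) by auto
 ultimately have "S<={A. invertible A & M A:Y} | S<={A. invertible A & M A:Z}" by (intro zconnE[OF assms(1)])
 thus "M ` S<=Y | M ` S<=Z" by auto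
qed

lemma pf_continuous: "p:polyfun K ==> continuous_on UNIV p" by (induction rule: polyfun.induct) (auto intro!: continuous_intros)

lemma zconn_connected: "connected S ==> (!!A. A:S ==> invertible A) ==> zconn S" unfolding zconn_def
proof (intro allI impI)
 fix Y Z assume S: "connected S" "!!A. A:S ==> invertible A" and *: "zclosed Y & zclosed Z & S<=Y Un Z & S Int Y Int Z = {}"
 have cl: "EX Y'. closed Y' & S Int Y = S Int Y'" if z: "zclosed Y" for Y
 proof -
  obtain R where R: "R<=PF" "Y = {A. invertible A & (ALL p:R. p A = 0)}" using zclosedE[OF z] by blast
  have "closed (\<Inter>p\<in>R. p -` {0})" using R pf_continuous by (intro closed_INT ballI) (auto intro!: continuous_closed_vimage simp: continuous_on_eq_continuous_at)
  moreover have "S Int Y = S Int (\<Inter>p\<in>R. p -` {0})" using R S by auto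
  ultimately show ?thesis by blast
 qed
 obtain Y' Z' where "closed Y'" "S Int Y = S Int Y'" "closed Z'" "S Int Z = S Int Z'" using cl[of Y] cl[of Z] * by blast
 have "S Int Y' = {} | S Int Z' = {}"
 proof -
  have "S<=Y' Un Z'" "Y' Int Z' Int S = {}" using * `S Int Y = S Int Y'` `S Int Z = S Int Z'` by blast+
  thus ?thesis using S(1) `closed Y'` `closed Z'` unfolding connected_closed by blast
 qed
 thus "S<=Y | S<=Z" using * `S Int Y = S Int Y'` `S Int Z = S Int Z'` by blast
qed

lemma zconn_translate: "zconn S ==> (!!A. A:S ==> invertible A) ==> invertible g ==> zconn ((**) g ` S)" by (rule zconn_image) (auto intro!: reg_mm reg_const reg_coord invertible_mult)

text \<open>A product of generators is reached from the identity through translates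
  \<open>g ** C\<close>, each connected and containing the point \<open>g\<close> reached
  before.\<close>

lemma zconn_generate: assumes "!!C. C:\<C> ==> zconn C" "!!C. C:\<C> ==> mat 1:C"
  "!!C A. C:\<C> ==> A:C ==> invertible A" "!!C A. C:\<C> ==> A:C ==> EX D:\<C>. minv A:D" shows "zconn (generate GL (\<Union>\<C>))"
proof -
 have sg: "subgroup (generate GL (\<Union>\<C>)) GL" using assms(3) by (intro group.generate_is_subgroup[OF group_GL]) (auto simp: GL_def)
 have main: "generate GL (\<Union>\<C>)<=Y"
  if YZ: "zclosed Y" "zclosed Z" "generate GL (\<Union>\<C>)<=Y Un Z" "generate GL (\<Union>\<C>) Int Y Int Z = {}" and 1: "mat 1:Y" for Y Z
 proof -
  have step: "g**A:Y" if "g:generate GL (\<Union>\<C>)" "g:Y" "A:C" "C:\<C>" for g A C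
  proof -
   have sub: "(**) g ` C<=generate GL (\<Union>\<C>)" using that subgroupD(3)[OF sg] generate.incl[of _ "\<Union>\<C>" GL] by blast
   have "(**) g ` C<=Y"
   proof (rule zconnD[OF _ YZ(1,2)])
    show "zconn ((**) g ` C)" using assms that subgroupD(1)[OF sg] by (intro zconn_translate) auto
    show "g:(**) g ` C" using assms(2)[OF that(4)] by (force intro: image_eqI[of _ _ "mat 1"])
   qed (use sub YZ that in auto)
   thus ?thesis using that by blast
  qed
  have "g**h:Y" if "h:generate GL (\<Union>\<C>)" "g:generate GL (\<Union>\<C>)" "g:Y" for g h using that
  proof (induction arbitrary: g rule: generate_GL_induct)
   case (incl h) thus ?case using step by blast
  next
   case (inv h)
   then obtain C where "C:\<C>" "h:C" by auto
   then obtain D where "D:\<C>" "minv h:D" "invertible h" using assms(3,4) by metis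
   thus ?case using step[of g "minv h" D] inv.prems inv_GL by metis
  next
   case (mult h k)
   hence "g**h:Y" "g**h:generate GL (\<Union>\<C>)" using subgroupD(3)[OF sg] by auto
   thus ?case using mult by (simp add: matrix_mul_assoc)
  qed simp
  from this[OF _ subgroupD(2)[OF sg] 1] show ?thesis by auto
 qed
 show ?thesis unfolding zconn_def
 proof (intro allI impI)
  fix Y Z assume *: "zclosed Y & zclosed Z & generate GL (\<Union>\<C>)<=Y Un Z & generate GL (\<Union>\<C>) Int Y Int Z = {}"
  hence "mat 1:Y | mat 1:Z" using subgroupD(2)[OF sg] by blast
  thus "generate GL (\<Union>\<C>)<=Y | generate GL (\<Union>\<C>)<=Z" using main[of Y Z] main[of Z Y] * by (metis Un_commute inf_commute inf_left_commute)
 qed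
qed

definition zcl :: "(complex^'n^'n) set => (complex^'n^'n) set" where
 "zcl S = {A. invertible A & (ALL p:{p:PF. ALL B:S. p B = 0}. p A = 0)}"

lemma zcl_closed: "zclosed (zcl S)" unfolding zcl_def zariski_closed_def by blast

lemma zcl_sub: "(!!A. A:S ==> invertible A) ==> S<=zcl S" by (auto simp: zcl_def)

lemma zcl_least: "zclosed Z ==> S<=Z ==> zcl S<=Z" unfolding zcl_def zariski_closed_def by blast

lemma zcl_zconn: assumes "zconn S" "!!A. A:S ==> invertible A" shows "zconn (zcl S)" unfolding zconn_def
proof (intro allI impI)
 fix Y Z assume *: "zclosed Y & zclosed Z & zcl S<=Y Un Z & zcl S Int Y Int Z = {}"
 have "S<=zcl S" by (rule zcl_sub[OF assms(2)])
 hence "S<=Y Un Z" "S Int Y Int Z = {}" using * by blast+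
 hence "S<=Y | S<=Z" using zconnE[OF assms(1), of Y Z] * by blast
 thus "zcl S<=Y | zcl S<=Z" using * zcl_least[of Y S] zcl_least[of Z S] by blast
qed

lemma zcl_image: assumes "!!A. A:S ==> M A:zcl S'" "!!i j. reg (%A. M A$i$j)" "!!A. invertible A ==> invertible (M A)"
  "!!A. A:S ==> invertible A" "A:zcl S" shows "M A:zcl S'"
proof -
 have "zcl S<={A. invertible A & M A:zcl S'}" using assms by (intro zcl_least zclosed_vimage zcl_closed) auto
 thus ?thesis using assms by blast
qed

text \<open>Multiplication is handled one variable at a time: first a group element times a closure
  point, then two closure points, always with a translation as the regular map.\<close>

lemma zcl_subgroup: assumes "subgroup K GL" shows "subgroup (zcl K) GL"
proof (rule subgroupI)
 note K = subgroupD[OF assms]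
 have sub: "K<=zcl K" using zcl_sub K by blast
 show "A:zcl K ==> invertible A" for A by (simp add: zcl_def)
 show "mat 1:zcl K" using sub K by auto
 have l: "g**A:zcl K" if "g:K" "A:zcl K" for g A by (rule zcl_image[of K "%A. g**A" K])
   (use K that sub in \<open>auto intro!: reg_mm reg_const reg_coord invertible_mult\<close>)
 show "A**B:zcl K" if "A:zcl K" "B:zcl K" for A B by (rule zcl_image[of K "%A. A**B" K])
   (use K that l in \<open>auto intro!: reg_mm reg_const reg_coord invertible_mult simp: zcl_def\<close>)
 show "minv A:zcl K" if "A:zcl K" for A by (rule zcl_image[of K "%A. minv A" K])
   (use K that sub in \<open>auto intro!: reg_minv invertible_minv\<close>)
qed

subsection \<open>Matrix exponential and Lie algebras\<close>

definition mpow :: "complex^'n^'n => nat => complex^'n^'n" where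
 "mpow X k = (((**) X) ^^ k) (mat 1)"

lemma mpow_0 [simp]: "mpow X 0 = mat 1" by (simp add: mpow_def)
lemma mpow_Suc: "mpow X (Suc k) = X**mpow X k" by (simp add: mpow_def)
definition mexp :: "complex^'n^'n => complex => complex^'n^'n" where
 "mexp X s = (\<chi> i j. \<Sum>k. mpow X k$i$j / fact k * s ^ k)"

lemma mpow_bound: "norm (mpow X k$i$j)<=(SUM a:UNIV. SUM b:UNIV. norm (X$a$b)) ^ k"
proof (induction k arbitrary: i j)
 case 0 thus ?case by (simp add: mat_def)
next
 case (Suc k)
 let ?c = "SUM a:UNIV. SUM b:UNIV. norm (X$a$b)"
 have c: "?c >= 0" by (intro sum_nonneg) auto
 have "norm (mpow X (Suc k)$i$j)<=(SUM l:UNIV. norm (X$i$l) * norm (mpow X k$l$j))" unfolding mpow_Suc mm_nth by (rule order_trans[OF norm_sum]) (simp add: norm_mult)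
 also have "...<=(SUM l:UNIV. norm (X$i$l) * ?c ^ k)" by (intro sum_mono mult_left_mono Suc) auto
 also have "... = (SUM l:UNIV. norm (X$i$l)) * ?c ^ k" by (simp add: sum_distrib_right)
 also have "...<=?c * ?c ^ k" using c by (intro mult_right_mono member_le_sum[of i UNIV "%a. SUM b:UNIV. norm (X$a$b)"])
   (auto intro: sum_nonneg)
 finally show ?case by simp
qed

lemma mexp_summable: "summable (%k. mpow X k$i$j / fact k * s ^ k)"
proof (rule summable_comparison_test', rule summable_exp)
 let ?c = "SUM a:UNIV. SUM b:UNIV. norm (X$a$b)"
 show "norm (mpow X k$i$j / fact k * s ^ k)<=inverse (fact k) * (?c * norm s) ^ k" for k using mpow_bound[of X k i j]
  by (simp add: norm_mult norm_divide norm_power power_mult_distrib divide_simps mult_right_mono)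
qed

definition cder :: "(complex => complex^'n^'n) => complex^'n^'n => complex => bool" where
 "cder f f' s \<longleftrightarrow> (ALL i j. ((%s. f s$i$j) has_field_derivative f'$i$j) (at s))"

definition rder :: "(real => complex^'n^'n) => complex^'n^'n => real => bool" where
 "rder f f' s \<longleftrightarrow> (ALL i j. ((%s. f s$i$j) has_vector_derivative f'$i$j) (at s))"

lemma cder_mm: "cder f f' s ==> cder g g' s ==> cder (%s. f s**g s) (f'**g s + f s**g') s" unfolding cder_def mm_nth vector_add_component sum.distrib[symmetric]
 by (auto intro!: derivative_eq_intros simp: add.commute mult.commute)

lemma rder_mm: "rder f f' s ==> rder g g' s ==> rder (%s. f s**g s) (f'**g s + f s**g') s" unfolding rder_def mm_nth vector_add_component sum.distrib[symmetric]
 by (auto intro!: has_vector_derivative_sum has_vector_derivative_mult[THEN has_vector_derivative_eq_rhs] simp: add.commute)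

lemma cder_const: "cder (%_. A) 0 s" by (simp add: cder_def)
lemma rder_const: "rder (%_. A) 0 s" by (simp add: rder_def)

lemma cder_zero: assumes "!!s. cder f 0 s" shows "f s = f 0"
proof (rule mat_eqI)
 fix i j
 have "EX c. ALL s. f s$i$j = c" using has_field_derivative_zero_constant[of UNIV "%s. f s$i$j"] assms by (auto simp: cder_def)
 thus "f s$i$j = f 0$i$j" by metis
qed

lemma rder_zero: assumes "!!s. rder f 0 s" shows "f s = f 0"
proof (rule mat_eqI)
 fix i j
 have "((%s. f s$i$j) has_vector_derivative 0) (at s within UNIV)" for s using assms by (simp add: rder_def)
 then obtain c where "!!s. f s$i$j = c" using has_vector_derivative_zero_constant[OF convex_UNIV, of "%s. f s$i$j"] by (metis UNIV_I)
 thus "f s$i$j = f 0$i$j" by simp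
qed

lemma mexp_cder: "cder (mexp X) (X**mexp X s) s" unfolding cder_def
proof (intro allI)
 fix i j
 define c where "c = (%k. mpow X k$i$j / fact k)"
 have "((%s. \<Sum>k. c k * s ^ k) has_field_derivative (\<Sum>k. diffs c k * s ^ k)) (at s)" by (rule termdiffs_strong_converges_everywhere) (unfold c_def, rule mexp_summable)
 moreover have "diffs c k = (SUM l:UNIV. X$i$l * (mpow X k$l$j / fact k))" for k
 proof -
  have "diffs c k = mpow X (Suc k)$i$j / fact k" unfolding diffs_def c_def by (simp add: divide_simps del: of_nat_Suc)
  thus ?thesis by (simp add: mpow_Suc mm_nth sum_divide_distrib)
 qed
 moreover have "(\<Sum>k. (SUM l:UNIV. X$i$l * (mpow X k$l$j / fact k)) * s ^ k)
   = (SUM l:UNIV. X$i$l * mexp X s$l$j)"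
 proof -
  have e: "(%k. (SUM l:UNIV. X$i$l * (mpow X k$l$j / fact k)) * s ^ k)
    = (%k. SUM l:UNIV. X$i$l * (mpow X k$l$j / fact k * s ^ k))" by (simp add: sum_distrib_right mult.assoc)
  have "(\<Sum>k. SUM l:UNIV. X$i$l * (mpow X k$l$j / fact k * s ^ k))
    = (SUM l:UNIV. \<Sum>k. X$i$l * (mpow X k$l$j / fact k * s ^ k))" by (rule suminf_sum) (intro summable_mult mexp_summable)
  also have "... = (SUM l:UNIV. X$i$l * mexp X s$l$j)" by (simp only: mexp_def vec_lambda_beta suminf_mult[OF mexp_summable])
  finally show ?thesis unfolding e .
 qed
 ultimately show "((%s. mexp X s$i$j) has_field_derivative (X**mexp X s)$i$j) (at s)" by (simp add: mexp_def c_def mm_nth)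
qed

lemma mexp_0 [simp]: "mexp X 0 = mat 1"
proof (rule mat_eqI)
 fix i j
 have "(%k. mpow X k$i$j / fact k * 0 ^ k) sums (mpow X 0$i$j / fact 0)" using powser_sums_zero[of "%k. mpow X k$i$j / fact k"] by simp
 thus "mexp X 0$i$j = mat 1$i$j" by (simp add: mexp_def sums_iff)
qed

lemma mexp_comm_gen: assumes "X**Y = Y**X" shows "mexp X s**Y = Y**mexp X s"
proof (rule mat_eqI)
 fix i j
 have c: "mpow X k**Y = Y**mpow X k" for k by (induction k) (auto simp: mpow_Suc mm_assoc, metis assms matrix_mul_assoc)
 have e1: "(SUM l:UNIV. mpow X k$i$l / fact k * s ^ k * Y$l$j)
   = (SUM l:UNIV. Y$i$l * (mpow X k$l$j / fact k * s ^ k))" for k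
 proof -
  have "(SUM l:UNIV. mpow X k$i$l / fact k * s ^ k * Y$l$j) = (mpow X k**Y)$i$j * (s ^ k / fact k)" unfolding mm_nth sum_distrib_right by (intro sum.cong) auto
  also have "... = (SUM l:UNIV. Y$i$l * (mpow X k$l$j / fact k * s ^ k))" unfolding c mm_nth sum_distrib_right by (intro sum.cong) auto
  finally show ?thesis .
 qed
 have "(mexp X s**Y)$i$j = (SUM l:UNIV. \<Sum>k. mpow X k$i$l / fact k * s ^ k * Y$l$j)" by (simp only: mm_nth mexp_def vec_lambda_beta suminf_mult2[OF mexp_summable])
 also have "... = (\<Sum>k. SUM l:UNIV. mpow X k$i$l / fact k * s ^ k * Y$l$j)" by (rule suminf_sum[symmetric]) (intro summable_mult2 mexp_summable)
 also have "... = (SUM l:UNIV. \<Sum>k. Y$i$l * (mpow X k$l$j / fact k * s ^ k))" unfolding e1 by (rule suminf_sum) (intro summable_mult mexp_summable)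
 also have "... = (Y**mexp X s)$i$j" by (simp only: mm_nth mexp_def vec_lambda_beta suminf_mult[OF mexp_summable])
 finally show "(mexp X s**Y)$i$j = (Y**mexp X s)$i$j" .
qed

lemma mexp_comm: "mexp X s**X = X**mexp X s" by (rule mexp_comm_gen) simp

lemma cder_uminus: assumes "cder f f' (- s)" shows "cder (%s. f (- s)) (- f') s" unfolding cder_def
proof (intro allI)
 fix i j
 have "((%s. f (- s)$i$j) has_field_derivative (f'$i$j * (-1))) (at s)" using assms by (intro DERIV_chain2[where g = uminus and f = "%s. f s$i$j"])
   (auto simp: cder_def intro!: derivative_eq_intros)
 thus "((%s. f (- s)$i$j) has_field_derivative (- f')$i$j) (at s)" by simp
qed

lemma mexp_inv: "mexp X s**mexp X (- s) = mat 1"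
proof -
 have "cder (%s. mexp X s**mexp X (- s)) 0 s" for s using cder_mm[OF mexp_cder[of X s] cder_uminus[OF mexp_cder[of X "- s"]]] by (simp add: mm_add matrix_mul_assoc mexp_comm)
 from cder_zero[OF this, of s] show ?thesis by simp
qed

lemma mexp_invertible: "invertible (mexp X s)" using mexp_inv invertible_def matrix_left_right_inverse by metis

lemma minv_mexp: "minv (mexp X s) = mexp X (- s)" by (rule minv_unique[OF mexp_inv])

lemma mexp_rder: "rder (%a. mexp X (of_real a)) (X**mexp X (of_real a)) a" using mexp_cder[of X "of_real a"] unfolding cder_def rder_def by (auto intro!: has_vector_derivative_real_field)

lemma rder_uminus: "rder f f' (- s) ==> rder (%s. f (- s)) (- f') s" unfolding rder_def
proof (intro allI)
 fix i j assume "ALL i j. ((%s. f s$i$j) has_vector_derivative f'$i$j) (at (- s))"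
 hence "((%s. f s$i$j) has_vector_derivative f'$i$j) (at (- s))" by blast
 moreover have "(uminus has_real_derivative -1) (at s)" by (auto intro!: derivative_eq_intros)
 ultimately show "((%s. f (- s)$i$j) has_vector_derivative (- f')$i$j) (at s)" using vector_diff_chain_at[of uminus "-1" s "%s. f s$i$j" "f'$i$j"]
  by (simp add: has_real_derivative_iff_has_vector_derivative o_def)
qed

lemma mexp_unique: assumes "!!a. rder f (f a**X) a" "f 0 = mat 1" shows "f a = mexp X (of_real a)"
proof -
 have "rder (%a. f a**mexp X (of_real (- a))) 0 a" for a using rder_mm[OF assms(1)[of a] rder_uminus[OF mexp_rder[of X "- a"]]] by (simp add: mm_add matrix_mul_assoc)
 from rder_zero[OF this, of a] have "f a**mexp X (- of_real a) = mat 1" using assms(2) by simp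
 hence "f a**(mexp X (- of_real a)**mexp X (of_real a)) = mexp X (of_real a)" by (simp add: matrix_mul_assoc)
 thus ?thesis using mexp_inv[of X "- of_real a"] by simp
qed

lemma mexp_conj:
 fixes g :: "complex^'n^'n" assumes "invertible g" shows "g**mexp X s**minv g = mexp (g**X**minv g) s"
proof -
 let ?Y = "g**X**minv g"
 have "cder (%s. (g**mexp X s**minv g)**mexp ?Y (- s)) 0 s" for s
 proof -
  have 1: "cder (%s. g**mexp X s**minv g) (g**(X**mexp X s)**minv g) s" using cder_mm[OF cder_mm[OF cder_const[of g] mexp_cder[of X s]] cder_const[of "minv g"]] by (simp add: mm_add)
  have 2: "g**(X**mexp X s)**minv g = (g**mexp X s**minv g)**?Y" using assms by (simp add: mm_assoc minv_cancel) (simp add: matrix_mul_assoc mexp_comm)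
  show ?thesis using cder_mm[OF 1 cder_uminus[OF mexp_cder[of ?Y "- s"]]] unfolding 2 by (simp add: mm_add matrix_mul_assoc)
 qed
 from cder_zero[OF this, of s]
 have "(g**mexp X s**minv g)**mexp ?Y (- s) = mat 1" using assms by (simp add: minv)
 hence "(g**mexp X s**minv g)**(mexp ?Y (- s)**mexp ?Y s) = mexp ?Y s" by (simp only: matrix_mul_assoc matrix_mul_lid)
 thus ?thesis using mexp_inv[of ?Y "- s"] by simp
qed

definition dd :: "(complex^'n^'n => complex) => complex^'n^'n => complex^'n^'n => complex" where
 "dd p A X = frechet_derivative p (at A) X"

lemma pf_has_derivative: "p:PF ==> (p has_derivative dd p A) (at A)"
proof -
 have "p:PF ==> p differentiable (at A)" by (induction rule: polyfun.induct)
   (auto intro!: derivative_intros bounded_linear_imp_differentiable bounded_linear_compose[OF bounded_linear_vec_nth] bounded_linear_vec_nth)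
 thus "p:PF ==> ?thesis" unfolding dd_def using frechet_derivative_works by blast
qed

lemma dd_eq: "(p has_derivative p') (at A) ==> dd p A = p'" unfolding dd_def by (metis frechet_derivative_at)

lemma dd_const: "dd (%_. c) A X = 0" using dd_eq[OF has_derivative_const] by metis
lemma dd_coord: "dd (%A. A$i$j) A X = X$i$j" by (subst dd_eq[OF bounded_linear_imp_has_derivative[OF
    bounded_linear_compose[OF bounded_linear_vec_nth bounded_linear_vec_nth]]]) simp
lemma dd_add: "p:PF ==> q:PF ==> dd (%A. p A + q A) A X = dd p A X + dd q A X" by (subst dd_eq[OF has_derivative_add[OF pf_has_derivative pf_has_derivative]]) auto
lemma dd_mult: "p:PF ==> q:PF ==> dd (%A. p A * q A) A X = p A * dd q A X + dd p A X * q A" by (subst dd_eq[OF has_derivative_mult[OF pf_has_derivative pf_has_derivative]]) auto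

lemmas dd_simps = dd_const dd_coord dd_add dd_mult

lemma dd_lin: "p:PF ==> dd p A (X + Y) = dd p A X + dd p A Y"
 "p:PF ==> dd p A (msc c X) = c * dd p A X" by (induction rule: polyfun.induct) (auto simp: dd_simps algebra_simps)

lemma dd_cder: "p:PF ==> cder f f' s ==> ((%s. p (f s)) has_field_derivative dd p (f s) f') (at s)" by (induction rule: polyfun.induct)
  (auto simp: dd_simps cder_def intro!: derivative_eq_intros)

lemma dd_rder: "p:PF ==> rder f f' s ==> ((%s. p (f s)) has_vector_derivative dd p (f s) f') (at s)" by (induction rule: polyfun.induct)
  (auto simp: dd_simps rder_def intro!: derivative_intros has_vector_derivative_mult[THEN has_vector_derivative_eq_rhs])

lemma dd_pf: "p:PF ==> (%A. dd p A (A**X)):PF" by (induction rule: polyfun.induct)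
  (auto simp: dd_simps mm_nth intro!: pf_sum polyfun.intros)

lemma dd_transl: "p:PF ==> (%A. p (B**A)):PF & dd (%A. p (B**A)) A X = dd p (B**A) (B**X)" by (induction rule: polyfun.induct)
  (auto simp: dd_simps mm_nth intro!: pf_sum polyfun.intros dd_eq[THEN fun_cong]
   bounded_linear_imp_has_derivative bounded_linear_sum bounded_linear_const_mult bounded_linear_compose[OF bounded_linear_vec_nth] bounded_linear_vec_nth)

lemma lie_def: "lie_algebra H = {X. ALL p:PF. (ALL A:H. p A = 0) --> dd p (mat 1) X = 0}" by (simp add: lie_algebra_def dd_def)

lemma lie_curve_c: assumes "cder f f' 0" "f 0 = mat 1" "!!s. f s:H" shows "f':lie_algebra H" unfolding lie_def
proof (intro CollectI ballI impI)
 fix p assume "p:PF" "ALL A:H. p A = 0"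
 hence "((%s. 0) has_field_derivative dd p (mat 1) f') (at 0)" using dd_cder[of p f f' 0] assms by simp
 thus "dd p (mat 1) f' = 0" using DERIV_unique DERIV_const by blast
qed

lemma lie_curve_r: assumes "rder f f' 0" "f 0 = mat 1" "!!s. f s:H" shows "f':lie_algebra H" unfolding lie_def
proof (intro CollectI ballI impI)
 fix p assume "p:PF" "ALL A:H. p A = 0"
 hence "((%s. 0) has_vector_derivative dd p (mat 1) f') (at 0)" using dd_rder[of p f f' 0] assms by simp
 thus "dd p (mat 1) f' = 0" using vector_derivative_unique_at has_vector_derivative_const by blast
qed

text \<open>The left-invariant derivation sending \<open>p\<close> to \<open>dd p A (A ** X)\<close>
  preserves the polynomials that vanish on \<open>H\<close>. Therefore all derivatives of
  \<open>p (mexp X s)\<close> vanish at \<open>s = 0\<close>, and the identity theorem for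
  holomorphic functions applies.\<close>

lemma lie_mexp: assumes H: "closed_subgroup H" and X: "X:lie_algebra H" shows "mexp X s:H"
proof -
 have sg: "subgroup H GL" using H by (simp add: closed_subgroup_def) obtain S where S: "S<=PF" "H = {A. invertible A & (ALL p:S. p A = 0)}"
  using H by (auto simp: closed_subgroup_def zariski_closed_def)
 have D: "(%A. dd p A (A**X)):PF & (ALL A:H. dd p A (A**X) = 0)"
  if p: "p:PF" "ALL A:H. p A = 0" for p
 proof (intro conjI ballI)
  show "(%A. dd p A (A**X)):PF" by (rule dd_pf[OF p(1)])
  fix A assume A: "A:H"
  have "ALL B:H. p (A**B) = 0" using p A subgroupD(3)[OF sg] by blast
  moreover have "(%B. p (A**B)):PF" using dd_transl[OF p(1)] by blast
  moreover have "ALL q:PF. (ALL A:H. q A = 0) --> dd q (mat 1) X = 0" using X by (simp add: lie_def)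
  ultimately have "dd (%B. p (A**B)) (mat 1) X = 0" by (drule_tac x = "%B. p (A**B)" in bspec) auto
  thus "dd p A (A**X) = 0" using dd_transl[OF p(1), of A "mat 1" X] by simp
 qed
 have "p (mexp X s) = 0" if "p:PF" "ALL A:H. p A = 0" for p
 proof -
  have der: "((%s. q (mexp X s)) has_field_derivative dd q (mexp X s) (mexp X s**X)) (at s)"
   if "q:PF" for q s using dd_cder[OF that mexp_cder[of X s]] by (simp add: mexp_comm)
  have ders: "EX q. q:PF & (ALL A:H. q A = 0) & (deriv ^^ n) (%s. p (mexp X s)) = (%s. q (mexp X s))" for n
  proof (induction n)
   case 0 thus ?case using that by auto
  next
   case (Suc n)
   then obtain q where q: "q:PF" "ALL A:H. q A = 0"
    "(deriv ^^ n) (%s. p (mexp X s)) = (%s. q (mexp X s))" by blast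
   have "(deriv ^^ Suc n) (%s. p (mexp X s)) = (%s. dd q (mexp X s) (mexp X s**X))" using der[OF q(1)] by (simp add: q(3) DERIV_imp_deriv fun_eq_iff)
   thus ?case using D[OF q(1,2)] by (intro exI[of _ "%A. dd q A (A**X)"]) auto
  qed
  have "(%s. p (mexp X s)) holomorphic_on UNIV" using der[OF that(1)] by (auto simp: holomorphic_on_def field_differentiable_def)
  moreover have "(deriv ^^ n) (%s. p (mexp X s)) 0 = 0" for n using ders[of n] subgroupD(2)[OF sg] by auto
  ultimately show ?thesis using holomorphic_fun_eq_0_on_connected[of "%s. p (mexp X s)" UNIV 0 s] by auto
 qed
 thus ?thesis using S mexp_invertible by auto
qed

lemma lie_sub:
 "X:lie_algebra H ==> Y:lie_algebra H ==> X + Y:lie_algebra H"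
 "X:lie_algebra H ==> msc c X:lie_algebra H"
 "0:lie_algebra H" using dd_lin(2)[of _ _ 0 0] by (auto simp: lie_def dd_lin)

lemma lie_mono: "H<=K ==> lie_algebra H<=lie_algebra K" by (auto simp: lie_def)

lemma lie_Ad: assumes H: "closed_subgroup H" and X: "X:lie_algebra H" and g: "invertible (g :: complex^'n^'n)" "!!h. h:H ==> g**h**minv g:H" shows "g**X**minv g:lie_algebra H"
proof (rule lie_curve_c)
 show "cder (%s. g**mexp X s**minv g) (g**X**minv g) 0" using cder_mm[OF cder_mm[OF cder_const[of g] mexp_cder[of X 0]] cder_const[of "minv g"]] by (simp add: mm_add)
qed (use g lie_mexp[OF H X] in \<open>auto simp: minv\<close>)

lemma lie_exp_iff: assumes "closed_subgroup H" shows "X:lie_algebra H \<longleftrightarrow> (ALL s. mexp X s:H)"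
 using lie_mexp[OF assms] lie_curve_c[of "mexp X" X H] mexp_cder[of X 0] by auto

lemma mexp_zconn: "zconn (range (mexp X))"
proof (rule zconn_connected)
 have "continuous_on UNIV (%s. \<chi> i j. mexp X s$i$j)" using mexp_cder[of X] unfolding cder_def by (intro continuous_on_vec_lambda) (meson DERIV_isCont continuous_at_imp_continuous_on)
 hence "continuous_on UNIV (mexp X)" by (simp add: vec_lambda_eta)
 thus "connected (range (mexp X))" by (intro connected_continuous_image) auto
qed (auto simp: mexp_invertible)

subsection \<open>The Lie--Kolchin theorem\<close>

text \<open>The polynomial \<open>p\<close> evaluated at the matrix \<open>g\<close> and applied to
  \<open>v\<close>, in Horner form.\<close>

definition pact :: "complex^'n^'n => complex poly => complex^'n => complex^'n" where
 "pact g p v = fold_coeffs (%a u. a *s v + g *v u) p 0"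

lemma pact_0 [simp]: "pact g 0 v = 0" by (simp add: pact_def)

lemma pact_pCons [simp]: "pact g (pCons a p) v = a *s v + g *v pact g p v" by (cases "p = 0 & a = 0") (auto simp: pact_def)

lemma pact_add: "pact g (p + q) v = pact g p v + pact g q v" by (induction p q rule: poly_induct2) (simp_all add: vec.scale_left_distrib vec.add algebra_simps)

lemma pact_smult: "pact g (smult c p) v = c *s pact g p v" by (induction p) (simp_all add: vec.scale_right_distrib vec.scale)

lemma pact_mult: "pact g (p * q) v = pact g p (pact g q v)" by (induction p) (simp_all add: pact_add pact_smult)

lemma pact_lin: "pact g p (u + v) = pact g p u + pact g p v" "pact g p (c *s u) = c *s pact g p u" by (induction p) (simp_all add: vec.scale_right_distrib vec.add vec.scale algebra_simps)

lemma pact_sum: "pact g p (SUM i:S. f i) = (SUM i:S. pact g p (f i))"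
proof (induction S rule: infinite_finite_induct)
 case empty thus ?case using pact_lin(2)[of g p 0 0] by simp
qed (auto simp: pact_lin(1) pact_lin(2)[of g p 0 0, simplified])

lemma pact_psum: "pact g (SUM i:S. f i) v = (SUM i:S. pact g (f i) v)" by (induction S rule: infinite_finite_induct) (auto simp: pact_add)

lemma pact_monom: "pact g (monom c i) v = c *s (((*v) g) ^^ i) v" by (induction i) (simp_all add: monom_0 monom_Suc vec.scale)

lemma annihilator_vec:
 fixes g :: "complex^'n^'n" shows "EX p. p~=0 & pact g p v = 0"
proof -
 let ?f = "%i. (((*v) g) ^^ i) v" and ?n = "CARD('n)"
 show ?thesis
 proof (cases "inj_on ?f {..?n}")
  case False
  then obtain i j where ij: "i~=j" "?f i = ?f j" by (auto simp: inj_on_def)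
  have "pact g (monom 1 i + monom (- 1) j) v = 0" using ij by (simp add: pact_add pact_monom)
  moreover have "coeff (monom 1 i + monom (- 1) j) i~=(0::complex)" using ij by simp
  ultimately show ?thesis by (metis coeff_0)
 next
  case True
  have "card (?f ` {..?n}) = Suc ?n" using True by (simp add: card_image)
  hence "vec.dependent (?f ` {..?n})" using vec.independent_card_le_dim[of "?f ` {..?n}" UNIV] by (auto simp: vec.dimension_def card_cart_basis)
  then obtain u where u: "EX w:?f ` {..?n}. u w~=0" "(SUM w:?f ` {..?n}. u w *s w) = 0" using vec.dependent_finite[of "?f ` {..?n}"] by auto
  define p where "p = (\<Sum>i\<le>?n. monom (u (?f i)) i)"
  have "pact g p v = (\<Sum>i\<le>?n. u (?f i) *s ?f i)" by (simp add: p_def pact_psum pact_monom)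
  also have "... = 0" using u(2) sum.reindex[OF True, of "%w. u w *s w"] by simp
  finally have "pact g p v = 0" .
  moreover obtain k where k: "k<=?n" "u (?f k)~=0" using u(1) by auto
  hence "coeff p k~=0" by (simp add: p_def coeff_sum)
  ultimately show ?thesis by (metis coeff_0)
 qed
qed

lemma annihilator: fixes g :: "complex^'n^'n" shows "EX p. p~=0 & (ALL v. pact g p v = 0)"
proof -
 have "ALL i. EX p. p~=0 & pact g p (axis i 1) = 0" using annihilator_vec[of g] by blast
 from choice[OF this] obtain m where m: "!!i. m i~=0" "!!i. pact g (m i) (axis i 1) = 0" by blast
 let ?p = "PROD i:UNIV. m i"
 have "pact g ?p (axis i 1) = 0" for i
 proof -
  have "?p = (PROD j:UNIV - {i}. m j) * m i" by (simp add: prod.remove[of UNIV i] mult.commute)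
  moreover have "pact g q 0 = 0" for q using pact_lin(2)[of g q 0 0] by simp
  ultimately show ?thesis by (simp add: pact_mult m)
 qed
 hence "pact g ?p (SUM i:UNIV. v$i *s axis i 1) = 0" for v by (simp add: pact_sum pact_lin)
 thus ?thesis using m by (intro exI[of _ ?p]) (simp add: basis_expansion)
qed

lemma pact_in: "vec.subspace U ==> (!!u. u:U ==> g *v u:U) ==> w:U ==> pact g p w:U" by (induction p) (auto simp: vec.subspace_def)

lemma pact_eigen: assumes "vec.subspace U" "!!u. u:U ==> g *v u:U" "g *v w - c *s w:U" shows "pact g p w - poly p c *s w:U"
proof (induction p)
 case 0 thus ?case using assms(1) by (simp add: vec.subspace_0)
next
 case (pCons a p)
 have "g *v (pact g p w - poly p c *s w) + poly p c *s (g *v w - c *s w):U" using pCons assms by (intro vec.subspace_add vec.subspace_scale) auto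
 thus ?case by (simp add: vec.diff vec.scale vec.scale_right_diff_distrib vec.scale_left_distrib algebra_simps)
qed

text \<open>One finite set serves all invariant subspaces \<open>U\<close> at once: an eigenvalue
  modulo \<open>U\<close> is a root of any polynomial that annihilates \<open>g\<close> on the whole
  space.\<close>

lemma eigen_finite:
 fixes g :: "complex^'n^'n" shows "EX C. finite C & (ALL U w c. vec.subspace U --> (ALL u:U. g *v u:U) --> w ~: U -->
  g *v w - c *s w:U --> c:C)"
proof -
 obtain p where p: "p~=0" "!!v. pact g p v = 0" using annihilator by blast
 show ?thesis
 proof (intro exI[of _ "{c. poly p c = 0}"] conjI allI impI)
  show "finite {c. poly p c = 0}" by (rule poly_roots_finite[OF p(1)])
  fix U w c assume "vec.subspace U" "ALL u:U. g *v u:U" "w ~: U" "g *v w - c *s w:U"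
  hence *: "vec.subspace U" "!!u. u:U ==> g *v u:U" "w ~: U" "g *v w - c *s w:U" by auto
  have "- (poly p c *s w):U" using pact_eigen[OF *(1,2,4), of p] p(2) by simp
  hence "poly p c *s w:U" using vec.subspace_neg[OF *(1)] by fastforce
  hence "poly p c~=0 ==> inverse (poly p c) *s (poly p c *s w):U" using vec.subspace_scale[OF *(1)] by blast
  thus "c:{c. poly p c = 0}" using *(3) by auto
 qed
qed

text \<open>Take a polynomial of least degree carrying \<open>w0\<close> into \<open>U\<close> and
  split off a root. The cofactor applied to \<open>w0\<close> is an eigenvector modulo
  \<open>U\<close>, outside \<open>U\<close> by minimality.\<close>

lemma eigen_mod:
 fixes g :: "complex^'n^'n" assumes "vec.subspace U" "vec.subspace W" "!!u. u:U ==> g *v u:U"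
  "!!u. u:W ==> g *v u:W" "w0:W" "w0 ~: U"
 obtains c w where "w:W" "w ~: U" "g *v w - c *s w:U"
proof -
 define P where "P = (%p. p~=0 & pact g p w0:U)" obtain p0 where "P p0" unfolding P_def using annihilator[of g] vec.subspace_0[OF assms(1)] by metis
 then obtain p where p: "P p" "!!q. P q ==> degree p<=degree q" using ex_has_least_nat[of P p0 degree] by blast
 have "degree p~=0"
 proof
  assume "degree p = 0"
  then obtain c where c: "p = [:c:]" using degree_eq_zeroE by blast
  hence "c~=0" "c *s w0:U" using p by (auto simp: P_def)
  hence "inverse c *s (c *s w0):U" using vec.subspace_scale[OF assms(1)] by blast
  thus False using `c~=0` assms(6) by simp
 qed
 then obtain c where "poly p c = 0" using alg_closed_imp_poly_has_root[of p] by auto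
 hence "[:- c, 1:] dvd p" by (simp add: poly_eq_0_iff_dvd)
 then obtain q where q: "p = [:- c, 1:] * q" by (elim dvdE)
 hence q0: "q~=0" using p(1) by (auto simp: P_def)
 have "degree p = 1 + degree q" unfolding q using q0 by (subst degree_mult_eq) auto
 hence "~ P q" using p(2)[of q] by auto
 hence "pact g q w0 ~: U" using q0 by (simp add: P_def)
 moreover have "pact g q w0:W" by (rule pact_in[OF assms(2,4,5)])
 moreover have "g *v pact g q w0 - c *s pact g q w0:U"
 proof -
  have "pact g p w0 = pact g [:- c, 1:] (pact g q w0)" by (simp only: q pact_mult)
  also have "... = g *v pact g q w0 - c *s pact g q w0" by simp
  finally show ?thesis using p(1) by (simp add: P_def)
 qed
 ultimately show ?thesis using that by blast
qed

lemma kernel_matrix: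
 fixes U :: "(complex^'n) set" assumes "vec.subspace U" shows "EX A :: complex^'n^'n. ALL v. A *v v = 0 \<longleftrightarrow> v:U"
proof -
 obtain B where B: "B<=U" "vec.independent B" "U<=vec.span B" using vec.basis_exists[of U] by metis obtain B' where B': "B<=B'" "B'<=UNIV" "vec.independent B'" "UNIV<=vec.span B'"
  by (rule vec.maximal_independent_subset_extend[OF subset_UNIV B(2)]) obtain f where f: "Vector_Spaces.linear (*s) (*s) f" "!!x. x:B' ==> f x = (if x:B then 0 else x)"
  using vec.linear_independent_extend[OF B'(3), of "%x. if x:B then 0 else x"] by blast
 have U: "U = vec.span B" using B vec.span_minimal[OF B(1) assms] by blast
 have fB: "f v = 0" if "v:vec.span B" for v by (rule vec.linear_eq_0_on_span[OF f(1) _ that]) (use f(2) B'(1) in auto)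
 have fB': "f v = v" if "v:vec.span (B' - B)" for v by (rule vec.linear_eq_on[OF f(1) vec.linear_ident that]) (use f(2) in auto)
 have "f v = 0 \<longleftrightarrow> v:U" for v
 proof
  assume v: "f v = 0"
  have "v:vec.span (B Un (B' - B))" using B' by (auto simp: Un_absorb1)
  then obtain u w where uw: "v = u + w" "u:vec.span B" "w:vec.span (B' - B)" unfolding vec.span_Un by blast
  hence "w = 0" using v fB fB' vec.linear_add[OF f(1)] by auto
  thus "v:U" using uw U by simp
 qed (use fB U in auto)
 moreover have "matrix f *v v = f v" for v by (rule matrix_works[OF f(1)])
 ultimately have "ALL v. matrix f *v v = 0 \<longleftrightarrow> v:U" by (simp only:) simp
 thus ?thesis by (rule exI)
qed

lemma scal_cancel:
 fixes w :: "complex^'n" assumes "vec.subspace U" "c *s w - d *s w:U" "w ~: U" shows "c = d"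
proof (rule ccontr)
 assume "c~=d"
 have "(c - d) *s w:U" using assms(2) by (simp add: vec.scale_left_diff_distrib)
 hence "inverse (c - d) *s ((c - d) *s w):U" by (rule vec.subspace_scale[OF assms(1)])
 hence "(inverse (c - d) * (c - d)) *s w:U" by (simp only: vec.scale_scale)
 thus False using `c~=d` assms(3) by (simp del: vec.scale_left_diff_distrib)
qed

text \<open>The eigenvalue at \<open>h *v w\<close> takes finitely many values, each on a Zariski
  closed set of elements \<open>h\<close>, so connectedness freezes it. A matrix with kernel
  \<open>U\<close> converts membership in \<open>U\<close> into polynomial equations.\<close>

lemma eigenvalue_const:
 fixes g :: "complex^'n^'n" assumes H: "zconn H" "!!h. h:H ==> invertible h" "mat 1:H" and U: "vec.subspace U" "!!u. u:U ==> g *v u:U" "!!h u. h:H ==> h *v u:U ==> u:U"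
  and w: "w ~: U" "g *v w - m *s w:U" and ex: "!!h. h:H ==> EX c. g *v (h *v w) - c *s (h *v w):U" and h: "h:H" shows "g *v (h *v w) - m *s (h *v w):U"
proof -
 obtain A :: "complex^'n^'n" where A: "!!v. A *v v = 0 \<longleftrightarrow> v:U" using kernel_matrix[OF U(1)] by auto
 obtain C where C: "finite C" "!!w c. w ~: U ==> g *v w - c *s w:U ==> c:C" using eigen_finite[of g] U(1,2) by auto
 let ?v = "%c h. A *v (g *v (h *v w) - c *s (h *v w))"
 define F where "F = (%c. {h. invertible h & ?v c h = 0})"
 have cl: "zclosed (F c)" for c
 proof -
  have rv: "reg (%h. (h *v u)$i)" for u :: "complex^'n" and i unfolding matrix_vector_mult_def vec_lambda_beta by (intro reg_sum reg_mult reg_coord reg_const) auto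
  have "reg (%h. (g *v (h *v w))$i + (- c) * (h *v w)$i)" for i unfolding matrix_vector_mult_def[of g] vec_lambda_beta by (intro reg_add reg_mult reg_const reg_sum rv) auto
  hence "reg (%h. (g *v (h *v w) - c *s (h *v w))$i)" for i by simp
  hence "reg (%h. ?v c h$i)" for i unfolding matrix_vector_mult_def[of A] vec_lambda_beta by (intro reg_mult reg_const reg_sum) auto
  thus ?thesis unfolding F_def by (intro zclosedI[of "range (%i h. ?v c h$i)"]) (auto simp: vec_eq_iff)
 qed
 have nu: "h *v w ~: U" if "h:H" for h using U(3)[OF that, of w] w(1) by blast
 have m: "m:C" using C(2) w by blast
 have "H<=F m"
 proof (rule zconn_const[OF H(1) C(1) cl _ _ H(3) _ m])
  show "H<=(UN c:C. F c)"
  proof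
   fix h assume h: "h:H"
   then obtain c where "g *v (h *v w) - c *s (h *v w):U" using ex by blast
   thus "h:(UN c:C. F c)" using C(2)[OF nu[OF h]] A H(2)[OF h] by (auto simp: F_def)
  qed
  show "H Int F c Int F d = {}" if "c~=d" for c d
  proof (rule ccontr)
   assume "H Int F c Int F d~={}"
   then obtain h where h: "h:H" "g *v (h *v w) - c *s (h *v w):U"
    "g *v (h *v w) - d *s (h *v w):U" using A by (auto simp: F_def)
   have "(g *v (h *v w) - d *s (h *v w)) - (g *v (h *v w) - c *s (h *v w)):U" by (rule vec.subspace_diff[OF U(1) h(3,2)])
   hence "c *s (h *v w) - d *s (h *v w):U" by simp
   thus False using scal_cancel[OF U(1) _ nu[OF h(1)]] that by blast
  qed
  show "mat 1:F m" using w(2) A by (simp add: F_def invertible_1)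
 qed
 thus ?thesis using h A by (auto simp: F_def)
qed

lemma derived_zconn: assumes H: "subgroup H GL" "zconn H" shows "zconn (derived GL H)" "!!g h. g:H ==> h:H ==> g**h**minv g**minv h:derived GL H"
  "derived GL H<=H" "!!g d. g:H ==> d:derived GL H ==> g**d**minv g:derived GL H"
proof -
 note S = subgroupD[OF H(1)]
 define c where "c = (%g h. g**h**minv g**minv (h :: complex^'a^'a))"
 have ds: "derived_set GL H = (\<Union>((%g. c g ` H) ` H))" using S(1) by (auto simp: c_def inv_GL) (auto simp: GL_def)
 have cinv: "minv (c g h) = c h g" if "g:H" "h:H" for g h using S(1) that by (simp add: c_def minv_mult invertible_mult invertible_minv minv_minv mm_assoc)
 show "zconn (derived GL H)" unfolding derived_def ds
 proof (rule zconn_generate)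
  fix C assume "C:(%g. c g ` H) ` H"
  then obtain g where g: "g:H" "C = c g ` H" by auto
  show "zconn C" unfolding g(2) by (rule zconn_image[OF H(2)])
    (use S g in \<open>auto simp: c_def intro!: reg_mm reg_const reg_coord reg_minv invertible_mult invertible_minv\<close>)
  have "c g (mat 1) = mat 1" using S(1)[OF g(1)] by (simp add: c_def minv)
  thus "mat 1:C" unfolding g(2) using S(2) by (metis image_eqI)
  fix A assume "A:C"
  then obtain h where h: "h:H" "A = c g h" using g by auto
  show "invertible A" using S(1) g(1) h by (auto simp: c_def intro!: invertible_mult invertible_minv)
  show "EX D:(%g. c g ` H) ` H. minv A:D" using cinv[OF g(1) h(1)] h g by auto
 qed
 show com: "g**h**minv g**minv h:derived GL H" if "g:H" "h:H" for g h unfolding derived_def ds using that by (intro generate.incl) (auto simp: c_def)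
 show sub: "derived GL H<=H" by (rule group.derived_incl[OF group_GL]) (use H in auto)
 show "g**d**minv g:derived GL H" if "g:H" "d:derived GL H" for g d
 proof -
  have sg: "subgroup (derived GL H) GL" using S(1) by (intro group.derived_is_subgroup[OF group_GL]) (auto simp: GL_def)
  have d: "d:H" using sub that by auto
  have "(g**d**minv g**minv d)**d:derived GL H" by (rule subgroupD(3)[OF sg com[OF that(1) d] that(2)])
  thus ?thesis using S(1)[OF d] by (simp add: mm_assoc minv)
 qed
qed

text \<open>Induction on the derived length, relative to \<open>U\<close> instead of in a quotient
  space. Let \<open>V\<close> be a minimal invariant space above \<open>U\<close>. The derived group
  acts on it modulo \<open>U\<close> by a character, and the eigenspace modulo \<open>U\<close> of
  any element of \<open>H\<close> is again invariant, so by minimality it is all of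
  \<open>V\<close>.\<close>

theorem lie_kolchin_mod:
 fixes H :: "(complex^'n^'n) set" assumes "subgroup H GL" "zconn H" "(derived GL ^^ k) H = {mat 1}"
  "vec.subspace U" "vec.subspace W" "U \<subset> W"
  "!!h u. h:H ==> u:U ==> h *v u:U" "!!h u. h:H ==> u:W ==> h *v u:W" shows "EX w:W - U. ALL h:H. EX c. h *v w - c *s w:U" using assms
proof (induction k arbitrary: H U W)
 case 0
 then obtain w where "w:W - U" by blast
 moreover have "h *v w - 1 *s w:U" if "h:H" for h using 0 that by (simp add: vec.subspace_0)
 ultimately show ?case by blast
next
 case (Suc k)
 note S = subgroupD[OF Suc.prems(1)]
 let ?D = "derived GL H"
 note D = derived_zconn[OF Suc.prems(1,2)]
 have sgD: "subgroup ?D GL" using S(1) by (intro group.derived_is_subgroup[OF group_GL]) (auto simp: GL_def)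
 have Dk: "(derived GL ^^ k) ?D = {mat 1}" using Suc.prems(3) by (simp add: funpow_swap1)
 define P where "P = (%V. vec.subspace V & U \<subset> V & V<=W & (ALL h:H. ALL u:V. h *v u:V))"
 have "P W" using Suc.prems by (auto simp: P_def)
 then obtain V where V: "P V" "!!V'. P V' ==> vec.dim V<=vec.dim V'" using ex_has_least_nat[of P W vec.dim] by blast
 have Vs: "vec.subspace V" "U \<subset> V" "V<=W" "!!h u. h:H ==> u:V ==> h *v u:V" using V(1) by (auto simp: P_def)
 have minV: "X = V" if "P X" "X<=V" for X using V(2)[OF that(1)] that Vs(1) by (intro vec.subspace_dim_equal) (auto simp: P_def)
 have U: "vec.subspace U" "!!h u. h:H ==> u:U ==> h *v u:U" using Suc.prems by auto
 have Uinv: "u:U" if "h:H" "h *v u:U" for h u using U(2)[OF S(4)[OF that(1)] that(2)] S(1)[OF that(1)] by (simp add: minv_vec)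
 note eq_scal = scal_cancel[OF U(1)] obtain w0 where w0: "w0:V - U" "ALL d:?D. EX c. d *v w0 - c *s w0:U" using Suc.IH[OF sgD D(1) Dk U(1) Vs(1,2)] U(2) Vs(4) D(3) by blast
 obtain ch where ch: "!!d. d:?D ==> d *v w0 - ch d *s w0:U" using w0(2) by metis
 have conj: "minv h**d**h:?D" if "h:H" "d:?D" for h d using D(4)[OF S(4)[OF that(1)] that(2)] S(1)[OF that(1)] by (simp add: minv_minv)
 have move: "d *v (h *v w) - c *s (h *v w):U"
  if "h:H" "d:?D" "(minv h**d**h) *v w - c *s w:U" for h d w c
 proof -
  have "h *v ((minv h**d**h) *v w - c *s w):U" by (rule U(2)[OF that(1,3)])
  thus ?thesis using S(1)[OF that(1)] by (simp add: vec.diff vec.scale matrix_vector_mul_assoc matrix_mul_assoc minv)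
 qed
 have chc: "ch (minv h**d**h) = ch d" if h: "h:H" and d: "d:?D" for h d
 proof (rule eq_scal)
  have dH: "d:H" using D(3) d by blast
  have 1: "d *v (h *v w0) - ch (minv h**d**h) *s (h *v w0):U" if "h:H" for h by (rule move[OF that d ch[OF conj[OF that d]]])
  have 2: "d *v (h *v w0) - ch d *s (h *v w0):U" by (rule eigenvalue_const[OF Suc.prems(2) S(1,2) U(1) U(2)[OF dH] Uinv _ ch[OF d] _ h])
    (use 1 w0 in auto)
  show "ch (minv h**d**h) *s (h *v w0) - ch d *s (h *v w0):U" using vec.subspace_diff[OF U(1) 2 1[OF h]] by simp
  show "h *v w0 ~: U" using Uinv[OF h] w0(1) by blast
 qed
 define X where "X = {w:V. ALL d:?D. d *v w - ch d *s w:U}"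
 have "P X" unfolding P_def
 proof (intro conjI ballI)
  show "vec.subspace X" unfolding vec.subspace_def
  proof (intro conjI ballI allI)
   show "0:X" using vec.subspace_0[OF Vs(1)] vec.subspace_0[OF U(1)] by (simp add: X_def)
   fix x y c assume x: "x:X"
   have "d *v (c *s x) - ch d *s (c *s x):U" if "d:?D" for d using vec.subspace_scale[OF U(1), of "d *v x - ch d *s x" c] x that
    by (simp add: X_def vec.scale vec.scale_right_diff_distrib mult.commute)
   thus "c *s x:X" using x vec.subspace_scale[OF Vs(1)] by (simp add: X_def)
   assume y: "y:X"
   have "d *v (x + y) - ch d *s (x + y):U" if "d:?D" for d using vec.subspace_add[OF U(1), of "d *v x - ch d *s x" "d *v y - ch d *s y"] x y that
    by (simp add: X_def vec.add vec.scale_right_distrib algebra_simps)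
   thus "x + y:X" using x y vec.subspace_add[OF Vs(1)] by (simp add: X_def)
  qed
  have "u:X" if u: "u:U" for u using u Vs(2) U(2) D(3) vec.subspace_diff[OF U(1)] vec.subspace_scale[OF U(1)] by (auto simp: X_def)
  moreover have "w0:X" "w0 ~: U" using w0 ch by (auto simp: X_def)
  ultimately show "U \<subset> X" by blast
  show "X<=W" using Vs by (auto simp: X_def)
  fix h w assume h: "h:H" and w: "w:X"
  have "d *v (h *v w) - ch d *s (h *v w):U" if d: "d:?D" for d using w conj[OF h d] chc[OF h d] by (intro move[OF h d]) (auto simp: X_def)
  thus "h *v w:X" using w Vs(4)[OF h] by (simp add: X_def)
 qed
 hence XV: "X = V" by (rule minV) (auto simp: X_def)
 have chV: "d *v w - ch d *s w:U" if "w:V" "d:?D" for w d using that XV by (auto simp: X_def)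
 have scal: "EX m. ALL w:V. g *v w - m *s w:U" if g: "g:H" for g
 proof -
  obtain m w1 where w1: "w1:V" "w1 ~: U" "g *v w1 - m *s w1:U" by (rule eigen_mod[OF U(1) Vs(1) U(2)[OF g] Vs(4)[OF g], of w0]) (use w0 in auto)
  define k where "k = (%h. g**h**minv g**minv h)"
  have kD: "k h:?D" if "h:H" for h using D(2)[OF g that] by (simp add: k_def)
  \<comment> \<open>Write \<open>g ** h\<close> as the commutator of the two times
    \<open>h ** g\<close>. The commutator acts by the scalar \<open>ch (k h)\<close>, so
    \<open>h\<close> maps eigenvectors of \<open>g\<close> to eigenvectors with a rescaled
    eigenvalue, and \<open>eigenvalue_const\<close> shows the rescaling to be trivial.\<close>
  have ev: "g *v (h *v w) - (ch (k h) * m) *s (h *v w):U"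
   if h: "h:H" and w: "w:V" "g *v w - m *s w:U" for h w
  proof -
   have gh: "g *v (h *v w) = k h *v (h *v (g *v w))" using S(1)[OF h] S(1)[OF g] by (simp add: k_def matrix_vector_mul_assoc mm_assoc minv_cancel minv)
   have "k h *v (h *v (g *v w)) - ch (k h) *s (h *v (g *v w)):U" by (rule chV[OF Vs(4)[OF h Vs(4)[OF g w(1)]] kD[OF h]])
   moreover have "ch (k h) *s (h *v (g *v w - m *s w)):U" by (intro vec.subspace_scale[OF U(1)] U(2)[OF h] w(2))
   ultimately have "(k h *v (h *v (g *v w)) - ch (k h) *s (h *v (g *v w)))
     + ch (k h) *s (h *v (g *v w - m *s w)):U" by (rule vec.subspace_add[OF U(1)])
   thus ?thesis unfolding gh by (simp add: vec.diff vec.scale vec.scale_right_diff_distrib algebra_simps)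
  qed
  have km: "ch (k h) * m = m" if h: "h:H" for h
  proof (rule eq_scal)
   have 2: "g *v (h *v w1) - m *s (h *v w1):U" by (rule eigenvalue_const[OF Suc.prems(2) S(1,2) U(1) U(2)[OF g] Uinv w1(2,3) _ h])
     (use ev[OF _ w1(1,3)] in blast)+
   show "(ch (k h) * m) *s (h *v w1) - m *s (h *v w1):U" using vec.subspace_diff[OF U(1) 2 ev[OF h w1(1,3)]] by simp
   show "h *v w1 ~: U" using Uinv[OF h] w1(2) by blast
  qed
  define Y where "Y = {w:V. g *v w - m *s w:U}"
  have "P Y" unfolding P_def
  proof (intro conjI ballI)
   show "vec.subspace Y" unfolding vec.subspace_def
   proof (intro conjI ballI allI)
    show "0:Y" using vec.subspace_0[OF Vs(1)] vec.subspace_0[OF U(1)] by (simp add: Y_def)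
    fix x y c assume x: "x:Y"
    have "g *v (c *s x) - m *s (c *s x):U" using vec.subspace_scale[OF U(1), of "g *v x - m *s x" c] x by (simp add: Y_def vec.scale vec.scale_right_diff_distrib mult.commute)
    thus "c *s x:Y" using x vec.subspace_scale[OF Vs(1)] by (simp add: Y_def)
    assume y: "y:Y"
    have "g *v (x + y) - m *s (x + y):U" using vec.subspace_add[OF U(1), of "g *v x - m *s x" "g *v y - m *s y"] x y by (simp add: Y_def vec.add vec.scale_right_distrib algebra_simps)
    thus "x + y:Y" using x y vec.subspace_add[OF Vs(1)] by (simp add: Y_def)
   qed
   have "u:Y" if u: "u:U" for u using u Vs(2) U(2)[OF g] vec.subspace_diff[OF U(1)] vec.subspace_scale[OF U(1)] by (auto simp: Y_def)
   moreover have "w1:Y" "w1 ~: U" using w1 by (auto simp: Y_def)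
   ultimately show "U \<subset> Y" by blast
   show "Y<=W" using Vs by (auto simp: Y_def)
   fix h w assume h: "h:H" and w: "w:Y"
   show "h *v w:Y" using ev[OF h, of w] km[OF h] w Vs(4)[OF h] by (simp add: Y_def)
  qed
  hence "Y = V" by (rule minV) (auto simp: Y_def)
  thus ?thesis by (auto simp: Y_def)
 qed
 show ?case using w0(1) Vs(3) scal by (intro bexI[of _ w0]) blast+
qed

lemma derived_grp: assumes "subgroup H GL" shows "(derived (grp H) ^^ k) H = (derived GL ^^ k) H"
proof (induction k)
 case (Suc k)
 interpret GL: group GL by (rule group_GL)
 have "(derived GL ^^ k) H<=H" by (induction k) (auto dest: GL.derived_incl[OF _ assms, THEN subsetD])
 thus ?case using GL.derived_consistent[OF _ assms] Suc by simp
qed simp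

lemma solvable_derived: assumes "subgroup H GL" "solvable (grp H)" obtains k where "(derived GL ^^ k) H = {mat 1}"
proof -
 interpret GL: group GL by (rule group_GL)
 interpret H: group "grp H" by (rule GL.subgroup_imp_group[OF assms(1)]) obtain k where k: "(derived (grp H) ^^ k) H = {mat 1}"
  using assms(2) H.solvable_iff_trivial_derived_seq by (auto simp: GL_def)
 show ?thesis using k derived_grp[OF assms(1)] that by metis
qed

subsection \<open>Flags\<close>

text \<open>\<open>lev r m\<close>: matrices that raise the position \<open>r\<close> of the basis vectors by at least \<open>m\<close>.\<close>

definition lev :: "('n => nat) => nat => (complex^'n^'n) set" where
 "lev r m = {X. ALL k l. r l < r k + m --> X$k$l = 0}"

lemma lev_mult: assumes "X:lev r a" "Y:lev r b" shows "X**Y:lev r (a + b)"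
proof -
 have "(SUM j:UNIV. X$k$j * Y$j$l) = 0" if "r l < r k + (a + b)" for k l
 proof (rule sum.neutral, rule ballI)
  fix j show "X$k$j * Y$j$l = 0" using assms that by (cases "r j < r k + a") (auto simp: lev_def)
 qed
 thus ?thesis by (simp add: lev_def mm_nth)
qed

lemma lev_mono: "m<=m' ==> lev r m'<=lev r m" by (auto simp: lev_def)

lemma lev_sub: "0:lev r m" "X:lev r m ==> Y:lev r m ==> X + Y:lev r m"
 "X:lev r m ==> Y:lev r m ==> X - Y:lev r m" "X:lev r m ==> msc c X:lev r m" by (auto simp: lev_def)

lemma lev_1: "mat 1:lev r 0" by (auto simp: lev_def mat_def)

lemma lev_mexp: assumes "X:lev r 0" shows "mexp X s:lev r 0"
proof -
 have "mpow X k:lev r 0" for k using assms lev_mult[of X r 0 _ 0] by (induction k) (auto simp: mpow_Suc lev_1)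
 thus ?thesis by (auto simp: lev_def mexp_def)
qed

text \<open>A basis is chosen one vector at a time, making \<open>HS\<close> triangular and
  \<open>SS\<close> strictly triangular. The bijection \<open>r\<close> records the order of the
  basis, because the index type carries none.\<close>

theorem flag_exists:
 fixes HS SS :: "(complex^'n^'n) set" assumes step: "!!U. vec.subspace U ==> U~=UNIV ==> (!!h u. h:HS Un SS ==> u:U ==> h *v u:U) ==>
  EX w. w ~: U & (ALL h:HS. EX c. h *v w - c *s w:U) & (ALL s:SS. s *v w:U)"
 obtains Q :: "complex^'n^'n" and r :: "'n => nat" where "invertible Q" "bij_betw r UNIV {..<CARD('n)}"
  "!!h. h:HS ==> minv Q**h**Q:lev r 0" "!!s. s:SS ==> minv Q**s**Q:lev r 1"
proof -
 let ?n = "CARD('n)" and ?sp = "%f i. vec.span (f ` {..<i::nat})"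
 define good where "good = (%k f. ALL i<k. f i ~: ?sp f i & (ALL h:HS. EX c. h *v f i - c *s f i:?sp f i)
   & (ALL s:SS. s *v f i:?sp f i))"
 have "k<=?n ==> EX f::nat => complex^'n. good k f" for k
 proof (induction k)
  case 0 thus ?case by (simp add: good_def)
 next
  case (Suc k)
  then obtain f :: "nat => complex^'n" where f: "good k f" by auto
  let ?U = "?sp f k"
  have mono: "?sp f i<=?U" if "i < k" for i using that by (intro vec.span_mono image_mono) auto
  have base: "f i:?U" if "i < k" for i using that by (intro vec.span_base) auto
  have ne: "?U~=UNIV"
  proof
   assume "?U = UNIV"
   hence "vec.dim (UNIV :: (complex^'n) set)<=card (f ` {..<k})" using vec.dim_le_card[of UNIV "f ` {..<k}"] by simp
   thus False using card_image_le[of "{..<k}" f] Suc.prems by (simp add: vec.dimension_def card_cart_basis)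
  qed
  have "h *v u:?U" if h: "h:HS Un SS" and u: "u:?U" for h u using u
  proof (induction rule: vec.span_induct_alt)
   case base thus ?case by (simp add: vec.span_zero)
  next
   case (step c x y)
   then obtain i where i: "i < k" "x = f i" by auto
   have "h *v f i:?U"
   proof (cases "h:HS")
    case True
    then obtain d where "h *v f i - d *s f i:?U" using f i mono[OF i(1)] unfolding good_def by blast
    hence "(h *v f i - d *s f i) + d *s f i:?U" using base[OF i(1)] by (intro vec.span_add vec.span_scale)
    thus ?thesis by simp
   next
    case False thus ?thesis using f i mono[OF i(1)] h unfolding good_def by blast
   qed
   thus ?case using step i by (simp add: vec.add vec.scale vec.span_add vec.span_scale)
  qed
  then obtain w where w: "w ~: ?U" "ALL h:HS. EX c. h *v w - c *s w:?U" "ALL s:SS. s *v w:?U" using assms[OF vec.subspace_span ne] by blast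
  have im: "f(k := w) ` {..<i} = f ` {..<i}" if "i<=k" for i using that by auto
  have "good (Suc k) (f(k := w))" unfolding good_def
  proof (intro allI impI)
   fix i assume "i < Suc k"
   then consider "i < k" | "i = k" by linarith
   thus "(f(k := w)) i ~: ?sp (f(k := w)) i & (ALL h:HS. EX c. h *v (f(k := w)) i - c *s (f(k := w)) i:?sp (f(k := w)) i)
     & (ALL s:SS. s *v (f(k := w)) i:?sp (f(k := w)) i)" using f w im[of i] by cases (auto simp: good_def)
  qed
  thus ?case by blast
 qed
 then obtain f :: "nat => complex^'n" where f: "good ?n f" by blast obtain r :: "'n => nat" where r: "bij_betw r UNIV {..<?n}"
  using ex_bij_betw_finite_nat[of "UNIV :: 'n set"] by (auto simp: atLeast0LessThan)
 define Q :: "complex^'n^'n" where "Q = (\<chi> i j. f (r j)$i)"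
 have Qv: "Q *v u = (SUM j:UNIV. u$j *s f (r j))" for u by (simp add: vec_eq_iff matrix_vector_mult_def Q_def mult.commute)
 have rlt: "r j < ?n" for j using r by (auto simp: bij_betw_def)
 have "u = 0" if u: "Q *v u = 0" for u
 proof (rule ccontr)
  assume "u~=0"
  then obtain j0 where "u$j0~=0" by (auto simp: vec_eq_iff)
  then obtain j where j: "u$j~=0" "!!k. u$k~=0 ==> r k<=r j" using ex_has_greatest_nat[of "%j. u$j~=0" j0 r ?n] rlt by (auto simp: less_imp_le)
  have "(SUM k:UNIV - {j}. u$k *s f (r k)):?sp f (r j)"
  proof (rule vec.span_sum)
   fix k assume k: "k:UNIV - {j}"
   show "u$k *s f (r k):?sp f (r j)"
   proof (cases "u$k = 0")
    case True thus ?thesis by (simp add: vec.span_zero)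
   next
    case False
    have "r k~=r j" using k r by (auto simp: bij_betw_def inj_on_def)
    hence "r k < r j" using j(2)[OF False] by simp
    thus ?thesis by (intro vec.span_scale vec.span_base) auto
   qed
  qed
  hence "- (inverse (u$j)) *s (SUM k:UNIV - {j}. u$k *s f (r k)):?sp f (r j)" by (rule vec.span_scale)
  moreover have "(SUM k:UNIV - {j}. u$k *s f (r k)) = - (u$j *s f (r j))" using u by (simp add: Qv sum.remove[of UNIV j] eq_neg_iff_add_eq_0 add.commute)
  ultimately have "f (r j):?sp f (r j)" using j(1) by (simp add: vec_eq_iff)
  thus False using f rlt[of j] by (simp add: good_def)
 qed
 then obtain B where "B**Q = mat 1" using matrix_left_invertible_ker[of Q] by blast
 hence Q: "invertible Q" using invertible_left_inverse by blast
 have sup: "EX u. v = Q *v u & (ALL j. m<=r j --> u$j = 0)" if vm: "v:?sp f m" "m<=?n" for v m using vm(1)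
 proof (induction rule: vec.span_induct_alt)
  case base thus ?case by (intro exI[of _ 0]) simp
 next
  case (step c x y)
  then obtain i u where i: "i < m" "x = f i" and u: "y = Q *v u" "ALL j. m<=r j --> u$j = 0" by auto
  obtain j where j: "r j = i" using r i vm(2) by (metis bij_betw_def imageE lessThan_iff order_less_le_trans)
  have "Q *v axis j 1 = f i" using j by (simp add: vec_eq_iff matrix_vector_mult_def Q_def axis_def if_distrib[of "%x. _ * x"] cong: if_cong)
  thus ?case using u i j by (intro exI[of _ "c *s axis j 1 + u"]) (auto simp: vec.add vec.scale axis_def)
 qed
 have entry: "(minv Q**h**Q)$k$l = c * (if k = l then 1 else 0) + u$k"
  if "h *v f (r l) = c *s f (r l) + Q *v u" for h k l c u
 proof -
  have "Q *v axis l 1 = f (r l)" by (simp add: vec_eq_iff matrix_vector_mult_def Q_def axis_def if_distrib[of "%x. _ * x"] cong: if_cong)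
  hence "(minv Q**h**Q) *v axis l 1 = minv Q *v (c *s (Q *v axis l 1) + Q *v u)" using that by (simp flip: matrix_vector_mul_assoc)
  also have "... = c *s axis l 1 + u" by (simp add: vec.add vec.scale minv_vec Q)
  finally have "((minv Q**h**Q) *v axis l 1)$k = (c *s axis l 1 + u)$k" by simp
  thus ?thesis by (simp add: matrix_vector_mult_def axis_def if_distrib[of "%x. _ * x"] cong: if_cong)
 qed
 show ?thesis
 proof (rule that[OF Q r])
  fix h assume h: "h:HS"
  have "(minv Q**h**Q)$k$l = 0" if "r l < r k" for k l
  proof -
   obtain c where "h *v f (r l) - c *s f (r l):?sp f (r l)" using f rlt[of l] h unfolding good_def by blast
   then obtain u where u: "h *v f (r l) - c *s f (r l) = Q *v u" "ALL j. r l<=r j --> u$j = 0" using sup[of _ "r l"] rlt[of l] by (meson less_imp_le)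
   hence "h *v f (r l) = c *s f (r l) + Q *v u" by (metis add.commute diff_add_cancel)
   thus ?thesis using entry u(2) that by auto
  qed
  thus "minv Q**h**Q:lev r 0" by (simp add: lev_def)
 next
  fix h assume h: "h:SS"
  have "(minv Q**h**Q)$k$l = 0" if "r l < r k + 1" for k l
  proof -
   have "h *v f (r l):?sp f (r l)" using f rlt[of l] h by (auto simp: good_def)
   then obtain u where u: "h *v f (r l) = Q *v u" "ALL j. r l<=r j --> u$j = 0" using sup[of _ "r l"] rlt[of l] by (meson less_imp_le)
   thus ?thesis using entry[of h l 0 u k] that by auto
  qed
  thus "minv Q**h**Q:lev r 1" by (simp add: lev_def)
 qed
qed

text \<open>\<open>N m\<close> measures how far above the diagonal an element differs from the
  identity. Commutators raise the level: from 0 to 1 because diagonal parts commute, and later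
  because a product of two matrices of level \<open>m\<close> has level \<open>2 m\<close>.\<close>

theorem triangular_solvable:
 fixes H :: "(complex^'n^'n) set" and Q :: "complex^'n^'n" assumes H: "subgroup H GL" and Q: "invertible Q" and bij: "bij_betw r UNIV {..<CARD('n)}"
  and tri: "!!h. h:H ==> minv Q**h**Q:lev r 0" shows "solvable (grp H)"
proof -
 note S = subgroupD[OF H]
 have r: "r k < CARD('n)" for k using bij by (auto simp: bij_betw_def)
 define T where "T = (%h. minv Q**h**Q)"
 have T: "T (g**h) = T g**T h" "T (mat 1) = mat 1" for g h using Q by (simp_all add: T_def mm_assoc minv_cancel minv)
 have Tdiff: "T (g - h) = T g - T h" for g h by (simp add: T_def mm_add)
 have T0: "T h:lev r 0" if "h:H" for h using tri[OF that] by (simp add: T_def)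
 define N where "N = (%m. {h:H. m = 0 | T h - mat 1:lev r m})"
 have Nsub: "subgroup (N m) GL" for m
 proof (rule subgroupI)
  show "A:N m ==> invertible A" for A using S by (simp add: N_def)
  show "mat 1:N m" using S by (simp add: N_def T lev_sub)
  show "A**B:N m" if "A:N m" "B:N m" for A B
  proof -
   have e: "T (A**B) - mat 1 = (T A - mat 1)**T B + (T B - mat 1)" by (simp add: T mm_add)
   have "T (A**B) - mat 1:lev r m" if "m~=0"
   proof -
    have "(T A - mat 1)**T B:lev r (m + 0)" using that `A:N m` `B:N m` T0 by (intro lev_mult) (auto simp: N_def)
    moreover have "T B - mat 1:lev r m" using that `B:N m` by (simp add: N_def)
    ultimately show ?thesis unfolding e by (intro lev_sub(2)) auto
   qed
   thus ?thesis using that S by (auto simp: N_def)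
  qed
  show "minv A:N m" if "A:N m" for A
  proof -
   have i: "minv A:H" "invertible A" using that S by (auto simp: N_def)
   have "T (minv A) - mat 1 = T (minv A)**(mat 1 - T A)" using i(2) by (simp add: mm_add minv flip: T(1)) (simp add: T)
   moreover have "T (minv A)**(mat 1 - T A):lev r (0 + m)" if "T A - mat 1:lev r m"
   proof (rule lev_mult[OF T0[OF i(1)]])
    have "0 - (T A - mat 1):lev r m" by (rule lev_sub(3)[OF lev_sub(1) that])
    thus "mat 1 - T A:lev r m" by simp
   qed
   ultimately show ?thesis using that i by (auto simp: N_def)
  qed
 qed
 have comm: "g**h**minv g**minv h:N (Suc m)" if g: "g:N m" and h: "h:N m" for g h m
 proof -
  have gh: "g:H" "h:H" using that by (auto simp: N_def)
  have inv: "invertible g" "invertible h" using gh S by auto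
  have cH: "minv g**minv h:H" using gh S by auto
  have "T g**T h - T h**T g:lev r (Suc m)"
  proof (cases "m = 0")
   case True
   have "(T g**T h - T h**T g)$k$l = 0" if kl: "r l < r k + 1" for k l
   proof (cases "r l < r k")
    case True
    have "T g**T h:lev r 0" "T h**T g:lev r 0" using lev_mult[OF T0[OF gh(1)] T0[OF gh(2)]] lev_mult[OF T0[OF gh(2)] T0[OF gh(1)]] by simp_all
    thus ?thesis using True by (simp add: lev_def)
   next
    case False
    hence rkl: "r k = r l" using kl by simp
    hence lk: "l = k" using bij by (metis UNIV_I bij_betw_inv_into_left)
    have z: "X$k$j * Y$j$k = 0" if "X:lev r 0" "Y:lev r 0" "j~=k" for X Y j
    proof -
     have "r j~=r k" using bij that(3) by (metis UNIV_I bij_betw_inv_into_left)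
     thus ?thesis using that(1,2) by (cases "r j < r k") (auto simp: lev_def)
    qed
    have d: "(X**Y)$k$k = X$k$k * Y$k$k" if "X:lev r 0" "Y:lev r 0" for X Y
    proof -
     have "(SUM j:UNIV - {k}. X$k$j * Y$j$k) = 0" by (rule sum.neutral) (use z[OF that] in blast)
     thus ?thesis unfolding mm_nth by (subst sum.remove[of UNIV k]) auto
    qed
    show ?thesis using d T0 gh by (simp add: lk mult.commute)
   qed
   thus ?thesis using True by (simp add: lev_def)
  next
   case False
   have "T g**T h - T h**T g = (T g - mat 1)**(T h - mat 1) - (T h - mat 1)**(T g - mat 1)" by (simp add: mm_add)
   moreover have "(T g - mat 1)**(T h - mat 1):lev r (m + m)" "(T h - mat 1)**(T g - mat 1):lev r (m + m)" using g h False by (auto simp: N_def intro!: lev_mult)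
   moreover have "lev r (m + m)<=lev r (Suc m)" using False by (intro lev_mono) auto
   ultimately show ?thesis by (auto intro: lev_sub)
  qed
  hence "(T g**T h - T h**T g)**T (minv g**minv h):lev r (Suc m + 0)" using T0[OF cH] by (rule lev_mult)
  moreover have "(T g**T h - T h**T g)**T (minv g**minv h)
    = T (g**h**minv g**minv h) - mat 1"
  proof -
   have "(g**h - h**g)**(minv g**minv h) = g**h**minv g**minv h - mat 1" using inv by (simp add: mm_add mm_assoc minv minv_cancel)
   hence "T ((g**h - h**g)**(minv g**minv h)) = T (g**h**minv g**minv h) - mat 1" by (simp add: Tdiff T(2))
   thus ?thesis by (simp add: T Tdiff)
  qed
  ultimately show ?thesis using gh S by (auto simp: N_def)
 qed
 have "(derived GL ^^ m) H<=N m" for m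
 proof (induction m)
  case 0 thus ?case by (simp add: N_def)
 next
  case (Suc m)
  have "derived_set GL (N m)<=N (Suc m)" using comm subgroupD(1)[OF Nsub] by (auto simp: inv_GL) (simp add: GL_def)
  hence "derived GL (N m)<=N (Suc m)" unfolding derived_def by (rule group.generate_subgroup_incl[OF group_GL _ Nsub])
  thus ?case using group.mono_derived[OF group_GL Suc] by auto
 qed
 moreover have "N CARD('n)<={mat 1}"
 proof
  fix h assume h: "h:N CARD('n)"
  have "T h - mat 1 = 0" using h r by (auto simp: N_def lev_def vec_eq_iff trans_less_add2)
  hence "Q**T h**minv Q = mat 1" using Q by (simp add: minv)
  thus "h:{mat 1}" using Q by (simp add: T_def mm_assoc minv_cancel minv)
 qed
 ultimately have "(derived GL ^^ CARD('n)) H<={mat 1}" by blast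
 moreover have "mat 1:(derived GL ^^ CARD('n)) H" using subgroupD(2)[OF group.exp_of_derived_is_subgroup[OF group_GL H]] .
 ultimately have d: "(derived GL ^^ CARD('n)) H = {\<one>\<^bsub>GL\<^esub>}" by (auto simp: GL_def)
 interpret GL: group GL by (rule group_GL)
 interpret H: group "grp H" by (rule GL.subgroup_imp_group[OF H])
 show ?thesis using derived_grp[OF H, of "CARD('n)"] d H.solvable_iff_trivial_derived_seq by (auto simp: GL_def)
qed

subsection \<open>Weights of a diagonalizable group\<close>

definition csub :: "(complex^'n^'n) set => bool" where
 "csub S \<longleftrightarrow> 0:S & (ALL X:S. ALL Y:S. X + Y:S) & (ALL c. ALL X:S. msc c X:S)"

lemma csubD: "csub S ==> 0:S" "csub S ==> X:S ==> Y:S ==> X + Y:S"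
 "csub S ==> X:S ==> msc c X:S" "csub S ==> X:S ==> - X:S"
 "csub S ==> X:S ==> Y:S ==> X - Y:S"
proof -
 show n: "csub S ==> X:S ==> - X:S" for X unfolding csub_def using msc_simps(5)[of X] by metis
 show "csub S ==> X:S ==> Y:S ==> X - Y:S" using n[of Y] unfolding csub_def by (metis add_uminus_conv_diff)
qed (auto simp: csub_def)

lemma csub_sum: "csub S ==> (!!i. i:F ==> f i:S) ==> (SUM i:F. f i):S" by (induction F rule: infinite_finite_induct) (auto intro: csubD)

lemma csub_lie: "csub (lie_algebra H)" by (auto simp: csub_def intro: lie_sub)

lemma csub_subspace: "csub S ==> subspace S"
proof -
 assume "csub S"
 moreover have "c *\<^sub>R X = msc (of_real c) X" for c and X :: "complex^'n^'n" by (rule mat_eqI) (simp only: vector_scaleR_component msc_nth, simp only: scaleR_conv_of_real)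
 ultimately show ?thesis unfolding subspace_def csub_def by metis
qed

text \<open>A finite-dimensional subspace is closed, so limits of difference quotients stay inside.
  This is how stability under a group passes to stability under brackets.\<close>

lemma csub_deriv: assumes S: "csub S" and f: "cder f f' 0" "!!s. f s:S" shows "f':S"
proof -
 define q where "q = (%n::nat. msc (of_nat (Suc n)) (f (1 / of_nat (Suc n)) - f 0))"
 have "q \<longlonglongrightarrow> f'"
 proof (rule vec_tendstoI, rule vec_tendstoI)
  fix i j
  have lim: "((%h. (f h$i$j - f 0$i$j) / h) \<longlongrightarrow> f'$i$j) (at 0)" using f(1) unfolding cder_def DERIV_def by simp
  have "filterlim (%n. 1 / of_nat (Suc n) :: complex) (at 0) sequentially" unfolding filterlim_at using LIMSEQ_Suc[OF lim_inverse_n[where 'a = complex]]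
   by (auto simp: divide_inverse simp del: of_nat_Suc)
  from filterlim_compose[OF lim this]
  show "(%n. q n$i$j) \<longlonglongrightarrow> f'$i$j" by (simp add: q_def algebra_simps del: of_nat_Suc)
 qed
 moreover have "q n:S" for n unfolding q_def using S f(2) by (intro csubD)
 ultimately show ?thesis using closed_subspace[OF csub_subspace[OF S]] closed_sequentially by blast
qed

definition br :: "complex^'n^'n => complex^'n^'n => complex^'n^'n" where
 "br X Y = X**Y - Y**X"

lemma br_lin: "br (X + Y) Z = br X Z + br Y Z" "br Z (X + Y) = br Z X + br Z Y"
 "br (msc c X) Z = msc c (br X Z)" "br Z (msc c X) = msc c (br Z X)" "br X 0 = 0" "br 0 X = 0"
 "br (- X) Z = - br X Z" "br Z (- X) = - br Z X" "br (X - Y) Z = br X Z - br Y Z" "br Z (X - Y) = br Z X - br Z Y" by (auto simp: br_def mm_add msc_add)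

lemma br_sum: "br (SUM i:F. f i) Z = (SUM i:F. br (f i) Z)" by (induction F rule: infinite_finite_induct) (auto simp: br_lin)

lemma br_anti: "br X Y = - br Y X" by (simp add: br_def)
lemma br_self: "br X X = 0" by (simp add: br_def)
lemma br_jacobi: "br X (br Y Z) = br (br X Y) Z + br Y (br X Z)" by (simp add: br_def mm_add mm_assoc)

text \<open>The trace form of the given matrix representation, in the role of the Killing form. On a
  diagonalizable torus it is a sum of products of diagonal entries, which makes its definiteness on
  real elements visible.\<close>

definition kap :: "complex^'n^'n => complex^'n^'n => complex" where "kap X Y = trace (X**Y)"

lemma tr_msc: "trace (msc c X) = c * trace X" by (simp add: trace_def sum_distrib_left)

lemma kap_lin: "kap (X + Y) Z = kap X Z + kap Y Z" "kap (msc c X) Z = c * kap X Z"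
 "kap Z (X + Y) = kap Z X + kap Z Y" "kap Z (msc c X) = c * kap Z X" "kap X 0 = 0" "kap 0 X = 0"
 "kap (X - Y) Z = kap X Z - kap Y Z" "kap (- X) Z = - kap X Z" "kap Z (- X) = - kap Z X" by (auto simp: kap_def mm_add trace_add trace_sub tr_msc) (auto simp: trace_def sum_negf)

lemma kap_sym: "kap X Y = kap Y X" unfolding kap_def by (rule trace_mul_sym)

lemma kap_br: "kap (br X Y) Z = kap X (br Y Z)"
proof -
 have "trace (Y**X**Z) = trace (X**(Z**Y))" using trace_mul_sym[of Y "X**Z"] by (simp add: mm_assoc)
 thus ?thesis by (simp add: kap_def br_def mm_add trace_sub mm_assoc)
qed

lemma kap_Ad: "invertible g ==> kap (g**X**minv g) (g**Y**minv g) = kap X Y"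
 for g :: "complex^'n^'n"
proof -
 assume g: "invertible g"
 have "trace (g**(X**Y**minv g)) = trace (X**Y**minv g**g)" by (rule trace_mul_sym)
 thus ?thesis using g by (simp add: kap_def mm_assoc minv minv_cancel)
qed

lemma kap_sum: "kap X (SUM i:F. f i) = (SUM i:F. kap X (f i))" by (induction F rule: infinite_finite_induct) (auto simp: kap_lin)

lemma nilpotent_vec: assumes "mpow X m = 0" "!!u. u:K ==> X *v u:K" "w:K" "w ~: U" "0:U" shows "EX w:K. w ~: U & X *v w:U"
proof -
 have inK: "mpow X k *v w:K" for k using assms(2,3) by (induction k) (auto simp: mpow_Suc simp flip: matrix_vector_mul_assoc)
 have "mpow X m *v w:U" using assms by simp
 then obtain k where k: "mpow X k *v w:U" "!!j. mpow X j *v w:U ==> k<=j" using ex_has_least_nat[of "%j. mpow X j *v w:U" m "%j. j"] by blast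
 have "k~=0" using k(1) assms(4) by (cases k) auto
 then obtain j where j: "k = Suc j" by (cases k) auto
 have "mpow X j *v w ~: U" using k(2)[of j] j by auto
 thus ?thesis using inK[of j] k(1) j by (auto simp: mpow_Suc simp flip: matrix_vector_mul_assoc)
qed

lemma mexp_trivial: assumes "!!s. mexp X s = mat 1" shows "X = 0"
proof (rule mat_eqI)
 fix i j
 have "((%s. mexp X s$i$j) has_field_derivative X$i$j) (at 0)" using mexp_cder[of X 0] by (simp add: cder_def)
 thus "X$i$j = 0$i$j" using assms DERIV_unique[OF _ DERIV_const] by simp
qed

lemma generate_triangular:
 fixes Q :: "complex^'n^'n" assumes "!!h. h:S ==> invertible h & minv Q**h**Q:lev r 0 & minv h:S"
  "invertible Q" "g:generate GL S" shows "minv Q**g**Q:lev r 0" using assms(3)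
proof (induction rule: generate_GL_induct)
 case one thus ?case using assms(2) by (simp add: minv lev_1)
next
 case (incl h) thus ?case using assms(1) by blast
next
 case (inv h) thus ?case using assms(1) inv_GL by metis
next
 case (mult h k)
 have "(minv Q**h**Q)**(minv Q**k**Q):lev r (0 + 0)" by (rule lev_mult) (use mult in auto)
 thus ?case using assms(2) by (simp add: mm_assoc minv_cancel)
qed

text \<open>Triangularity in a fixed basis is a Zariski closed condition, so it passes from the
  generators to the closure of the group they generate, where it gives solvability.\<close>

lemma solvable_hull:
 fixes \<C> :: "(complex^'n^'n) set set" assumes C: "!!C. C:\<C> ==> zconn C" "!!C. C:\<C> ==> mat 1:C"
  "!!C A. C:\<C> ==> A:C ==> invertible A" "!!C A. C:\<C> ==> A:C ==> minv A:C" and Q: "invertible (Q :: complex^'n^'n)" "bij_betw r UNIV {..<CARD('n)}"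
  and tri: "!!C A. C:\<C> ==> A:C ==> minv Q**A**Q:lev r 0" and G: "closed_subgroup G" "\<Union>\<C><=G"
 defines "K \<equiv> zcl (generate GL (\<Union>\<C>))" shows "closed_subgroup K" "zariski_connected K" "solvable (grp K)" "K<=G" "\<Union>\<C><=K"
proof -
 let ?S = "generate GL (\<Union>\<C>)"
 have sS: "subgroup ?S GL" using C(3) by (intro group.generate_is_subgroup[OF group_GL]) (auto simp: GL_def)
 have inv: "A:?S ==> invertible A" for A using subgroupD(1)[OF sS] .
 show cs: "closed_subgroup K" unfolding closed_subgroup_def K_def using zcl_subgroup[OF sS] zcl_closed by blast
 have "zconn ?S" by (rule zconn_generate[OF C(1-3)]) (use C(4) in blast)+
 hence "zconn K" unfolding K_def using inv by (rule zcl_zconn)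
 thus "zariski_connected K" using zconn_closed zcl_closed K_def by blast
 have sub: "?S<=G" by (rule group.generate_subgroup_incl[OF group_GL G(2)]) (use G(1) in \<open>simp add: closed_subgroup_def\<close>)
 thus "K<=G" unfolding K_def using G by (intro zcl_least) (auto simp: closed_subgroup_def)
 have "\<Union>\<C><=?S" by (auto intro: generate.incl)
 thus "\<Union>\<C><=K" unfolding K_def using zcl_sub inv by blast
 let ?Z = "{A. invertible A & (ALL p:{%A. (minv Q**A**Q)$k$l |k l. r l < r k}. p A = 0)}"
 have "zclosed ?Z" by (rule zclosedI[OF _ refl]) (auto intro!: reg_mm reg_const reg_coord)
 moreover have "?S<=?Z"
 proof
  fix A assume A: "A:?S"
  have "minv Q**A**Q:lev r 0" by (rule generate_triangular[OF _ Q(1) A]) (use C(3,4) tri in blast)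
  thus "A:?Z" using inv[OF A] by (auto simp: lev_def)
 qed
 ultimately have "K<=?Z" unfolding K_def by (rule zcl_least)
 hence "minv Q**A**Q:lev r 0" if "A:K" for A using that by (fastforce simp: lev_def)
 thus "solvable (grp K)" using cs Q by (intro triangular_solvable[of K Q r]) (auto simp: closed_subgroup_def)
qed

lemma csub_vec: "vec.subspace {w. ALL X:S. X *v w:U}" if "vec.subspace U" for U :: "(complex^'n) set" using that by (auto simp: vec.subspace_def vec.add vec.scale)

locale diag_group =
 fixes T :: "(complex^'n^'n) set" and g0 :: "complex^'n^'n" assumes closed_T: "closed_subgroup T" and conn_T: "zconn T" and inv_g0: "invertible g0"
  and diag: "t:T ==> i~=j ==> (g0**t**minv g0)$i$j = 0"
begin

lemmas sgT = subgroupD[OF closed_T[unfolded closed_subgroup_def, THEN conjunct1]]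

text \<open>The matrix in coordinates that make \<open>T\<close> diagonal.\<close>

definition "hat X = g0**X**minv g0"
definition "dg t k = hat t$k$k"
definition "Ad t X = t**X**minv (t :: complex^'n^'n)"

lemma hat_mult: "hat (X**Y) = hat X**hat Y" by (simp add: hat_def mm_assoc minv_cancel inv_g0)
lemma hat_1: "hat (mat 1) = mat 1" by (simp add: hat_def minv inv_g0)
lemma hat_lin: "hat (X + Y) = hat X + hat Y" "hat (msc c X) = msc c (hat X)" "hat 0 = 0" "hat (X - Y) = hat X - hat Y" by (simp_all add: hat_def mm_add)
lemma hat_inj: "hat X = hat Y ==> X = Y"
proof -
 assume "hat X = hat Y"
 hence "minv g0**hat X**g0 = minv g0**hat Y**g0" by simp
 thus ?thesis by (simp add: hat_def mm_assoc minv_cancel minv inv_g0)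
qed

lemma hat_t: "t:T ==> (hat t**X)$k$l = dg t k * X$k$l" "t:T ==> (X**hat t)$k$l = X$k$l * dg t l"
proof -
 assume t: "t:T"
 have "(SUM j:UNIV - {k}. hat t$k$j * X$j$l) = 0" "(SUM j:UNIV - {l}. X$k$j * hat t$j$l) = 0" using diag[OF t] by (auto intro!: sum.neutral simp: hat_def)
 thus "(hat t**X)$k$l = dg t k * X$k$l" "(X**hat t)$k$l = X$k$l * dg t l" unfolding mm_nth dg_def by (subst sum.remove[of UNIV k], auto)(subst sum.remove[of UNIV l], auto)
qed

lemma dg_nz: "t:T ==> dg t k~=0"
proof
 assume t: "t:T" "dg t k = 0"
 have "hat t**hat (minv t) = mat 1" using sgT(1)[OF t(1)] by (simp flip: hat_mult add: minv hat_1)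
 thus False using hat_t(1)[OF t(1), of "hat (minv t)" k k] t(2) by (simp add: mat_def)
qed

lemma Ad_lin: "Ad t (X + Y) = Ad t X + Ad t Y" "Ad t (msc c X) = msc c (Ad t X)" "Ad t 0 = 0" "Ad t (X - Y) = Ad t X - Ad t Y" by (simp_all add: Ad_def mm_add)

lemma Ad_sum: "Ad t (SUM i:F. f i) = (SUM i:F. Ad t (f i))" by (induction F rule: infinite_finite_induct) (auto simp: Ad_lin)

lemma Ad_mult: "invertible t ==> Ad t (X**Y) = Ad t X**Ad t Y" by (simp add: Ad_def mm_assoc minv_cancel)

lemma Ad_br: "invertible t ==> Ad t (br X Y) = br (Ad t X) (Ad t Y)" by (simp add: br_def Ad_lin Ad_mult)

lemma hat_Ad: "t:T ==> hat (Ad t X)$k$l * dg t l = dg t k * hat X$k$l"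
proof -
 assume t: "t:T"
 have "hat (Ad t X)**hat t = hat t**hat X" using sgT(1)[OF t] by (simp add: Ad_def mm_assoc minv flip: hat_mult)
 thus ?thesis using hat_t[OF t] by metis
qed

definition wtv :: "(complex^'n^'n => complex) => complex^'n^'n => bool" where
 "wtv bt X \<longleftrightarrow> (ALL t:T. Ad t X = msc (bt t) X)"

lemma wtv_entry: "wtv bt X ==> hat X$k$l~=0 ==> t:T ==> dg t k = bt t * dg t l" using hat_Ad[of t X k l] by (auto simp: wtv_def hat_lin)

lemma wtv_br: "wtv bt X ==> wtv gm Y ==> wtv (%t. bt t * gm t) (br X Y)" using sgT(1) by (auto simp: wtv_def Ad_br br_lin mult.commute)

lemma kap_wtv: assumes "wtv bt X" "wtv gm Y" "t:T" "bt t * gm t~=1" shows "kap X Y = 0"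
proof -
 have "kap (Ad t X) (Ad t Y) = kap X Y" using kap_Ad sgT(1)[OF assms(3)] by (simp add: Ad_def)
 hence "(bt t * gm t) * kap X Y = kap X Y" using assms by (simp add: wtv_def kap_lin mult_ac)
 thus ?thesis using assms(4) by (metis mult_cancel_right2)
qed

definition "ch k l = (\<lambda>t\<in>T. dg t k / dg t l)"
text \<open>The component of weight \<open>bt\<close>: in diagonalizing coordinates, the matrix
  units of weight \<open>bt\<close> are kept.\<close>

definition "cpt bt X = minv g0**(\<chi> k l. if ch k l = bt then hat X$k$l else 0)**g0"

lemma hat_cpt: "hat (cpt bt X)$k$l = (if ch k l = bt then hat X$k$l else 0)"
proof -
 have "hat (cpt bt X) = (\<chi> k l. if ch k l = bt then hat X$k$l else 0)" by (simp add: hat_def cpt_def mm_assoc minv_cancel minv inv_g0)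
 thus ?thesis by simp
qed

definition "chs = (%(k, l). ch k l) ` UNIV"

lemma fin_chs: "finite chs" by (simp add: chs_def)
lemma ch_chs: "ch k l:chs" unfolding chs_def by (rule image_eqI[of _ _ "(k, l)"]) auto
lemma chs_ext: "bt:chs ==> gm:chs ==> bt~=gm ==> EX t:T. bt t~=gm t" by (auto simp: chs_def ch_def)

lemma hat_sum: "hat (SUM i:F. f i) = (SUM i:F. hat (f i))" by (induction F rule: infinite_finite_induct) (auto simp: hat_lin)

lemma cpt_sum: "(SUM bt:chs. cpt bt X) = X"
proof (rule hat_inj, rule mat_eqI)
 fix k l
 have "hat (SUM bt:chs. cpt bt X)$k$l = (SUM bt:chs. if ch k l = bt then hat X$k$l else 0)" by (simp add: hat_sum hat_cpt)
 also have "... = hat X$k$l" using fin_chs ch_chs by simp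
 finally show "hat (SUM bt:chs. cpt bt X)$k$l = hat X$k$l" .
qed

lemma cpt_wtv: "wtv bt (cpt bt X)" unfolding wtv_def
proof (rule ballI, rule hat_inj, rule mat_eqI)
 fix t k l assume t: "t:T"
 have "hat (Ad t (cpt bt X))$k$l * dg t l = (bt t * hat (cpt bt X)$k$l) * dg t l"
 proof (cases "ch k l = bt")
  case True
  have "ch k l t = dg t k / dg t l" using t by (simp add: ch_def)
  hence e: "bt t * dg t l = dg t k" unfolding True using dg_nz[OF t, of l] by simp
  show ?thesis unfolding hat_Ad[OF t] e[symmetric] by (simp only: mult_ac)
 next
  case False
  thus ?thesis using hat_Ad[OF t, of "cpt bt X" k l] by (simp add: hat_cpt)
 qed
 thus "hat (Ad t (cpt bt X))$k$l = hat (msc (bt t) (cpt bt X))$k$l" using dg_nz[OF t, of l] by (simp add: hat_lin)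
qed

text \<open>Subtracting \<open>gm t\<close> times the sum from its image under \<open>Ad t\<close>
  removes the component of weight \<open>gm\<close> and rescales the one of weight \<open>bt\<close>
  by a nonzero factor. Induction on the number of weights.\<close>

lemma separate: assumes "finite F" "bt:F" "!!gm. gm:F ==> wtv gm (f gm)" "(SUM gm:F. f gm):S"
  "!!gm. gm:F ==> gm~=bt ==> EX t:T. bt t~=gm t" "csub S" "!!t X. t:T ==> X:S ==> Ad t X:S" shows "f bt:S" using assms(1-5)
proof (induction "card F" arbitrary: F f rule: less_induct)
 case less
 show ?case
 proof (cases "F = {bt}")
  case True thus ?thesis using less by simp
 next
  case False
  then obtain gm where g: "gm:F" "gm~=bt" using less.prems by blast
  then obtain t where t: "t:T" "bt t~=gm t" using less.prems by blast
  let ?f = "%dl. msc (dl t - gm t) (f dl)"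
  have "Ad t (SUM dl:F. f dl) - msc (gm t) (SUM dl:F. f dl):S" using assms(6,7) t less.prems by (intro csubD) auto
  also have "Ad t (SUM dl:F. f dl) - msc (gm t) (SUM dl:F. f dl) = (SUM dl:F. ?f dl)"
  proof -
   have "Ad t (f dl) = msc (dl t) (f dl)" if "dl:F" for dl using less.prems(3)[OF that] t by (simp add: wtv_def)
   hence "Ad t (SUM dl:F. f dl) = (SUM dl:F. msc (dl t) (f dl))" by (simp add: Ad_sum)
   moreover have "msc c (SUM dl:F. f dl) = (SUM dl:F. msc c (f dl))" for c using less.prems(1) by (induction F rule: finite_induct) (auto simp: msc_add)
   moreover have "msc (c - d) X = msc c X - msc d X" for c d and X :: "complex^'n^'n" using msc_add(2)[of c "- d" X] by simp
   ultimately show ?thesis by (simp add: sum_subtractf)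
  qed
  also have "... = (SUM dl:F - {gm}. ?f dl)" using less.prems(1) g by (simp add: sum.remove[of F gm])
  finally have sum: "(SUM dl:F - {gm}. ?f dl):S" .
  have "?f bt:S"
  proof (rule less.hyps[of "F - {gm}" ?f])
   show "card (F - {gm}) < card F" using g less.prems by (intro psubset_card_mono) auto
   show "wtv dl (?f dl)" if "dl:F - {gm}" for dl using less.prems(3)[of dl] that by (simp add: wtv_def Ad_lin mult.commute)
  qed (use less.prems g sum in auto)
  hence "msc (inverse (bt t - gm t)) (?f bt):S" by (rule csubD(3)[OF assms(6)])
  thus ?thesis using t by simp
 qed
qed

lemma cpt_in: assumes "csub S" "!!t X. t:T ==> X:S ==> Ad t X:S" "X:S" "bt:chs" shows "cpt bt X:S" by (rule separate[of chs bt "%bt. cpt bt X" S])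
  (use assms fin_chs cpt_wtv cpt_sum chs_ext in auto)

lemma csub_split: assumes "csub S" "!!bt. bt:chs ==> cpt bt X:S" shows "X:S" using csub_sum[OF assms(1), of chs "%bt. cpt bt X"] assms(2) cpt_sum by simp

text \<open>The powers of \<open>X\<close> have weights \<open>bt ^ m\<close>. If none vanished,
  finiteness of the matrix positions would make two of these weights agree, so \<open>bt\<close>
  would take values in roots of unity of a fixed order. Connectedness of \<open>T\<close> would then
  make it trivial.\<close>

lemma wtv_nilpotent: assumes X: "wtv bt X" and t: "t0:T" "bt t0~=1" shows "EX m. mpow X m = 0"
proof (rule ccontr)
 assume "~ ?thesis"
 hence nz: "mpow X m~=0" for m by blast
 have wm: "wtv (%t. bt t ^ m) (mpow X m)" for m
 proof (induction m)
  case 0 thus ?case using sgT(1) by (auto simp: wtv_def Ad_def minv)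
 next
  case (Suc m) thus ?case using X sgT(1) by (auto simp: wtv_def mpow_Suc Ad_mult mult.commute)
 qed
 have "EX k l. hat (mpow X m)$k$l~=0" for m using nz[of m] hat_inj[of "mpow X m" 0] by (auto simp: hat_lin vec_eq_iff)
 then obtain k l where kl: "!!m. hat (mpow X m)$k m$l m~=0" by metis
 have e: "dg t (k m) = bt t ^ m * dg t (l m)" if "t:T" for t m using wtv_entry[OF wm kl that] .
 have "~ inj (%m. (k m, l m))" using finite_imageD[of "%m. (k m, l m)" UNIV] by (meson finite infinite_UNIV_nat)
 then obtain m m' where m: "m < m'" "k m = k m'" "l m = l m'" by (auto simp: inj_def) (metis nat_neq_iff)
 define d where "d = m' - m"
 have b0: "bt t~=0" if "t:T" for t using e[OF that, of 1] dg_nz[OF that] by auto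
 have root: "bt t ^ d = 1" if "t:T" for t
 proof -
  have "bt t ^ m * dg t (l m) = bt t ^ m' * dg t (l m)" using e[OF that, of m] e[OF that, of m'] m by metis
  hence eq: "bt t ^ m = bt t ^ m'" using dg_nz[OF that, of "l m"] by simp
  have "m' = m + d" using m by (simp add: d_def)
  hence "bt t ^ m * bt t ^ d = bt t ^ m * 1" using eq by (simp add: power_add)
  thus ?thesis using b0[OF that] by (metis mult_cancel_left power_not_zero)
 qed
 have d: "d > 0" using m by (simp add: d_def)
 define F where "F = (%c. {A. invertible A & hat A$k 1$k 1 - c * hat A$l 1$l 1 = 0})"
 have "T<=F 1"
 proof (rule zconn_const[OF conn_T, where F = F and c = 1 and C = "{z. z ^ d = 1}" and a = "mat 1"])
  show "finite {z :: complex. z ^ d = 1}" by (rule finite_roots_unity) (use d in simp)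
  show "zclosed (F c)" for c
  proof -
   have "reg (%A. hat A$k 1$k 1 + (- c) * hat A$l 1$l 1)" unfolding hat_def by (intro reg_add reg_mult reg_mm reg_const reg_coord)
   thus ?thesis unfolding F_def by (intro zclosed_reg) simp
  qed
  show "T<=(UN c:{z. z ^ d = 1}. F c)"
  proof
   fix t assume t: "t:T"
   thus "t:(UN c:{z. z ^ d = 1}. F c)" using root[OF t] e[OF t, of 1] sgT(1)[OF t] by (auto simp: F_def dg_def)
  qed
  show "T Int F c Int F c' = {}" if "c~=c'" for c c'
  proof (rule ccontr)
   assume "T Int F c Int F c'~={}"
   then obtain t where "t:T" "t:F c" "t:F c'" by auto
   thus False using that dg_nz[of t "l 1"] by (simp add: F_def dg_def)
  qed
  show "mat 1:T" by (rule sgT(2))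
  have "(mat 1 :: complex^'n^'n)$j$j = 1" for j by (simp add: mat_def)
  thus "mat 1:F 1" by (simp add: F_def hat_1 invertible_1)
 qed auto
 hence "t0:F 1" using t by auto
 thus False using e[OF t(1), of 1] t dg_nz[OF t(1), of "l 1"] by (simp add: F_def dg_def)
qed

text \<open>Engel's theorem in Jacobson's form, for Lie algebras without zero weight: extend a maximal
 strictly triangular subalgebra by a weight vector that normalizes it.\<close>

definition "strict S \<longleftrightarrow> (ALL U. vec.subspace U & U~=UNIV & (ALL X:S. ALL u:U. X *v u:U) -->
 (EX w. w ~: U & (ALL X:S. X *v w:U)))"

definition "talg S \<longleftrightarrow> csub S & (ALL X:S. ALL Y:S. br X Y:S) & (ALL t:T. ALL X:S. Ad t X:S)"

lemma strict_flag:
 fixes S :: "(complex^'n^'n) set" assumes "strict S"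
 obtains Q :: "complex^'n^'n" and r where "invertible Q" "bij_betw r UNIV {..<CARD('n)}"
  "!!X. X:S ==> minv Q**X**Q:lev r 1"
proof (rule flag_exists[of "{}" S])
 show "EX w. w ~: U & (ALL h:{}. EX c. h *v w - c *s w:U) & (ALL s:S. s *v w:U)"
  if "vec.subspace U" "U~=UNIV" "!!h u. h:{} Un S ==> u:U ==> h *v u:U" for U using assms that unfolding strict_def by simp
qed (use that in blast)

text \<open>The vectors that \<open>S\<close> sends into \<open>U\<close> form a space stable under
  \<open>X\<close>, since brackets of \<open>S\<close> with \<open>X\<close> stay in
  \<open>S\<close>. Nilpotency of \<open>X\<close> provides one of them, outside \<open>U\<close>,
  that \<open>X\<close> also sends into \<open>U\<close>.\<close>

lemma strict_extend:
 fixes S :: "(complex^'n^'n) set" assumes S: "strict S" "csub S" and X: "!!Y. Y:S ==> br Y X:S" "mpow X m = 0" shows "strict {Y + msc c X |Y c. Y:S}" unfolding strict_def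
proof (intro allI impI)
 fix U :: "(complex^'n) set"
 assume U: "vec.subspace U & U~=UNIV & (ALL Z:{Y + msc c X |Y c. Y:S}. ALL u:U. Z *v u:U)"
 have S1: "Y:{Y + msc c X |Y c. Y:S}" if "Y:S" for Y by (rule CollectI, rule exI[of _ Y], rule exI[of _ 0]) (simp add: that)
 have S2: "X:{Y + msc c X |Y c. Y:S}" by (rule CollectI, rule exI[of _ 0], rule exI[of _ 1]) (simp add: csubD(1)[OF S(2)])
 have U3: "ALL Z:{Y + msc c X |Y c. Y:S}. ALL u:U. Z *v u:U" by (rule conjunct2[OF conjunct2[OF U]])
 have US: "Y *v u:U" if "Y:S" "u:U" for Y u by (rule bspec[OF bspec[OF U3 S1[OF that(1)]] that(2)])
 have UX: "X *v u:U" if "u:U" for u by (rule bspec[OF bspec[OF U3 S2] that])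
 define K where "K = {w. ALL Y:S. Y *v w:U}"
 have "vec.subspace U & U~=UNIV & (ALL Y:S. ALL u:U. Y *v u:U)" using conjunct1[OF U] conjunct1[OF conjunct2[OF U]] US by simp
 with S(1) obtain w0 where "w0 ~: U & (ALL Y:S. Y *v w0:U)" unfolding strict_def by (elim allE[of _ U] impE exE)
 hence w0: "w0 ~: U" "w0:K" by (simp_all add: K_def)
 have "X *v w:K" if "w:K" for w
 proof -
  have "Y *v (X *v w):U" if Y: "Y:S" for Y
  proof -
   have "br Y X *v w = Y *v (X *v w) - X *v (Y *v w)" unfolding br_def matrix_vector_mult_diff_rdistrib matrix_vector_mul_assoc by (rule refl)
   hence e: "Y *v (X *v w) = X *v (Y *v w) + br Y X *v w" by (metis add_diff_cancel_left' add.commute diff_add_cancel)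
   have "X *v (Y *v w):U" using `w:K` Y by (intro UX) (simp add: K_def)
   moreover have "br Y X *v w:U" using `w:K` X(1)[OF Y] by (simp add: K_def)
   ultimately show ?thesis unfolding e by (rule vec.subspace_add[OF conjunct1[OF U]])
  qed
  thus ?thesis by (simp add: K_def)
 qed
 then obtain w where w: "w:K" "w ~: U" "X *v w:U" using nilpotent_vec[OF X(2), of K w0 U] w0 vec.subspace_0[OF conjunct1[OF U]] by auto
 have "(Y + msc c X) *v w:U" if "Y:S" for Y c
 proof -
  have "(Y + msc c X) *v w = Y *v w + c *s (X *v w)" by (simp add: vec_eq_iff matrix_vector_mult_def sum.distrib sum_distrib_left distrib_right mult.assoc)
  moreover have "c *s (X *v w):U" by (rule vec.subspace_scale[OF conjunct1[OF U] w(3)])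
  moreover have "Y *v w:U" using w(1) that by (simp add: K_def)
  ultimately show ?thesis by (metis vec.subspace_add[OF conjunct1[OF U]])
 qed
 hence "ALL Z:{Y + msc c X |Y c. Y:S}. Z *v w:U" by auto
 thus "EX w. w ~: U & (ALL Z:{Y + msc c X |Y c. Y:S}. Z *v w:U)" using w(2) by (intro exI[of _ w]) simp
qed

theorem engel: assumes S: "talg S" and nt: "!!X. X:S ==> wtv (%_. 1) X ==> X = 0" shows "strict S"
proof -
 define P where "P = (%R. talg R & strict R & R<=S)"
 have "talg {0}" by (auto simp: talg_def csub_def br_lin Ad_lin)
 moreover have "strict {0}" by (auto simp: strict_def vec.subspace_0)
 moreover have "0:S" using S csubD(1) by (auto simp: talg_def)
 ultimately have "P {0}" by (simp add: P_def)
 moreover have "dim R < Suc DIM(complex^'n^'n)" for R :: "(complex^'n^'n) set" using dim_subset_UNIV[of R] by simp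
 ultimately obtain R where R: "P R" "!!R'. P R' ==> dim R'<=dim R" using ex_has_greatest_nat[of P "{0}" dim] by blast
 have tR: "talg R" "strict R" "R<=S" "csub R" using R(1) by (auto simp: P_def talg_def)
 have "S<=R"
 proof (rule ccontr)
  assume "~ S<=R"
  then obtain X where X: "X:S" "X ~: R" by auto
  then obtain bt where b: "bt:chs" "cpt bt X ~: R" using csub_split[OF tR(4)] by blast
  have Sd: "csub S" "!!t X. t:T ==> X:S ==> Ad t X:S" "!!X Y. X:S ==> Y:S ==> br X Y:S" using S by (auto simp: talg_def)
  have Rd: "!!t X. t:T ==> X:R ==> Ad t X:R" "!!X Y. X:R ==> Y:R ==> br X Y:R" using tR(1) by (auto simp: talg_def)
  have cS: "cpt bt X:S" by (rule cpt_in[OF Sd(1,2) X(1) b(1)]) obtain Q :: "complex^'n^'n" and r where Q: "invertible Q" "bij_betw r UNIV {..<CARD('n)}"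
   "!!X. X:R ==> minv Q**X**Q:lev r 1" by (rule strict_flag[OF tR(2)]) (rule that)
  have rlt: "r k < CARD('n)" for k using Q(2) by (auto simp: bij_betw_def)
  let ?q = "%X. minv Q**X**Q" and ?n = "CARD('n)"
  \<comment> \<open>Levels above the diagonal range between minus and plus \<open>?n\<close>; the
    shift by \<open>?n\<close> keeps them natural numbers. A weight vector of highest level outside
    \<open>R\<close> has all its brackets with \<open>R\<close> inside \<open>R\<close>, since
    bracketing with \<open>R\<close> raises the level.\<close>
  define Lv where "Lv = (%m. {X :: complex^'n^'n. ALL k l. r l + ?n < r k + m --> X$k$l = 0})"
  define W where "W = (%(X, m). X:S & X ~: R & (EX bt. wtv bt X) & ?q X:Lv m)"
  have "~ r l + ?n < r k + 0" for k l using rlt[of k] by simp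
  hence "?q (cpt bt X):Lv 0" unfolding Lv_def by blast
  hence "W (cpt bt X, 0)" using cS b cpt_wtv by (auto simp: W_def)
  moreover have "m < 2 * ?n + 1" if "W (Z, m)" for Z m
  proof (rule ccontr)
   assume "~ ?thesis"
   hence "r l + ?n < r k + m" for k l using rlt[of l] by linarith
   moreover have "ALL k l. r l + ?n < r k + m --> ?q Z$k$l = 0" using that by (simp add: W_def Lv_def)
   ultimately have "?q Z = 0" by (intro mat_eqI) simp
   hence "Q**?q Z**minv Q = 0" by (simp add: mm_add)
   hence "Z = 0" using Q(1) by (simp add: mm_assoc minv minv_cancel)
   thus False using that csubD(1)[OF tR(4)] by (simp add: W_def)
  qed
  ultimately obtain p where p: "W p" "!!q. W q ==> snd q<=snd p" using ex_has_greatest_nat[of W "(cpt bt X, 0)" snd "2 * ?n + 1"] by force obtain Z m where Zm: "p = (Z, m)" by (cases p)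
  then obtain gm where Z: "Z:S" "Z ~: R" "wtv gm Z" "?q Z:Lv m" using p by (auto simp: W_def)
  have Lmul: "A**B:Lv (Suc m)" if "A:lev r 1 & B:Lv m | A:Lv m & B:lev r 1" for A B m
  proof -
   have "(SUM j:UNIV. A$k$j * B$j$l) = 0" if kl: "r l + ?n < r k + Suc m" for k l
   proof (rule sum.neutral, rule ballI)
    fix j show "A$k$j * B$j$l = 0" using `A:lev r 1 & B:Lv m | A:Lv m & B:lev r 1`
    proof
     assume "A:lev r 1 & B:Lv m"
     thus ?thesis using kl by (cases "r j < r k + 1") (auto simp: lev_def Lv_def)
    next
     assume "A:Lv m & B:lev r 1"
     thus ?thesis using kl by (cases "r l < r j + 1") (auto simp: lev_def Lv_def)
    qed
   qed
   thus ?thesis by (simp add: Lv_def mm_nth)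
  qed
  have wR: "br Y Z:R" if Y: "Y:R" "wtv dl Y" for Y dl
  proof (rule ccontr)
   assume nR: "br Y Z ~: R"
   have "?q (br Y Z) = ?q Y**?q Z - ?q Z**?q Y" using Q(1) by (simp add: br_def mm_add mm_assoc minv_cancel)
   moreover have "?q Y**?q Z:Lv (Suc m)" "?q Z**?q Y:Lv (Suc m)" using Lmul[of "?q Y" "?q Z"] Lmul[of "?q Z" "?q Y"] Q(3)[OF Y(1)] Z(4) by auto
   ultimately have "?q (br Y Z):Lv (Suc m)" by (auto simp: Lv_def)
   moreover have "br Y Z:S" using Sd(3) Y tR(3) Z by blast
   ultimately have "W (br Y Z, Suc m)" using nR wtv_br[OF Y(2) Z(3)] by (auto simp: W_def)
   thus False using p(2) Zm by fastforce
  qed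
  have ZR: "br Y Z:R" if Y: "Y:R" for Y
  proof -
   have "(SUM bt:chs. br (cpt bt Y) Z):R" using wR cpt_wtv cpt_in[OF tR(4) Rd(1) Y] by (intro csub_sum[OF tR(4)]) blast
   thus ?thesis by (simp only: cpt_sum flip: br_sum)
  qed
  have "EX t:T. gm t~=1"
  proof (rule ccontr)
   assume "~ ?thesis"
   hence "wtv (%_. 1) Z" using Z(3) by (simp add: wtv_def)
   thus False using nt[OF Z(1)] Z(2) csubD(1)[OF tR(4)] by simp
  qed
  then obtain k where k: "mpow Z k = 0" using wtv_nilpotent[OF Z(3)] by blast
  let ?R = "{Y + msc c Z |Y c. Y:R}"
  have RinR: "Y:?R" if "Y:R" for Y using that by (intro CollectI exI[of _ Y] exI[of _ 0]) simp
  have "strict ?R" by (rule strict_extend[OF tR(2,4) ZR k])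
  moreover have "?R<=S" using tR(3) Z(1) Sd(1) by (auto intro!: csubD)
  moreover have "talg ?R" unfolding talg_def
  proof (intro conjI ballI)
   show "csub ?R" unfolding csub_def
   proof (intro conjI ballI allI)
    show "0:?R" by (rule RinR[OF csubD(1)[OF tR(4)]])
    fix A c assume "A:?R"
    then obtain Y d where A: "A = Y + msc d Z" "Y:R" by auto
    hence "msc c A = msc c Y + msc (c * d) Z" by (simp add: msc_add)
    thus "msc c A:?R" using A csubD(3)[OF tR(4)] by blast
    fix B assume "B:?R"
    then obtain Y' d' where B: "B = Y' + msc d' Z" "Y':R" by auto
    hence "A + B = (Y + Y') + msc (d + d') Z" using A by (simp add: msc_add)
    thus "A + B:?R" using A B csubD(2)[OF tR(4)] by blast
   qed
   fix A B assume "A:?R" "B:?R"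
   then obtain Y d Y' d' where A: "A = Y + msc d Z" "Y:R" and B: "B = Y' + msc d' Z" "Y':R" by auto
   have "br A B = br Y Y' + msc d' (br Y Z) - msc d (br Y' Z)" using br_anti[of Z Y'] by (simp add: A B br_lin br_self msc_add)
   moreover have "br Y Y' + msc d' (br Y Z) - msc d (br Y' Z):R" using A B ZR Rd(2) tR(4) by (intro csubD) auto
   ultimately show "br A B:?R" using RinR by simp
  next
   fix t A assume t: "t:T" and "A:?R"
   then obtain Y d where A: "A = Y + msc d Z" "Y:R" by auto
   hence "Ad t A = Ad t Y + msc (d * gm t) Z" using Z(3) t by (simp add: Ad_lin wtv_def)
   thus "Ad t A:?R" using Rd(1)[OF t A(2)] by blast
  qed
  ultimately have "dim ?R<=dim R" using R(2) by (simp add: P_def)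
  moreover have "R<=?R" using RinR by blast
  moreover have "Z:?R" using csubD(1)[OF tR(4)] by (intro CollectI exI[of _ 0] exI[of _ 1]) simp
  moreover have "subspace R" "subspace ?R" using tR(4) `talg ?R` by (auto simp: talg_def intro: csub_subspace)
  ultimately show False using Z(2) subspace_dim_equal[of R ?R] by blast
 qed
 thus ?thesis using tR by auto
qed

end

subsection \<open>Complex conjugation, brackets and one-parameter groups\<close>

definition cnjm :: "complex^'n^'n => complex^'n^'n" where "cnjm A = (\<chi> i j. cnj (A$i$j))"

lemma cnjm_nth [simp]: "cnjm A$i$j = cnj (A$i$j)" by (simp add: cnjm_def)
lemma cnjm_mult: "cnjm (A**B) = cnjm A**cnjm B" by (rule mat_eqI) (simp add: mm_nth)
lemma cnjm_1: "cnjm (mat 1) = mat 1" by (rule mat_eqI) (simp add: mat_def)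
lemma cnjm_lin: "cnjm (A + B) = cnjm A + cnjm B" "cnjm (A - B) = cnjm A - cnjm B" "cnjm (msc c A) = msc (cnj c) (cnjm A)"
 "cnjm (cnjm A) = A" by (rule mat_eqI, simp)+
lemma cnjm_br: "cnjm (br A B) = br (cnjm A) (cnjm B)" by (simp add: br_def cnjm_lin cnjm_mult)
lemma cnjm_real: "cnjm A = A \<longleftrightarrow> (ALL i j. A$i$j:\<real>)" by (auto simp: vec_eq_iff Reals_cnj_iff)
lemma cnjm_kap: "kap (cnjm A) (cnjm B) = cnj (kap A B)" by (simp add: kap_def trace_def mm_nth)

lemma cnjm_inv: assumes A: "invertible A" shows "invertible (cnjm A)" "minv (cnjm A) = cnjm (minv A)"
proof -
 have e: "cnjm A**cnjm (minv A) = mat 1" using minv(1)[OF A] by (simp add: cnjm_1 flip: cnjm_mult)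
 have e2: "cnjm (minv A)**cnjm A = mat 1" using minv(2)[OF A] by (simp add: cnjm_1 flip: cnjm_mult)
 show "invertible (cnjm A)" unfolding invertible_def by (rule exI[of _ "cnjm (minv A)"]) (simp add: e e2)
 show "minv (cnjm A) = cnjm (minv A)" by (rule minv_unique[OF e])
qed

lemma pf_real: "p:polyfun \<real> ==> p (cnjm A) = cnj (p A)" by (induction rule: polyfun.induct) (auto simp: Reals_cnj_iff)

lemma real_closed_cnj: "zariski_closed \<real> H ==> A:H ==> cnjm A:H" unfolding zariski_closed_def using pf_real cnjm_inv(1) by fastforce

lemma cnjm_lie: assumes "closed_subgroup H" "zariski_closed \<real> H" "X:lie_algebra H" shows "cnjm X:lie_algebra H"
proof (rule lie_curve_r)
 show "rder (%a. cnjm (mexp X (of_real a))) (cnjm X) 0" using mexp_rder[of X 0] unfolding rder_def by (auto intro!: has_vector_derivative_cnj)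
 show "cnjm (mexp X (complex_of_real s)):H" for s by (rule real_closed_cnj[OF assms(2) lie_mexp[OF assms(1,3)]])
qed (simp add: cnjm_1)

lemma Ad_cder: "cder (%s. mexp X s**Y**mexp X (- s)) (br X Y) 0"
proof -
 have "cder (%s. mexp X (- s)) (- (X**mexp X (- 0))) 0" by (rule cder_uminus) (rule mexp_cder)
 from cder_mm[OF cder_mm[OF mexp_cder[of X 0] cder_const[of Y]] this] show ?thesis by (simp add: br_def mm_add)
qed

lemma Ad_rder: "rder (%s. mexp X (of_real s)**Y**mexp X (- of_real s)) (br X Y) 0"
proof -
 have "rder (%s. mexp X (of_real s)) X (- 0)" using mexp_rder[of X 0] by simp
 hence "rder (%s. mexp X (of_real (- s))) (- X) 0" by (rule rder_uminus)
 from rder_mm[OF rder_mm[OF mexp_rder[of X 0] rder_const[of Y]] this] show ?thesis by (simp add: br_def mm_add)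
qed

lemma rder_unique: "rder f A a ==> rder f B a ==> A = B" unfolding rder_def by (intro mat_eqI) (metis vector_derivative_unique_at)

lemma lie_br: assumes H: "closed_subgroup H" and X: "X:lie_algebra H" "Y:lie_algebra H" shows "br X Y:lie_algebra H"
proof (rule csub_deriv[OF csub_lie Ad_cder])
 note sg = subgroupD[OF conjunct1[OF H[unfolded closed_subgroup_def]]]
 show "mexp X s**Y**mexp X (- s):lie_algebra H" for s using lie_Ad[OF H X(2) mexp_invertible[of X s]] sg(3,4) lie_mexp[OF H X(1), of s] by (simp add: minv_mexp) (metis minv_mexp)
qed

lemma mexp_add: assumes "X**Y = Y**X" shows "mexp (X + Y) (of_real a) = mexp X (of_real a)**mexp Y (of_real a)"
proof (rule mexp_unique[symmetric])
 fix a
 let ?E = "mexp X (of_real a)" and ?F = "mexp Y (of_real a)"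
 have 1: "X**?E = ?E**X" by (simp only: mexp_comm)
 have 2: "X**?F = ?F**X" "Y**?F = ?F**Y" using assms mexp_comm_gen[of Y X] by (simp_all only: mexp_comm)
 have "(X**?E)**?F + ?E**(Y**?F) = (?E**?F)**(X + Y)" by (simp only: 1 2 mm_assoc mm_add)
 thus "rder (%a. mexp X (of_real a)**mexp Y (of_real a)) ((?E**?F)**(X + Y)) a" using rder_mm[OF mexp_rder[of X a] mexp_rder[of Y a]] by simp
qed simp

lemma mexp_msc: "mexp (msc c X) s = mexp X (c * s)"
proof -
 have "mpow (msc c X) k = msc (c ^ k) (mpow X k)" for k by (induction k) (simp_all add: mpow_Suc mult_ac)
 thus ?thesis by (simp add: mexp_def power_mult_distrib mult_ac)
qed

lemma heis_Ad: assumes "br X Y = Z" "br X Z = 0" shows "mexp X a**Y**mexp X (- a) = Y + msc a Z"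
proof -
 define f where "f = (%s. mexp X (- s)**(Y + msc s Z)**mexp X s)"
 have "cder f 0 s" for s
 proof -
  have 1: "cder (%s. mexp X (- s)) (- (X**mexp X (- s))) s" by (rule cder_uminus) (rule mexp_cder)
  have 2: "cder (%s. Y + msc s Z) Z s" unfolding cder_def by (auto intro!: derivative_eq_intros)
  let ?W = "Y + msc s Z"
  have "X**?W = Z + ?W**X" using assms by (simp add: br_def mm_add algebra_simps)
  hence "mexp X (- s)**(X**?W) = mexp X (- s)**(Z + ?W**X)" by simp
  hence "(X**mexp X (- s))**?W = mexp X (- s)**Z + (mexp X (- s)**?W)**X" by (simp only: mexp_comm[symmetric] mm_assoc mm_add(1)[of _ Z])
  hence "(- (X**mexp X (- s))**?W + mexp X (- s)**Z) = - ((mexp X (- s)**?W)**X)" by (simp only: mm_add(6)) simp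
  hence "(- (X**mexp X (- s))**?W + mexp X (- s)**Z)**mexp X s + (mexp X (- s)**?W)**(X**mexp X s) = 0" by (simp only: mm_add(6)) (simp only: mm_assoc, simp)
  thus ?thesis unfolding f_def using cder_mm[OF cder_mm[OF 1 2] mexp_cder[of X s]] by simp
 qed
 hence "f a = f 0" by (rule cder_zero)
 hence "mexp X (- a)**(Y + msc a Z)**mexp X a = Y" by (simp add: f_def)
 hence "mexp X a**Y**mexp X (- a) = mexp X a**(mexp X (- a)**(Y + msc a Z)**mexp X a)**mexp X (- a)" by simp
 also have "... = (mexp X a**mexp X (- a))**(Y + msc a Z)**(mexp X a**mexp X (- a))" by (simp only: mm_assoc)
 finally show ?thesis by (simp add: mexp_inv)
qed

lemma heis_group: assumes "br X Y = Z" "br X Z = 0" "br Y Z = 0" shows "mexp X (of_real a)**mexp Y (of_real b) = mexp Y (of_real b)**mexp Z (of_real (a * b))**mexp X (of_real a)"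
proof -
 have "mexp X (of_real a)**mexp Y (of_real b)**mexp X (- of_real a) = mexp (Y + msc (of_real a) Z) (of_real b)"
  using mexp_conj[OF mexp_invertible[of X "of_real a"], of Y "of_real b"] heis_Ad[OF assms(1,2), of "of_real a"] by (simp add: minv_mexp)
 also have "... = mexp Y (of_real b)**mexp Z (of_real (a * b))" using mexp_add[of Y "msc (of_real a) Z" b] assms(3) by (simp add: mexp_msc br_def)
 finally have e: "mexp X (of_real a)**mexp Y (of_real b)**mexp X (- of_real a) = mexp Y (of_real b)**mexp Z (of_real (a * b))" .
 have "mexp X (of_real a)**mexp Y (of_real b) =
   (mexp X (of_real a)**mexp Y (of_real b)**mexp X (- of_real a))**mexp X (of_real a)" using mexp_inv[of X "- of_real a"] by (simp add: mm_assoc)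
 thus ?thesis unfolding e .
qed

lemma mexp_commute: assumes "br X Y = 0" shows "mexp X s**mexp Y t = mexp Y t**mexp X s" using assms by (intro mexp_comm_gen mexp_comm_gen[symmetric]) (simp add: br_def)

text \<open>Additivity transports the derivative at 0 to every point and gives the differential
  equation of the exponential. Real entries make the generator real.\<close>

lemma one_param: assumes d: "!!a. EX D. rder z D a" and add: "!!a b. z (a + b) = z a**z b" and z0: "z 0 = mat 1" and re: "!!a i j. z a$i$j:\<real>"
 shows "EX X. cnjm X = X & (ALL a. z a = mexp X (of_real a))"
proof -
 obtain X where X: "rder z X 0" using d by blast
 have "rder z (z a**X) a" for a
 proof -
  have "rder (%s. z a**z s) (0**z 0 + z a**X) 0" by (rule rder_mm[OF rder_const X])
  hence r: "rder (%s. z (a + s)) (z a**X) 0" by (simp add: add mm_add)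
  have "((%s. z s$i$j) has_vector_derivative (z a**X)$i$j) (at a)" for i j
  proof -
   have "((%s. z (a + s)$i$j) has_vector_derivative (z a**X)$i$j) (at (a - a))" using r by (simp add: rder_def)
   moreover have "((%s. s - a) has_vector_derivative 1) (at a)" by (auto intro!: derivative_eq_intros)
   ultimately have "((%s. z (a + s)$i$j) \<circ> (%s. s - a) has_vector_derivative 1 *\<^sub>R (z a**X)$i$j) (at a)" by (intro vector_diff_chain_at) auto
   thus ?thesis by (simp add: o_def)
  qed
  thus ?thesis by (simp add: rder_def)
 qed
 hence z: "z a = mexp X (of_real a)" for a using mexp_unique z0 by blast
 have "rder (%a. cnjm (z a)) (cnjm X) 0" using X unfolding rder_def by (auto intro!: has_vector_derivative_cnj)
 moreover have "cnjm (z a) = z a" for a using re by (simp add: cnjm_real)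
 ultimately have "rder z (cnjm X) 0" by simp
 hence "cnjm X = X" by (rule rder_unique[OF _ X])
 thus ?thesis using z by blast
qed

lemma mexp_chain: assumes "(u has_real_derivative u') (at 0)" "u 0 = 0" shows "rder (%s. mexp X (of_real (u s))) (msc (of_real u') X) 0" unfolding rder_def
proof (intro allI)
 fix i j
 have "((%a. mexp X (of_real a)$i$j) has_vector_derivative X$i$j) (at (u 0))" using mexp_rder[of X 0] assms(2) by (simp add: rder_def)
 hence "((%a. mexp X (of_real a)$i$j) \<circ> u has_vector_derivative u' *\<^sub>R X$i$j) (at 0)"
  using assms(1) by (intro vector_diff_chain_at) (simp_all add: has_real_derivative_iff_has_vector_derivative)
 thus "((%s. mexp X (of_real (u s))$i$j) has_vector_derivative msc (of_real u') X$i$j) (at 0)" by (simp add: o_def scaleR_conv_of_real)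
qed

context diag_group
begin

text \<open>Differences of diagonal entries form a finite set; this finiteness is what breaks an
  infinite string of eigenvectors in \<open>sl2_lowest\<close>.\<close>

lemma ad_eigen: assumes "!!k l. k~=l ==> hat h$k$l = 0" "br h X = msc c X" "X~=0" shows "c:(%(k, l). hat h$k$k - hat h$l$l) ` UNIV"
proof -
 have "hat X~=hat 0" using assms(3) hat_inj by blast
 then obtain k l where kl: "hat X$k$l~=0" by (force simp: hat_lin vec_eq_iff)
 have e: "hat (br h X) = hat h**hat X - hat X**hat h" by (simp add: br_def hat_lin hat_mult)
 have "(hat h**hat X)$k$l = (SUM m:UNIV. if m = k then hat h$k$k * hat X$k$l else 0)" unfolding mm_nth by (intro sum.cong) (auto simp: assms(1))
 moreover have "(hat X**hat h)$k$l = (SUM m:UNIV. if m = l then hat X$k$l * hat h$l$l else 0)" unfolding mm_nth by (intro sum.cong) (auto simp: assms(1))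
 ultimately have "hat (br h X)$k$l = (hat h$k$k - hat h$l$l) * hat X$k$l" unfolding e by (simp add: algebra_simps)
 hence "c = hat h$k$k - hat h$l$l" using kl assms(2) by (simp add: hat_lin)
 thus ?thesis by (intro image_eqI[of _ _ "(k, l)"]) auto
qed

text \<open>The string through a lowest weight vector of positive weight would never end.\<close>

lemma sl2_lowest: assumes h: "!!k l. k~=l ==> hat h$k$l = 0" and ef: "br e f = h" "br h e = msc 2 e" and v: "br f v = 0" "br h v = msc (of_real c) v" "0 < c" shows "v = 0"
proof (rule ccontr)
 assume v0: "v~=0"
 define V where "V = (%k. (br e ^^ k) v)"
 have V: "V 0 = v" "V (Suc k) = br e (V k)" for k by (simp_all add: V_def)
 have H: "br h (V k) = msc (of_real (c + 2 * of_nat k)) (V k)" for k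
 proof (induction k)
  case (Suc k)
  have "br h (V (Suc k)) = br (br h e) (V k) + br e (br h (V k))" unfolding V by (rule br_jacobi)
  hence "br h (V (Suc k)) = msc (2 + of_real (c + 2 * of_nat k)) (V (Suc k))" unfolding Suc ef(2) br_lin V(2)[symmetric] msc_add(2) .
  moreover have "(2 + of_real (c + 2 * of_nat k) :: complex) = of_real (c + 2 * of_nat (Suc k))" by simp
  ultimately show ?case by (simp only:)
 qed (simp add: V v)
 have F: "br f (V (Suc k)) = msc (- of_real (of_nat (Suc k) * (c + of_nat k))) (V k)" for k
 proof (induction k)
  case 0
  have "br f (V (Suc 0)) = br (br f e) (V 0) + br e (br f (V 0))" unfolding V by (rule br_jacobi)
  thus ?case unfolding br_anti[of f e] ef(1) by (simp add: V v br_lin)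
 next
  case (Suc k)
  have "br f (V (Suc (Suc k))) = br (br f e) (V (Suc k)) + br e (br f (V (Suc k)))" unfolding V(2)[of "Suc k"] by (rule br_jacobi)
  also have "... = msc (- of_real (c + 2 * of_nat (Suc k))) (V (Suc k)) + msc (- of_real (of_nat (Suc k) * (c + of_nat k))) (V (Suc k))"
   unfolding br_anti[of f e] ef(1) Suc br_lin H V(2)[symmetric] by (simp only: msc_simps(6))
  finally have "br f (V (Suc (Suc k))) = msc (- of_real (c + 2 * of_nat (Suc k)) + - of_real (of_nat (Suc k) * (c + of_nat k))) (V (Suc k))" unfolding msc_add(2) .
  moreover have "(- of_real (c + 2 * of_nat (Suc k)) + - of_real (of_nat (Suc k) * (c + of_nat k)) :: complex) =
   - of_real (of_nat (Suc (Suc k)) * (c + of_nat (Suc k)))" by (simp add: algebra_simps)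
  ultimately show ?case by (simp only:)
 qed
 have nz: "V k~=0" for k
 proof (induction k)
  case (Suc k)
  show ?case
  proof
   assume "V (Suc k) = 0"
   hence e: "msc (- of_real (of_nat (Suc k) * (c + of_nat k))) (V k) = 0" using F[of k] by (simp only: br_lin)
   have "(of_nat (Suc k) * (c + of_nat k) :: real)~=0" using v(3) by (simp del: of_nat_Suc add: add_pos_nonneg less_imp_neq[symmetric])
   hence n: "(- of_real (of_nat (Suc k) * (c + of_nat k)) :: complex)~=0" by (metis neg_equal_0_iff_equal of_real_eq_0_iff)
   have "V k = 0"
   proof (rule mat_eqI)
    fix i j show "V k$i$j = 0$i$j" using arg_cong[OF e, of "%A. A$i$j"] n by simp
   qed
   thus False using Suc by simp
  qed
 qed (simp add: V v0)
 have "range (%k. of_real (c + 2 * of_nat k) :: complex)<=(%(k, l). hat h$k$k - hat h$l$l) ` UNIV" using ad_eigen[OF h H nz] by blast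
 hence "finite (range (%k::nat. of_real (c + 2 * of_nat k) :: complex))" by (rule finite_subset) simp
 moreover have "inj (%k::nat. of_real (c + 2 * of_nat k) :: complex)" by (rule injI, unfold of_real_eq_iff) simp
 ultimately show False using finite_imageD infinite_UNIV_nat by blast
qed

end

subsection \<open>Characters and cocharacters\<close>

definition laur :: "(complex => complex) => bool" where
 "laur f \<longleftrightarrow> (EX p::complex poly. EX k::nat. ALL c. c~=0 --> f c = poly p c / c ^ k)"

lemma laur_const: "laur (%_. d)" unfolding laur_def by (rule exI[of _ "[:d:]"], rule exI[of _ 0]) simp

lemma laur_mult: assumes "laur f" "laur g" shows "laur (%c. f c * g c)"
proof -
 obtain p k q l where "!!c. c~=0 ==> f c = poly p c / c ^ k" "!!c. c~=0 ==> g c = poly q c / c ^ l" using assms unfolding laur_def by metis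
 thus ?thesis unfolding laur_def by (intro exI[of _ "p * q"] exI[of _ "k + l"]) (simp add: power_add)
qed

lemma laur_add: assumes "laur f" "laur g" shows "laur (%c. f c + g c)"
proof -
 obtain p k q l where "!!c. c~=0 ==> f c = poly p c / c ^ k" "!!c. c~=0 ==> g c = poly q c / c ^ l" using assms unfolding laur_def by metis
 thus ?thesis unfolding laur_def by (intro exI[of _ "p * monom 1 l + q * monom 1 k"] exI[of _ "k + l"]) (simp add: power_add poly_monom field_simps)
qed

lemma laur_pf: "p:PF ==> (!!i j. laur (%c. l c$i$j)) ==> laur (%c. p (l c))" by (induction rule: polyfun.induct) (auto intro: laur_const laur_mult laur_add)

text \<open>After removing the power of the variable the polynomial has no complex root at all, so
  it is constant by the fundamental theorem of algebra.\<close>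

lemma laur_char: assumes f: "laur f" and nz: "!!c. c~=0 ==> f c~=0" and f1: "f 1 = 1" shows "EX m::int. ALL c. c~=0 --> f c = c powi m"
proof -
 obtain p k where p: "!!c. c~=0 ==> f c = poly p c / c ^ k" using f unfolding laur_def by metis
 have "p~=0" using p[of 1] f1 by auto
 then obtain q where q: "p = [:- 0, 1:] ^ Polynomial.order 0 p * q" "~ [:- 0, 1:] dvd q" using order_decomp by blast
 have pc: "poly p c = c ^ Polynomial.order 0 p * poly q c" for c by (subst q(1)) simp
 have "poly q c~=0" for c
 proof (cases "c = 0")
  case True thus ?thesis using q(2) by (simp add: poly_eq_0_iff_dvd)
 next
  case False thus ?thesis using nz[OF False] p[OF False] pc by auto
 qed
 hence "constant (poly q)" using fundamental_theorem_of_algebra by blast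
 hence "poly q c = poly q 1" for c unfolding constant_def by blast
 moreover have "poly q 1 = 1" using p[of 1] pc[of 1] f1 by simp
 ultimately have "f c = c ^ Polynomial.order 0 p / c ^ k" if "c~=0" for c using p[OF that] pc[of c] by simp
 hence "f c = c powi (int (Polynomial.order 0 p) - int k)" if "c~=0" for c using that by (simp add: power_int_diff)
 thus ?thesis by blast
qed

lemma powi_inj: assumes "(2::complex) powi m = 2 powi k" shows "m = k"
proof -
 have "norm ((2::complex) powi m) = norm ((2::complex) powi k)" using assms by simp
 hence "(2::real) powi m = 2 powi k" by (simp add: norm_power_int)
 thus ?thesis by (metis linorder_neq_iff order_less_irrefl power_int_strict_increasing one_less_numeral_iff semiring_norm(76))
qed

context diag_group
begin

abbreviation "XT \<equiv> character_group T"

lemma XT_I: assumes "!!t. t:T ==> \<psi> t~=0" "!!s t. s:T ==> t:T ==> \<psi> (s**t) = \<psi> s * \<psi> t" "reg f" "!!t. t:T ==> f t = \<psi> t"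
  "\<psi>:extensional T" shows "\<psi>:carrier XT"
proof -
 obtain q k where q: "q:PF" "!!A. invertible A ==> f A * det A ^ k = q A" using assms(3) unfolding reg_def by blast
 have "regular_on T \<psi>" unfolding regular_on_def
 proof (rule bexI[OF _ q(1)], rule exI[of _ k], intro ballI)
  fix A assume A: "A:T"
  have "det A~=0" using sgT(1)[OF A] by (simp add: invertible_det_nz)
  thus "\<psi> A = q A / det A ^ k" using q(2)[OF sgT(1)[OF A]] assms(4)[OF A] by (simp add: field_simps)
 qed
 thus ?thesis using assms(1,2,5) by (auto simp: character_group_def hom_def Gm_def GL_def)
qed

lemma XT_D: assumes "\<psi>:carrier XT" shows "t:T ==> \<psi> t~=0" "s:T ==> t:T ==> \<psi> (s**t) = \<psi> s * \<psi> t" "EX f. reg f & (ALL t:T. f t = \<psi> t)"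
  "\<psi>:extensional T" "\<psi> (mat 1) = 1" "t:T ==> \<psi> (minv t) = 1 / \<psi> t"
proof -
 have h: "\<psi>:hom (grp T) Gm" "\<psi>:extensional T" "regular_on T \<psi>" using assms by (auto simp: character_group_def)
 show nz: "\<psi> t~=0" if "t:T" for t using h(1) that by (auto simp: hom_def Gm_def GL_def)
 show m: "\<psi> (s**t) = \<psi> s * \<psi> t" if "s:T" "t:T" for s t using h(1) that by (auto simp: hom_def Gm_def GL_def)
 show "\<psi>:extensional T" by (rule h(2))
 have "\<psi> (mat 1**mat 1) = \<psi> (mat 1) * \<psi> (mat 1)" using m sgT(2) by blast
 thus 1: "\<psi> (mat 1) = 1" using nz sgT(2) by simp
 show "\<psi> (minv t) = 1 / \<psi> t" if "t:T" for t using m[OF that sgT(4)[OF that]] nz[OF that] 1 minv(1)[OF sgT(1)[OF that]] by (simp add: field_simps)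
 obtain p k where p: "p:PF" "!!A. A:T ==> \<psi> A = p A / det A ^ k" using h(3) unfolding regular_on_def by blast
 have "reg (%A. p A / det A ^ k)" unfolding reg_def by (rule bexI[OF _ p(1)], rule exI[of _ k]) (auto simp: invertible_det_nz)
 thus "EX f. reg f & (ALL t:T. f t = \<psi> t)" using p(2) by (intro exI[of _ "%A. p A / det A ^ k"]) auto
qed

lemma XT_mult: assumes "\<psi>:carrier XT" "\<phi>:carrier XT" shows "(\<lambda>t\<in>T. \<psi> t * \<phi> t):carrier XT"
proof -
 obtain f where f: "reg f" "ALL t:T. f t = \<psi> t" using XT_D(3)[OF assms(1)] by blast obtain g where g: "reg g" "ALL t:T. g t = \<phi> t" using XT_D(3)[OF assms(2)] by blast
 note fg = f g
 show ?thesis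
 proof (rule XT_I[OF _ _ reg_mult[OF fg(1,3)]])
  show "(\<lambda>t\<in>T. \<psi> t * \<phi> t) t~=0" if "t:T" for t using XT_D(1) assms that by simp
  show "(\<lambda>t\<in>T. \<psi> t * \<phi> t) (s**t) = (\<lambda>t\<in>T. \<psi> t * \<phi> t) s * (\<lambda>t\<in>T. \<psi> t * \<phi> t) t" if "s:T" "t:T" for s t
   using XT_D(2)[OF assms(1) that] XT_D(2)[OF assms(2) that] that sgT(3)[OF that] by simp
 qed (use fg in auto)
qed

lemma XT_inv: assumes "\<psi>:carrier XT" shows "(\<lambda>t\<in>T. 1 / \<psi> t):carrier XT"
proof -
 obtain f where f: "reg f" "ALL t:T. f t = \<psi> t" using XT_D(3) assms by meson
 obtain q k where q: "q:PF" "!!A. invertible A ==> f A * det A ^ k = q A" using f(1) unfolding reg_def by blast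
 let ?g = "%A. q (minv A) * det A ^ k"
 have "reg ?g" by (intro reg_mult reg_subst[OF q(1)] reg_minv reg_pf[OF pf_power[OF pf_det]])
 moreover have "!!t. t:T ==> ?g t = 1 / \<psi> t"
 proof -
  fix t assume t: "t:T"
  note it = sgT(1)[OF t]
  have "det (minv t) * det t = 1" using minv(2)[OF it] det_mul[of "minv t" t] by simp
  hence "det (minv t) ^ k * det t ^ k = 1" by (metis power_mult_distrib power_one)
  hence "?g t = f (minv t)" unfolding q(2)[OF invertible_minv[OF it], symmetric] by (simp add: mult.assoc)
  thus "?g t = 1 / \<psi> t" using f(2) sgT(4)[OF t] XT_D(6)[OF assms t] by simp
 qed
 ultimately have g: "reg ?g" "!!t. t:T ==> ?g t = 1 / \<psi> t" by blast+
 show ?thesis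
 proof (rule XT_I[OF _ _ g(1)])
  show "(\<lambda>t\<in>T. 1 / \<psi> t) t~=0" if "t:T" for t using XT_D(1)[OF assms that] that by simp
  show "(\<lambda>t\<in>T. 1 / \<psi> t) (s**t) = (\<lambda>t\<in>T. 1 / \<psi> t) s * (\<lambda>t\<in>T. 1 / \<psi> t) t" if "s:T" "t:T" for s t
   using XT_D(2)[OF assms that] that sgT(3)[OF that] by simp
  show "?g t = (\<lambda>t\<in>T. 1 / \<psi> t) t" if "t:T" for t using g(2)[OF that] that by simp
 qed auto
qed

lemma XT_group: "group XT"
proof (rule groupI)
 show "\<one>\<^bsub>XT\<^esub>:carrier XT" by (rule XT_I[of _ "%_. 1"]) (auto simp: character_group_def sgT reg_const)
next
 fix \<psi> assume p: "\<psi>:carrier XT"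
 show "\<one>\<^bsub>XT\<^esub> \<otimes>\<^bsub>XT\<^esub> \<psi> = \<psi>" using XT_D(4)[OF p] by (auto simp: character_group_def extensional_def)
 show "EX \<phi>:carrier XT. \<phi> \<otimes>\<^bsub>XT\<^esub> \<psi> = \<one>\<^bsub>XT\<^esub>"
  using XT_D(1)[OF p] by (intro bexI[OF _ XT_inv[OF p]]) (auto simp: character_group_def intro!: restrict_ext)
next
 fix \<psi> \<phi> assume p: "\<psi>:carrier XT" "\<phi>:carrier XT"
 show "\<psi> \<otimes>\<^bsub>XT\<^esub> \<phi>:carrier XT" using XT_mult[OF p] by (simp add: character_group_def)
next
 fix \<psi> \<phi> \<xi> :: "complex^'n^'n => complex"
 show "\<psi> \<otimes>\<^bsub>XT\<^esub> \<phi> \<otimes>\<^bsub>XT\<^esub> \<xi> = \<psi> \<otimes>\<^bsub>XT\<^esub> (\<phi> \<otimes>\<^bsub>XT\<^esub> \<xi>)" by (auto simp: character_group_def mult.assoc)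
qed

lemma XT_inv_eq: assumes "\<psi>:carrier XT" "t:T" shows "(inv\<^bsub>XT\<^esub> \<psi>) t = 1 / \<psi> t"
proof -
 interpret X: group XT by (rule XT_group)
 have "(inv\<^bsub>XT\<^esub> \<psi>) \<otimes>\<^bsub>XT\<^esub> \<psi> = \<one>\<^bsub>XT\<^esub>" using assms by simp
 hence "(inv\<^bsub>XT\<^esub> \<psi>) t * \<psi> t = 1" using assms(2) by (auto simp: character_group_def dest!: fun_cong[of _ _ t])
 thus ?thesis using XT_D(1)[OF assms] by (simp add: field_simps)
qed

lemma cochar: assumes "l:carrier (cocharacter_group T)" shows "c~=0 ==> l c:T" "c~=0 ==> d~=0 ==> l (c * d) = l c**l d" "l 1 = mat 1" "laur (%c. l c$i$j)"
proof -
 have h: "l:hom Gm (grp T)" using assms by (auto simp: cocharacter_group_def)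
 show 1: "l c:T" if "c~=0" for c using h that by (auto simp: hom_def Gm_def GL_def)
 show 2: "l (c * d) = l c**l d" if "c~=0" "d~=0" for c d using h that by (auto simp: hom_def Gm_def GL_def)
 show "laur (%c. l c$i$j)" using assms by (simp add: cocharacter_group_def laur_def)
 have "l 1**l 1 = l 1" using 2[of 1 1] by simp
 hence "minv (l 1)**(l 1**l 1) = minv (l 1)**l 1" by simp
 thus "l 1 = mat 1" using sgT(1)[OF 1[of 1]] by (simp add: minv_cancel minv)
qed

text \<open>Shows that the description in \<open>pairing\<close> is uniquely satisfied. Along a
  cocharacter the determinant is itself a power of \<open>c\<close>, so the denominator of a regular
  function stays within Laurent polynomials.\<close>

lemma pairing_eq: assumes p: "\<psi>:carrier XT" and l: "l:carrier (cocharacter_group T)" shows "c~=0 ==> \<psi> (l c) = c powi pairing \<psi> l"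
proof -
 note L = cochar[OF l]
 have "regular_on T \<psi>" using p by (auto simp: character_group_def)
 then obtain q k where q: "q:PF" "!!A. A:T ==> \<psi> A = q A / det A ^ k" unfolding regular_on_def by blast
 have dn: "det (l c)~=0" if "c~=0" for c using sgT(1)[OF L(1)[OF that]] by (simp add: invertible_det_nz) obtain m where m: "!!c. c~=0 ==> det (l c) = c powi m"
  using laur_char[OF laur_pf[OF pf_det L(4)] dn] L(3) by (metis det_I)
 have "laur (%c. q (l c))" by (rule laur_pf[OF q(1) L(4)])
 moreover have "laur (%c. c powi (- m * int k))"
 proof (cases "0<=- m * int k")
  case True
  thus ?thesis unfolding laur_def by (intro exI[of _ "monom 1 (nat (- m * int k))"] exI[of _ 0]) (simp add: poly_monom power_int_def)
 next
  case False
  thus ?thesis unfolding laur_def by (intro exI[of _ 1] exI[of _ "nat (m * int k)"]) (simp add: power_int_def field_simps)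
 qed
 ultimately have "laur (%c. q (l c) * c powi (- m * int k))" by (rule laur_mult)
 moreover have e: "q (l c) * c powi (- m * int k) = \<psi> (l c)" if "c~=0" for c using q(2)[OF L(1)[OF that]] m[OF that] that by (simp add: power_int_minus power_int_mult field_simps)
 ultimately have "laur (%c. \<psi> (l c))" unfolding laur_def by metis
 then obtain k where k: "!!c. c~=0 ==> \<psi> (l c) = c powi k" using laur_char[of "%c. \<psi> (l c)"] XT_D(1,5)[OF p] L(1,3) by (metis (no_types, lifting))
 have "pairing \<psi> l = k" unfolding pairing_def
 proof (rule the_equality)
  fix k' assume "ALL c. c~=0 --> \<psi> (l c) = c powi k'"
  thus "k' = k" using k[of 2] powi_inj by simp
 qed (use k in blast)
 thus "\<psi> (l c) = c powi pairing \<psi> l" if "c~=0" using k[OF that] by simp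
qed

end

subsection \<open>The trace form of a pinned group\<close>

text \<open>\<open>cent\<close> says that \<open>T\<close> is its own centralizer. It is supplied by
  \<open>centralizer_torus\<close> for a nonempty word; the empty word is covered by
  \<open>fibre_Nil\<close>.\<close>

locale pin = pinning G Bp Bm T I al alv x y
 for G Bp Bm T :: "(complex^'n^'n) set" and I :: "'i set" and al alv x y + assumes real_G: "zariski_closed \<real> G" and ss_G: "semisimple G" and laced: "simply_laced_group G T Bp"
  and cent: "g:G ==> (!!t. t:T ==> g**t = t**g) ==> g:T"
begin

text \<open>A real diagonalizing matrix exists because the torus is split. Its reality makes
  \<open>hat\<close> commute with complex conjugation, on which \<open>tt_pos\<close>
  depends.\<close>

definition g0 :: "complex^'n^'n" where
 "g0 = (SOME g. invertible g & cnjm g = g & (ALL A:conj_set g T. ALL i j. i~=j --> A$i$j = 0))"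

lemma g0: "invertible g0" "cnjm g0 = g0" "A:conj_set g0 T ==> i~=j ==> A$i$j = 0"
proof -
 obtain g where "g:real_points {g. invertible g}" "ALL A:conj_set g T. ALL i j. i~=j --> A$i$j = 0" using split_T unfolding split_torus_def by (elim conjE bexE)
 hence "EX g. invertible g & cnjm g = g & (ALL A:conj_set g T. ALL i j. i~=j --> A$i$j = 0)" by (intro exI[of _ g]) (simp add: real_points_def cnjm_real)
 hence s: "invertible g0 & cnjm g0 = g0 & (ALL A:conj_set g0 T. ALL i j. i~=j --> A$i$j = 0)" unfolding g0_def by (rule someI_ex)
 show "invertible g0" "cnjm g0 = g0" "A:conj_set g0 T ==> i~=j ==> A$i$j = 0" using s by simp_all
qed

lemma cl_G: "closed_subgroup G" using ss_G by (simp add: semisimple_def)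
lemma T_torus: "torus T" using split_T by (simp add: split_torus_def)
lemma cl_T: "closed_subgroup T" using T_torus by (simp add: torus_def)
lemma T_conn: "zconn T" using T_torus zconn_closed by (auto simp: torus_def closed_subgroup_def)
lemma real_T: "zariski_closed \<real> T" using split_T by (simp add: split_torus_def)

sublocale diag_group T g0 by standard (use cl_T T_conn g0 in \<open>auto simp: conj_set_def\<close>)

lemma Bp: "closed_subgroup Bp" "zconn Bp" "solvable (grp Bp)" "Bp<=G"
 "closed_subgroup B' ==> zariski_connected B' ==> solvable (grp B') ==> B'<=G ==> Bp<=B' ==> B' = Bp"
 using borel_Bp(1) zconn_closed unfolding borel_subgroup_def Let_def closed_subgroup_def by blast+
lemma T_Bp: "T<=Bp" "T<=G" using T_eq Bp(4) by auto

lemmas sgG = subgroupD[OF conjunct1[OF cl_G[unfolded closed_subgroup_def]]]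
lemmas sgB = subgroupD[OF conjunct1[OF Bp(1)[unfolded closed_subgroup_def]]]

abbreviation "gg \<equiv> lie_algebra G"
abbreviation "bb \<equiv> lie_algebra Bp"
abbreviation "tt \<equiv> lie_algebra T"

lemma ttb: "X:tt ==> X:bb" using lie_mono[OF T_Bp(1)] by blast
lemma bbg: "X:bb ==> X:gg" using lie_mono[OF Bp(4)] by blast
lemma ttg: "X:tt ==> X:gg" using lie_mono[OF T_Bp(2)] by blast

lemma Ad_G: "g:G ==> X:gg ==> g**X**minv g:gg" using lie_Ad[OF cl_G, of X g] sgG by simp
lemma Ad_B: "g:Bp ==> X:bb ==> g**X**minv g:bb" using lie_Ad[OF Bp(1), of X g] sgB by simp

lemma tt_diag: assumes "X:tt" "k~=l" shows "hat X$k$l = 0"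
proof -
 have "csub {X. hat X$k$l = 0}" by (auto simp: csub_def hat_lin)
 moreover have "cder (mexp X) X 0" using mexp_cder[of X 0] by simp
 moreover have "mexp X s:{X. hat X$k$l = 0}" for s using lie_mexp[OF cl_T assms(1)] diag assms(2) by (simp add: hat_def)
 ultimately show ?thesis using csub_deriv[of "{X. hat X$k$l = 0}" "mexp X" X] by simp
qed

lemma tt_cnj: "X:tt ==> cnjm X:tt" by (rule cnjm_lie[OF cl_T real_T])

lemma hat_cnj: "hat (cnjm X) = cnjm (hat X)" using g0 cnjm_inv(2)[OF g0(1)] by (simp add: hat_def cnjm_mult)

lemma kap_hat: "kap (hat X) (hat Y) = kap X Y" unfolding hat_def by (rule kap_Ad[OF g0(1)])

text \<open>In the real diagonalizing coordinates the value is the sum of the squared moduli of the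
  diagonal entries.\<close>

lemma tt_pos: assumes X: "X:tt" "X~=0" shows "EX p>0. kap X (cnjm X) = of_real p"
proof -
 let ?d = "%k. hat X$k$k"
 have "(hat X**cnjm (hat X))$k$k = (SUM m:UNIV. if m = k then of_real ((cmod (?d k))\<^sup>2) else 0)" for k
  unfolding mm_nth using tt_diag[OF X(1)] by (intro sum.cong) (auto simp: complex_norm_square[symmetric])
 hence "kap X (cnjm X) = of_real (SUM k:UNIV. (cmod (?d k))\<^sup>2)" unfolding kap_hat[of X, symmetric] hat_cnj by (simp add: kap_def trace_def)
 moreover have "EX k. ?d k~=0"
 proof (rule ccontr)
  assume "~ (EX k. ?d k~=0)"
  hence "hat X = hat 0" using tt_diag[OF X(1)] by (intro mat_eqI) (metis hat_lin(3) zero_index)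
  thus False using X(2) hat_inj by blast
 qed
 hence "0 < (SUM k:UNIV. (cmod (?d k))\<^sup>2)" by (auto intro!: sum_pos2)
 ultimately show ?thesis by blast
qed

lemma tt_nondeg: assumes "X:tt" "!!H. H:tt ==> kap X H = 0" shows "X = 0" using tt_pos[OF assms(1)] assms(2)[OF tt_cnj[OF assms(1)]] by auto

text \<open>An element of weight zero commutes with \<open>T\<close>, so its exponentials centralize
  \<open>T\<close> and lie in it by \<open>cent\<close>.\<close>

lemma wt1_tt: assumes X: "X:gg" "wtv (%_. 1) X" shows "X:tt" unfolding lie_exp_iff[OF cl_T]
proof (intro allI cent)
 fix s show "mexp X s:G" by (rule lie_mexp[OF cl_G X(1)])
 fix t assume t: "t:T"
 have "t**X**minv t = X" using X(2) t by (simp add: wtv_def Ad_def)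
 hence "t**mexp X s**minv t = mexp X s" using mexp_conj[OF sgT(1)[OF t], of X s] by simp
 hence "(t**mexp X s**minv t)**t = mexp X s**t" by simp
 thus "mexp X s**t = t**mexp X s" using minv(2)[OF sgT(1)[OF t]] by (simp add: mm_assoc)
qed

lemma tt_wt1: assumes "X:tt" shows "wtv (%_. 1) X" unfolding wtv_def
proof (intro ballI, rule hat_inj, rule mat_eqI)
 fix t k l assume t: "t:T"
 have "hat (Ad t X)$k$l * dg t l = hat X$k$l * dg t l" unfolding hat_Ad[OF t] using tt_diag[OF assms, of k l] by (cases "k = l") auto
 thus "hat (Ad t X)$k$l = hat (msc 1 X)$k$l" using dg_nz[OF t] by simp
qed

lemma tt_br: assumes H: "H:tt" and X: "wtv bt X" shows "EX c. br H X = msc c X"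
proof -
 have "csub {msc c X |c. True}" unfolding csub_def by (auto intro: exI[of _ 0] simp flip: msc_add(2))
 moreover have "mexp H s**X**mexp H (- s):{msc c X |c. True}" for s
 proof -
  have "mexp H s**X**minv (mexp H s) = msc (bt (mexp H s)) X" using X lie_mexp[OF cl_T H, of s] unfolding wtv_def Ad_def by blast
  thus ?thesis unfolding minv_mexp by blast
 qed
 ultimately have "br H X:{msc c X |c. True}" using csub_deriv[OF _ Ad_cder] by blast
 thus ?thesis by blast
qed

lemma talg_gg: "talg gg" using csub_lie lie_br[OF cl_G] Ad_G T_Bp(2) by (auto simp: talg_def Ad_def)

lemma mexp_tri:
 fixes Q :: "complex^'n^'n" assumes "invertible Q" "minv Q**X**Q:lev r 0" shows "minv Q**mexp X s**Q:lev r 0"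
proof -
 have "minv Q**mexp X s**Q = mexp (minv Q**X**Q) s" using mexp_conj[OF invertible_minv[OF assms(1)], of X s] by (simp add: minv_minv assms(1))
 thus ?thesis using lev_mexp[OF assms(2)] by simp
qed

text \<open>The radical of the form is stable under \<open>G\<close> and has no weight zero part,
  because the form is nondegenerate on \<open>tt\<close>. By Engel it is strictly triangular, so its
  exponentials generate a normal group whose closure is connected and solvable; semisimplicity makes
  that group trivial.\<close>

lemma kap_nondeg: assumes X: "X:gg" "!!Y. Y:gg ==> kap X Y = 0" shows "X = 0"
proof -
 define r where "r = {X:gg. ALL Y:gg. kap X Y = 0}"
 have cs: "csub r" using csubD[OF csub_lie[of G]] by (auto simp: r_def csub_def kap_lin)
 have Adr: "g**X**minv g:r" if g: "g:G" and X: "X:r" for g X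
 proof -
  have "kap (g**X**minv g) Y = 0" if "Y:gg" for Y
  proof -
   note ig = sgG(1)[OF g]
   have "Y = g**(minv g**Y**g)**minv g" by (simp add: mm_assoc minv_cancel[OF ig] minv[OF ig])
   moreover have "minv g**Y**g:gg" using Ad_G[OF sgG(4)[OF g] that] by (simp add: minv_minv[OF ig])
   ultimately show ?thesis using X kap_Ad[OF ig, of X "minv g**Y**g"] by (simp add: r_def)
  qed
  thus ?thesis using Ad_G[OF g] X by (simp add: r_def)
 qed
 have "talg r" unfolding talg_def
 proof (intro conjI ballI cs)
  show "br X Y:r" if "X:r" "Y:r" for X Y using that lie_br[OF cl_G] by (auto simp: r_def kap_br)
  show "Ad t X:r" if "t:T" "X:r" for t X using Adr[of t X] that T_Bp(2) by (auto simp: Ad_def)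
 qed
 moreover have "X = 0" if X: "X:r" "wtv (%_. 1) X" for X using X(1) wt1_tt[OF _ X(2)] tt_nondeg[of X] ttg by (simp add: r_def)
 ultimately have "strict r" by (rule engel)
 then obtain Q :: "complex^'n^'n" and q where Q: "invertible Q" "bij_betw q UNIV {..<CARD('n)}"
  "!!X. X:r ==> minv Q**X**Q:lev q 1" by (rule strict_flag) (rule that)
 define \<C> where "\<C> = (%X. range (mexp X)) ` r"
 have C: "zconn C & mat 1:C & (ALL A:C. invertible A & minv A:C & minv Q**A**Q:lev q 0 & A:G)"
  if CC: "C:\<C>" for C
 proof -
  obtain X where X: "X:r" "C = range (mexp X)" using CC by (auto simp: \<C>_def)
  have "minv Q**X**Q:lev q 0" using Q(3)[OF X(1)] lev_mono[of 0 1 q] by auto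
  moreover have "X:gg" using X(1) by (simp add: r_def)
  moreover have "mat 1:range (mexp X)" using mexp_0[of X] by (metis rangeI)
  ultimately show ?thesis unfolding X(2) by (auto simp: minv_mexp mexp_zconn mexp_invertible mexp_tri[OF Q(1)] lie_mexp[OF cl_G])
 qed
 have US: "\<Union>\<C><=G" using C by blast
 define K where "K = zcl (generate GL (\<Union>\<C>))"
 have K: "closed_subgroup K" "zariski_connected K" "solvable (grp K)" "K<=G" "\<Union>\<C><=K" unfolding K_def by (rule solvable_hull[OF _ _ _ _ Q(1,2) _ cl_G US]; use C in blast)+
 note sgK = subgroupD[OF conjunct1[OF K(1)[unfolded closed_subgroup_def]]]
 have Cconj: "g**A**minv g:\<Union>\<C>" if "g:G" "A:\<Union>\<C>" for g A
 proof -
  obtain X s where "X:r" "A = mexp X s" using `A:\<Union>\<C>` by (auto simp: \<C>_def)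
  thus ?thesis using Adr[OF `g:G`, of X] mexp_conj[OF sgG(1)[OF `g:G`], of X s] by (auto simp: \<C>_def)
 qed
 have genC: "g**A**minv g:generate GL (\<Union>\<C>)" if g: "g:G" and "A:generate GL (\<Union>\<C>)" for g A using that(2)
 proof (induction rule: generate_GL_induct)
  case one thus ?case using generate.one[of GL "\<Union>\<C>"] minv(1)[OF sgG(1)[OF g]] by (simp add: GL_def)
 next
  case (incl h) thus ?case using Cconj[OF g] generate.incl by metis
 next
  case (inv h)
  then obtain C where "C:\<C>" "h:C" by blast
  hence "inv\<^bsub>GL\<^esub> h:\<Union>\<C>" using C inv_GL by (metis UnionI)
  thus ?case using Cconj[OF g] generate.incl by metis
 next
  case (mult h k)
  have "g**(h**k)**minv g = (g**h**minv g)**(g**k**minv g)" by (simp add: mm_assoc minv_cancel[OF sgG(1)[OF g]])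
  thus ?case using generate.eng[OF mult.IH] by (simp add: GL_def)
 qed
 have inG: "generate GL (\<Union>\<C>)<=G" using group.generate_subgroup_incl[OF group_GL US] cl_G by (simp add: closed_subgroup_def)
 have Kconj: "g**A**minv g:K" if g: "g:G" and "A:K" for g A unfolding K_def
 proof (rule zcl_image[of "generate GL (\<Union>\<C>)" "%A. g**A**minv g"])
  show "g**A**minv g:zcl (generate GL (\<Union>\<C>))" if "A:generate GL (\<Union>\<C>)" for A using genC[OF g that] zcl_sub[of "generate GL (\<Union>\<C>)"] inG sgG(1) by blast
  show "reg (%A. (g**A**minv g)$i$j)" for i j by (intro reg_mm reg_const reg_coord)
  show "A:zcl (generate GL (\<Union>\<C>))" using `A:K` by (simp add: K_def)
  show "invertible (g**A**minv g)" if "invertible A" for A using that sgG(1)[OF g] by (intro invertible_mult invertible_minv)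
 qed (use inG sgG(1) in blast)
 have "K \<lhd> grp G"
 proof -
  interpret gG: group "grp G" using group.subgroup_imp_group[OF group_GL] cl_G by (auto simp: closed_subgroup_def)
  have "subgroup K (grp G)"
  proof (rule gG.subgroupI)
   show "inv\<^bsub>grp G\<^esub> A:K" if "A:K" for A using that K(4) group.m_inv_consistent[OF group_GL, of G A] cl_G sgK(4)[OF that] inv_GL[OF sgK(1)[OF that]]
    by (auto simp: closed_subgroup_def)
  qed (use K(4) sgK in \<open>auto simp: GL_def\<close>)
  moreover have "g \<otimes>\<^bsub>grp G\<^esub> h \<otimes>\<^bsub>grp G\<^esub> inv\<^bsub>grp G\<^esub> g:K" if "g:carrier (grp G)" "h:K" for g h
  proof -
   have g: "g:G" using that(1) by simp
   have "inv\<^bsub>grp G\<^esub> g = minv g" using group.m_inv_consistent[OF group_GL _ g] cl_G inv_GL[OF sgG(1)[OF g]] by (auto simp: closed_subgroup_def)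
   thus ?thesis using Kconj[OF g that(2)] by (simp add: GL_def)
  qed
  ultimately show ?thesis using gG.normal_inv_iff by blast
 qed
 hence "K = {mat 1}" using ss_G K unfolding semisimple_def by blast
 moreover have "X:r" using X by (simp add: r_def)
 ultimately have "mexp X s = mat 1" for s using K(5) by (auto simp: \<C>_def)
 thus ?thesis by (rule mexp_trivial)
qed

lemma kap_cpt: assumes "!!gm. gm:chs ==> kap X (cpt gm Y) = 0" shows "kap X Y = 0" using kap_sum[of X "%gm. cpt gm Y" chs] assms by (simp add: cpt_sum)

lemma pair_exists: assumes X: "X:gg" "wtv bt X" "X~=0"
 obtains Y where "Y:gg" "wtv (%t. 1 / bt t) Y" "kap X Y = 1"
proof -
 obtain Y where Y: "Y:gg" "kap X Y~=0" using kap_nondeg X by blast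
 then obtain gm where gm: "gm:chs" "kap X (cpt gm Y)~=0" using kap_cpt by blast
 have "gm t = 1 / bt t" if "t:T" for t using kap_wtv[OF X(2) cpt_wtv that] gm(2) by (metis (no_types) mult.commute mult_eq_0_iff nonzero_eq_divide_eq zero_neq_one)
 hence w: "wtv (%t. 1 / bt t) (cpt gm Y)" using cpt_wtv[of gm Y] by (simp add: wtv_def)
 have c: "cpt gm Y:gg" using cpt_in[OF csub_lie _ Y(1) gm(1)] talg_gg by (auto simp: talg_def)
 let ?Y = "msc (1 / kap X (cpt gm Y)) (cpt gm Y)"
 have "wtv (%t. 1 / bt t) ?Y" using w by (simp add: wtv_def Ad_lin mult.commute)
 moreover have "kap X ?Y = 1" using gm(2) by (simp add: kap_lin)
 ultimately show ?thesis using that csubD(3)[OF csub_lie c] by blast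
qed

lemma wtv_add: "wtv bt X ==> wtv bt Y ==> wtv bt (X + Y)" "wtv bt X ==> wtv bt (msc c X)"
 "wtv bt X ==> wtv bt Y ==> wtv bt (X - Y)" by (simp_all add: wtv_def Ad_lin msc_add mult.commute)

lemma wtv_br1: assumes "wtv bt X" "wtv (%t. 1 / bt t) Y" "!!t. t:T ==> bt t~=0" shows "wtv (%_. 1) (br X Y)" using wtv_br[OF assms(1,2)] assms(3) by (simp add: wtv_def)

text \<open>With \<open>H = br z Y\<close>, suitable multiples of \<open>z\<close>,
  \<open>H\<close>, \<open>Y\<close> form an sl2-triple. The part \<open>v\<close> of
  \<open>X\<close> orthogonal to \<open>Y\<close> satisfies \<open>br v Y = 0\<close>, because this
  bracket lies in \<open>tt\<close> and is orthogonal to \<open>tt\<close>; so \<open>v\<close> is a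
  lowest weight vector of positive weight. That \<open>H\<close> acts on \<open>v\<close> as on
  \<open>z\<close> follows since \<open>v + z\<close> is a weight vector too.\<close>

lemma one_dim: assumes z: "z:gg" "wtv bt z" "cnjm z = z" and Y: "Y:gg" "wtv (%t. 1 / bt t) Y" "cnjm Y = Y" and k: "kap z Y = 1" and bt: "!!t. t:T ==> bt t~=0"
  and H': "H':tt" "br H' z = msc d z" "d~=0" and X: "X:gg" "wtv bt X" shows "X = msc (kap X Y) z"
proof -
 define H where "H = br z Y"
 have H: "H:tt" unfolding H_def by (rule wt1_tt[OF lie_br[OF cl_G z(1) Y(1)] wtv_br1[OF z(2) Y(2) bt]])
 have kH: "kap K H = c" if "br K z = msc c z" for K c using kap_br[of K z Y] that k by (simp add: H_def kap_lin)
 have "H~=0" using kH[OF H'(2)] H'(3) by (auto simp: kap_lin)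
 moreover have cH: "cnjm H = H" by (simp add: H_def cnjm_br z Y)
 ultimately obtain p where p: "p > 0" "kap H H = of_real p" using tt_pos[OF H] by auto
 have Hz: "br H z = msc (of_real p) z" using tt_br[OF H z(2)] kH[of H] p(2) by auto
 define v where "v = X - msc (kap X Y) z"
 have v: "v:gg" "wtv bt v" "kap v Y = 0" using X z csubD[OF csub_lie[of G]] wtv_add k by (auto simp: v_def kap_lin)
 have "br v Y:tt" by (rule wt1_tt[OF lie_br[OF cl_G v(1) Y(1)] wtv_br1[OF v(2) Y(2) bt]])
 moreover have "kap (br v Y) K = 0" if K: "K:tt" for K
 proof -
  obtain c where "br K Y = msc c Y" using tt_br[OF K Y(2)] by blast
  hence "br Y K = msc (- c) Y" using br_anti[of Y K] by simp
  thus ?thesis using kap_br[of v Y K] v(3) by (simp add: kap_lin)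
 qed
 ultimately have vY: "br v Y = 0" by (rule tt_nondeg) obtain c where c: "br H v = msc c v" using tt_br[OF H v(2)] by blast
 have "v = 0"
 proof (cases "c = of_real p")
  case True
  show ?thesis
  proof (rule sl2_lowest)
   show "br z (msc (of_real (2 / p)) Y) = msc (of_real (2 / p)) H" by (simp add: br_lin H_def)
   show "hat (msc (of_real (2 / p)) H)$k$l = 0" if "k~=l" for k l using tt_diag[OF H that] by (simp add: hat_lin)
   show "br (msc (of_real (2 / p)) H) z = msc 2 z" unfolding br_lin Hz using p by simp
   show "br (msc (of_real (2 / p)) Y) v = 0" unfolding br_lin using vY br_anti[of Y v] by simp
   show "br (msc (of_real (2 / p)) H) v = msc (of_real 2) v" unfolding br_lin c using True p by simp
  qed simp
 next
  case False obtain c' where c': "br H (v + z) = msc c' (v + z)" using tt_br[OF H wtv_add(1)[OF v(2) z(2)]] by blast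
  have e: "msc c v + msc (of_real p) z = msc c' v + msc c' z" using c' unfolding br_lin c Hz msc_add .
  have "kap (msc c v + msc (of_real p) z) Y = kap (msc c' v + msc c' z) Y" by (simp only: e)
  hence "c' = of_real p" by (simp add: kap_lin v(3) k)
  hence e2: "msc c v = msc (of_real p) v" using e by simp
  show ?thesis
  proof (rule mat_eqI)
   fix i j have "msc c v$i$j = msc (of_real p) v$i$j" by (simp only: e2)
   thus "v$i$j = 0$i$j" using False by simp
  qed
 qed
 thus ?thesis by (simp add: v_def)
qed

end

lemma solvable_flag:
 fixes H :: "(complex^'n^'n) set" assumes H: "subgroup H GL" "zconn H" "solvable (grp H)"
 obtains Q :: "complex^'n^'n" and q where "invertible Q" "bij_betw q UNIV {..<CARD('n)}"
  "!!h. h:H ==> minv Q**h**Q:lev q 0"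
proof -
 obtain k where k: "(derived GL ^^ k) H = {mat 1}" using solvable_derived[OF H(1,3)] .
 show thesis
 proof (rule flag_exists[of H "{}"])
  fix U assume U: "vec.subspace U" "U~=UNIV" "!!h u. h:H Un {} ==> u:U ==> h *v u:U"
  hence "EX w:UNIV - U. ALL h:H. EX c. h *v w - c *s w:U" by (intro lie_kolchin_mod[OF H(1,2) k]) (auto simp: vec.subspace_def)
  thus "EX w. w ~: U & (ALL h:H. EX c. h *v w - c *s w:U) & (ALL s:{}. s *v w:U)" by blast
 qed (rule that; assumption)
qed

context pin
begin

lemma Bp_kolchin: assumes "vec.subspace U" "vec.subspace W" "U \<subset> W" "!!h u. h:Bp ==> u:U ==> h *v u:U"
  "!!h u. h:Bp ==> u:W ==> h *v u:W" shows "EX w:W - U. ALL h:Bp. EX c. h *v w - c *s w:U"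
proof -
 have sg: "subgroup Bp GL" using Bp(1) by (simp add: closed_subgroup_def) obtain k where "(derived GL ^^ k) Bp = {mat 1}" using solvable_derived[OF sg Bp(3)] .
 thus ?thesis using lie_kolchin_mod[OF sg Bp(2) _ assms] by blast
qed

text \<open>The orthogonal complement of the Lie algebra of the Borel subgroup lies inside it: otherwise
 some element outside, minimal for a filtration stable under the Borel subgroup, would generate
 together with the Borel subgroup a larger connected solvable group.\<close>

lemma borel_perp: assumes X0: "X0:gg" "!!b. b:bb ==> kap X0 b = 0" shows "X0:bb"
proof (rule ccontr)
 assume nX0: "X0 ~: bb"
 define E where "E = {X:gg. ALL b:bb. kap X b = 0}"
 have csE: "csub E" using csubD[OF csub_lie[of G]] by (auto simp: E_def csub_def kap_lin)
 have csb: "csub bb" by (rule csub_lie)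
 have AdE: "g**X**minv g:E" if g: "g:Bp" and X: "X:E" for g X
 proof -
  have "kap (g**X**minv g) Y = 0" if "Y:bb" for Y
  proof -
   note ig = sgB(1)[OF g]
   have "Y = g**(minv g**Y**g)**minv g" by (simp add: mm_assoc minv_cancel[OF ig] minv[OF ig])
   moreover have "minv g**Y**g:bb" using Ad_B[OF sgB(4)[OF g] that] by (simp add: minv_minv[OF ig])
   ultimately show ?thesis using X kap_Ad[OF ig, of X "minv g**Y**g"] by (simp add: E_def)
  qed
  thus ?thesis using Ad_G[of g X] X g Bp(4) by (auto simp: E_def)
 qed
 obtain Q :: "complex^'n^'n" and q where Q: "invertible Q" "bij_betw q UNIV {..<CARD('n)}"
  "!!h. h:Bp ==> minv Q**h**Q:lev q 0" using solvable_flag[OF _ Bp(2,3)] Bp(1) unfolding closed_subgroup_def by metis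
 define P where "P = (%X. minv Q**X**Q)"
 define N where "N = CARD('n)"
 have qN: "q k < N" for k using Q(2) by (auto simp: N_def bij_betw_def)
 \<comment> \<open>A numbering of matrix positions such that conjugation by a triangular matrix
   moves entries only to larger keys. Hence \<open>Z m\<close>, the matrices without entries below
   key \<open>m\<close>, is stable under the Borel group, and \<open>stepZ\<close> says that the
   layer at \<open>m\<close> is acted on by scalars.\<close>
 define key where "key = (%k l. (N - q k) * N + q l)"
 have key_mono: "key k' l'<=key k l" if "q k<=q k'" "q l'<=q l" for k l k' l' using that by (simp add: key_def add_mono mult_le_mono1 diff_le_mono2)
 have key_inj: "k = k' & l = l'" if "key k l = key k' l'" for k l k' l'
 proof -
  have "key k l mod N = key k' l' mod N" "key k l div N = key k' l' div N" using that by simp_all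
  hence "q l = q l'" "N - q k = N - q k'" using qN[of l] qN[of l'] by (simp_all add: key_def)
  thus ?thesis using qN[of k] qN[of k'] Q(2) by (auto simp: bij_betw_def inj_on_def)
 qed
 define Z where "Z = (%m. {X. ALL k l. P X$k$l~=0 --> m<=key k l})"
 have Plin: "P (X + Y) = P X + P Y" "P (msc c X) = msc c (P X)" "P 0 = 0" "P (X - Y) = P X - P Y" for X Y c by (simp_all add: P_def mm_add)
 have csZ: "csub (Z m)" for m unfolding csub_def Z_def by (auto simp: Plin) (metis add_cancel_right_left)
 have entry: "(A**Y**B)$k$l~=0 ==> EX k' l'. A$k$k'~=0 & Y$k'$l'~=0 & B$l'$l~=0"
  for A Y B :: "complex^'n^'n" and k l unfolding mm_nth by (metis (no_types, lifting) mult_eq_0_iff sum.not_neutral_contains_not_neutral)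
 have levq: "q k<=q l" if "A:lev q 0" "A$k$l~=0" for A :: "complex^'n^'n" and k l using that by (rule_tac ccontr) (auto simp: lev_def not_le)
 have stepZ: "EX c. b**X**minv b - msc c X:Z (Suc m)" if b: "b:Bp" and X: "X:Z m" for b X m
 proof -
  let ?A = "P b" and ?B = "P (minv b)" and ?Y = "P X"
  have AB: "?A:lev q 0" "?B:lev q 0" unfolding P_def using Q(3)[OF b] Q(3)[OF sgB(4)[OF b]] by auto
  have PA: "P (b**X**minv b) = ?A**?Y**?B" by (simp add: P_def mm_assoc minv_cancel[OF Q(1)])
  have big: "m<=key k l" if nz: "(?A**?Y**?B)$k$l~=0" for k l
  proof -
   obtain k' l' where e: "?A$k$k'~=0" "?Y$k'$l'~=0" "?B$l'$l~=0" using entry[OF nz] by blast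
   hence "m<=key k' l'" "q k<=q k'" "q l'<=q l" using X levq[OF AB(1) e(1)] levq[OF AB(2) e(3)] by (auto simp: Z_def)
   thus ?thesis using key_mono[of k k' l' l] by simp
  qed
  have diag1: "(?A**?Y**?B)$k$l = ?A$k$k * ?B$l$l * ?Y$k$l" if km: "key k l = m" for k l
  proof -
   have z: "?A$k$k' * ?Y$k'$l' * ?B$l'$l = 0" if "(k', l')~=(k, l)" for k' l'
   proof (rule ccontr)
    assume n: "?A$k$k' * ?Y$k'$l' * ?B$l'$l~=0"
    hence "?A$k$k'~=0" "?Y$k'$l'~=0" "?B$l'$l~=0" by auto
    hence "m<=key k' l'" "q k<=q k'" "q l'<=q l" using X levq[OF AB(1)] levq[OF AB(2)] by (auto simp: Z_def)
    hence "key k' l' = key k l" using key_mono[of k k' l' l] km by simp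
    thus False using key_inj that by blast
   qed
   have "(?A**?Y**?B)$k$l = (SUM l':UNIV. SUM k':UNIV. ?A$k$k' * ?Y$k'$l' * ?B$l'$l)" by (simp add: mm_nth sum_distrib_right)
   also have "... = (SUM l':UNIV. SUM k':UNIV. if k' = k then if l' = l then ?A$k$k * ?Y$k$l * ?B$l$l else 0 else 0)" using z by (intro sum.cong refl) auto
   finally show ?thesis by (simp add: mult_ac)
  qed
  obtain c where c: "!!k l. key k l = m ==> (?A**?Y**?B)$k$l = c * ?Y$k$l"
  proof (cases "EX k l. key k l = m")
   case True
   then obtain k l where "key k l = m" by blast
   hence "(?A**?Y**?B)$k'$l' = ?A$k$k * ?B$l$l * ?Y$k'$l'" if "key k' l' = m" for k' l' using diag1[OF that] key_inj[of k l k' l'] that by auto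
   thus thesis by (rule that)
  qed (use that in blast)
  have "Suc m<=key k l" if "P (b**X**minv b - msc c X)$k$l~=0" for k l
  proof (rule ccontr)
   assume "~ Suc m<=key k l"
   then consider "key k l < m" | "key k l = m" by linarith
   thus False
   proof cases
    case 1
    hence "?Y$k$l = 0" "(?A**?Y**?B)$k$l = 0" using X big[of k l] by (auto simp: Z_def not_less[symmetric])
    thus False using that by (simp add: Plin PA)
   next
    case 2 thus False using that c[OF 2] by (simp add: Plin PA)
   qed
  qed
  thus ?thesis by (intro exI[of _ c]) (simp add: Z_def)
 qed
 have Zmono: "Z (Suc m)<=Z m" for m unfolding Z_def by (auto dest: Suc_leD)
 have big0: "X:bb" if "X:Z (N * N + N)" for X
 proof -
  have "P X$k$l = 0" for k l
  proof (rule ccontr)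
   assume "P X$k$l~=0"
   hence "N * N + N<=key k l" using that by (simp add: Z_def)
   moreover have "(N - q k) * N<=N * N" by (rule mult_le_mono1) simp
   ultimately show False using qN[of l] by (simp add: key_def)
  qed
  hence "P X = 0" by (simp add: vec_eq_iff)
  hence "Q**P X**minv Q = 0" by (simp add: mm_add)
  hence "X = 0" by (simp add: P_def mm_assoc minv_cancel[OF Q(1)] minv[OF Q(1)])
  thus ?thesis using csubD(1)[OF csb] by simp
 qed
 obtain m X1 where m: "X1:E" "X1 ~: bb" "X1:Z m" "!!X. X:E ==> X:Z (Suc m) ==> X:bb"
 proof (rule ccontr)
  assume no: "~ thesis"
  have "EX X:E. X ~: bb & X:Z m" for m
  proof (induction m)
   case 0 show ?case using X0 nX0 by (intro bexI[of _ X0]) (auto simp: Z_def E_def)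
  next
   case (Suc m) thus ?case using that no by blast
  qed
  thus False using big0 by blast
 qed
 have csEZ: "csub (E Int Z m)" using csE csZ[of m] by (auto simp: csub_def)
 have AdZ: "b**X**minv b:Z m" if "b:Bp" "X:Z m" for b X
 proof -
  obtain c where "b**X**minv b - msc c X:Z (Suc m)" using stepZ[OF `b:Bp` `X:Z m`] by blast
  hence "(b**X**minv b - msc c X) + msc c X:Z m" using Zmono csubD(2,3)[OF csZ] `X:Z m` by blast
  thus ?thesis by simp
 qed
 obtain gm where gm: "gm:chs" "cpt gm X1 ~: bb" using csub_split[OF csb, of X1] m(2) by blast
 define X where "X = cpt gm X1"
 have "Ad t Y:E Int Z m" if "t:T" "Y:E Int Z m" for t Y using that AdE[of t Y] AdZ[of t Y] T_Bp(1) by (auto simp: Ad_def)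
 hence "X:E Int Z m" unfolding X_def by (rule cpt_in[OF csEZ _ _ gm(1)]) (use m in auto)
 hence X: "X:E" "X:Z m" "X ~: bb" using gm(2) by (auto simp: X_def)
 \<comment> \<open>Spanned by \<open>X\<close> and the part of \<open>E\<close> in
   \<open>bb\<close>, this is a Lie algebra stable under the Borel group. Its elements of weight
   zero lie in \<open>tt\<close> and are orthogonal to \<open>tt\<close>, hence vanish, so Engel's
   theorem applies.\<close>
 define s where "s = {Y + msc c X |Y c. Y:E & Y:bb}"
 have sI: "Y + msc c X:s" if "Y:E" "Y:bb" for Y c using that unfolding s_def by blast
 have sE: "s<=E" using csubD[OF csE] X(1) by (auto simp: s_def)
 have css: "csub s" unfolding csub_def
 proof (intro conjI ballI allI)
  show "0:s" using sI[of 0 0] csubD(1)[OF csE] csubD(1)[OF csb] by simp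
  show "A + B:s" if A: "A:s" and B: "B:s" for A B
  proof -
   obtain Y c Y' c' where e: "A = Y + msc c X" "B = Y' + msc c' X" "Y:E" "Y:bb" "Y':E" "Y':bb" using A B unfolding s_def by blast
   have eq: "A + B = (Y + Y') + msc (c + c') X" by (simp add: e msc_add)
   show ?thesis unfolding eq by (rule sI[OF csubD(2)[OF csE e(3,5)] csubD(2)[OF csb e(4,6)]])
  qed
  show "msc d A:s" if A: "A:s" for d A
  proof -
   obtain Y c where e: "A = Y + msc c X" "Y:E" "Y:bb" using A unfolding s_def by blast
   have "msc d A = msc d Y + msc (d * c) X" by (simp add: e msc_add)
   thus ?thesis using sI[of "msc d Y"] csubD(3)[OF csE] csubD(3)[OF csb] e by simp
  qed
 qed
 have Xs: "X:s" using sI[of 0 1] csubD(1)[OF csE] csubD(1)[OF csb] by simp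
 have Es: "Y:s" if "Y:E" "Y:bb" for Y using sI[OF that, of 0] by simp
 have AdX: "b**X**minv b:s" if b: "b:Bp" for b
 proof -
  obtain c where c: "b**X**minv b - msc c X:Z (Suc m)" using stepZ[OF b X(2)] by blast
  have "b**X**minv b - msc c X:E" using AdE[OF b X(1)] csubD(3,5)[OF csE] X(1) by blast
  hence "(b**X**minv b - msc c X) + msc c X:s" using m(4)[OF _ c] by (intro sI)
  thus ?thesis by simp
 qed
 have Ads: "b**A**minv b:s" if b: "b:Bp" and A: "A:s" for b A
 proof -
  obtain Y c where e: "A = Y + msc c X" "Y:E" "Y:bb" using A unfolding s_def by blast
  have "b**Y**minv b:s" by (rule Es[OF AdE[OF b e(2)] Ad_B[OF b e(3)]])
  moreover have "b**A**minv b = b**Y**minv b + msc c (b**X**minv b)" by (simp add: e mm_add)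
  ultimately show ?thesis using csubD(2,3)[OF css] AdX[OF b] by simp
 qed
 have brb: "br Y A:s" if "Y:bb" "A:s" for Y A
 proof (rule csub_deriv[OF css Ad_cder])
  show "mexp Y t**A**mexp Y (- t):s" for t using Ads[OF lie_mexp[OF Bp(1) `Y:bb`] `A:s`, of t] by (simp add: minv_mexp)
 qed
 have "talg s" unfolding talg_def
 proof (intro conjI ballI css)
  show "br A B:s" if A: "A:s" and B: "B:s" for A B
  proof -
   obtain Y c where e: "A = Y + msc c X" "Y:E" "Y:bb" using A unfolding s_def by blast obtain Y' c' where e': "B = Y' + msc c' X" "Y':E" "Y':bb" using B unfolding s_def by blast
   have "br A B = br Y B + msc c (br X Y')" unfolding e br_lin by (simp add: e' br_lin br_self)
   moreover have "br X Y':s" unfolding br_anti[of X Y'] using csubD(4)[OF css brb[OF e'(3) Xs]] .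
   ultimately show ?thesis using csubD(2,3)[OF css] brb[OF e(3) B] by simp
  qed
  show "Ad t A:s" if "t:T" "A:s" for t A using Ads that T_Bp(1) by (auto simp: Ad_def)
 qed
 moreover have "A = 0" if A: "A:s" "wtv (%_. 1) A" for A
 proof -
  have AE: "A:E" using A(1) sE by blast
  thus ?thesis using wt1_tt[OF _ A(2)] tt_nondeg[of A] ttb by (simp add: E_def)
 qed
 ultimately have "strict s" by (rule engel) obtain R :: "complex^'n^'n" and r where R: "invertible R" "bij_betw r UNIV {..<CARD('n)}"
  "!!h. h:Bp ==> minv R**h**R:lev r 0" "!!A. A:s ==> minv R**A**R:lev r 1"
 proof (rule flag_exists[of Bp s])
  fix U assume U: "vec.subspace U" "U~=UNIV" "!!h u. h:Bp Un s ==> u:U ==> h *v u:U"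
  define K where "K = {w. ALL A:s. A *v w:U}"
  have "vec.subspace U & U~=UNIV & (ALL Y:s. ALL u:U. Y *v u:U)" using U by blast
  with `strict s` obtain w0 where "w0 ~: U & (ALL Y:s. Y *v w0:U)" unfolding strict_def by (elim allE[of _ U] impE exE)
  hence "U \<subset> K" using U(3) by (auto simp: K_def)
  moreover have "vec.subspace K" unfolding K_def by (rule csub_vec[OF U(1)])
  moreover have "h *v u:K" if h: "h:Bp" and u: "u:K" for h u
  proof -
   have "A *v (h *v u):U" if A: "A:s" for A
   proof -
    have "minv h**A**h:s" using Ads[OF sgB(4)[OF h] A] by (simp add: minv_minv[OF sgB(1)[OF h]])
    hence "h *v ((minv h**A**h) *v u):U" using u U(3) h by (auto simp: K_def)
    moreover have "h *v ((minv h**A**h) *v u) = A *v (h *v u)" by (simp add: matrix_vector_mul_assoc mm_assoc minv_cancel[OF sgB(1)[OF h]])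
    ultimately show ?thesis by simp
   qed
   thus ?thesis by (simp add: K_def)
  qed
  ultimately have "EX w:K - U. ALL h:Bp. EX c. h *v w - c *s w:U" using U by (intro Bp_kolchin) auto
  thus "EX w. w ~: U & (ALL h:Bp. EX c. h *v w - c *s w:U) & (ALL A:s. A *v w:U)" by (auto simp: K_def)
 qed (rule that; assumption)
 define \<C> where "\<C> = {Bp, range (mexp X)}"
 have Xg: "X:gg" using X(1) by (simp add: E_def)
 have "minv R**X**R:lev r 0" using R(4)[OF Xs] lev_mono[of 0 1 r] by auto
 hence tr: "minv R**mexp X t**R:lev r 0" for t by (rule mexp_tri[OF R(1)])
 have "mat 1:range (mexp X)" using mexp_0[of X] by (metis rangeI)
 hence C: "zconn C & mat 1:C & (ALL A:C. invertible A & minv A:C & minv R**A**R:lev r 0 & A:G)"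
  if "C:\<C>" for C using that sgB Bp(2,4) R(3) tr mexp_zconn lie_mexp[OF cl_G Xg] by (auto simp: \<C>_def minv_mexp mexp_invertible)
 have US: "\<Union>\<C><=G" using C by blast
 define K where "K = zcl (generate GL (\<Union>\<C>))"
 have K: "closed_subgroup K" "zariski_connected K" "solvable (grp K)" "K<=G" "\<Union>\<C><=K" unfolding K_def by (rule solvable_hull[OF _ _ _ _ R(1,2) _ cl_G US]; use C in blast)+
 hence "K = Bp" by (intro Bp(5)) (auto simp: \<C>_def)
 hence "mexp X t:Bp" for t using K(5) by (auto simp: \<C>_def)
 thus False using X(3) lie_exp_iff[OF Bp(1)] by blast
qed

text \<open>Only weight \<open>bt\<close> can pair with \<open>Y\<close>. As the root space of
  \<open>bt\<close> is a line outside \<open>bb\<close>, no element of \<open>bb\<close> has a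
  component there, so \<open>Y\<close> is orthogonal to \<open>bb\<close> and
  \<open>borel_perp\<close> applies.\<close>

lemma bb_dichotomy: assumes z: "z:gg" "wtv bt z" "z ~: bb" and dim: "!!X. X:gg ==> wtv bt X ==> EX c. X = msc c z" and Y: "Y:gg" "wtv (%t. 1 / bt t) Y" and bt: "!!t. t:T ==> bt t~=0"
 shows "Y:bb"
proof (rule borel_perp[OF Y(1)], rule kap_cpt)
 fix b gm assume b: "b:bb" "gm:chs"
 have c: "cpt gm b:bb" using cpt_in[OF csub_lie _ b] Ad_B T_Bp(1) by (auto simp: Ad_def)
 show "kap Y (cpt gm b) = 0"
 proof (cases "EX t:T. 1 / bt t * gm t~=1")
  case True thus ?thesis using kap_wtv[OF Y(2) cpt_wtv] by blast
 next
  case False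
  hence "gm t = bt t" if "t:T" for t using bt[OF that] that by (auto simp: field_simps)
  hence "wtv bt (cpt gm b)" using cpt_wtv[of gm b] by (simp add: wtv_def)
  then obtain d where d: "cpt gm b = msc d z" using dim bbg[OF c] by blast
  have "d = 0"
  proof (rule ccontr)
   assume "d~=0"
   hence "msc (1 / d) (cpt gm b) = z" by (simp add: d)
   thus False using csubD(3)[OF csub_lie c, of "1 / d"] z(3) by simp
  qed
  thus ?thesis by (simp add: d kap_lin)
 qed
qed

subsection \<open>The one-parameter subgroups of the pinning\<close>

text \<open>The first index belongs to the coroot and the second to the root.\<close>

definition a :: "'i => 'i => int" where "a i j = pairing (al j) (alv i)"

lemma simpleI: "i:I ==> al i:simple_roots G T Bp" using simple_roots_index by (auto simp: bij_betw_def)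
lemma alpha_pos: "i:I ==> al i:positive_roots G T Bp" using simpleI by (auto simp: simple_roots_def)
lemma alpha_XT: "i:I ==> al i:carrier XT" using alpha_pos by (auto simp: positive_roots_def roots_def)
lemma cochar_av: "i:I ==> alv i:carrier (cocharacter_group T)" using simple_coroots by (auto simp: is_coroot_def)
lemma alpha_av: "i:I ==> j:I ==> c~=0 ==> al j (alv i c) = c powi a i j" unfolding a_def by (rule pairing_eq[OF alpha_XT cochar_av])
lemma a_diag: "i:I ==> a i i = 2" using simple_coroots by (auto simp: is_coroot_def a_def)
lemma a_off: assumes "i:I" "j:I" "i~=j" shows "a i j = 0 | a i j = -1"
proof -
 have "al i~=al j" using simple_roots_index assms by (auto simp: bij_betw_def inj_on_def)
 hence "pairing (al j) (alv i):{0, - 1}" using bspec[OF bspec[OF laced[unfolded simply_laced_group_def] simpleI[OF assms(2)]] simpleI[OF assms(1)]]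
   simple_coroots[OF assms(1)] by simp
 thus ?thesis by (simp add: a_def)
qed

definition m2 :: "real => real => real => real => real^2^2" where "m2 p q r s = vector [vector [p, q], vector [r, s]]"

lemma m2: "m2 p q r s**m2 p' q' r' s' = m2 (p * p' + q * r') (p * q' + q * s') (r * p' + s * r') (r * q' + s * s')"
 "det (m2 p q r s) = p * s - q * r" by (simp_all add: m2_def vec_eq_iff forall_2 matrix_matrix_mult_def sum_2 det_2)

text \<open>The homomorphism chosen from \<open>SL2_hom\<close>, with the matrix given by its four
  entries. By \<open>sl(4)\<close> every rank one identity then becomes arithmetic of these
  entries.\<close>

definition sl where "sl i = (%p q r s. (SOME \<phi>. \<phi>:hom SL2R (grp (real_points G)) &
    (ALL a. \<phi> (m2 1 a 0 1) = x i a) & (ALL a. \<phi> (m2 1 0 a 1) = y i a) &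
    (ALL c. c~=0 --> \<phi> (m2 c 0 0 (inverse c)) = alv i (of_real c))) (m2 p q r s))"

lemma sl: assumes i: "i:I" shows "sl i 1 b 0 1 = x i b" "sl i 1 0 b 1 = y i b" "c~=0 ==> sl i c 0 0 (1 / c) = alv i (of_real c)"
  "p * s - q * r = 1 ==> p' * s' - q' * r' = 1 ==> sl i p q r s**sl i p' q' r' s' =
   sl i (p * p' + q * r') (p * q' + q * s') (r * p' + s * r') (r * q' + s * s')"
  "p * s - q * r = 1 ==> sl i p q r s:real_points G"
proof -
 define \<phi> where "\<phi> = (SOME \<phi>. \<phi>:hom SL2R (grp (real_points G)) &
    (ALL a. \<phi> (m2 1 a 0 1) = x i a) & (ALL a. \<phi> (m2 1 0 a 1) = y i a) &
    (ALL c. c~=0 --> \<phi> (m2 c 0 0 (inverse c)) = alv i (of_real c)))"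
 have "EX \<phi>. \<phi>:hom SL2R (grp (real_points G)) &
    (ALL a. \<phi> (m2 1 a 0 1) = x i a) & (ALL a. \<phi> (m2 1 0 a 1) = y i a) &
    (ALL c. c~=0 --> \<phi> (m2 c 0 0 (inverse c)) = alv i (of_real c))" using SL2_hom[OF i] unfolding m2_def by blast
 hence \<phi>: "\<phi>:hom SL2R (grp (real_points G)) &
    (ALL a. \<phi> (m2 1 a 0 1) = x i a) & (ALL a. \<phi> (m2 1 0 a 1) = y i a) &
    (ALL c. c~=0 --> \<phi> (m2 c 0 0 (inverse c)) = alv i (of_real c))" unfolding \<phi>_def by (rule someI_ex)
 have s: "sl i p q r s = \<phi> (m2 p q r s)" for p q r s by (simp add: sl_def \<phi>_def)
 show "sl i 1 b 0 1 = x i b" "sl i 1 0 b 1 = y i b" "c~=0 ==> sl i c 0 0 (1 / c) = alv i (of_real c)" using \<phi> by (simp_all add: s flip: inverse_eq_divide)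
 show "p * s - q * r = 1 ==> p' * s' - q' * r' = 1 ==> sl i p q r s**sl i p' q' r' s' =
   sl i (p * p' + q * r') (p * q' + q * s') (r * p' + s * r') (r * q' + s * s')" using \<phi> unfolding s m2(1)[symmetric] by (auto simp: hom_def SL2R_def GL_def m2(2))
 show "p * s - q * r = 1 ==> sl i p q r s:real_points G" using \<phi> unfolding s by (auto simp: hom_def SL2R_def GL_def m2(2))
qed

lemma sl_1: assumes "i:I" shows "sl i 1 0 0 1 = mat 1"
proof -
 have e: "sl i 1 0 0 1**sl i 1 0 0 1 = sl i 1 0 0 1" using sl(4)[OF assms, of 1 1 0 0 1 1 0 0] by simp
 have inv: "invertible (sl i 1 0 0 1)" using sl(5)[OF assms, of 1 1 0 0] sgG(1) by (simp add: real_points_def)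
 have "minv (sl i 1 0 0 1)**(sl i 1 0 0 1**sl i 1 0 0 1) = mat 1" unfolding e minv(2)[OF inv] ..
 thus ?thesis by (simp add: minv_cancel[OF inv])
qed

lemma xy_add: assumes "i:I" shows "x i (s + t) = x i s**x i t" "y i (s + t) = y i s**y i t"
  "c~=0 ==> d~=0 ==> alv i (of_real (c * d)) = alv i (of_real c)**alv i (of_real d)"
  "x i 0 = mat 1" "y i 0 = mat 1"
proof -
 note s = sl(1-3)[OF assms, symmetric]
 show "x i (s + t) = x i s**x i t" "y i (s + t) = y i s**y i t" unfolding s by (subst sl(4)[OF assms], simp, simp, simp add: add.commute)+
 show "c~=0 ==> d~=0 ==> alv i (of_real (c * d)) = alv i (of_real c)**alv i (of_real d)" using cochar(2)[OF cochar_av[OF assms], of "of_real c" "of_real d"] by simp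
 show "x i 0 = mat 1" "y i 0 = mat 1" unfolding s by (rule sl_1[OF assms])+
qed

lemma poly_rder: assumes "!!j k. EX p::real poly. ALL b. z b$j$k = of_real (poly p b)" shows "EX D. rder z D b"
proof -
 have "EX D. ((%b. z b$j$k) has_vector_derivative D) (at b)" for j k
 proof -
  obtain p :: "real poly" where p: "!!b. z b$j$k = of_real (poly p b)" using assms by blast
  have "((%b. of_real (poly p b) :: complex) has_vector_derivative of_real (poly (pderiv p) b)) (at b)" by (rule has_vector_derivative_of_real) (rule poly_DERIV)
  thus ?thesis unfolding p by blast
 qed
 then obtain D where "!!j k. ((%b. z b$j$k) has_vector_derivative D j k) (at b)" by metis
 thus ?thesis by (intro exI[of _ "\<chi> j k. D j k"]) (simp add: rder_def)
qed

lemma av_rder: assumes i: "i:I" shows "EX D. rder (%s. alv i (of_real (exp s))) D b"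
proof -
 have "EX D. ((%s. alv i (of_real (exp s))$j$k) has_vector_derivative D) (at b)" for j k
 proof -
  obtain p l where p: "!!c. c~=0 ==> alv i c$j$k = poly p c / c ^ l" using cochar(4)[OF cochar_av[OF i], of j k] unfolding laur_def by blast
  have "((%s. of_real (exp s) :: complex) has_vector_derivative of_real (exp b)) (at b)" by (rule has_vector_derivative_of_real) (rule DERIV_exp)
  moreover have "EX D. ((%c. poly p c / c ^ l) has_field_derivative D) (at (of_real (exp b)))" by (rule exI, rule DERIV_divide[OF poly_DERIV DERIV_power[OF DERIV_ident]]) simp
  ultimately have "EX D. ((%c. poly p c / c ^ l) \<circ> (%s. of_real (exp s)) has_vector_derivative D) (at b)" using field_vector_diff_chain_at by blast
  thus ?thesis by (simp add: o_def p)
 qed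
 then obtain D where "!!j k. ((%s. alv i (of_real (exp s))$j$k) has_vector_derivative D j k) (at b)" by metis
 thus ?thesis by (intro exI[of _ "\<chi> j k. D j k"]) (simp add: rder_def)
qed

definition "e i = (SOME X. cnjm X = X & (ALL a. x i a = mexp X (of_real a)))"
definition "f i = (SOME X. cnjm X = X & (ALL a. y i a = mexp X (of_real a)))"
definition "h i = (SOME X. cnjm X = X & (ALL s. alv i (of_real (exp s)) = mexp X (of_real s)))"

lemma real_xy: assumes "i:I" shows "x i t:real_points G" "y i t:real_points G" "c~=0 ==> alv i (of_real c):real_points G"
 using sl(5)[OF assms, of 1 1 t 0] sl(5)[OF assms, of 1 1 0 t] sl(5)[OF assms, of c "1 / c" 0 0] by (simp_all add: sl(1-3)[OF assms])

lemma efh: assumes i: "i:I" shows "cnjm (e i) = e i" "x i t = mexp (e i) (of_real t)" "cnjm (f i) = f i" "y i t = mexp (f i) (of_real t)"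
  "cnjm (h i) = h i" "alv i (of_real (exp s)) = mexp (h i) (of_real s)"
proof -
 have "cnjm (e i) = e i & (ALL a. x i a = mexp (e i) (of_real a))" unfolding e_def
  by (rule someI_ex, rule one_param[OF poly_rder[OF polynomial_x[OF i]]]) (use xy_add[OF i] real_xy[OF i] in \<open>auto simp: real_points_def\<close>)
 thus "cnjm (e i) = e i" "x i t = mexp (e i) (of_real t)" by auto
 have "cnjm (f i) = f i & (ALL a. y i a = mexp (f i) (of_real a))" unfolding f_def
  by (rule someI_ex, rule one_param[OF poly_rder[OF polynomial_y[OF i]]]) (use xy_add[OF i] real_xy[OF i] in \<open>auto simp: real_points_def\<close>)
 thus "cnjm (f i) = f i" "y i t = mexp (f i) (of_real t)" by auto
 have "cnjm (h i) = h i & (ALL a. alv i (of_real (exp a)) = mexp (h i) (of_real a))" unfolding h_def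
 proof (rule someI_ex, rule one_param[OF av_rder[OF i]])
  show "alv i (of_real (exp (s + t))) = alv i (of_real (exp s))**alv i (of_real (exp t))" for s t unfolding exp_add by (rule xy_add(3)[OF i]) simp_all
  show "alv i (of_real (exp 0)) = mat 1" using cochar(3)[OF cochar_av[OF i]] by simp
  show "alv i (of_real (exp s))$k$l:\<real>" for s k l using real_xy(3)[OF i, of "exp s"] by (simp add: real_points_def)
 qed
 thus "cnjm (h i) = h i" "alv i (of_real (exp s)) = mexp (h i) (of_real s)" by auto
qed

lemma e_root: assumes i: "i:I" shows "e i:gg" "wtv (al i) (e i)" "e i~=0"
proof -
 obtain U where U: "is_root_subgroup G T (al i) U" "bij_betw (x i) UNIV (real_points U)" using x_onto[OF i] by blast
 have "x i t:U" for t using U(2) by (auto simp: bij_betw_def real_points_def)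
 hence "e i:lie_algebra U" using mexp_rder[of "e i" 0] efh(2)[OF i] by (intro lie_curve_r[of "%t. mexp (e i) (of_real t)"]) auto
 hence "e i:root_space G T (al i)" using U(1) by (simp add: is_root_subgroup_def)
 thus "e i:gg" "wtv (al i) (e i)" by (auto simp: root_space_def wtv_def Ad_def msc_def)
 show "e i~=0"
 proof
  assume z: "e i = 0"
  have "mexp (msc 0 (0 :: complex^'n^'n)) 1 = mat 1" unfolding mexp_msc by simp
  hence "x i 1 = mat 1" unfolding efh(2)[OF i] z by simp
  hence "x i 1 = x i 0" using xy_add(4)[OF i] by simp
  thus False using U(2) by (auto simp: bij_betw_def dest: injD)
 qed
qed

lemma f_root: assumes i: "i:I" shows "f i:gg" "wtv (%t. 1 / al i t) (f i)" "f i~=0"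
proof -
 obtain U where U: "is_root_subgroup G T (inv\<^bsub>XT\<^esub> (al i)) U" "bij_betw (y i) UNIV (real_points U)" using y_onto[OF i] by blast
 have "y i t:U" for t using U(2) by (auto simp: bij_betw_def real_points_def)
 hence "f i:lie_algebra U" using mexp_rder[of "f i" 0] efh(4)[OF i] by (intro lie_curve_r[of "%t. mexp (f i) (of_real t)"]) auto
 hence "f i:root_space G T (inv\<^bsub>XT\<^esub> (al i))" using U(1) by (simp add: is_root_subgroup_def)
 thus "f i:gg" "wtv (%t. 1 / al i t) (f i)" using XT_inv_eq[OF alpha_XT[OF i]] by (auto simp: root_space_def wtv_def Ad_def msc_def)
 show "f i~=0"
 proof
  assume z: "f i = 0"
  have "mexp (msc 0 (0 :: complex^'n^'n)) 1 = mat 1" unfolding mexp_msc by simp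
  hence "y i 1 = mat 1" unfolding efh(4)[OF i] z by simp
  hence "y i 1 = y i 0" using xy_add(5)[OF i] by simp
  thus False using U(2) by (auto simp: bij_betw_def dest: injD)
 qed
qed

lemma h_tt: assumes i: "i:I" shows "h i:tt"
proof (rule lie_curve_r)
 show "rder (%s. mexp (h i) (of_real s)) (h i) 0" using mexp_rder[of "h i" 0] by simp
 show "mexp (h i) (of_real s):T" for s unfolding efh(6)[OF i, symmetric] by (rule cochar(1)[OF cochar_av[OF i]]) simp
qed simp

lemma h_br: assumes i: "i:I" and X: "wtv bt X" and m: "!!c. c~=0 ==> bt (alv i c) = c powi m" shows "br (h i) X = msc (of_int m) X"
proof -
 have "mexp (h i) (of_real s)**X**mexp (h i) (- of_real s) = msc (of_real (exp (of_int m * s))) X" for s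
 proof -
  have "alv i (of_real (exp s)):T" by (rule cochar(1)[OF cochar_av[OF i]]) simp
  hence "Ad (alv i (of_real (exp s))) X = msc (of_real (exp s) powi m) X" using X m by (simp add: wtv_def)
  moreover have "(of_real (exp s) :: complex) powi m = of_real (exp (of_int m * s))" by (simp add: exp_power_int flip: of_real_power_int)
  ultimately show ?thesis unfolding efh(6)[OF i] Ad_def by (simp add: minv_mexp)
 qed
 hence 1: "rder (%s. msc (of_real (exp (of_int m * s))) X) (br (h i) X) 0" using Ad_rder[of "h i" X] by simp
 have "rder (%s. msc (of_real (exp (of_int m * s))) X) (msc (of_int m) X) 0" unfolding rder_def
 proof (intro allI)
  fix k l
  have "((%s. of_real (exp (of_int m * s)) :: complex) has_vector_derivative of_real (of_int m)) (at 0)" by (rule has_vector_derivative_of_real) (auto intro!: derivative_eq_intros)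
  hence "((%s. of_real (exp (of_int m * s)) * X$k$l) has_vector_derivative of_real (of_int m) * X$k$l) (at 0)" by (rule has_vector_derivative_mult_left)
  thus "((%s. msc (of_real (exp (of_int m * s))) X$k$l) has_vector_derivative msc (of_int m) X$k$l) (at 0)" by simp
 qed
 from rder_unique[OF 1 this] show ?thesis .
qed

lemma h_e: "i:I ==> j:I ==> br (h i) (e j) = msc (of_int (a i j)) (e j)" using h_br[OF _ e_root(2)] alpha_av by blast
lemma h_f: "i:I ==> j:I ==> br (h i) (f j) = msc (- of_int (a i j)) (f j)" using h_br[OF _ f_root(2), of i j "- a i j"] alpha_av by (simp add: power_int_minus inverse_eq_divide)

text \<open>Factor the product of \<open>x t\<close>, \<open>y u\<close> and \<open>x (- t)\<close>
  in the special linear group as lower, diagonal, upper. The functions \<open>?u\<close>,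
  \<open>?p\<close>, \<open>?q\<close> are determined by the requirement that the diagonal part be
  \<open>exp s\<close>; comparing derivatives at \<open>s = 0\<close> gives the formula.\<close>

lemma Ad_xf: assumes i: "i:I" and t: "t~=0" shows "mexp (e i) (of_real t)**f i**mexp (e i) (- of_real t) = f i + msc (of_real t) (h i) - msc (of_real (t\<^sup>2)) (e i)"
proof -
 let ?u = "%s. (exp s - 1) / t" and ?p = "%s. (1 - exp (- s)) / t" and ?q = "%s. - t * (1 - exp (- s))"
 have eq: "mexp (e i) (of_real t)**mexp (f i) (of_real (?u s))**mexp (e i) (of_real (- t)) =
   mexp (f i) (of_real (?p s))**mexp (h i) (of_real s)**mexp (e i) (of_real (?q s))" for s
 proof -
  have A: "sl i 1 t 0 1**sl i 1 0 u 1**sl i 1 (- t) 0 1 = sl i (1 + t * u) (t - (1 + t * u) * t) u (1 - u * t)" for u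
   by (subst sl(4)[OF i], simp, simp, subst sl(4)[OF i]) (simp_all add: algebra_simps)
  have B: "sl i 1 0 p 1**sl i c 0 0 (1 / c)**sl i 1 q 0 1 = sl i c (c * q) (p * c) (p * c * q + 1 / c)" if "c~=0" for p c q
   using that by (subst sl(4)[OF i], simp, simp, subst sl(4)[OF i]) simp_all
  have n: "exp s~=0" by simp
  have args: "1 + t * ?u s = exp s" "t - exp s * t = exp s * ?q s" "?p s * exp s = ?u s" using t by (simp_all add: field_simps exp_minus)
  have arg4: "1 - ?u s * t = ?u s * ?q s + 1 / exp s" using t by (simp add: field_simps exp_minus)
  have "x i t**y i (?u s)**x i (- t) = y i (?p s)**alv i (of_real (exp s))**x i (?q s)" unfolding sl(1,2)[OF i, symmetric] sl(3)[OF i n, symmetric] A B[OF n] args arg4 ..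
  thus ?thesis unfolding efh[OF i] .
 qed
 have du: "(?u has_real_derivative 1 / t) (at 0)" "(?p has_real_derivative 1 / t) (at 0)" "(?q has_real_derivative - t) (at 0)" using t by (auto intro!: derivative_eq_intros)
 have "rder (%s. mexp (e i) (of_real t)**mexp (f i) (of_real (?u s))**mexp (e i) (of_real (- t)))
   (mexp (e i) (of_real t)**msc (of_real (1 / t)) (f i)**mexp (e i) (of_real (- t))) 0" using rder_mm[OF rder_mm[OF rder_const mexp_chain[OF du(1)]] rder_const] by (simp add: mm_add)
 moreover have "rder (%s. mexp (f i) (of_real (?p s))**mexp (h i) (of_real s)**mexp (e i) (of_real (?q s)))
   (msc (of_real (1 / t)) (f i) + h i + msc (of_real (- t)) (e i)) 0" using rder_mm[OF rder_mm[OF mexp_chain[OF du(2)] mexp_rder] mexp_chain[OF du(3)], of "f i" "h i" "e i"] by simp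
 ultimately have "mexp (e i) (of_real t)**msc (of_real (1 / t)) (f i)**mexp (e i) (of_real (- t)) =
   msc (of_real (1 / t)) (f i) + h i + msc (of_real (- t)) (e i)" unfolding eq by (rule rder_unique)
 hence "msc (of_real t) (mexp (e i) (of_real t)**msc (of_real (1 / t)) (f i)**mexp (e i) (of_real (- t))) =
   msc (of_real t) (msc (of_real (1 / t)) (f i) + h i + msc (of_real (- t)) (e i))" by simp
 thus ?thesis using t by (simp add: msc_add power2_eq_square)
qed

lemma ef: assumes i: "i:I" shows "br (e i) (f i) = h i"
proof -
 have "mexp (e i) (of_real t)**f i**mexp (e i) (- of_real t) = f i + msc (of_real t) (h i) - msc (of_real (t\<^sup>2)) (e i)" for t using Ad_xf[OF i] by (cases "t = 0") simp_all
 hence "rder (%t. f i + msc (of_real t) (h i) - msc (of_real (t\<^sup>2)) (e i)) (br (e i) (f i)) 0" using Ad_rder[of "e i" "f i"] by simp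
 moreover have "rder (%t. f i + msc (of_real t) (h i) - msc (of_real (t\<^sup>2)) (e i)) (h i) 0" unfolding rder_def
 proof (intro allI)
  fix k l
  have "((%t. of_real (t\<^sup>2) :: complex) has_vector_derivative of_real 0) (at 0)" by (rule has_vector_derivative_of_real) (auto intro!: derivative_eq_intros)
  hence 1: "((%t. of_real (t\<^sup>2) * e i$k$l) has_vector_derivative of_real 0 * e i$k$l) (at 0)" by (rule has_vector_derivative_mult_left)
  have "((%t. of_real t :: complex) has_vector_derivative of_real 1) (at 0)" by (rule has_vector_derivative_of_real) (auto intro!: derivative_eq_intros)
  hence 2: "((%t. of_real t * h i$k$l) has_vector_derivative of_real 1 * h i$k$l) (at 0)" by (rule has_vector_derivative_mult_left)
  show "((%t. (f i + msc (of_real t) (h i) - msc (of_real (t\<^sup>2)) (e i))$k$l) has_vector_derivative h i$k$l) (at 0)"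
   using has_vector_derivative_diff[OF has_vector_derivative_add[OF has_vector_derivative_const[of "f i$k$l"] 2] 1] by simp
 qed
 ultimately show ?thesis by (rule rder_unique)
qed

end

section \<open>Serre relations and the simple reflections on root subgroups\<close>

context diag_group
begin

lemma Ad_comp: "invertible g ==> invertible k ==> Ad (g**k) X = Ad g (Ad k X)" by (simp add: Ad_def minv_mult mm_assoc)

lemma Ad_mexp: "br X (br X Y) = 0 ==> Ad (mexp X s) Y = Y + msc s (br X Y)" using heis_Ad[of X Y "br X Y" s] by (simp add: Ad_def minv_mexp)

lemma conj_mexp: "invertible g ==> g**mexp X s**minv g = mexp (Ad g X) s" by (simp add: Ad_def mexp_conj)

text \<open>Applications of \<open>sl2_lowest\<close> along the string through \<open>u\<close>. For
  \<open>m = 0\<close> the vector \<open>br e u\<close> is lowest of weight 2; for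
  \<open>m = -1\<close> the vector \<open>br e (br e u)\<close> is lowest of weight 3.\<close>

lemma serre: assumes h: "!!k l. k~=l ==> hat h$k$l = 0" and ef: "br e f = h" "br h e = msc 2 e" and u: "br f u = 0" "br h u = msc (of_int m) u"
 shows "m = 0 ==> br e u = 0" "m = -1 ==> br f (br e u) = u" "m = -1 ==> br e (br e u) = 0"
proof -
 have fe: "br f (br e v) = br e (br f v) - br h v" for v using br_jacobi[of f e v] by (simp add: br_anti[of f e] ef(1) br_lin)
 have he: "br h (br e v) = msc (2 + c) (br e v)" if "br h v = msc c v" for v c using br_jacobi[of h e v] by (simp add: that ef(2) br_lin msc_add)
 have 1: "br f (br e u) = - msc (of_int m) u" by (simp add: fe u br_lin)
 show "br e u = 0" if "m = 0" by (rule sl2_lowest[OF h ef, of _ 2]) (use 1 he[OF u(2)] that in simp_all)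
 show 2: "br f (br e u) = u" if "m = -1" using 1 that by simp
 show "br e (br e u) = 0" if m: "m = -1"
 proof (rule sl2_lowest[OF h ef, of _ 3])
  have h1: "br h (br e u) = msc 1 (br e u)" using he[OF u(2)] m by simp
  thus "br f (br e (br e u)) = 0" unfolding fe[of "br e u"] 2[OF m] by simp
  show "br h (br e (br e u)) = msc (of_real 3) (br e (br e u))" using he[OF h1] by simp
 qed simp_all
qed

text \<open>The lift of the reflection on a two-dimensional representation with basis
  \<open>u\<close>, \<open>p\<close>. The sign covers both expressions of \<open>n\<close> in
  \<open>n_mexp\<close>: it is 1 when the outer factors are negative root groups and -1 when they
  are positive.\<close>

lemma Ad_n: assumes "br e u = p" "br e p = 0" "br f u = 0" "br f p = u" "\<epsilon> * \<epsilon> = 1"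
 defines "n \<equiv> mexp e \<epsilon>**mexp f (- \<epsilon>)**mexp e \<epsilon>" shows "Ad n u = msc \<epsilon> p" "Ad n p = - msc \<epsilon> u"
proof -
 have n: "Ad n X = Ad (mexp e \<epsilon>) (Ad (mexp f (- \<epsilon>)) (Ad (mexp e \<epsilon>) X))" for X unfolding n_def by (simp add: Ad_comp mexp_invertible invertible_mult)
 have A: "Ad (mexp e s) u = u + msc s p" "Ad (mexp e s) p = p" "Ad (mexp f s) u = u" "Ad (mexp f s) p = p + msc s u" for s
  using Ad_mexp[of e u s] Ad_mexp[of e p s] Ad_mexp[of f u s] Ad_mexp[of f p s] assms(1-4) by (simp_all add: br_lin)
 show "Ad n u = msc \<epsilon> p" "Ad n p = - msc \<epsilon> u" unfolding n Ad_lin A by (simp_all add: A Ad_lin msc_add assms(5))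
qed

lemma heis_n:
 fixes e f u p :: "complex^'n^'n" assumes "br e u = p" "br e p = 0" "br f u = 0" "br f p = u" "\<epsilon> * \<epsilon> = 1" "br u p = 0"
 defines "n \<equiv> mexp e \<epsilon>**mexp f (- \<epsilon>)**mexp e \<epsilon>" shows "n**mexp u (of_real b)**minv n =
  mexp u (- of_real b)**(mexp e \<epsilon>**mexp u (of_real b)**mexp e (- \<epsilon>))"
proof -
 have "n**mexp u (of_real b)**minv n = mexp (msc \<epsilon> p) (of_real b)" using Ad_n(1)[OF assms(1-5)] unfolding n_def by (subst conj_mexp) (simp_all add: mexp_invertible invertible_mult)
 moreover have "mexp e \<epsilon>**mexp u (of_real b)**mexp e (- \<epsilon>) = mexp (u + msc \<epsilon> p) (of_real b)"
  using conj_mexp[OF mexp_invertible[of e \<epsilon>], of u "of_real b"] Ad_mexp[of e u \<epsilon>] assms(1,2) by (simp add: minv_mexp)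
 moreover have "mexp (u + msc \<epsilon> p) (of_real b) = mexp u (of_real b)**mexp (msc \<epsilon> p) (of_real b)" using assms(6) by (intro mexp_add) (simp add: br_def)
 moreover have "mexp u (- of_real b)**(mexp u (of_real b)**mexp (msc \<epsilon> p) (of_real b)) = mexp (msc \<epsilon> p) (of_real b)"
  using mexp_inv[of u "- of_real b"] by (simp flip: mm_assoc)
 ultimately show ?thesis by simp
qed

end

context pin
begin

lemma alpha_nz: "i:I ==> t:T ==> al i t~=0" using XT_D(1)[OF alpha_XT] .

lemma real_wt: assumes "cnjm z = z" "z~=0" "wtv bt z" "t:T" shows "cnj (bt (cnjm t)) = bt t"
proof -
 have c: "cnjm t:T" using real_closed_cnj[OF real_T assms(4)] .
 have "cnjm (Ad (cnjm t) z) = msc (cnj (bt (cnjm t))) z" using assms(1,3) c by (simp add: wtv_def cnjm_lin)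
 moreover have "cnjm (Ad (cnjm t) z) = Ad t z" using cnjm_inv(2)[OF sgT(1)[OF c]] assms(1) by (simp add: Ad_def cnjm_mult cnjm_lin)
 moreover have "Ad t z = msc (bt t) z" using assms(3,4) by (simp add: wtv_def)
 ultimately have e: "msc (cnj (bt (cnjm t))) z = msc (bt t) z" by simp obtain k l where "z$k$l~=0" using assms(2) by (metis mat_eqI zero_index)
 thus ?thesis using arg_cong[OF e, of "%A. A$k$l"] by simp
qed

text \<open>Since the root space is a line, one nonzero vector in \<open>bb\<close> puts all of it
  into \<open>bb\<close>.\<close>

lemma root_pos: assumes "bt:carrier XT" "t0:T" "bt t0~=1" "z:bb" "z~=0" "wtv bt z" "!!X. X:gg ==> wtv bt X ==> EX c. X = msc c z" shows "bt:positive_roots G T Bp"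
proof -
 have rs: "X:root_space G T bt \<longleftrightarrow> X:gg & wtv bt X" for X by (auto simp: root_space_def wtv_def Ad_def msc_def)
 have "bt~=\<one>\<^bsub>XT\<^esub>" using assms(2,3) by (auto simp: character_group_def)
 moreover have "X:bb" if "X:gg" "wtv bt X" for X using assms(7)[OF that] csubD(3)[OF csub_lie assms(4)] by auto
 ultimately show ?thesis using assms bbg unfolding positive_roots_def roots_def by (auto simp: rs)
qed

text \<open>If a bracket of \<open>e i\<close> with \<open>f j\<close> did not vanish, then \<open>al i - al j\<close> would be a root of
 multiplicity one, and either it or its negative would be positive, so that \<open>al i\<close> or \<open>al j\<close> would decompose.\<close>

lemma ef_comm: assumes i: "i:I" and j: "j:I" and ne: "i~=j" shows "br (e i) (f j) = 0"
proof (rule ccontr)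
 define z where "z = br (e i) (f j)"
 assume "br (e i) (f j)~=0"
 hence z0: "z~=0" by (simp add: z_def)
 define bt where "bt = (\<lambda>t\<in>T. al i t * (1 / al j t))"
 define bt' where "bt' = (\<lambda>t\<in>T. 1 / bt t)"
 have XTj: "(\<lambda>t\<in>T. 1 / al j t):carrier XT" by (rule XT_inv[OF alpha_XT[OF j]])
 have btX: "bt:carrier XT" using XT_mult[OF alpha_XT[OF i] XTj] by (simp add: bt_def cong: restrict_cong)
 have bt'X: "bt':carrier XT" unfolding bt'_def by (rule XT_inv[OF btX])
 have btnz: "bt t~=0" if "t:T" for t using XT_D(1)[OF btX that] .
 have w: "wtv bt' X \<longleftrightarrow> wtv (%t. 1 / bt t) X" for X by (simp add: wtv_def bt'_def)
 have zg: "z:gg" unfolding z_def by (rule lie_br[OF cl_G e_root(1)[OF i] f_root(1)[OF j]])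
 have zw: "wtv bt z" using wtv_br[OF e_root(2)[OF i] f_root(2)[OF j]] by (simp add: wtv_def bt_def z_def)
 have zr: "cnjm z = z" by (simp add: z_def cnjm_br efh i j) obtain Y0 where Y0: "Y0:gg" "wtv (%t. 1 / bt t) Y0" "kap z Y0 = 1" using pair_exists[OF zg zw z0] by blast
 have "wtv (%t. 1 / bt t) (cnjm Y0)" unfolding wtv_def
 proof
  fix t assume t: "t:T"
  have c: "cnjm t:T" using real_closed_cnj[OF real_T t] .
  have "Ad t (cnjm Y0) = cnjm (Ad (cnjm t) Y0)" using cnjm_inv(2)[OF sgT(1)[OF c]] by (simp add: Ad_def cnjm_mult cnjm_lin)
  also have "... = msc (1 / cnj (bt (cnjm t))) (cnjm Y0)" using Y0(2) c by (simp add: wtv_def cnjm_lin)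
  finally show "Ad t (cnjm Y0) = msc (1 / bt t) (cnjm Y0)" by (simp add: real_wt[OF zr z0 zw t])
 qed
 moreover have "cnjm Y0:gg" using cnjm_lie[OF cl_G real_G Y0(1)] .
 moreover have "kap z (cnjm Y0) = 1" using cnjm_kap[of z Y0] zr Y0(3) by simp
 \<comment> \<open>The average with its conjugate makes the dual vector real, as
   \<open>one_dim\<close> demands, without changing its pairing with the real vector
   \<open>z\<close>.\<close>
 moreover define Y where "Y = msc (1 / 2) (Y0 + cnjm Y0)"
 ultimately have Y: "Y:gg" "wtv (%t. 1 / bt t) Y" "kap z Y = 1" using Y0 by (auto simp: Y_def kap_lin intro!: csubD(2,3)[OF csub_lie] wtv_add)
 have Yr: "cnjm Y = Y" by (simp add: Y_def cnjm_lin add.commute)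
 have btav: "bt (alv i c) = c powi (2 - a i j)" if "c~=0" for c using alpha_av[OF i i that] alpha_av[OF i j that] cochar(1)[OF cochar_av[OF i] that] that a_diag[OF i]
  by (simp add: bt_def power_int_diff)
 define d where "d = (of_int (2 - a i j) :: complex)"
 have "(of_int (2 - a i j) :: complex)~=of_int 0" using a_off[OF i j ne] unfolding of_int_eq_iff by auto
 hence d: "d~=0" by (simp add: d_def)
 have hz: "br (h i) z = msc d z" unfolding d_def by (rule h_br[OF i zw btav])
 have "1 / bt (alv i c) = c powi (- (2 - a i j))" if "c~=0" for c using btav[OF that] by (metis inverse_eq_divide power_int_minus)
 hence hY: "br (h i) Y = msc (- d) Y" using h_br[OF i Y(2), of "- (2 - a i j)"] by (simp add: d_def)
 have dimz: "EX c. X = msc c z" if "X:gg" "wtv bt X" for X using one_dim[OF zg zw zr Y(1,2) Yr Y(3) btnz h_tt[OF i] hz d that] by blast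
 have bw: "wtv (%t. 1 / (1 / bt t)) X \<longleftrightarrow> wtv bt X" for X by (simp add: wtv_def)
 have dimY: "EX c. X = msc c Y" if "X:gg" "wtv bt' X" for X
 proof -
  have X: "wtv (%t. 1 / bt t) X" using `wtv bt' X` w by simp
  have "X = msc (kap X z) Y" by (rule one_dim[OF Y(1,2) Yr zg _ zr _ _ h_tt[OF i] hY _ `X:gg` X])
    (use zw bw kap_sym[of Y z] Y(3) btnz d in auto)
  thus ?thesis by blast
 qed
 have t0: "alv i 2:T" by (rule cochar(1)[OF cochar_av[OF i]]) simp
 have "(2 :: complex) powi (2 - a i j)~=2 powi 0" using a_off[OF i j ne] powi_inj[of "2 - a i j" 0] by auto
 hence n1: "bt (alv i 2)~=1" using btav[of 2] by simp
 show False
 proof (cases "z:bb")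
  case True
  have p: "bt:positive_roots G T Bp" by (rule root_pos[OF btX t0 n1 True z0 zw dimz])
  have "al i = bt \<otimes>\<^bsub>XT\<^esub> al j" using XT_D(4)[OF alpha_XT[OF i]] alpha_nz[OF j] by (auto simp: character_group_def bt_def extensional_def)
  thus False using simpleI[OF i] p alpha_pos[OF j] by (auto simp: simple_roots_def)
 next
  case False
  have Yb: "Y:bb" by (rule bb_dichotomy[OF zg zw False dimz Y(1,2) btnz])
  have "bt' (alv i 2)~=1" using n1 t0 btnz by (auto simp: bt'_def)
  moreover have "Y~=0" using Y(3) by (auto simp: kap_lin)
  ultimately have p: "bt':positive_roots G T Bp" using Y(2) w by (intro root_pos[OF bt'X t0 _ Yb _ _ dimY]) auto
  have "al j = bt' \<otimes>\<^bsub>XT\<^esub> al i" using XT_D(4)[OF alpha_XT[OF j]] alpha_nz[OF i] alpha_nz[OF j] by (auto simp: character_group_def bt'_def bt_def extensional_def)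
  thus False using simpleI[OF j] p alpha_pos[OF i] by (auto simp: simple_roots_def)
 qed
qed

lemma h_diag: "i:I ==> k~=l ==> hat (h i)$k$l = 0" using tt_diag[OF h_tt] .

lemma serre_e: assumes i: "i:I" and j: "j:I" and ne: "i~=j" shows "a i j = 0 ==> br (e i) (e j) = 0" "a i j = -1 ==> br (f i) (br (e i) (e j)) = e j"
  "a i j = -1 ==> br (e i) (br (e i) (e j)) = 0"
proof -
 have h2: "br (h i) (e i) = msc 2 (e i)" using h_e[OF i i] a_diag[OF i] by simp
 have u: "br (f i) (e j) = 0" using ef_comm[OF j i] ne br_anti[of "f i" "e j"] by simp
 note s = serre[OF h_diag[OF i] ef[OF i] h2 u h_e[OF i j]]
 show "a i j = 0 ==> br (e i) (e j) = 0" "a i j = -1 ==> br (f i) (br (e i) (e j)) = e j"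
  "a i j = -1 ==> br (e i) (br (e i) (e j)) = 0" by (rule s, assumption+)+
qed

lemma serre_f: assumes i: "i:I" and j: "j:I" and ne: "i~=j" shows "a i j = 0 ==> br (f i) (f j) = 0" "a i j = -1 ==> br (e i) (br (f i) (f j)) = f j"
  "a i j = -1 ==> br (f i) (br (f i) (f j)) = 0"
proof -
 have d: "hat (- h i)$k$l = 0" if "k~=l" for k l using h_diag[OF i that] hat_lin(2)[of "-1" "h i"] by simp
 have h0: "br (f i) (e i) = - h i" using br_anti[of "f i" "e i"] ef[OF i] by simp
 have h2: "br (- h i) (f i) = msc 2 (f i)" unfolding br_lin using h_f[OF i i] a_diag[OF i] by simp
 have u: "br (- h i) (f j) = msc (of_int (a i j)) (f j)" unfolding br_lin using h_f[OF i j] by simp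
 note s = serre[OF d h0 h2 ef_comm[OF i j ne] u]
 show "a i j = 0 ==> br (f i) (f j) = 0" "a i j = -1 ==> br (e i) (br (f i) (f j)) = f j"
  "a i j = -1 ==> br (f i) (br (f i) (f j)) = 0" by (rule s, assumption+)+
qed

text \<open>The scale of the trace form at the simple root \<open>i\<close>: by
  \<open>kap_hh\<close> the coroot has norm \<open>2 * d i\<close>.\<close>

definition "d i = kap (e i) (f i)"

lemma kap_hh: "i:I ==> K:tt ==> br K (e i) = msc c (e i) ==> kap K (h i) = c * d i" using kap_br[of K "e i" "f i"] ef[of i] by (simp add: d_def kap_lin)

lemma h_nz: assumes "i:I" shows "h i~=0"
proof
 assume "h i = 0"
 hence "msc 2 (e i) = 0" using h_e[OF assms assms] a_diag[OF assms] by (simp add: br_lin)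
 hence "msc (1 / 2) (msc 2 (e i)) = 0" by (simp only: msc_simps)
 thus False using e_root(3)[OF assms] by simp
qed

lemma d_pos: assumes "i:I" obtains q where "q > 0" "d i = of_real q"
proof -
 obtain p where p: "p > 0" "kap (h i) (h i) = of_real p" using tt_pos[OF h_tt h_nz, OF assms assms] efh(5)[OF assms] by auto
 have "kap (h i) (h i) = 2 * d i" using kap_hh[OF assms h_tt[OF assms] h_e[OF assms assms]] a_diag[OF assms] by simp
 hence "d i = of_real (p / 2)" using p(2) by simp
 thus ?thesis using p(1) that[of "p / 2"] by simp
qed

text \<open>Both \<open>a i j * d j\<close> and \<open>a j i * d i\<close> compute the trace form of
  \<open>h i\<close> and \<open>h j\<close>. Hence the two integers vanish together, and otherwise
  both are -1 off the diagonal.\<close>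

lemma a_symd: assumes i: "i:I" and j: "j:I" shows "a i j = a j i" "a i j~=0 ==> d i = d j"
proof -
 have "kap (h i) (h j) = of_int (a i j) * d j" "kap (h j) (h i) = of_int (a j i) * d i" by (rule kap_hh[OF j h_tt[OF i] h_e[OF i j]], rule kap_hh[OF i h_tt[OF j] h_e[OF j i]])
 hence e: "of_int (a i j) * d j = of_int (a j i) * d i" using kap_sym by metis
 moreover have "d i~=0" "d j~=0" using d_pos[OF i] d_pos[OF j] by (metis less_irrefl of_real_eq_0_iff)+
 ultimately have "a i j = 0 \<longleftrightarrow> a j i = 0" by (metis mult_eq_0_iff of_int_eq_0_iff)
 thus s: "a i j = a j i" using a_off[OF i j] a_off[OF j i] by (cases "i = j") auto
 show "d i = d j" if "a i j~=0" using e that s by simp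
qed

lemma T_comm: assumes "s:T" "t:T" shows "s**t = t**s"
proof (rule hat_inj, rule mat_eqI)
 fix k l
 show "hat (s**t)$k$l = hat (t**s)$k$l" unfolding hat_mult hat_t(1)[OF assms(1)] hat_t(2)[OF assms(1)] by (cases "k = l") (use diag[OF assms(2)] in \<open>auto simp: hat_def\<close>)
qed

lemma ht: assumes i: "i:I" and t: "t:T" shows "t**x i b**minv t = mexp (e i) (al i t * of_real b)"
  "t**y i b**minv t = mexp (f i) (1 / al i t * of_real b)" using conj_mexp[OF sgT(1)[OF t]] e_root(2)[OF i] f_root(2)[OF i] t by (simp_all add: efh[OF i] wtv_def mexp_msc mult.commute)

definition "n i = y i 1**x i (-1)**y i 1"

lemma n_sl: assumes i: "i:I" shows "n i = sl i 0 (-1) 1 0" "n i = x i (-1)**y i 1**x i (-1)"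
proof -
 show A: "n i = sl i 0 (-1) 1 0" unfolding n_def sl(1,2)[OF i, symmetric] by (subst sl(4)[OF i], simp, simp, subst sl(4)[OF i]) simp_all
 show "n i = x i (-1)**y i 1**x i (-1)" unfolding A sl(1,2)[OF i, symmetric] by (subst sl(4)[OF i], simp, simp, subst sl(4)[OF i]) simp_all
qed

lemma n_mexp: assumes i: "i:I" shows "n i = mexp (f i) 1**mexp (e i) (-1)**mexp (f i) 1" "n i = mexp (e i) (-1)**mexp (f i) (- (-1))**mexp (e i) (-1)"
 unfolding n_def using efh(2,4)[OF i] n_sl(2)[OF i, unfolded n_def] by simp_all

lemma n_inv: "i:I ==> invertible (n i)" unfolding n_mexp(1) by (intro invertible_mult mexp_invertible)

lemma pp: assumes i: "i:I" and j: "j:I" and ne: "i~=j" and a: "a i j = -1" shows "br (e j) (br (e i) (e j)) = 0" "br (f j) (br (f i) (f j)) = 0"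
proof -
 have "a j i = -1" using a_symd(1)[OF i j] a by simp
 hence "br (e j) (br (e j) (e i)) = 0" "br (f j) (br (f j) (f i)) = 0" using serre_e(3)[OF j i] serre_f(3)[OF j i] ne by auto
 thus "br (e j) (br (e i) (e j)) = 0" "br (f j) (br (f i) (f j)) = 0" using br_anti[of "e i" "e j"] br_anti[of "f i" "f j"] by (simp_all add: br_lin)
qed

lemma nx1: assumes i: "i:I" and j: "j:I" and ne: "i~=j" and a: "a i j = -1" shows "n i**x j b**minv (n i) = x j (- b)**(x i (-1)**x j b**x i 1)"
 using heis_n[OF refl serre_e(3)[OF i j ne a] _ serre_e(2)[OF i j ne a] _ pp(1)[OF i j ne a], of "-1" b]
  ef_comm[OF j i] ne br_anti[of "f i" "e j"] by (simp add: efh i j n_mexp(2))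

lemma ny1: assumes i: "i:I" and j: "j:I" and ne: "i~=j" and a: "a i j = -1" shows "n i**y j b**minv (n i) = y j (- b)**(y i 1**y j b**y i (-1))"
 using heis_n[OF refl serre_f(3)[OF i j ne a] ef_comm[OF i j ne] serre_f(2)[OF i j ne a] _ pp(2)[OF i j ne a], of 1 b] by (simp add: efh i j n_mexp(1))

lemma nn: assumes i: "i:I" and j: "j:I" and ne: "i~=j" and a: "a i j = -1" shows "(n j**n i)**x j b**minv (n j**n i) = x i b"
  "(n j**n i)**y j b**minv (n j**n i) = y i b"
proof -
 have a': "a j i = -1" using a_symd(1)[OF i j] a by simp
 have E1: "Ad (n i) (e j) = - br (e i) (e j)" using Ad_n(1)[OF refl serre_e(3)[OF i j ne a] _ serre_e(2)[OF i j ne a], of "-1"] ef_comm[OF j i] ne br_anti[of "f i" "e j"]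
  by (simp add: n_mexp(2)[OF i])
 have F1: "Ad (n i) (f j) = br (f i) (f j)" using Ad_n(1)[OF refl serre_f(3)[OF i j ne a] ef_comm[OF i j ne] serre_f(2)[OF i j ne a], of 1] by (simp add: n_mexp(1)[OF i])
 have E2: "Ad (n j) (br (e j) (e i)) = e i"
  using Ad_n(2)[OF refl serre_e(3)[OF j i ne[symmetric] a'] _ serre_e(2)[OF j i ne[symmetric] a'], of "-1"] ef_comm[OF i j] ne br_anti[of "f j" "e i"] by (simp add: n_mexp(2)[OF j])
 have F2: "Ad (n j) (br (f j) (f i)) = - f i" using Ad_n(2)[OF refl serre_f(3)[OF j i ne[symmetric] a'] ef_comm[OF j i ne[symmetric]] serre_f(2)[OF j i ne[symmetric] a'], of 1]
  by (simp add: n_mexp(1)[OF j])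
 have m: "Ad g (- X) = - Ad g X" for g X using Ad_lin(2)[of g "-1" X] by simp
 have "Ad (n j**n i) (e j) = e i" "Ad (n j**n i) (f j) = f i" unfolding Ad_comp[OF n_inv[OF j] n_inv[OF i]] E1 F1 br_anti[of "e i" "e j"] br_anti[of "f i" "f j"] by (simp_all add: m E2 F2)
 thus "(n j**n i)**x j b**minv (n j**n i) = x i b"
  "(n j**n i)**y j b**minv (n j**n i) = y i b" using conj_mexp[OF invertible_mult[OF n_inv[OF j] n_inv[OF i]]] by (simp_all add: efh i j)
qed

text \<open>Both sides lie in a Heisenberg group with normal form \<open>y j\<close>, central
  factor, \<open>y i\<close>. The left side has central coordinate \<open>p * q\<close>, so on the
  right the last \<open>y j\<close> must have parameter \<open>p * q / (p + r)\<close> and the first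
  one the rest of \<open>q\<close>.\<close>

lemma yyy: assumes i: "i:I" and j: "j:I" and ne: "i~=j" and a: "a i j = -1" and pr: "0 < p" "0 < r"
 shows "y i p**(y j q**y i r) = y j (q * r / (p + r))**(y i (p + r)**y j (p * q / (p + r)))"
proof -
 let ?Z = "%t. mexp (br (f i) (f j)) (of_real t)"
 have H: "y i s**y j t = y j t**?Z (s * t)**y i s" for s t unfolding efh(4)[OF i] efh(4)[OF j] by (rule heis_group[OF refl serre_f(3)[OF i j ne a] pp(2)[OF i j ne a]])
 have "y i p**(y j q**y i r) = (y i p**y j q)**y i r" by (simp only: mm_assoc)
 also have "... = y j q**?Z (p * q)**y i (p + r)" unfolding H by (simp only: mm_assoc xy_add(2)[OF i, symmetric])
 also have "... = y j (q * r / (p + r) + p * q / (p + r))**?Z ((p + r) * (p * q / (p + r)))**y i (p + r)"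
 proof -
  have "q * r / (p + r) + p * q / (p + r) = q * (p + r) / (p + r)" unfolding add_divide_distrib[symmetric] by (simp add: algebra_simps)
  hence "q * r / (p + r) + p * q / (p + r) = q" "(p + r) * (p * q / (p + r)) = p * q" using pr by simp_all
  thus ?thesis by (simp only:)
 qed
 finally show ?thesis unfolding H xy_add(2)[OF j] by (simp only: mm_assoc)
qed

lemma xy_comm: assumes "i:I" "j:I" "i~=j" shows "x i s**y j t = y j t**x i s" "a i j = 0 ==> x i s**x j t = x j t**x i s" "a i j = 0 ==> y i s**y j t = y j t**y i s"
 using mexp_commute ef_comm[OF assms] serre_e(1)[OF assms] serre_f(1)[OF assms] by (simp_all add: efh assms)

text \<open>The root value must be real here because the parameters of \<open>x i\<close> and
  \<open>y i\<close> are real; \<open>n_T\<close> extends the formula to the complex torus.\<close>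

lemma Ty: assumes i: "i:I" and t: "t:T" and r: "al i t = of_real c" "c~=0" shows "n i**t**minv (n i) = t**alv i (of_real (1 / c))"
proof -
 have al: "al i (minv t) = of_real (1 / c)" using XT_D(6)[OF alpha_XT[OF i] t] r by simp
 note it = sgT(1)[OF t] and t' = sgT(4)[OF t]
 have X: "minv t**x i b**t = x i (b / c)" and Y: "minv t**y i b**t = y i (c * b)" for b using ht[OF i t', of b] r(2) unfolding al minv_minv[OF it] by (simp_all add: efh[OF i] mult.commute)
 have "minv t**n i**t = (minv t**y i 1**t)**(minv t**x i (-1)**t)**(minv t**y i 1**t)" by (simp add: n_def mm_assoc minv_cancel[OF it])
 also have "... = y i c**x i (- 1 / c)**y i c" unfolding X Y by simp
 also have "... = sl i 0 (- 1 / c) c 0" unfolding sl(1,2)[OF i, symmetric] using r(2) by (subst sl(4)[OF i], simp, simp, subst sl(4)[OF i]) simp_all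
 also have "... = alv i (of_real (1 / c))**n i" unfolding n_sl(1)[OF i] using r(2) by (subst sl(3)[OF i, symmetric], simp, subst sl(4)[OF i]) simp_all
 finally have "t**(minv t**n i**t) = t**(alv i (of_real (1 / c))**n i)" by simp
 hence "n i**t = t**alv i (of_real (1 / c))**n i" by (simp add: mm_assoc minv_cancel[OF it])
 hence "n i**t**minv (n i) = t**alv i (of_real (1 / c))**(n i**minv (n i))" by (simp only: mm_assoc)
 thus ?thesis by (simp add: minv[OF n_inv[OF i]])
qed

end

subsection \<open>Block minors along the socle filtration\<close>

lemma projection:
 fixes U :: "(complex^'n) set" assumes "vec.subspace U" shows "EX P :: complex^'n^'n. (ALL v. P *v v:U) & (ALL v:U. P *v v = v)"
proof -
 obtain B where B: "B<=U" "vec.independent B" "U<=vec.span B" using vec.basis_exists[of U] by metis obtain B' where B': "B<=B'" "B'<=UNIV" "vec.independent B'" "UNIV<=vec.span B'"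
  by (rule vec.maximal_independent_subset_extend[OF subset_UNIV B(2)]) obtain f where f: "Vector_Spaces.linear (*s) (*s) f" "!!x. x:B' ==> f x = (if x:B then x else 0)"
  using vec.linear_independent_extend[OF B'(3), of "%x. if x:B then x else 0"] by blast
 have U: "U = vec.span B" using B vec.span_minimal[OF B(1) assms] by blast
 have fB: "f v = v" if "v:vec.span B" for v by (rule vec.linear_eq_on[OF f(1) vec.linear_ident that]) (use f(2) B'(1) in auto)
 have fB': "f v = 0" if "v:vec.span (B' - B)" for v by (rule vec.linear_eq_0_on_span[OF f(1) _ that]) (use f(2) in auto)
 have "f v:U" for v
 proof -
  have "v:vec.span (B Un (B' - B))" using B' by (auto simp: Un_absorb1)
  then obtain u w where uw: "v = u + w" "u:vec.span B" "w:vec.span (B' - B)" unfolding vec.span_Un by blast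
  thus "f v:U" using fB fB' vec.linear_add[OF f(1)] U by auto
 qed
 moreover have "matrix f *v v = f v" for v by (rule matrix_works[OF f(1)])
 ultimately show ?thesis using fB U by (intro exI[of _ "matrix f"]) auto
qed

text \<open>The determinant of the compression of \<open>A\<close> to the image of the projection
  \<open>P\<close>: the summand \<open>mat 1 - P\<close> fills the complement with the
  identity.\<close>

definition bmin :: "complex^'n^'n => complex^'n^'n => complex" where
 "bmin P A = det (P**A**P + (mat 1 - P))"

definition proj :: "complex^'n^'n => (complex^'n) set => bool" where
 "proj P U \<longleftrightarrow> vec.subspace U & (ALL v. P *v v:U) & (ALL v:U. P *v v = v)"

lemma proj_stable:
 fixes P :: "complex^'n^'n" assumes "proj P U" "!!v. v:U ==> A *v v:U" shows "P**(A**P) = A**P" using assms by (simp add: matrix_eq proj_def flip: matrix_vector_mul_assoc)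

lemma proj_idem: "proj P U ==> P**P = P" for P :: "complex^'n^'n" using proj_stable[of P U "mat 1"] by simp

lemma bmin_1: "bmin P (mat 1) = 1" if "proj P U" using proj_idem[OF that] by (simp add: bmin_def)

lemma bmin_mult:
 fixes P :: "complex^'n^'n" assumes P: "proj P U" and b: "!!v. v:U ==> b *v v:U" shows "bmin P (A**b) = bmin P A * bmin P b"
proof -
 have e: "P**(b**P) = b**P" by (rule proj_stable[OF P b])
 note i = proj_idem[OF P]
 have 1: "P**(mat 1 - P) = 0" "(mat 1 - P)**P = 0" "(mat 1 - P)**(mat 1 - P) = mat 1 - P" by (simp_all add: mm_add i)
 have "(P**A**P + (mat 1 - P))**(P**b**P + (mat 1 - P)) =
   P**A**(P**(P**(b**P))) + P**A**(P**(mat 1 - P)) + ((mat 1 - P)**P)**(b**P) + (mat 1 - P)**(mat 1 - P)" by (simp only: mm_add(1,2) mm_assoc add_ac)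
 also have "... = P**(A**b)**P + (mat 1 - P)" by (simp only: 1 e mm_add(7,8) add_0_right mm_assoc)
 finally show ?thesis by (simp add: bmin_def flip: det_mul)
qed

lemma bmin_pf: "bmin P:PF"
proof -
 have "(%A. (P**A**P + (mat 1 - P))$i$j):PF" for i j unfolding vector_add_component mm_nth by (intro polyfun.add polyfun.mult pf_sum pf_const polyfun.coord finite_UNIV) simp_all
 thus ?thesis unfolding bmin_def[abs_def] by (rule pf_det_gen)
qed

text \<open>If \<open>g\<close> moved \<open>w\<close> out of \<open>U\<close> to \<open>u\<close>,
  a rank one correction of \<open>P\<close> would be the identity on \<open>U\<close> and kill
  \<open>u\<close>. Its minor is 1, but after multiplication by \<open>g\<close> the vector
  \<open>w\<close> is killed and the minor is 0.\<close>

lemma bmin_stab: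
 fixes P :: "complex^'n^'n" assumes P: "proj P U" and inv: "!!A. bmin P (A**g) = bmin P A" and w: "w:U" shows "g *v w:U"
proof (rule ccontr)
 define u where "u = g *v w"
 assume "g *v w ~: U"
 hence u: "u ~: U" by (simp add: u_def)
 have sU: "vec.subspace U" using P by (simp add: proj_def) obtain K :: "complex^'n^'n" where K: "!!v. K *v v = 0 \<longleftrightarrow> v:U" using kernel_matrix[OF sU] by blast
 then obtain k where k: "(K *v u)$k~=0" using u by (metis vec_eq_iff zero_index)
 define A where "A = P - (\<chi> i j. (P *v u)$i * (K$k$j / (K *v u)$k))"
 have Av: "A *v v = P *v v - ((K *v v)$k / (K *v u)$k) *s (P *v u)" for v
 proof -
  have "(\<chi> i j. p$i * (K$k$j / t)) *v v = ((K *v v)$k / t) *s p" for p :: "complex^'n" and t by (simp add: vec_eq_iff matrix_vector_mult_def sum_distrib_left sum_divide_distrib mult_ac)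
  thus ?thesis unfolding A_def matrix_vector_mult_diff_rdistrib by simp
 qed
 have "A *v v = v" if "v:U" for v using P K[of v] that by (simp add: Av proj_def)
 hence "A**P = P" using P by (simp add: matrix_eq proj_def flip: matrix_vector_mul_assoc)
 hence A1: "bmin P A = 1" using proj_idem[OF P] by (simp add: bmin_def mm_assoc)
 define D where "D = P**(A**g)**P + (mat 1 - P)"
 have "A *v u = 0" using k by (simp add: Av)
 moreover have "P *v w = w" using P w by (simp add: proj_def)
 ultimately have Dw: "D *v w = 0" by (simp add: D_def matrix_vector_mult_add_rdistrib matrix_vector_mult_diff_rdistrib u_def flip: matrix_vector_mul_assoc)
 have "invertible D" using inv[of A] A1 by (simp add: D_def bmin_def invertible_det_nz)
 hence "w = 0" using minv_vec(1)[of D w] Dw by simp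
 hence "u:U" using vec.subspace_0[OF sU] by (simp add: u_def)
 thus False using u by simp
qed

lemma laur_ext: assumes "laur f" "laur g" "!!c::real. 0 < c ==> f (of_real c) = g (of_real c)" "c~=0" shows "f c = g c"
proof -
 obtain p k q l where p: "!!c. c~=0 ==> f c = poly p c / c ^ k" and q: "!!c. c~=0 ==> g c = poly q c / c ^ l" using assms(1,2) unfolding laur_def by metis
 define r where "r = p * monom 1 l - q * monom 1 k"
 have "poly r (of_real c) = 0" if "c > 0" for c :: real using assms(3)[OF that] p[of "of_real c"] q[of "of_real c"] that by (simp add: r_def poly_monom field_simps)
 hence "of_real ` {0<..}<={z. poly r z = 0}" by auto
 moreover have "infinite (of_real ` {0::real<..} :: complex set)" using finite_imageD[of "of_real :: real => complex" "{0<..}"] infinite_Ioi by (auto simp: inj_on_def)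
 ultimately have "r = 0" using poly_roots_finite finite_subset by blast
 hence "poly p c * c ^ l = poly q c * c ^ k"  using poly_0[of c] by (simp add: r_def poly_monom flip: `r = 0`)
 thus ?thesis unfolding p[OF assms(4)] q[OF assms(4)] using assms(4) by (simp add: frac_eq_eq)
qed

definition rpol :: "(real => complex) => bool" where "rpol f \<longleftrightarrow> (EX P::complex poly. ALL a. f a = poly P (of_real a))"

lemma rpol: "rpol (%_. c)" "rpol f ==> rpol g ==> rpol (%a. f a + g a)" "rpol f ==> rpol g ==> rpol (%a. f a * g a)"
proof -
 show "rpol (%_. c)" unfolding rpol_def by (rule exI[of _ "[:c:]"]) simp
 show "rpol (%a. f a + g a)" "rpol (%a. f a * g a)" if fg: "rpol f" "rpol g"
 proof -
  obtain P Q where "!!a. f a = poly P (of_real a)" "!!a. g a = poly Q (of_real a)" using fg unfolding rpol_def by blast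
  thus "rpol (%a. f a + g a)" "rpol (%a. f a * g a)" unfolding rpol_def by (auto intro: exI[of _ "P + Q"] exI[of _ "P * Q"])
 qed
qed

lemma rpol_poly: "rpol (%a. of_real (poly p a))"
proof (induction p)
 case (pCons c p)
 have "rpol (%a. of_real a)" unfolding rpol_def by (rule exI[of _ "[:0, 1:]"]) simp
 hence "rpol (%a. of_real c + of_real a * of_real (poly p a))" using pCons rpol by simp
 thus ?case by simp
qed (simp add: rpol)

lemma rpol_pf: "p:PF ==> (!!i j. rpol (%a. l a$i$j)) ==> rpol (%a. p (l a))" by (induction rule: polyfun.induct) (auto intro: rpol)

lemma rpol_sum: "finite S ==> (!!s. s:S ==> rpol (f s)) ==> rpol (%a. SUM s:S. f s a)" by (induction S rule: finite_induct) (simp_all add: rpol)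

lemma rpol_cont: assumes "rpol f" shows "continuous_on UNIV f"
proof -
 obtain P where "f = (%a. poly P (of_real a))" using assms unfolding rpol_def by blast
 thus ?thesis by (simp only:) (intro continuous_intros)
qed

lemma rpol_bounded: assumes "rpol f" "(f \<longlongrightarrow> L) at_top" shows "f a = L"
proof -
 obtain P where P: "!!a. f a = poly P (of_real a)" using assms(1) unfolding rpol_def by blast
 have "\<forall>\<^sub>F a in at_top. cmod (f a) < cmod L + 1" using tendsto_norm[OF assms(2)] by (rule order_tendstoD) simp
 then obtain a0 where a0: "!!a. a >= a0 ==> cmod (f a) < cmod L + 1" by (auto simp: eventually_at_top_linorder) obtain c Q where PQ: "P = pCons c Q" by (cases P)
 have "Q = 0"
 proof (rule ccontr)
  assume "Q~=0"
  then obtain r where r: "!!z. r<=cmod z ==> cmod L + 1<=cmod (poly (pCons c Q) z)" using poly_infinity by blast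
  define b where "b = max \<bar>r\<bar> a0"
  have "r<=cmod (of_real b)" by (simp add: b_def)
  hence "cmod L + 1<=cmod (f b)" using r P[of b] by (simp only: PQ)
  thus False using a0[of b] by (simp add: b_def)
 qed
 hence c: "f a = c" for a by (simp add: P PQ)
 hence "f = (%_. c)" by blast
 hence "c = L" using assms(2) LIM_unique tendsto_unique[of at_top f L c] by simp
 thus ?thesis using c by simp
qed

lemma real_points_iff: "A:real_points H \<longleftrightarrow> A:H & cnjm A = A" by (simp add: real_points_def cnjm_real)

lemma real_points_subgroup: assumes "subgroup H GL" shows "subgroup (real_points H) GL"
 using subgroupD[OF assms] by (intro subgroupI) (auto simp: real_points_iff cnjm_1 cnjm_mult cnjm_inv(2)[symmetric])

section \<open>The socle filtration of the real Borel group and its block minors\<close>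

context pin
begin

abbreviation "GR \<equiv> real_points G"
abbreviation "BR \<equiv> real_points Bp"

lemmas sgGR = subgroupD[OF real_points_subgroup[OF conjunct1[OF cl_G[unfolded closed_subgroup_def]]]]
lemmas sgBR = subgroupD[OF real_points_subgroup[OF conjunct1[OF Bp(1)[unfolded closed_subgroup_def]]]]

lemma BR_GR: "BR<=GR" using Bp(4) by (auto simp: real_points_def)

lemma rad_sub: "unipotent_radical Bp<=Bp" unfolding unipotent_radical_def using normal_imp_subgroup subgroup.subset by fastforce

lemma x_BR: "i:I ==> x i b:BR" using x_in_radical rad_sub by (auto simp: real_points_def)
lemma T_BR: "t:T ==> cnjm t = t ==> t:BR" using T_Bp by (auto simp: real_points_iff)
lemma av_BR: "i:I ==> c~=0 ==> alv i (of_real c):BR" using real_xy(3) cochar(1)[OF cochar_av] T_Bp(1) by (auto simp: real_points_def)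

text \<open>Two elements of \<open>GR\<close> define the same real flag exactly when they differ by
  \<open>NR\<close> on the right, so functions on flags are built from functions that transform well
  under this group.\<close>

definition "NR = {g:GR. conj_set g BR = BR}"

lemma NR_D: assumes "g:NR" shows "invertible g" "b:BR ==> minv g**b**g:BR" "b:BR ==> g**b**minv g:BR"
proof -
 show g: "invertible g" using assms sgGR(1) by (auto simp: NR_def)
 show "g**b**minv g:BR" if "b:BR" using assms that by (auto simp: NR_def conj_set_def)
 show "minv g**b**g:BR" if bB: "b:BR"
 proof -
  obtain c where "c:BR" "b = g**c**minv g" using assms bB by (auto simp: NR_def conj_set_def)
  thus ?thesis by (simp add: mm_assoc minv_cancel[OF g] minv[OF g])
 qed
qed

lemma BR_NR: "BR<=NR"
proof
 fix b assume b: "b:BR"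
 have "c:conj_set b BR" if "c:BR" for c unfolding conj_set_def by (rule image_eqI[of _ _ "minv b**c**b"])
   (use sgBR b that in \<open>auto simp: mm_assoc minv_cancel minv sgBR(1)[OF b]\<close>)
 moreover have "conj_set b BR<=BR" using sgBR b by (auto simp: conj_set_def)
 ultimately show "b:NR" using b BR_GR by (auto simp: NR_def)
qed

text \<open>The span of the common eigenvectors of \<open>BR\<close> modulo \<open>U\<close>. Unlike
  a flag chosen by the Lie-Kolchin theorem it is canonical, hence stable under everything that
  normalizes \<open>BR\<close>.\<close>

definition soc :: "(complex^'n) set => (complex^'n) set" where
 "soc U = vec.span {v. ALL b:BR. EX c. b *v v - c *s v:U}"

definition Ws :: "nat => (complex^'n) set" where "Ws k = (soc ^^ k) {0}"

lemma soc_sub: assumes "vec.subspace U" "!!b u. b:BR ==> u:U ==> b *v u:U" shows "U<=soc U"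
proof
 fix u assume "u:U"
 hence "u:{v. ALL b:BR. EX c. b *v v - c *s v:U}" using assms(2) by (auto intro: exI[of _ 0])
 thus "u:soc U" unfolding soc_def by (rule vec.span_base)
qed

lemma stable_span: fixes A :: "complex^'n^'n" assumes "!!v. v:S ==> A *v v:W" "vec.subspace W" "w:vec.span S" shows "A *v w:W"
proof -
 have "vec.subspace {w. A *v w:W}" unfolding vec.subspace_def using vec.subspace_0[OF assms(2)] vec.subspace_add[OF assms(2)] vec.subspace_scale[OF assms(2)]
  by (auto simp: matrix_vector_right_distrib vec.scale)
 thus ?thesis using vec.span_minimal[of S "{w. A *v w:W}"] assms(1,3) by auto
qed

lemma soc_stable: assumes U: "vec.subspace U" "!!g u. g:NR ==> u:U ==> g *v u:U" and g: "g:NR" and w: "w:soc U" shows "g *v w:soc U"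
proof (rule stable_span[OF _ _ w[unfolded soc_def]])
 fix v assume v: "v:{v. ALL b:BR. EX c. b *v v - c *s v:U}"
 have "EX c. b *v (g *v v) - c *s (g *v v):U" if b: "b:BR" for b
 proof -
  obtain c where "(minv g**b**g) *v v - c *s v:U" using v NR_D(2)[OF g b] by blast
  hence "g *v ((minv g**b**g) *v v - c *s v):U" by (rule U(2)[OF g])
  moreover have "g *v ((minv g**b**g) *v v) = b *v (g *v v)" by (simp add: matrix_vector_mul_assoc mm_assoc minv_cancel[OF NR_D(1)[OF g]])
  ultimately show ?thesis by (auto simp: matrix_vector_mult_diff_distrib vec.scale)
 qed
 thus "g *v v:soc U" unfolding soc_def by (intro vec.span_base) simp
qed (simp add: soc_def vec.subspace_span)

lemma Ws: "vec.subspace (Ws k)" "g:NR ==> w:Ws k ==> g *v w:Ws k" "Ws k<=Ws (Suc k)" "Ws (Suc k) = soc (Ws k)" "Ws 0 = {0}"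
proof -
 have 1: "vec.subspace (Ws k) & (ALL g w. g:NR --> w:Ws k --> g *v w:Ws k)" for k
 proof (induction k)
  case 0 show ?case by (simp add: Ws_def vec.subspace_single_0)
 next
  case (Suc k)
  thus ?case using soc_stable[of "Ws k"] by (auto simp: Ws_def) (simp add: soc_def vec.subspace_span)
 qed
 show "vec.subspace (Ws k)" "g:NR ==> w:Ws k ==> g *v w:Ws k" using 1 by auto
 show "Ws (Suc k) = soc (Ws k)" "Ws 0 = {0}" by (simp_all add: Ws_def)
 have "b *v u:Ws k" if "b:BR" "u:Ws k" for b u using 1 BR_NR that by blast
 thus "Ws k<=Ws (Suc k)" using soc_sub[of "Ws k"] 1[of k] by (simp add: Ws_def)
qed

text \<open>In a flag that makes \<open>Bp\<close> triangular, take the first member not contained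
  in \<open>U\<close>. On it \<open>Bp\<close> acts by scalars modulo the preceding member, which
  lies in \<open>U\<close>.\<close>

lemma soc_proper: assumes U: "vec.subspace U" "U~=UNIV" shows "EX v. v ~: U & (ALL b:Bp. EX c. b *v v - c *s v:U)"
proof -
 obtain Q :: "complex^'n^'n" and q where Q: "invertible Q" "bij_betw q UNIV {..<CARD('n)}"
  "!!h. h:Bp ==> minv Q**h**Q:lev q 0" using solvable_flag[OF _ Bp(2,3)] Bp(1) unfolding closed_subgroup_def by metis
 define F where "F = (%j. {v. ALL k. j<=q k --> (minv Q *v v)$k = 0})"
 have F0: "F 0<=U"
 proof
  fix v assume "v:F 0"
  hence "minv Q *v v = 0" by (simp add: F_def vec_eq_iff)
  hence "v = 0" using minv_vec(2)[OF Q(1), of v] by simp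
  thus "v:U" using vec.subspace_0[OF U(1)] by simp
 qed
 have Fn: "F (CARD('n)) = UNIV" using Q(2) by (auto simp: F_def bij_betw_def) (metis lessThan_iff not_less rangeI)
 define j where "j = (LEAST j. ~ F j<=U)"
 have j: "~ F j<=U" unfolding j_def by (rule LeastI[of _ "CARD('n)"]) (use Fn U(2) in auto)
 then obtain j' where j': "j = Suc j'" using F0 by (cases j) auto
 have Fj: "F j'<=U" using not_less_Least[of j' "%j. ~ F j<=U"] j' unfolding j_def[symmetric] by auto obtain v where v: "v:F j" "v ~: U" using j by blast
 have "EX c. b *v v - c *s v:U" if b: "b:Bp" for b
 proof -
  define A where "A = minv Q**b**Q"
  define u where "u = minv Q *v v"
  have A: "A$k$l = 0" if "q l < q k" for k l using Q(3)[OF b] that by (simp add: A_def lev_def)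
  have u: "u$k = 0" if "j<=q k" for k using v(1) that by (simp add: F_def u_def)
  have e: "minv Q *v (b *v v - c *s v) = A *v u - c *s u" for c by (simp add: A_def u_def matrix_vector_mult_diff_distrib vec.scale matrix_vector_mul_assoc mm_assoc minv(1)[OF Q(1)])
  obtain c where c: "!!k. q k = j' ==> (A *v u)$k = c * u$k"
  proof (cases "EX k. q k = j'")
   case True
   then obtain k where k: "q k = j'" by blast
   have "(A *v u)$k' = A$k$k * u$k'" if "q k' = j'" for k'
   proof -
    have kk: "k' = k" using Q(2) k that by (auto simp: bij_betw_def inj_on_def)
    have z: "A$k$l * u$l = (if l = k then A$k$k * u$k else 0)" for l
    proof (cases "q l < q k | j<=q l")
     case True thus ?thesis using A[of l k] u[of l] k j' by auto
    next
     case False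
     hence "q l = q k" using k j' by linarith
     hence "l = k" using Q(2) by (auto simp: bij_betw_def inj_on_def)
     thus ?thesis by simp
    qed
    have "(SUM l:UNIV. A$k$l * u$l) = (SUM l:UNIV. if l = k then A$k$k * u$k else 0)" by (rule sum.cong[OF refl z])
    hence "(SUM l:UNIV. A$k$l * u$l) = A$k$k * u$k" by simp
    thus ?thesis unfolding kk matrix_vector_mult_def by (simp only: vec_lambda_beta)
   qed
   thus thesis by (rule that)
  qed (use that in blast)
  have "(A *v u - c *s u)$k = 0" if k: "j'<=q k" for k
  proof (cases "q k = j'")
   case True thus ?thesis using c by simp
  next
   case False
   hence kj: "j<=q k" using k j' by simp
   hence z: "A$k$l * u$l = 0" for l using A[of l k] u[of l] by (cases "q l < q k") auto
   have "(A *v u)$k = 0" unfolding matrix_vector_mult_def by (simp only: vec_lambda_beta z sum.neutral_const)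
   thus ?thesis using u[OF kj] by simp
  qed
  hence "b *v v - c *s v:F j'" by (simp add: F_def e)
  thus ?thesis using Fj by blast
 qed
 thus ?thesis using v(2) by blast
qed

lemma Ws_top: "Ws (CARD('n)) = UNIV"
proof (rule ccontr)
 assume n: "Ws (CARD('n))~=UNIV"
 have mono: "Ws k<=Ws l" if "k<=l" for k l using lift_Suc_mono_le[of Ws, OF Ws(3) that] .
  have strict: "vec.dim (Ws k) < vec.dim (Ws (Suc k))" if "k<=CARD('n)" for k
  proof -
   have "Ws k~=UNIV" using mono[OF that] n by blast
   then obtain v where v: "v ~: Ws k" "ALL b:Bp. EX c. b *v v - c *s v:Ws k" using soc_proper[OF Ws(1)] by blast
   have "BR<=Bp" by (auto simp: real_points_def)
   hence "v:Ws (Suc k)" unfolding Ws(4) soc_def using v(2) by (intro vec.span_base) auto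
   hence "Ws k \<subset> Ws (Suc k)" using Ws(3)[of k] v(1) by blast
   hence "vec.span (Ws k) \<subset> vec.span (Ws (Suc k))" using Ws(1) by (simp add: vec.span_eq_iff[THEN iffD2])
   thus ?thesis by (rule vec.dim_psubset)
  qed
 have "k<=CARD('n) ==> k < vec.dim (Ws (Suc k))" for k
 proof (induction k)
  case 0 show ?case using strict[of 0] by simp
 next
  case (Suc k) thus ?case using strict[of "Suc k"] by simp
 qed
 from this[of "CARD('n)"] have "CARD('n) < vec.dim (Ws (Suc (CARD('n))))" by simp
 moreover have "vec.dim (Ws (Suc (CARD('n))))<=CARD('n)" by (rule dim_subset_UNIV_cart_gen)
 ultimately show False by simp
qed

definition "Pr k = (SOME P. proj P (Ws k))"

lemma Pr: "proj (Pr k) (Ws k)" unfolding Pr_def by (rule someI_ex) (use projection[OF Ws(1)[of k]] Ws(1)[of k] in \<open>auto simp: proj_def\<close>)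

definition "Dl k A = bmin (Pr k) A"
text \<open>Multiplying over all layers adds up exponents that are nonnegative by
  \<open>mk_nonneg\<close>, so the total is positive as soon as one layer contributes.\<close>

definition "om0 A = (\<Prod>k\<le>CARD('n). Dl k A)"

lemma Dl: "Dl k (mat 1) = 1" "g:NR ==> Dl k (A**g) = Dl k A * Dl k g" "Dl k:PF" using bmin_1[OF Pr] bmin_mult[OF Pr Ws(2)] bmin_pf by (auto simp: Dl_def[abs_def])

lemma om0: "om0 (mat 1) = 1" "g:NR ==> om0 (A**g) = om0 A * om0 g" "om0:PF" using Dl by (auto simp: om0_def[abs_def] prod.distrib intro!: pf_prod)

text \<open>Multiplicativity of \<open>Dl k\<close> is at hand only for real arguments, where the
  coroot value lies in \<open>BR\<close>. The resulting identity of Laurent polynomials extends to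
  complex \<open>c\<close> and shows that the minor never vanishes.\<close>

lemma Dl_av: assumes i: "i:I" shows "EX m::int. ALL c. c~=0 --> Dl k (alv i c) = c powi m"
proof -
 note L = cochar[OF cochar_av[OF i]]
 have l: "laur (%c. Dl k (alv i c))" by (rule laur_pf[OF Dl(3) L(4)])
 then obtain p r where p: "!!c. c~=0 ==> Dl k (alv i c) = poly p c / c ^ r" unfolding laur_def by blast
 have "laur (%c. Dl k (alv i (1 / c)))"
 proof -
  have "EX q s. ALL c. c~=0 --> poly p (1 / c) = poly q c / c ^ s" by (rule exI[of _ "reflect_poly p"], rule exI[of _ "degree p"]) (auto simp: poly_reflect_poly_nz inverse_eq_divide)
  then obtain q s where "!!c. c~=0 ==> poly p (1 / c) = poly q c / c ^ s" by blast
  thus ?thesis unfolding laur_def by (intro exI[of _ "q * monom 1 r"] exI[of _ s]) (simp add: p poly_monom power_divide)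
 qed
 hence l2: "laur (%c. Dl k (alv i c) * Dl k (alv i (1 / c)))" by (rule laur_mult[OF l])
 have "Dl k (alv i c) * Dl k (alv i (1 / c)) = 1" if "c~=0" for c
 proof (rule laur_ext[OF l2 laur_const _ that])
  fix c :: real assume c: "c > 0"
  hence "alv i (of_real (1 / c)):NR" using av_BR[OF i, of "1 / c"] BR_NR by auto
  hence "Dl k (alv i (of_real c)**alv i (of_real (1 / c))) = Dl k (alv i (of_real c)) * Dl k (alv i (of_real (1 / c)))" by (rule Dl(2))
  thus "Dl k (alv i (of_real c)) * Dl k (alv i (1 / of_real c)) = 1" using L(2)[of "of_real c" "1 / of_real c"] L(3) c Dl(1) by simp
 qed
 thus ?thesis using laur_char[OF l] L(3) Dl(1) by (metis (no_types, lifting) mult_eq_0_iff zero_neq_one)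
qed

definition "mk k i = (SOME m::int. ALL c. c~=0 --> Dl k (alv i c) = c powi m)"

lemma mk: "i:I ==> c~=0 ==> Dl k (alv i c) = c powi mk k i" using someI_ex[OF Dl_av[of i k]] unfolding mk_def by blast

lemma y_n: assumes i: "i:I" and t: "t~=0" shows "y i t = x i (1 / t)**n i**alv i (of_real t)**x i (1 / t)" unfolding n_sl(1)[OF i] sl(1,2)[OF i, symmetric] sl(3)[OF i t, symmetric]
 using t by (subst sl(4)[OF i], simp, simp, subst sl(4)[OF i], simp, simp, subst sl(4)[OF i]) simp_all

lemma x_poly: "i:I ==> rpol (%b. x i b$k$l)" "i:I ==> rpol (%b. y i b$k$l)" using polynomial_x[of i k l] polynomial_y[of i k l] rpol_poly by (metis (no_types, lifting) ext)+

lemma Dl_poly: assumes i: "i:I" shows "rpol (%b. Dl k (A**y i b))" "rpol (%b. Dl k (A**x i b**C))" by (rule rpol_pf[OF Dl(3)], unfold mm_nth, intro rpol_sum rpol x_poly[OF i] finite)+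

text \<open>By \<open>y_n\<close>, \<open>y i b\<close> is \<open>n i\<close> times the coroot value
  at \<open>b\<close> between two factors \<open>x i (1 / b)\<close>. The outer factors tend to the
  identity, and the coroot contributes the power of \<open>b\<close>.\<close>

lemma mk_lim: assumes i: "i:I" shows "((%b. Dl k (A**y i b) / of_real b powi mk k i) \<longlongrightarrow> Dl k (A**n i)) at_top"
proof -
 have e: "Dl k (A**y i b) / of_real b powi mk k i = Dl k (A**x i (1 / b)**n i) * Dl k (mat 1**x i (1 / b)**mat 1)" if b: "b > 0" for b
 proof -
  have "Dl k (A**y i b) = Dl k (A**x i (1 / b)**n i**alv i (of_real b)**x i (1 / b))" using y_n[OF i] b by (simp add: mm_assoc)
  also have "... = Dl k (A**x i (1 / b)**n i) * of_real b powi mk k i * Dl k (x i (1 / b))"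
   using Dl(2) BR_NR x_BR[OF i] av_BR[OF i, of b] mk[OF i, of "of_real b"] b by (simp add: subset_iff)
  finally show ?thesis using b by simp
 qed
 have lim: "((%b::real. 1 / b) \<longlongrightarrow> 0) at_top" by real_asymp
 have c: "((%b. g (1 / b)) \<longlongrightarrow> g 0) at_top" if "rpol g" for g using continuous_on_tendsto_compose[OF rpol_cont[OF that] lim] by simp
 have "((%b. Dl k (A**x i (1 / b)**n i) * Dl k (mat 1**x i (1 / b)**mat 1)) \<longlongrightarrow>
   Dl k (A**x i 0**n i) * Dl k (mat 1**x i 0**mat 1)) at_top" by (intro tendsto_mult c[of "%b. Dl k (A**x i b**n i)"] c[of "%b. Dl k (mat 1**x i b**mat 1)"] Dl_poly[OF i])
 hence "((%b. Dl k (A**x i (1 / b)**n i) * Dl k (mat 1**x i (1 / b)**mat 1)) \<longlongrightarrow> Dl k (A**n i)) at_top" using xy_add(4)[OF i] Dl(1) by simp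
 thus ?thesis by (rule Lim_transform_eventually) (rule eventually_mono[OF eventually_gt_at_top[of "0::real"]], use e in simp)
qed

text \<open>With a negative exponent the polynomial \<open>Dl k (y i b)\<close> would tend to 0 and
  so vanish identically, although it equals 1 at \<open>b = 0\<close>.\<close>

lemma mk_nonneg: assumes i: "i:I" shows "0<=mk k i"
proof (rule ccontr)
 assume "~ 0<=mk k i"
 hence m: "nat (- mk k i) > 0" "mk k i = - int (nat (- mk k i))" by auto
 have "((%b::real. (1 / b) ^ nat (- mk k i)) \<longlongrightarrow> 0 ^ nat (- mk k i)) at_top" by (intro tendsto_power) real_asymp
 hence z: "((%b::real. of_real ((1 / b) ^ nat (- mk k i)) :: complex) \<longlongrightarrow> of_real 0) at_top" using m(1) by (intro tendsto_of_real) (simp add: power_0_left)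
 have "((%b. of_real ((1 / b) ^ nat (- mk k i)) * (Dl k (mat 1**y i b) / of_real b powi mk k i)) \<longlongrightarrow> of_real 0 * Dl k (mat 1**n i)) at_top"
  by (rule tendsto_mult[OF z mk_lim[OF i]])
 moreover have "of_real ((1 / b) ^ nat (- mk k i)) * (Dl k (mat 1**y i b) / of_real b powi mk k i) = Dl k (mat 1**y i b)" if "b > 0" for b
 proof -
  have "(of_real b :: complex) powi mk k i = inverse (of_real b ^ nat (- mk k i))" by (subst m(2)) (simp only: power_int_minus power_int_of_nat)
  thus ?thesis using `b > 0` by (simp add: power_divide)
 qed
 ultimately have "((%b. Dl k (mat 1**y i b)) \<longlongrightarrow> of_real 0 * Dl k (mat 1**n i)) at_top"
  by (elim Lim_transform_eventually) (rule eventually_mono[OF eventually_gt_at_top[of "0::real"]])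
 hence "Dl k (mat 1**y i 0) = 0" using rpol_bounded[OF Dl_poly(1)[OF i, of k "mat 1"]] by simp
 thus False using xy_add(5)[OF i] Dl(1) by simp
qed

text \<open>With exponent 0 the polynomial has a finite limit and is therefore constant;
  \<open>bmin_stab\<close> converts this invariance of the minor into stability of the
  layer.\<close>

lemma mk_zero: assumes i: "i:I" and m: "mk k i = 0" and w: "w:Ws k" shows "y i b *v w:Ws k"
proof (rule bmin_stab[OF Pr _ w])
 fix A
 have c: "Dl k (A**y i b) = Dl k (A**n i)" for b using rpol_bounded[OF Dl_poly(1)[OF i]] mk_lim[OF i, of k A] m by simp
 show "bmin (Pr k) (A**y i b) = bmin (Pr k) A" using c[of b] c[of 0] xy_add(5)[OF i] by (simp add: Dl_def)
qed

text \<open>On an eigenvector modulo \<open>Ws k\<close>, conjugation by the coroot value at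
  \<open>s\<close> replaces \<open>x i b\<close> by \<open>x i (s^2 * b)\<close> without changing
  the eigenvalue. Letting \<open>s\<close> tend to 0 shows that it is 1, and differentiation at the
  identity gives the claim.\<close>

lemma e_layer: assumes i: "i:I" and w: "w:Ws (Suc k)" shows "e i *v w:Ws k"
proof (rule stable_span[OF _ Ws(1) w[unfolded Ws(4) soc_def]])
 fix v assume v: "v:{v. ALL b:BR. EX c. b *v v - c *s v:Ws k}" obtain K :: "complex^'n^'n" where K: "!!v. K *v v = 0 \<longleftrightarrow> v:Ws k" using kernel_matrix[OF Ws(1)] by blast
 have ev: "EX c. K *v (b *v v) = c *s (K *v v)" if bB: "b:BR" for b
 proof -
  obtain c where "b *v v - c *s v:Ws k" using v bB by blast
  hence "K *v (b *v v - c *s v) = 0" using K by blast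
  thus ?thesis by (auto simp: matrix_vector_mult_diff_distrib vec.scale)
 qed
 have x1: "K *v (x i b *v v) = K *v v" for b
 proof (cases "v:Ws k")
  case True
  hence "x i b *v v:Ws k" using Ws(2) x_BR[OF i] BR_NR by blast
  thus ?thesis using K True by metis
 next
  case False obtain c where c: "K *v (x i b *v v) = c *s (K *v v)" using ev x_BR[OF i] by blast
  have sc: "K *v (x i (s\<^sup>2 * b) *v v) = c *s (K *v v)" if s: "s > 0" for s :: real
  proof -
   let ?h = "alv i (of_real s)"
   have hB: "?h:BR" "?h:T" using av_BR[OF i] cochar(1)[OF cochar_av[OF i]] s by auto
   have ih: "invertible ?h" using hB sgBR(1) by blast
   have "?h**x i b**minv ?h = x i (s\<^sup>2 * b)" using ht(1)[OF i hB(2)] alpha_av[OF i i, of "of_real s"] a_diag[OF i] s by (simp add: efh(2)[OF i])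
   hence "x i (s\<^sup>2 * b)**?h = (?h**x i b**minv ?h)**?h" by (simp only:)
   hence "x i (s\<^sup>2 * b)**?h = ?h**x i b" by (simp only: mm_assoc minv(2)[OF ih] matrix_mul_rid)
   hence e1: "x i (s\<^sup>2 * b) *v (?h *v v) = ?h *v (x i b *v v)" by (simp add: matrix_vector_mul_assoc) obtain l where l: "?h *v v - l *s v:Ws k" using v hB by blast
   obtain c' where c': "K *v (x i (s\<^sup>2 * b) *v v) = c' *s (K *v v)" using ev x_BR[OF i] by blast
   have st: "K *v (g *v u) = K *v (g *v u')" if "u - u':Ws k" "g:BR" for g u u'
   proof -
    have "g *v (u - u'):Ws k" using Ws(2) that BR_NR by blast
    hence "K *v (g *v (u - u')) = 0" using K by blast
    thus ?thesis by (simp add: matrix_vector_mult_diff_distrib)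
   qed
   have cx: "x i b *v v - c *s v:Ws k" using c K[of "x i b *v v - c *s v"] by (simp add: matrix_vector_mult_diff_distrib vec.scale)
   have Kh: "K *v (?h *v v) = l *s (K *v v)" using K[of "?h *v v - l *s v"] l by (simp add: matrix_vector_mult_diff_distrib vec.scale)
   have "K *v (x i (s\<^sup>2 * b) *v (?h *v v)) = l *s (c' *s (K *v v))" using st[OF l x_BR[OF i]] c' by (simp add: vec.scale)
   moreover have "K *v (?h *v (x i b *v v)) = c *s (l *s (K *v v))" using st[OF cx hB(1)] Kh by (simp add: vec.scale)
   ultimately have "(l * c') *s (K *v v) = (l * c) *s (K *v v)" using e1 by (auto simp: mult.commute)
   moreover have "l~=0"
   proof
    assume "l = 0"
    hence "minv ?h *v (?h *v v):Ws k" using l Ws(2) sgBR(4)[OF hB(1)] BR_NR by auto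
    thus False using False minv_vec(1)[OF ih] by simp
   qed
   moreover have "K *v v~=0" using K False by blast
   ultimately show ?thesis using c' by simp
  qed
  have "K *v (x i b *v v) = K *v v" unfolding vec_eq_iff
  proof
   fix j
   have rp: "rpol (%b. (K *v (x i b *v v))$j)" unfolding matrix_vector_mult_def by (simp, intro rpol_sum rpol x_poly[OF i] finite)
   have "((%s::real. s\<^sup>2 * b) \<longlongrightarrow> 0\<^sup>2 * b) (at_right 0)" by (intro tendsto_intros)
   hence "((%s. (K *v (x i (s\<^sup>2 * b) *v v))$j) \<longlongrightarrow> (K *v (x i 0 *v v))$j) (at_right 0)" using continuous_on_tendsto_compose[OF rpol_cont[OF rp]] by fastforce
   moreover have "((%s. (K *v (x i (s\<^sup>2 * b) *v v))$j) \<longlongrightarrow> (c *s (K *v v))$j) (at_right 0)"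
    by (rule tendsto_eventually) (auto simp: eventually_at_right_less sc eventually_at_filter)
   ultimately show "(K *v (x i b *v v))$j = (K *v v)$j" unfolding c xy_add(4)[OF i] using tendsto_unique trivial_limit_at_right_real by fastforce
  qed
  thus ?thesis .
 qed
 define V :: "complex^'n^'n" where "V = (\<chi> k l. v$k)"
 have V: "(A**V)$k$l = (A *v v)$k" for A :: "complex^'n^'n" and k l by (simp add: mm_nth matrix_vector_mult_def V_def)
 have "rder (%b. K**mexp (e i) (of_real b)**V) (K**e i**V) 0" using rder_mm[OF rder_mm[OF rder_const[of K] mexp_rder[of "e i" 0]] rder_const[of V]] by (simp add: mm_add)
 moreover have "K**mexp (e i) (of_real b)**V = K**V" for b by (rule mat_eqI) (simp add: V x1 flip: efh(2)[OF i] matrix_vector_mul_assoc)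
 ultimately have "K**e i**V = 0" using rder_unique[OF _ rder_const] by simp
 hence "(K**e i) *v v = 0" using V[of "K**e i"] by (simp add: vec_eq_iff)
 hence "K *v (e i *v v) = 0" by (simp add: matrix_vector_mul_assoc)
 thus "e i *v v:Ws k" using K by blast
qed

lemma nx: assumes i: "i:I" shows "n i**x i b**minv (n i) = y i (- b)" "Ad (n i) (e i) = - f i"
proof -
 show 1: "n i**x i b**minv (n i) = y i (- b)" for b
 proof -
  have "n i**x i b = y i (- b)**n i" unfolding n_sl(1)[OF i] sl(1,2)[OF i, symmetric] by (subst sl(4)[OF i], simp, simp, subst sl(4)[OF i]) simp_all
  hence "n i**x i b**minv (n i) = y i (- b)**(n i**minv (n i))" by (simp only: mm_assoc)
  thus ?thesis by (simp add: minv[OF n_inv[OF i]])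
 qed
 have "mexp (Ad (n i) (e i)) (of_real b) = mexp (- f i) (of_real b)" for b using 1[of b] conj_mexp[OF n_inv[OF i], of "e i"] mexp_msc[of "-1" "f i"] by (simp add: efh(2,4)[OF i])
 thus "Ad (n i) (e i) = - f i" using mexp_rder[of "Ad (n i) (e i)" 0] mexp_rder[of "- f i" 0] rder_unique by simp
qed

text \<open>If all the exponents of \<open>alv i\<close> vanished, then \<open>e i\<close> and \<open>f i\<close>, hence also the diagonalizable
 matrix \<open>h i\<close>, would lower the filtration.\<close>

lemma mk_pos: assumes i: "i:I" shows "EX k<=CARD('n). 0 < mk k i"
proof (rule ccontr)
 assume "~ ?thesis"
 hence z: "mk k i = 0" if "k<=CARD('n)" for k using mk_nonneg[OF i, of k] that by force
 define N where "N = CARD('n)"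
 have ys: "y i b *v w:Ws k" if "w:Ws k" "k<=N" for b w k using mk_zero[OF i z] that by (simp add: N_def)
 have xs: "x i b *v w:Ws k" if "w:Ws k" for b w k using Ws(2) x_BR[OF i] BR_NR that by blast
 have ns: "n i *v w:Ws k" if "w:Ws k" "k<=N" for w k using that by (simp add: n_def xs ys flip: matrix_vector_mul_assoc)
 have "minv (n i) = y i (-1)**(x i 1**y i (-1))"
 proof -
  have yy: "y i 1**y i (-1) = mat 1" "x i (-1)**x i 1 = mat 1" using xy_add(2)[OF i, of 1 "-1"] xy_add(1)[OF i, of "-1" 1] xy_add(4,5)[OF i] by simp_all
  have c: "A**(B**C) = C" if "A**B = mat 1" for A B C :: "complex^'n^'n" using that by (simp add: mm_assoc[symmetric])
  show ?thesis unfolding n_def by (intro minv_unique) (simp only: mm_assoc c[OF yy(1)] c[OF yy(2)] yy)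
 qed
 hence ns': "minv (n i) *v w:Ws k" if "w:Ws k" "k<=N" for w k using that by (simp add: xs ys flip: matrix_vector_mul_assoc)
 have fl: "f i *v w:Ws k" if w: "w:Ws (Suc k)" "Suc k<=N" for w k
 proof -
  have "n i *v (e i *v (minv (n i) *v w)):Ws k" using w by (intro ns e_layer[OF i] ns') auto
  moreover have "n i *v (e i *v (minv (n i) *v w)) = - (f i *v w)"
  proof -
   have "n i *v (e i *v (minv (n i) *v w)) = Ad (n i) (e i) *v w" by (simp only: Ad_def matrix_vector_mul_assoc mm_assoc)
   thus ?thesis unfolding nx(2)[OF i] by (simp add: vec_eq_iff matrix_vector_mult_def sum_negf)
  qed
  ultimately show ?thesis using vec.subspace_neg[OF Ws(1)] by fastforce
 qed
 have hl: "h i *v w:Ws k" if w: "w:Ws (Suc k)" "Suc k<=N" for w k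
 proof -
  have "e i *v (f i *v w):Ws k" "f i *v (e i *v w):Ws k"
  proof -
   have a: "f i *v w:Ws (Suc k)" "e i *v w:Ws (Suc k)" using fl[OF w] e_layer[OF i w(1)] Ws(3) by blast+
   show "e i *v (f i *v w):Ws k" by (rule e_layer[OF i a(1)])
   show "f i *v (e i *v w):Ws k" by (rule fl[OF a(2) w(2)])
  qed
  moreover have "h i *v w = e i *v (f i *v w) - f i *v (e i *v w)" unfolding ef[OF i, symmetric] br_def matrix_vector_mult_diff_rdistrib matrix_vector_mul_assoc ..
  ultimately show ?thesis using vec.subspace_diff[OF Ws(1)] by simp
 qed
 have "hat (h i)~=hat 0" using h_nz[OF i] hat_inj by blast
 then obtain k l where "hat (h i)$k$l~=0" by (force simp: hat_lin vec_eq_iff)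
 hence k: "hat (h i)$k$k~=0" using h_diag[OF i] by (cases "k = l") auto
 define v where "v = minv g0 *v axis k 1"
 have gv: "g0 *v v = axis k 1" by (simp add: v_def minv_vec(2)[OF g0(1)])
 have "g0 *v (h i *v v) = hat (h i) *v axis k 1" by (simp add: v_def hat_def matrix_vector_mul_assoc mm_assoc)
 also have "... = hat (h i)$k$k *s axis k 1" using h_diag[OF i] by (auto simp: vec_eq_iff matrix_vector_mult_def axis_def if_distrib[of "%x. _ * x"] cong: if_cong)
 also have "... = g0 *v (hat (h i)$k$k *s v)" by (simp add: vec.scale gv)
 finally have "minv g0 *v (g0 *v (h i *v v)) = minv g0 *v (g0 *v (hat (h i)$k$k *s v))" by simp
 hence hv: "h i *v v = hat (h i)$k$k *s v" by (simp only: minv_vec(1)[OF g0(1)])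
 have "v ~: Ws j" if "j<=N" for j using that
 proof (induction j)
  case 0
  have "v~=0"
  proof
   assume "v = 0"
   hence "axis k (1::complex) = 0" using gv by simp
   hence "axis k (1::complex)$k = 0" by (simp only: zero_index)
   thus False by (simp add: axis_def)
  qed
  thus ?case by (simp add: Ws(5))
 next
  case (Suc j)
  show ?case
  proof
   assume "v:Ws (Suc j)"
   hence "hat (h i)$k$k *s v:Ws j" using hl[OF _ Suc.prems] hv by metis
   hence "(1 / hat (h i)$k$k) *s (hat (h i)$k$k *s v):Ws j" by (rule vec.subspace_scale[OF Ws(1)])
   thus False using Suc k by simp
  qed
 qed
 thus False using Ws_top by (auto simp: N_def)
qed

definition "M i = nat (\<Sum>k\<le>CARD('n). mk k i)"

lemma M: assumes i: "i:I" shows "0 < M i" "c~=0 ==> om0 (alv i c) = c ^ M i"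
proof -
 have nn: "0<=(\<Sum>k\<le>CARD('n). mk k i)" by (intro sum_nonneg mk_nonneg[OF i])
 have "0 < (\<Sum>k\<le>CARD('n). mk k i)" using mk_pos[OF i] mk_nonneg[OF i] by (auto intro!: sum_pos2)
 thus "0 < M i" by (simp add: M_def)
 have p: "(PROD k:S. c powi mk k i) = c powi (SUM k:S. mk k i)" if c: "c~=0" and S: "finite S" for S and c :: complex
  using S by (induction S rule: finite_induct) (simp_all add: power_int_add[OF disjI1[OF c]])
 thus "om0 (alv i c) = c ^ M i" if "c~=0" using p[OF that finite_atMost] nn by (simp add: om0_def mk[OF i that] M_def flip: power_int_of_nat)
qed

end

subsection \<open>Positive definiteness and a dominant element\<close>

lemma scaleR_msc: "c *\<^sub>R X = msc (of_real c) X" by (rule mat_eqI, simp only: vector_scaleR_component msc_nth, rule scaleR_conv_of_real)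

lemma cnjm_mexp: assumes "cnjm X = X" shows "cnjm (mexp X (of_real s)) = mexp X (of_real s)"
proof (rule mexp_unique)
 fix a
 have "rder (%a. cnjm (mexp X (of_real a))) (cnjm (X**mexp X (of_real a))) a" using mexp_rder[of X a] unfolding rder_def by (auto intro!: has_vector_derivative_cnj)
 thus "rder (%a. cnjm (mexp X (of_real a))) (cnjm (mexp X (of_real a))**X) a" by (simp add: cnjm_mult assms flip: mexp_comm)
qed (simp add: cnjm_1)

lemma mexp_diag: assumes "!!k l. k~=l ==> D$k$l = 0" shows "mexp D s$k$k = exp (D$k$k * s)"
proof -
 have "mpow D m$k$l = (if k = l then (D$k$k) ^ m else 0)" for m k l
 proof (induction m arbitrary: k l)
  case (Suc m)
  have "mpow D (Suc m)$k$l = (SUM j:UNIV. if j = k then D$k$k * mpow D m$k$l else 0)" unfolding mpow_Suc mm_nth by (intro sum.cong refl) (auto simp: assms)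
  thus ?case by (simp add: Suc)
 qed (simp add: mat_def)
 thus ?thesis by (simp add: mexp_def exp_def scaleR_conv_of_real power_mult_distrib field_simps)
qed

context pin
begin

lemma om0_exp: assumes "finite F" "F<=I" shows "mexp (SUM j:F. msc (of_real (c j)) (h j)) 1:BR &
  om0 (mexp (SUM j:F. msc (of_real (c j)) (h j)) 1) = of_real (exp (SUM j:F. c j * M j))" using assms
proof (induction F rule: finite_induct)
 case empty
 have "mexp (msc 0 (0 :: complex^'n^'n)) 1 = mat 1" unfolding mexp_msc by simp
 thus ?case using om0(1) sgBR(2) by simp
next
 case (insert j F)
 let ?S = "SUM j:F. msc (of_real (c j)) (h j)" and ?X = "msc (of_real (c j)) (h j)"
 have j: "j:I" using insert by simp
 have "?S:tt" using insert h_tt by (intro csub_sum[OF csub_lie] csubD(3)[OF csub_lie]) auto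
 hence "br (h j) ?S = 0" using h_br[OF j tt_wt1, of ?S 0] by simp
 hence "br ?S ?X = 0" using br_anti[of ?S "h j"] by (simp add: br_lin)
 hence e: "mexp (?X + ?S) 1 = mexp ?S 1**mexp ?X 1" using mexp_add[of ?S ?X 1] by (simp add: br_def add.commute)
 have X: "mexp ?X 1 = alv j (of_real (exp (c j)))" unfolding efh(6)[OF j] by (simp add: mexp_msc)
 have XB: "mexp ?X 1:BR" unfolding X by (rule av_BR[OF j]) simp
 have "om0 (mexp ?X 1) = of_real (exp (c j * M j))" unfolding X using M(2)[OF j, of "of_real (exp (c j))"] by (simp add: exp_of_nat_mult[symmetric] mult.commute flip: of_real_power)
 thus ?case using insert e XB sgBR(3)[OF _ XB] om0(2)[of "mexp ?X 1" "mexp ?S 1"] BR_NR by (simp add: exp_add mult.commute subset_iff)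
qed

text \<open>Evaluating \<open>om0\<close> on the exponential of the combination gives the
  exponential of the sum of \<open>c j * M j\<close>, and the exponents \<open>M j\<close> are
  positive.\<close>

lemma no_rel: assumes "!!j. j:I ==> 0<=c j" "(SUM j:I. msc (of_real (c j)) (h j)) = 0" "i:I" shows "c i = 0"
proof -
 have "mexp (msc 0 (0 :: complex^'n^'n)) 1 = mat 1" unfolding mexp_msc by simp
 hence "of_real (exp (SUM j:I. c j * M j)) = (1 :: complex)" using om0_exp[OF finite_I subset_refl, of c] assms(2) om0(1) by simp
 hence "(SUM j:I. c j * M j) = 0" by (metis exp_eq_one_iff of_real_eq_1_iff)
 hence "c i * M i = 0" using finite_I assms(1,3) by (subst (asm) sum_nonneg_eq_0_iff) auto
 thus ?thesis using M(1)[OF assms(3)] by simp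
qed

text \<open>Definiteness is inherited from the trace form on \<open>tt\<close>. The coefficients of
  \<open>H\<close> are divided by the square root of \<open>r i\<close> to cancel the scales
  \<open>d i\<close>. Absolute values make them nonnegative, so that \<open>no_rel\<close> gives
  \<open>H ~= 0\<close>, and do not increase the quadratic form because off-diagonal entries are at
  most 0.\<close>

lemma a_pos:
 fixes v :: "'i => int" assumes k: "k:I" "v k~=0" shows "0 < (SUM i:I. v i * (SUM j:I. a i j * v j))"
proof -
 have "ALL i:I. EX q>0. d i = of_real q" using d_pos by metis
 then obtain r where r: "!!i. i:I ==> 0 < r i" "!!i. i:I ==> d i = of_real (r i)" by metis
 define w where "w i = \<bar>of_int (v i)\<bar> / sqrt (r i)" for i
 define H where "H = (SUM i:I. msc (of_real (w i)) (h i))"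
 have H: "H:tt" unfolding H_def by (intro csub_sum[OF csub_lie] csubD(3)[OF csub_lie] h_tt)
 have Hr: "cnjm H = H"
 proof -
  have "cnjm (SUM i:F. msc (of_real (w i)) (h i)) = (SUM i:F. msc (of_real (w i)) (h i))" if "F<=I" "finite F" for F
   using that(2,1) by (induction F rule: finite_induct) (simp_all add: cnjm_lin efh, rule mat_eqI, simp)
  thus ?thesis using finite_I by (simp add: H_def)
 qed
 have w0: "0<=w j" if "j:I" for j using r(1)[OF that] by (simp add: w_def)
 have "H~=0"
 proof
  assume "H = 0"
  hence "w k = 0" using no_rel[of w k] w0 k(1) unfolding H_def by simp
  thus False using r(1)[OF k(1)] k(2) by (simp add: w_def)
 qed
 then obtain p where p: "p > 0" "kap H H = of_real p" using tt_pos[OF H] Hr by auto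
 have t: "w i * w j * (of_int (a i j) * r j) = \<bar>of_int (v i)\<bar> * of_int (a i j) * \<bar>of_int (v j)\<bar>" if ij: "i:I" "j:I" for i j
 proof (cases "a i j = 0")
  case False
  hence "d i = d j" by (rule a_symd(2)[OF ij])
  hence "r i = r j" using r(2) ij by (metis of_real_eq_iff)
  thus ?thesis using r(1)[OF ij(2)] by (simp add: w_def field_simps)
 qed simp
 have "kap H H = (SUM i:I. SUM j:I. of_real (w i * w j * (of_int (a i j) * r j)))"
 proof -
  have "kap H (msc (of_real (w j)) (h j)) = (SUM i:I. of_real (w i * w j * (of_int (a i j) * r j)))" if j: "j:I" for j
  proof -
   have "kap (h j) H = (SUM i:I. of_real (w i) * kap (h j) (h i))" unfolding H_def kap_sum by (simp add: kap_lin)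
   also have "... = (SUM i:I. of_real (w i) * (of_int (a i j) * of_real (r j)))"
   proof (intro sum.cong refl)
    fix i assume i: "i:I"
    show "of_real (w i) * kap (h j) (h i) = of_real (w i) * (of_int (a i j) * of_real (r j))" using kap_hh[OF j h_tt[OF i] h_e[OF i j]] r(2)[OF j] kap_sym[of "h j" "h i"] by simp
   qed
   finally show ?thesis using kap_sym[of H "h j"] by (simp add: kap_lin sum_distrib_left mult_ac)
  qed
  hence "kap H H = (SUM j:I. SUM i:I. of_real (w i * w j * (of_int (a i j) * r j)))" by (subst (2) H_def) (simp add: kap_sum)
  thus ?thesis by (subst sum.swap)
 qed
 also have "... = of_real (SUM i:I. SUM j:I. \<bar>of_int (v i)\<bar> * of_int (a i j) * \<bar>of_int (v j)\<bar>)" by (simp add: t)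
 finally have "p = (SUM i:I. SUM j:I. \<bar>of_int (v i)\<bar> * of_int (a i j) * \<bar>of_int (v j)\<bar>)" unfolding p(2) of_real_eq_iff .
 also have "... = of_int (SUM i:I. SUM j:I. \<bar>v i\<bar> * a i j * \<bar>v j\<bar>)" by simp
 finally have "0 < (of_int (SUM i:I. SUM j:I. \<bar>v i\<bar> * a i j * \<bar>v j\<bar>) :: real)" using p(1) by (simp only:)
 hence "0 < (SUM i:I. SUM j:I. \<bar>v i\<bar> * a i j * \<bar>v j\<bar>)" by (simp only: of_int_0_less_iff)
 also have "...<=(SUM i:I. SUM j:I. v i * (a i j * v j))"
 proof (intro sum_mono)
  fix i j assume ij: "i:I" "j:I"
  show "\<bar>v i\<bar> * a i j * \<bar>v j\<bar><=v i * (a i j * v j)"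
  proof (cases "i = j")
   case False
   then consider "a i j = 0" | "a i j = -1" using a_off[OF ij] by blast
   thus ?thesis using abs_ge_self[of "v i * v j"] by cases (auto simp: abs_mult)
  qed (simp add: a_diag ij)
 qed
 finally show ?thesis by (simp add: sum_distrib_left)
qed

lemma inner_hat: assumes "X:tt" shows "inner (hat X) (hat Y) = Re (kap X (cnjm Y))"
proof -
 have "inner (hat X) (hat Y) = (SUM k:UNIV. SUM l:UNIV. if l = k then Re (hat X$k$k * cnj (hat Y$k$k)) else 0)"
  unfolding inner_vec_def by (intro sum.cong refl) (auto simp: inner_complex_def tt_diag[OF assms])
 moreover have "kap X (cnjm Y) = kap (hat X) (cnjm (hat Y))" by (simp only: kap_hat hat_cnj[symmetric])
 moreover have "kap (hat X) (cnjm (hat Y)) = (SUM k:UNIV. SUM l:UNIV. if l = k then hat X$k$k * cnj (hat Y$k$k) else 0)"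
  unfolding kap_def trace_def mm_nth by (intro sum.cong refl) (auto simp: tt_diag[OF assms])
 ultimately show ?thesis by simp
qed

text \<open>By \<open>no_rel\<close> the origin is outside the convex hull of the simple coroots. A
  separating hyperplane whose normal lies in the hull gives an element with positive inner product
  against every simple coroot, and this product is the root value times the positive number
  \<open>d i\<close>.\<close>

lemma dominant: "EX H. H:tt & cnjm H = H & (ALL i:I. EX r>0. br H (e i) = msc (of_real r) (e i) & br H (f i) = msc (- of_real r) (f i))"
proof (cases "I = {}")
 case True
 thus ?thesis using csubD(1)[OF csub_lie] by (intro exI[of _ 0]) (simp add: cnjm_real)
next
 case False
 have inj: "inj_on (%i. hat (h i)) I"
 proof (rule inj_onI)
  fix i j assume ij: "i:I" "j:I" "hat (h i) = hat (h j)"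
  hence "h i = h j" using hat_inj by blast
  hence eq: "msc (of_int (a i i)) (e i) = msc (of_int (a j i)) (e i)" using h_e[OF ij(1,1)] h_e[OF ij(2,1)] by simp
  obtain k l where "e i$k$l~=0" using e_root(3)[OF ij(1)] by (metis mat_eqI zero_index)
  hence "a j i = 2" using arg_cong[OF eq, of "%A. A$k$l"] a_diag[OF ij(1)] by simp
  thus "i = j" using a_off[OF ij(2,1)] by auto
 qed
 let ?S = "(%i. hat (h i)) ` I"
 have fin: "finite ?S" using finite_I by simp
 have hs: "(SUM X:?S. u X *\<^sub>R X) = hat (SUM i:I. msc (of_real (u (hat (h i)))) (h i))" for u unfolding sum.reindex[OF inj] hat_sum by (simp add: scaleR_msc hat_lin)
 have 0: "0 ~: convex hull ?S"
 proof
  assume "0:convex hull ?S"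
  then obtain u where u: "ALL X:?S. 0<=u X" "sum u ?S = 1" "(SUM X:?S. u X *\<^sub>R X) = 0" unfolding convex_hull_finite[OF fin] by auto
  have "(SUM i:I. msc (of_real (u (hat (h i)))) (h i)) = 0" using u(3) hs hat_inj[of _ 0] by (simp add: hat_lin)
  hence "u (hat (h i)) = 0" if "i:I" for i using no_rel[of "%i. u (hat (h i))" i] u(1) that by blast
  thus False using u(2) by (simp add: sum.reindex[OF inj])
 qed
 obtain A b where A: "A:convex hull ?S" "0 < b" "!!X. X:convex hull ?S ==> b < inner A X" by (rule separating_hyperplane_closed_0_inset[of "convex hull ?S"])
   (use 0 False finite_imp_compact_convex_hull[OF fin, THEN compact_imp_closed] in auto)
 obtain u where u: "(SUM X:?S. u X *\<^sub>R X) = A" using A(1) unfolding convex_hull_finite[OF fin] by auto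
 define H where "H = (SUM i:I. msc (of_real (u (hat (h i)))) (h i))"
 have HA: "hat H = A" using u hs by (simp add: H_def)
 have H: "H:tt" unfolding H_def by (intro csub_sum[OF csub_lie] csubD(3)[OF csub_lie] h_tt)
 have Hr: "cnjm H = H"
 proof -
  have "cnjm (SUM i:F. msc (of_real (u (hat (h i)))) (h i)) = (SUM i:F. msc (of_real (u (hat (h i)))) (h i))" if "F<=I" "finite F" for F
   using that(2,1) by (induction F rule: finite_induct) (simp_all add: cnjm_lin efh, rule mat_eqI, simp)
  thus ?thesis using finite_I by (simp add: H_def)
 qed
 have "EX r>0. br H (e i) = msc (of_real r) (e i) & br H (f i) = msc (- of_real r) (f i)" if i: "i:I" for i
 proof -
  obtain c where c: "br H (e i) = msc c (e i)" using tt_br[OF H e_root(2)[OF i]] by blast obtain c' where c': "br H (f i) = msc c' (f i)" using tt_br[OF H f_root(2)[OF i]] by blast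
  obtain q where q: "q > 0" "d i = of_real q" using d_pos[OF i] by blast
  have k: "kap H (h i) = c * of_real q" using kap_hh[OF i H c] q(2) by simp
  have "kap (br H (f i)) (e i) = - kap H (h i)" using kap_br[of H "f i" "e i"] br_anti[of "f i" "e i"] ef[OF i] by (simp add: kap_lin)
  hence "c' * of_real q = - c * of_real q" using c' k q(2) kap_sym[of "f i" "e i"] by (simp add: kap_lin d_def)
  hence "(c' + c) * of_real q = 0" by (simp add: distrib_right)
  hence cc: "c' = - c" using q(1) by (simp add: eq_neg_iff_add_eq_0)
  have "0 < inner (hat H) (hat (h i))" using A(3)[of "hat (h i)"] A(2) HA hull_subset[of ?S convex] i by fastforce
  hence pos: "0 < Re (kap H (h i))" using inner_hat[OF H, of "h i"] efh(5)[OF i] by simp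
  have "cnj (kap H (h i)) = kap H (h i)" using cnjm_kap[of H "h i"] Hr efh(5)[OF i] by simp
  hence "cnj c = c" using q(1) by (simp add: k)
  hence cr: "c = of_real (Re c)" by (simp add: complex_eq_iff)
  have "0 < Re c" using pos q(1) by (simp add: k zero_less_mult_iff)
  thus ?thesis using c c' cc cr by (intro exI[of _ "Re c"]) simp
 qed
 thus ?thesis using H Hr by blast
qed

definition "rho = (SOME H. H:tt & cnjm H = H & (ALL i:I. EX r>0. br H (e i) = msc (of_real r) (e i) & br H (f i) = msc (- of_real r) (f i)))"

lemma rho: "rho:tt" "cnjm rho = rho" "i:I ==> EX r>0. br rho (e i) = msc (of_real r) (e i) & br rho (f i) = msc (- of_real r) (f i)"
 using someI_ex[OF dominant] unfolding rho_def[symmetric] by blast+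

definition "E s = mexp rho (of_real s)"
definition "rd k = Re (hat rho$k$k)"
text \<open>Conjugation by the one-parameter group of \<open>rho\<close>: as \<open>s\<close> grows
  it contracts the groups \<open>y i\<close> and expands the groups \<open>x i\<close>.\<close>

definition "Ec s A = E s**A**E (- s)"

lemma E_T: "E s:T" "E s:BR" "invertible (E s)" "minv (E s) = E (- s)" "E s**E (- s) = mat 1" "E (- s)**E s = mat 1"
proof -
 show T: "E s:T" unfolding E_def by (rule lie_mexp[OF cl_T rho(1)])
 thus "E s:BR" by (rule T_BR) (simp add: E_def cnjm_mexp rho(2))
 show "invertible (E s)" using sgT(1)[OF T] .
 show "minv (E s) = E (- s)" by (simp add: E_def minv_mexp)
 show "E s**E (- s) = mat 1" "E (- s)**E s = mat 1" using mexp_inv[of rho "of_real s"] mexp_inv[of rho "- of_real s"] by (simp_all add: E_def)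
qed

lemma Ec_mult: "Ec s (A**B) = Ec s A**Ec s B"
proof -
 have "Ec s A**Ec s B = E s**A**(E (- s)**E s)**B**E (- s)" by (simp only: Ec_def mm_assoc)
 thus ?thesis by (simp add: E_T(6) Ec_def mm_assoc)
qed

lemma Ec_hat: "hat (Ec s A)$k$l = of_real (exp ((rd k - rd l) * s)) * hat A$k$l"
proof -
 have dg: "dg (E s) k = of_real (exp (rd k * s))" for k
 proof -
  have "hat (E s) = mexp (hat rho) (of_real s)" unfolding hat_def E_def by (rule mexp_conj[OF g0(1)])
  moreover have "hat rho$k$k = of_real (rd k)" using arg_cong[OF hat_cnj[of rho], of "%A. A$k$k"] rho(2) by (simp add: rd_def complex_eq_iff)
  ultimately show ?thesis using mexp_diag[of "hat rho" "of_real s" k] tt_diag[OF rho(1)] by (simp add: dg_def exp_of_real flip: of_real_mult)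
 qed
 have "Ad (E s) A = Ec s A" by (simp add: Ad_def Ec_def E_T(4))
 hence "hat (Ec s A)$k$l * of_real (exp (rd l * s)) = of_real (exp (rd k * s)) * hat A$k$l" using hat_Ad[OF E_T(1)[of s], of A k l] by (simp add: dg)
 hence "hat (Ec s A)$k$l = of_real (exp (rd k * s)) / of_real (exp (rd l * s)) * hat A$k$l" by (simp add: field_simps)
 thus ?thesis by (simp add: left_diff_distrib exp_diff)
qed

lemma Ec_xy: assumes i: "i:I" shows "EX r>0. ALL s b. Ec s (x i b) = x i (exp (r * s) * b) & Ec s (y i b) = y i (exp (- r * s) * b)"
proof -
 obtain r where r: "r > 0" "br rho (e i) = msc (of_real r) (e i)" "br rho (f i) = msc (- of_real r) (f i)" using rho(3)[OF i] by blast
 have A: "Ad (E s) X = msc (of_real (exp (q * s))) X" if X: "br rho X = msc (of_real q) X" for q X s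
 proof (rule hat_inj, rule mat_eqI)
  fix k l
  have "hat (br rho X)$k$l = (hat rho$k$k - hat rho$l$l) * hat X$k$l"
  proof -
   have "(hat rho**hat X)$k$l = (SUM m:UNIV. if m = k then hat rho$k$k * hat X$k$l else 0)"
    "(hat X**hat rho)$k$l = (SUM m:UNIV. if m = l then hat X$k$l * hat rho$l$l else 0)" unfolding mm_nth by (intro sum.cong refl; auto simp: tt_diag[OF rho(1)])+
   thus ?thesis by (simp add: br_def hat_lin hat_mult algebra_simps)
  qed
  hence "of_real q * hat X$k$l = (hat rho$k$k - hat rho$l$l) * hat X$k$l" by (simp add: X hat_lin)
  hence "hat X$k$l = 0 | of_real q = hat rho$k$k - hat rho$l$l" by simp
  hence "hat X$k$l = 0 | q = rd k - rd l" unfolding rd_def by (metis Re_complex_of_real minus_complex.simps(1))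
  moreover have "Ad (E s) X = Ec s X" by (simp add: Ad_def Ec_def E_T(4))
  ultimately show "hat (Ad (E s) X)$k$l = hat (msc (of_real (exp (q * s))) X)$k$l" by (auto simp: Ec_hat hat_lin)
 qed
 have "Ec s (x i b) = x i (exp (r * s) * b)" for s b using conj_mexp[OF E_T(3)[of s], of "e i" "of_real b"] A[OF r(2)] by (simp add: E_T(4) Ec_def efh(2)[OF i] mexp_msc)
 moreover have "Ec s (y i b) = y i (exp (- r * s) * b)" for s b
  using conj_mexp[OF E_T(3)[of s], of "f i" "of_real b"] A[of "f i" "- r"] r(3) by (simp add: E_T(4) Ec_def efh(4)[OF i] mexp_msc)
 ultimately show ?thesis using r(1) by blast
qed

end

subsection \<open>Exponential expansions\<close>

inductive ep :: "(real => complex^'n^'n => complex) => bool" where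
 base: "q:PF ==> ep (%s A. of_real (exp (l * s)) * q A)"
| add: "ep u ==> ep v ==> ep (%s A. u s A + v s A)"

lemma ep_mult: assumes "ep u" "ep v" shows "ep (%s A. u s A * v s A)" using assms
proof (induction u rule: ep.induct)
 case (base q l)
 from base(2) show ?case
 proof (induction v rule: ep.induct)
  case (base q' l')
  have "ep (%s A. of_real (exp ((l + l') * s)) * (q A * q' A))" by (intro ep.base polyfun.mult `q:PF` base)
  moreover have "(%s A. of_real (exp ((l + l') * s)) * (q A * q' A)) =
    (%s A. (of_real (exp (l * s)) * q A) * (of_real (exp (l' * s)) * q' A))"
  proof -
   have "exp ((l + l') * s) = exp (l * s) * exp (l' * s)" for s by (simp add: distrib_right exp_add)
   thus ?thesis by (intro ext) (simp only: of_real_mult mult_ac)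
  qed
  ultimately show ?case by (simp only:)
 next
  case (add u v) thus ?case using ep.add by (fastforce simp: distrib_left)
 qed
next
 case (add u v') thus ?case using ep.add by (fastforce simp: distrib_right)
qed

lemma ep_const: "q:PF ==> ep (%s. q)" using ep.base[of q 0] by simp

lemma ep_sum: "finite S ==> (!!k. k:S ==> ep (u k)) ==> ep (%s A. SUM k:S. u k s A)"
proof (induction S rule: finite_induct)
 case empty thus ?case using ep_const[of "%_. 0"] by simp
next
 case (insert k S) thus ?case using ep.add[of "u k" "%s A. SUM k:S. u k s A"] by simp
qed

lemma ep_expand: assumes "ep u" shows "EX S C. finite S & (ALL l. C l:PF) & (ALL l. l ~: S --> C l = (%_. 0)) & (ALL s A. u s A = (SUM l:S. of_real (exp (l * s)) * C l A))" using assms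
proof (induction rule: ep.induct)
 case (base q l)
 thus ?case by (intro exI[of _ "{l}"] exI[of _ "%k. if k = l then q else (%_. 0)"]) auto
next
 case (add u v) obtain S C where 1: "finite S & (ALL l. C l:PF) & (ALL l. l ~: S --> C l = (%_. 0)) &
  (ALL s A. u s A = (SUM l:S. of_real (exp (l * s)) * C l A))" using add(3) by blast obtain S' C' where 2: "finite S' & (ALL l. C' l:PF) & (ALL l. l ~: S' --> C' l = (%_. 0)) &
  (ALL s A. v s A = (SUM l:S'. of_real (exp (l * s)) * C' l A))" using add(4) by blast
 have u: "u s A = (SUM l:S Un S'. of_real (exp (l * s)) * C l A)" for s A using 1 2 by (subst conjunct2[OF conjunct2[OF conjunct2[OF 1]], rule_format], intro sum.mono_neutral_left) auto
 have v: "v s A = (SUM l:S Un S'. of_real (exp (l * s)) * C' l A)" for s A using 1 2 by (subst conjunct2[OF conjunct2[OF conjunct2[OF 2]], rule_format], intro sum.mono_neutral_left) auto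
 show ?case
 proof (intro exI[of _ "S Un S'"] exI[of _ "%l A. C l A + C' l A"] conjI allI impI)
  show "(%A. C l A + C' l A):PF" for l using 1 2 by (intro polyfun.add) blast+
  show "u s A + v s A = (SUM l:S Un S'. of_real (exp (l * s)) * (C l A + C' l A))" for s A unfolding u v by (simp add: sum.distrib distrib_left)
 qed (use 1 2 in auto)
qed

lemma exp_decay_real: fixes b :: real assumes "m < 0" shows "((%s. exp (m * s) * b) \<longlongrightarrow> 0) at_top"
proof -
 have "((%s::real. exp (m * s)) \<longlongrightarrow> 0) at_top" by (rule filterlim_compose[OF exp_at_bot filterlim_tendsto_neg_mult_at_bot[OF tendsto_const assms filterlim_ident]])
 from tendsto_mult[OF this tendsto_const[of b]] show ?thesis by simp
qed

lemma exp_decay: "m < 0 ==> ((%s::real. of_real (exp (m * s)) * (c::complex)) \<longlongrightarrow> 0) at_top"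
proof -
 assume "m < 0"
 hence "((%s::real. exp (m * s)) \<longlongrightarrow> 0) at_top" using exp_decay_real[of m 1] by simp
 hence "((%s::real. of_real (exp (m * s)) * c) \<longlongrightarrow> of_real 0 * c) at_top" by (intro tendsto_intros)
 thus ?thesis by simp
qed

lemma exp_grow: assumes "((%s::real. of_real (exp (m * s)) * (c::complex)) \<longlongrightarrow> L) at_top" "0 < m" shows "c = 0"
proof -
 have "((%s::real. of_real (exp (- m * s)) * 1 * (of_real (exp (m * s)) * c)) \<longlongrightarrow> 0 * L) at_top" using exp_decay[of "- m" 1] assms by (intro tendsto_mult) auto
 hence "((%s::real. c) \<longlongrightarrow> 0) at_top" by (simp add: mult.assoc[symmetric] flip: of_real_mult exp_add)
 thus ?thesis by (simp add: tendsto_const_iff)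
qed

text \<open>A finite limit forces the coefficient of the largest growing exponential to vanish,
  which removes them one by one. Decaying terms disappear in the limit, and only the constant term
  remains.\<close>

lemma exp_coeff:
 fixes c :: "real => complex" assumes "finite S" "((%s. SUM l:S. of_real (exp (l * s)) * c l) \<longlongrightarrow> L) at_top" shows "(if 0:S then c 0 else 0) = L" using assms
proof (induction S rule: finite_linorder_max_induct)
 case empty thus ?case by (simp add: tendsto_const_iff)
next
 case (insert b S)
 have nb: "b ~: S" using insert(2) by blast
 hence sum: "(SUM l:insert b S. of_real (exp (l * s)) * c l) = of_real (exp (b * s)) * c b + (SUM l:S. of_real (exp (l * s)) * c l)" for s using insert(1) by simp
 show ?case
 proof (cases "b > 0")
  case True
  have dec: "((%s. SUM l:S. of_real (exp ((l - b) * s)) * c l) \<longlongrightarrow> (SUM l:S. 0)) at_top" using insert(2) by (intro tendsto_sum exp_decay) auto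
  have "((%s. of_real (exp (- b * s)) * 1 * (SUM l:insert b S. of_real (exp (l * s)) * c l)) \<longlongrightarrow> 0 * L) at_top"
   using exp_decay[of "- b" 1] True insert(4) by (intro tendsto_mult) auto
  moreover have "of_real (exp (- b * s)) * 1 * (SUM l:insert b S. of_real (exp (l * s)) * c l) =
    c b + (SUM l:S. of_real (exp ((l - b) * s)) * c l)" for s unfolding sum by (simp add: distrib_left sum_distrib_left left_diff_distrib exp_diff exp_minus field_simps)
  ultimately have "((%s. (c b + (SUM l:S. of_real (exp ((l - b) * s)) * c l)) - (SUM l:S. of_real (exp ((l - b) * s)) * c l)) \<longlongrightarrow> 0 * L - (SUM l:S. 0)) at_top"
   using dec by (intro tendsto_diff) simp_all
  hence cb: "c b = 0" by (simp add: tendsto_const_iff)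
  thus ?thesis using insert(3) insert(4) True sum by simp
 next
  case False
  have "((%s. SUM l:S. of_real (exp (l * s)) * c l) \<longlongrightarrow> (SUM l:S. 0)) at_top" using insert(2) False by (intro tendsto_sum exp_decay) fastforce
  moreover have "((%s::real. of_real (exp (b * s)) * c b) \<longlongrightarrow> (if b = 0 then c b else 0)) at_top" using False exp_decay[of b "c b"] by auto
  ultimately have "((%s. SUM l:insert b S. of_real (exp (l * s)) * c l) \<longlongrightarrow> (if b = 0 then c b else 0) + (SUM l:S. 0)) at_top" unfolding sum by (intro tendsto_add)
  hence "(if b = 0 then c b else 0) = L" using tendsto_unique[OF _ _ insert(4)] by force
  moreover have "0 ~: S" using insert(2) False by fastforce
  ultimately show ?thesis by auto
 qed
qed

section \<open>The coefficient of the big cell and the verification of the abstract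
  relations\<close>

context pin
begin

lemma Ec_ep: "p:PF ==> ep (%s A. p (Ec s A))"
proof (induction rule: polyfun.induct)
 case (coord i j)
 have "X$i$j = (SUM k:UNIV. SUM l:UNIV. minv g0$i$k * hat X$k$l * g0$l$j)" for X :: "complex^'n^'n"
 proof -
  have "X = minv g0**(hat X**g0)" by (simp add: hat_def mm_assoc minv_cancel[OF g0(1)] minv[OF g0(1)])
  hence "X$i$j = (minv g0**(hat X**g0))$i$j" by simp
  thus ?thesis unfolding mm_nth by (simp add: sum_distrib_left mult.assoc)
 qed
 hence e: "Ec s A$i$j = (SUM k:UNIV. SUM l:UNIV. of_real (exp ((rd k - rd l) * s)) * (minv g0$i$k * hat A$k$l * g0$l$j))" for s A by (simp add: Ec_hat mult_ac)
 have "(%A. minv g0$i$k * hat A$k$l * g0$l$j):PF" for k l unfolding hat_def mm_nth by (intro polyfun.mult pf_const pf_sum polyfun.coord finite) simp_all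
 thus ?case unfolding e by (intro ep_sum ep.base finite)
qed (auto intro: ep_const ep.add ep_mult)

definition "omC = (SOME SC. finite (fst SC) & (ALL l. snd SC l:PF) & (ALL l. l ~: fst SC --> snd SC l = (%_. 0)) &
 (ALL s A. om0 (Ec s A) = (SUM l:fst SC. of_real (exp (l * s)) * snd SC l A)))"
text \<open>The constant term of \<open>om0\<close> under conjugation by \<open>rho\<close>. On the
  big cell it agrees with the limit of the conjugates and forgets the contracted factor, yet being a
  polynomial it is defined at every matrix.\<close>

definition "om A = snd omC 0 A"

lemma omC: "finite (fst omC)" "snd omC l:PF" "l ~: fst omC ==> snd omC l = (%_. 0)"
 "om0 (Ec s A) = (SUM l:fst omC. of_real (exp (l * s)) * snd omC l A)"
proof -
 obtain S C where "finite S & (ALL l. C l:PF) & (ALL l. l ~: S --> C l = (%_. 0)) & (ALL s A. om0 (Ec s A) = (SUM l:S. of_real (exp (l * s)) * C l A))"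
  using ep_expand[OF Ec_ep[OF om0(3)]] by auto
 hence "EX SC. finite (fst SC) & (ALL l. snd SC l:PF) & (ALL l. l ~: fst SC --> snd SC l = (%_. 0)) &
   (ALL s A. om0 (Ec s A) = (SUM l:fst SC. of_real (exp (l * s)) * snd SC l A))" by (intro exI[of _ "(S, C)"]) simp
 from someI_ex[OF this, folded omC_def]
 show "finite (fst omC)" "snd omC l:PF" "l ~: fst omC ==> snd omC l = (%_. 0)"
  "om0 (Ec s A) = (SUM l:fst omC. of_real (exp (l * s)) * snd omC l A)" by auto
qed

lemma om_PF: "om:PF" using omC(2)[of 0] by (simp add: om_def[abs_def])

lemma om_lim: assumes "((%s. om0 (Ec s A)) \<longlongrightarrow> L) at_top" shows "om A = L"
 using exp_coeff[OF omC(1), of "%l. snd omC l A" L] assms omC(3)[of 0] unfolding omC(4) om_def by (auto split: if_splits)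

text \<open>The conjugating elements lie in the real Borel group, so multiplicativity on the right
  applies to each of them and their contributions cancel.\<close>

lemma Ec_NR: assumes g: "g:NR" shows "om0 (A**Ec s g) = om0 A * om0 g"
proof -
 have ei: "E s:NR" "E (- s):NR" using E_T(2) BR_NR by auto
 have "om0 (A**Ec s g) = om0 (((A**E s)**g)**E (- s))" by (simp add: Ec_def mm_assoc)
 also have "... = om0 A * om0 g * (om0 (E s) * om0 (E (- s)))" by (simp add: om0(2) ei g)
 also have "om0 (E s) * om0 (E (- s)) = 1" using om0(2)[OF ei(2), of "E s"] om0(1) by (simp add: E_T(5))
 finally show ?thesis by simp
qed

lemma om_NR: assumes g: "g:NR" shows "om (A**g) = om A * om0 g"
proof -
 have "(SUM l:fst omC. of_real (exp (l * s)) * (snd omC l (A**g) - snd omC l A * om0 g)) = om0 (Ec s (A**g)) - om0 (Ec s A) * om0 g" for s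
  unfolding omC(4) by (simp add: right_diff_distrib sum_subtractf sum_distrib_right mult.assoc)
 also have "... s = 0" for s using Ec_NR[OF g, of "Ec s A" s] by (simp add: Ec_mult)
 finally have "((%s. SUM l:fst omC. of_real (exp (l * s)) * (snd omC l (A**g) - snd omC l A * om0 g)) \<longlongrightarrow> 0) at_top" by simp
 from exp_coeff[OF omC(1) this] show ?thesis using omC(3)[of 0] unfolding om_def by (auto split: if_splits)
qed

lemma om0_nz: "g:NR ==> om0 g~=0"
proof -
 assume g: "g:NR"
 have i: "invertible g" by (rule NR_D(1)[OF g])
 have "om0 (minv g**g) = om0 (minv g) * om0 g" by (rule om0(2)[OF g])
 thus ?thesis using om0(1) by (auto simp: minv[OF i])
qed

text \<open>Dynamical substitutes for the negative unipotent group and the Borel group: contraction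
  to the identity in one direction, existence of a limit in the other. Both are stable under
  products and contain the respective generators.\<close>

definition "Uc = {v. ((%s. Ec s v) \<longlongrightarrow> mat 1) at_top}"
definition "Bc = {b. EX L. ((%s. Ec (- s) b) \<longlongrightarrow> L) at_top}"

lemma mm_tendsto: "(F \<longlongrightarrow> A) net ==> (K \<longlongrightarrow> B) net ==> ((%s. F s**K s) \<longlongrightarrow> A**B) net"
 for F :: "_ => complex^'m^'m" by (intro vec_tendstoI) (simp add: mm_nth tendsto_sum tendsto_mult tendsto_vec_nth)

lemma rpol_tendsto:
 fixes z :: "real => complex^'m^'m" assumes "!!k l. rpol (%b. z b$k$l)" "(u \<longlongrightarrow> b) net" shows "((%s. z (u s)) \<longlongrightarrow> z b) net"
 by (intro vec_tendstoI) (rule continuous_on_tendsto_compose[OF rpol_cont[OF assms(1)] assms(2)], simp_all)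

lemma Uc: "mat 1:Uc" "u:Uc ==> v:Uc ==> u**v:Uc" "i:I ==> y i b:Uc"
 "mat 1:Bc" "u:Bc ==> v:Bc ==> u**v:Bc" "i:I ==> x i b:Bc" "t:T ==> t:Bc"
proof -
 have 1: "Ec s (mat 1) = mat 1" for s by (simp add: Ec_def E_T(5))
 thus "mat 1:Uc" "mat 1:Bc" unfolding Uc_def Bc_def by (auto intro: exI[of _ "mat 1"])
 show "u**v:Uc" if "u:Uc" "v:Uc" for u v
 proof -
  have "((%s. Ec s u**Ec s v) \<longlongrightarrow> mat 1**mat 1) at_top" by (rule mm_tendsto) (use that in \<open>auto simp: Uc_def\<close>)
  thus ?thesis by (simp add: Uc_def Ec_mult)
 qed
 show "u**v:Bc" if "u:Bc" "v:Bc" for u v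
 proof -
  obtain L L' where "((%s. Ec (- s) u) \<longlongrightarrow> L) at_top" "((%s. Ec (- s) v) \<longlongrightarrow> L') at_top" using `u:Bc` `v:Bc` unfolding Bc_def by blast
  from mm_tendsto[OF this] show ?thesis unfolding Bc_def Ec_mult[symmetric] by blast
 qed
 show "y i b:Uc" if i: "i:I" for i b
 proof -
  obtain r where r: "r > 0" "!!s. Ec s (y i b) = y i (exp (- r * s) * b)" using Ec_xy[OF i] by blast
  have "((%s. exp (- r * s) * b) \<longlongrightarrow> 0) at_top" using r(1) exp_decay_real[of "- r" b] by simp
  from rpol_tendsto[OF x_poly(2)[OF i] this] show ?thesis unfolding Uc_def by (simp add: r(2) xy_add(5)[OF i])
 qed
 show "x i b:Bc" if i: "i:I" for i b
 proof -
  obtain r where r: "r > 0" "!!s. Ec s (x i b) = x i (exp (r * s) * b)" using Ec_xy[OF i] by blast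
  have "((%s. exp (r * - s) * b) \<longlongrightarrow> 0) at_top" using r(1) exp_decay_real[of "- r" b] by simp
  from rpol_tendsto[OF x_poly(1)[OF i] this] show ?thesis unfolding Bc_def by (auto simp: r(2))
 qed
 show "t:Bc" if t: "t:T" for t
 proof -
  have "Ec s t = t" for s unfolding Ec_def T_comm[OF E_T(1) t] by (simp only: mm_assoc E_T(5) matrix_mul_rid)
  thus ?thesis unfolding Bc_def by auto
 qed
qed

lemma om_UB: assumes v: "v:Uc" and b: "b:NR" shows "om (v ** b) = om0 b"
proof -
 have "om v = 1"
 proof (rule om_lim)
  have "isCont om0 (mat 1)" using pf_continuous[OF om0(3)] by (simp add: continuous_on_eq_continuous_at)
  hence "((%s. om0 (Ec s v)) \<longlongrightarrow> om0 (mat 1)) at_top" using v isCont_tendsto_compose unfolding Uc_def by blast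
  thus "((%s. om0 (Ec s v)) \<longlongrightarrow> 1) at_top" by (simp add: om0(1))
 qed
 thus ?thesis using om_NR[OF b] by simp
qed

text \<open>In diagonalizing coordinates conjugation scales each entry by an exponential.
  Convergence in both directions kills every entry with nonzero rate, and the others already have
  the values of the limit, the identity.\<close>

lemma Uc_Bc: assumes "v:Uc" "v:Bc" shows "v = mat 1"
proof (rule hat_inj, rule mat_eqI)
 fix k l
 have ht: "((%s. hat (F s)) \<longlongrightarrow> hat L) at_top" if "(F \<longlongrightarrow> L) at_top" for F :: "real => complex^'n^'n" and L
  unfolding hat_def by (intro mm_tendsto tendsto_const that)
 have u: "((%s. of_real (exp ((rd k - rd l) * s)) * hat v$k$l) \<longlongrightarrow> hat (mat 1)$k$l) at_top"
  using tendsto_vec_nth[OF tendsto_vec_nth[OF ht]] assms(1) unfolding Uc_def Ec_hat[symmetric] by blast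
 obtain L where L: "((%s. Ec (- s) v) \<longlongrightarrow> L) at_top" using assms(2) unfolding Bc_def by blast
 have "((%s. of_real (exp ((rd k - rd l) * - s)) * hat v$k$l) \<longlongrightarrow> hat L$k$l) at_top" using tendsto_vec_nth[OF tendsto_vec_nth[OF ht[OF L]]] unfolding Ec_hat .
 moreover have "(rd k - rd l) * - s = (rd l - rd k) * s" for s by (simp add: algebra_simps)
 ultimately have d: "((%s. of_real (exp ((rd l - rd k) * s)) * hat v$k$l) \<longlongrightarrow> hat L$k$l) at_top" by (simp only:)
 show "hat v$k$l = hat (mat 1)$k$l"
 proof (cases "rd k = rd l")
  case True thus ?thesis using u by (simp add: tendsto_const_iff)
 next
  case False
  hence "hat v$k$l = 0" using exp_grow[OF u] exp_grow[OF d] by linarith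
  moreover have "k~=l" using False by auto
  ultimately show ?thesis unfolding hat_1 by (simp add: mat_def)
 qed
qed

end

subsection \<open>Invertible matrices as an additive group\<close>

typedef ('n::finite) gl = "{A :: complex^'n^'n. invertible A}" morphisms mx Gl by (rule exI[of _ "mat 1"]) (simp add: invertible_1)

instantiation gl :: (finite) group_add
begin
definition "0 = Gl (mat 1)"
definition "g + k = Gl (mx g**mx k)"
definition "- g = Gl (minv (mx g))"
definition "g - k = g + - (k :: 'a gl)"

lemma mx_inv [simp]: "invertible (mx g)" using mx[of g] by simp
lemma mx_Gl [simp]: "invertible A ==> mx (Gl A) = A" by (simp add: Gl_inverse)
lemma mx_simps [simp]: "mx 0 = mat 1" "mx (g + k) = mx g**mx k" "mx (- g) = minv (mx g)" by (simp_all add: zero_gl_def plus_gl_def uminus_gl_def invertible_1 invertible_mult invertible_minv)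
lemma gl_eqI: "mx g = mx k ==> g = k" by (simp add: mx_inject)

instance by standard (auto intro!: gl_eqI simp: mm_assoc minv minus_gl_def)
end

lemma mx_cj: "mx (cj g u) = mx g**mx u**minv (mx g)" by (simp add: cj_def del: add_uminus_conv_diff)

context pin
begin

definition "X i b = Gl (x i b)"
definition "Y i b = Gl (y i b)"
definition "Hh i c = Gl (alv i (of_real c))"
definition "Nn i = Y i 1 + X i (-1) + Y i 1"

lemma mxs: assumes i: "i:I" shows "mx (X i b) = x i b" "mx (Y i b) = y i b" "c~=0 ==> mx (Hh i c) = alv i (of_real c)" "mx (Nn i) = n i"
proof -
 show 1: "mx (X i b) = x i b" "mx (Y i b) = y i b" for b by (simp_all add: X_def Y_def efh i mexp_invertible)
 show "c~=0 ==> mx (Hh i c) = alv i (of_real c)" using sgT(1)[OF cochar(1)[OF cochar_av[OF i]]] by (simp add: Hh_def)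
 show "mx (Nn i) = n i" by (simp add: Nn_def 1 n_def mm_assoc)
qed

lemma inv_xy: "i:I ==> minv (x i b) = x i (- b)" "i:I ==> minv (y i b) = y i (- b)" using minv_mexp by (simp_all add: efh)

lemma av_T: "i:I ==> c~=0 ==> alv i c:T" using cochar(1)[OF cochar_av] .

lemma av_one: assumes i: "i:I" shows "n i**x i t = sl i 0 (-1) 1 t" "n i**n i = alv i (of_real (-1))"
 "t~=0 ==> n i**x i t = x i (- 1 / t)**alv i (of_real (1 / t))**y i (1 / t)"
 "t~=0 ==> minv (n i)**y i t = y i (- 1 / t)**alv i (of_real t)**x i (1 / t)"
proof -
 note s = n_sl(1)[OF i] sl(1,2)[OF i, symmetric]
 show "n i**x i t = sl i 0 (-1) 1 t" unfolding s by (subst sl(4)[OF i]) simp_all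
 have "sl i (-1) 0 0 (-1) = alv i (of_real (-1))" using sl(3)[OF i, of "-1"] by simp
 thus "n i**n i = alv i (of_real (-1))" unfolding s by (subst sl(4)[OF i]) simp_all
 show "n i**x i t = x i (- 1 / t)**alv i (of_real (1 / t))**y i (1 / t)" if t: "t~=0"
 proof -
  have h: "alv i (of_real (1 / t)) = sl i (1 / t) 0 0 t" using sl(3)[OF i, of "1 / t"] t by simp
  show ?thesis unfolding s h using t by (subst sl(4)[OF i], simp, simp, subst sl(4)[OF i], simp, simp, subst sl(4)[OF i]) simp_all
 qed
 have "n i**(y i (- 1 / t)**alv i (of_real t)**x i (1 / t)) = y i t" if t: "t~=0" unfolding s sl(3)[OF i t, symmetric] using t
  by (subst sl(4)[OF i], simp, simp, subst sl(4)[OF i], simp, simp, subst sl(4)[OF i]) simp_all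
 hence "minv (n i)**(n i**(y i (- 1 / t)**alv i (of_real t)**x i (1 / t))) = minv (n i)**y i t" if "t~=0" using that by simp
 thus "minv (n i)**y i t = y i (- 1 / t)**alv i (of_real t)**x i (1 / t)" if "t~=0" using that unfolding minv_cancel(1)[OF n_inv[OF i]] by metis
qed

lemma Um_Uc: "v:ggen {Y i t |i t. i:I} ==> mx v:Uc"
proof (induction rule: ggen.induct)
 case zero thus ?case by (simp add: Uc(1))
next
 case (plus s g) thus ?case using Uc(2,3) by (auto simp: mxs)
next
 case (minus s g)
 then obtain i t where "i:I" "s = Y i t" by blast
 thus ?case using minus Uc(2)[OF Uc(3)[of i "- t"]] by (simp add: mxs inv_xy)
qed

lemma Bb_Bc: "v:ggen ({X i t |i t. i:I} Un {Hh i c |i c. i:I & c~=0}) ==> mx v:Bc & mx v:BR"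
proof (induction rule: ggen.induct)
 case zero thus ?case by (simp add: Uc(4) sgBR(2))
next
 case (plus s g)
 hence "mx s:Bc & mx s:BR" using Uc(6,7) x_BR av_BR av_T by (auto simp: mxs)
 thus ?case using plus Uc(5) sgBR(3) by simp
next
 case (minus s g)
 then consider (x) i t where "i:I" "s = X i t" | (h) i c where "i:I" "s = Hh i c" "c~=0" by blast
 hence "minv (mx s):Bc & minv (mx s):BR"
 proof cases
  case x thus ?thesis using Uc(6) x_BR by (simp add: mxs inv_xy)
 next
  case h thus ?thesis using Uc(7) sgT(4)[OF av_T] sgBR(4)[OF av_BR] by (simp add: mxs)
 qed
 thus ?case using minus Uc(5) sgBR(3) by simp
qed

lemma chev_gl: "chev I a X Y Hh Nn (%g. om (mx g)) M"
proof unfold_locales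
 show "Nn i = Y i 1 + X i (-1) + Y i 1" if "i:I" for i by (simp add: Nn_def)
 show "X i (s + t) = X i s + X i t" "Y i (s + t) = Y i s + Y i t" if "i:I" for i s t using that by (auto intro!: gl_eqI simp: mxs xy_add)
 show "Hh i (c * d) = Hh i c + Hh i d" if "i:I" "c~=0" "d~=0" for i c d using that by (intro gl_eqI) (simp add: mxs xy_add(3) del: of_real_mult)
 show "Hh i c + Hh j d = Hh j d + Hh i c" if "i:I" "j:I" "c~=0" "d~=0" for i j c d using that T_comm[OF av_T av_T] by (intro gl_eqI) (simp add: mxs)
 show "cj (Hh i c) (X j b) = X j (c powi a i j * b)" "cj (Hh i c) (Y j b) = Y j (c powi (- a i j) * b)"
  if i: "i:I" and j: "j:I" and c: "c~=0" for i j c b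
 proof -
  have t: "alv i (of_real c):T" using av_T i c by simp
  have al: "al j (alv i (of_real c)) = of_real (c powi a i j)" "1 / al j (alv i (of_real c)) = of_real (c powi (- a i j))"
   using alpha_av[OF i j, of "of_real c"] c by (simp_all add: power_int_minus inverse_eq_divide)
  show "cj (Hh i c) (X j b) = X j (c powi a i j * b)" "cj (Hh i c) (Y j b) = Y j (c powi (- a i j) * b)"
   using ht[OF j t, of b] unfolding al by (auto intro!: gl_eqI simp: mx_cj mxs i j c efh(2,4)[OF j] power_int_minus divide_inverse mult.commute)
 qed
 show "cj (Nn i) (Hh j c) = Hh j c + Hh i (c powi (- a j i))" if i: "i:I" and j: "j:I" and c: "c~=0" for i j c
 proof -
  have t: "alv j (of_real c):T" using av_T j c by simp
  have "1 / c powi a j i = c powi (- a j i)" by (simp add: power_int_minus inverse_eq_divide)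
  thus ?thesis using Ty[OF i t, of "c powi a j i"] alpha_av[OF j i, of "of_real c"] c by (intro gl_eqI) (simp add: mx_cj mxs i j)
 qed
 show "Y i t = X i (1 / t) + Nn i + Hh i t + X i (1 / t)" if "i:I" "t~=0" for i t using y_n[OF that] that by (intro gl_eqI) (simp add: mxs mm_assoc)
 show "Nn i + X i t = X i (- 1 / t) + Hh i (1 / t) + Y i (1 / t)" if "i:I" "t~=0" for i t using av_one(3)[OF that] that by (intro gl_eqI) (simp add: mxs)
 show "- Nn i + Y i t = Y i (- 1 / t) + Hh i t + X i (1 / t)" if "i:I" "t~=0" for i t using av_one(4)[OF that] that by (intro gl_eqI) (simp add: mxs)
 show "cj (Nn i) (X i b) = Y i (- b)" if "i:I" for i b using nx(1)[OF that] that by (intro gl_eqI) (simp add: mx_cj mxs)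
 show "Nn i + Nn i = Hh i (-1)" if "i:I" for i using av_one(2)[OF that] that by (intro gl_eqI) (simp add: mxs)
 show "X i s + Y j t = Y j t + X i s" if "i:I" "j:I" "i~=j" for i j s t using xy_comm(1)[OF that] that by (intro gl_eqI) (simp add: mxs)
 show "X i s + X j t = X j t + X i s" "Y i s + Y j t = Y j t + Y i s" if "i:I" "j:I" "i~=j" "a i j = 0" for i j s t using xy_comm(2,3)[OF that(1-3)] that by (auto intro!: gl_eqI simp: mxs)
 show "cj (Nn i) (X j b) = - X j b + X i (-1) + X j b + X i 1" "cj (Nn i) (Y j b) = - Y j b + Y i 1 + Y j b + Y i (-1)"
  "cj (Nn j + Nn i) (X j b) = X i b" "cj (Nn j + Nn i) (Y j b) = Y i b"
  if "i:I" "j:I" "i~=j" "a i j = -1" for i j b using nx1[OF that] ny1[OF that] nn[OF that] that by (auto intro!: gl_eqI simp: mx_cj mxs inv_xy mm_assoc)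
 show "Y i p + Y j q + Y i r = Y j (q * r / (p + r)) + Y i (p + r) + Y j (p * q / (p + r))"
  if "i:I" "j:I" "i~=j" "a i j = -1" "0 < p" "0 < r" for i j p q r using yyy[OF that] that by (intro gl_eqI) (simp add: mxs mm_assoc)
 show "s = t" if "i:I" "X i s = X i t" for i s t
 proof -
  have "x i s = x i t" using that mxs(1) by metis
  thus ?thesis using x_onto[OF that(1)] by (auto simp: bij_betw_def inj_on_def)
 qed
 show "ggen {Y i t |i t. i:I} Int ggen ({X i t |i t. i:I} Un {Hh i c |i c. i:I & c~=0}) = {0}" using Um_Uc Bb_Bc Uc_Bc by (auto intro!: gl_eqI ggen.zero)
 have B: "mx u:NR" if "u:ggen ({X i t |i t. i:I} Un {Hh i c |i c. i:I & c~=0})" for u using Bb_Bc[OF that] BR_NR by auto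
 have oN: "om A = om0 A" if "A:NR" for A using om_UB[OF Uc(1) that] by simp
 show "om (mx (v + u)) = om (mx u)"
  if v: "v:ggen {Y i t |i t. i:I}" and u: "u:ggen ({X i t |i t. i:I} Un {Hh i c |i c. i:I & c~=0})" for v u using om_UB[OF Um_Uc[OF v] B[OF u]] oN[OF B[OF u]] by simp
 show "om (mx (u' + u)) = om (mx u') * om (mx u)"
  if u': "u':ggen ({X i t |i t. i:I} Un {Hh i c |i c. i:I & c~=0})" and u: "u:ggen ({X i t |i t. i:I} Un {Hh i c |i c. i:I & c~=0})" for u u'
  using om_NR[OF B[OF u]] oN[OF B[OF u]] oN[OF B[OF u']] by simp
 show "om (mx (0 :: 'n gl)) = 1" using om_UB[OF Uc(1), of "mat 1"] sgBR(2) BR_NR om0(1) by auto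
 have o: "om A = om0 A" if "A:BR" for A using om_UB[OF Uc(1), of A] that BR_NR by auto
 \<comment> \<open>Conjugation by \<open>E s\<close> changes the parameter of \<open>x i\<close>
   without changing \<open>om0\<close>, so the parameter may be sent to 0.\<close>
 show "om (mx (X i t)) = 1" if i: "i:I" for i t
 proof -
  obtain r where r: "r > 0" "!!s. Ec s (x i t) = x i (exp (r * s) * t)" using Ec_xy[OF i] by blast
  have "om0 (x i (exp (r * s) * t)) = om0 (x i t)" for s using Ec_NR[of "x i t" "mat 1" s] x_BR[OF i] BR_NR om0(1) by (auto simp: r(2))
  hence e: "om0 (x i (exp (- r * s) * t)) = om0 (x i t)" for s by (metis mult_minus_left mult_minus_right)
  have "((%s. exp (- r * s) * t) \<longlongrightarrow> 0) at_top" using r(1) exp_decay_real[of "- r" t] by simp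
  from rpol_tendsto[OF x_poly(1)[OF i] this] have "((%s. x i (exp (- r * s) * t)) \<longlongrightarrow> mat 1) at_top" by (simp add: xy_add(4)[OF i])
  moreover have "isCont om0 (mat 1)" using pf_continuous[OF om0(3)] by (simp add: continuous_on_eq_continuous_at)
  ultimately have "((%s. om0 (x i (exp (- r * s) * t))) \<longlongrightarrow> om0 (mat 1)) at_top" using isCont_tendsto_compose by blast
  thus ?thesis unfolding e using o[OF x_BR[OF i]] om0(1) by (simp add: mxs i tendsto_const_iff)
 qed
 show "om (mx (Hh i c)) = of_real (c ^ M i)" if "i:I" "c~=0" for i c using that o[OF av_BR] M(2)[of i "of_real c"] by (simp add: mxs)
qed (use finite_I a_diag a_off a_symd(1) a_pos M(1) in auto)

end

sublocale pin < C: chev I a X Y Hh Nn "%g. om (mx g)" M by (rule chev_gl)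

subsection \<open>Words in the Weyl group\<close>

lemma normalizer_iff:
 fixes H T :: "(complex^'n^'n) set" assumes H: "subgroup H GL" and T: "T<=H" shows "g:normalizer (grp H) T \<longleftrightarrow> g:H & (%t. g**t**minv g) ` T = T"
proof -
 have "g <#\<^bsub>grp H\<^esub> T #>\<^bsub>grp H\<^esub> inv\<^bsub>grp H\<^esub> g = (%t. g**t**minv g) ` T" if "g:H"
  using group.m_inv_consistent[OF group_GL H that] inv_GL[OF subgroupD(1)[OF H that]] by (auto simp: r_coset_def l_coset_def GL_def)
 thus ?thesis using T by (auto simp: normalizer_def stabilizer_def)
qed

context pin
begin

text \<open>For positive real \<open>c\<close> this follows from \<open>Ty\<close>. Both sides have
  Laurent polynomial entries, so it extends to complex \<open>c\<close>.\<close>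

lemma av_n: assumes i: "i:I" and c: "c~=0" shows "alv i c**n i**alv i c = n i"
proof (rule mat_eqI)
 fix k l
 have sum: "laur (%c. SUM m:S. F m c)" if "finite S" "!!m. laur (F m)" for S :: "'n set" and F using that(1) by (induction S rule: finite_induct) (simp_all add: laur_const laur_add that(2))
 show "(alv i c**n i**alv i c)$k$l = n i$k$l"
 proof (rule laur_ext[OF _ laur_const _ c])
  show "laur (%c. (alv i c**n i**alv i c)$k$l)" unfolding mm_nth by (intro sum laur_mult laur_const cochar(4)[OF cochar_av[OF i]]) simp_all
  fix c :: real assume c: "c > 0"
  let ?t = "alv i (of_real c)"
  have t: "?t:T" using av_T[OF i] c by simp
  have "n i**?t**minv (n i) = ?t**alv i (of_real (1 / c\<^sup>2))" by (rule Ty[OF i t]) (use alpha_av[OF i i, of "of_real c"] a_diag[OF i] c in simp_all)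
  hence st: "?t**(n i**?t**minv (n i)) = ?t**(?t**alv i (of_real (1 / c\<^sup>2)))" by simp
  have e: "?t**(?t**alv i (of_real (1 / c\<^sup>2))) = mat 1" using cochar(2,3)[OF cochar_av[OF i]] c by (simp add: power2_eq_square flip: cochar(2)[OF cochar_av[OF i]])
  have "?t**n i**?t = ?t**(n i**?t**minv (n i))**n i" by (simp add: mm_assoc minv[OF n_inv[OF i]])
  hence "?t**n i**?t = n i" unfolding st e by simp
  thus "(?t**n i**?t)$k$l = n i$k$l" by simp
 qed
qed

text \<open>Multiply \<open>t\<close> by the coroot value at a square root \<open>c\<close> of the
  inverse of \<open>al i t\<close>. The root is then 1, \<open>Ty\<close> shows that
  \<open>n i\<close> commutes with the product, and \<open>av_n\<close> accounts for the coroot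
  factor. Conjugation by the inverse of \<open>n i\<close> agrees with conjugation by
  \<open>n i\<close>, because the square of \<open>n i\<close> lies in the commutative group
  \<open>T\<close>.\<close>

lemma n_T: assumes i: "i:I" and t: "t:T" shows "n i**t**minv (n i) = t**alv i (inverse (al i t))" "n i**t**minv (n i):T"
  "minv (n i)**t**n i:T"
proof -
 note L = cochar[OF cochar_av[OF i]]
 have A: "n i**t**minv (n i) = t**alv i (inverse (al i t)) & n i**t**minv (n i):T" if t: "t:T" for t
 proof -
  have al: "al i t~=0" by (rule alpha_nz[OF i t])
  define c where "c = csqrt (inverse (al i t))"
  have cc: "c * c = inverse (al i t)" "c~=0" using al by (auto simp: c_def power2_eq_square[symmetric])
  define u where "u = t**alv i c"
  have u: "u:T" unfolding u_def by (rule sgT(3)[OF t L(1)[OF cc(2)]])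
  have "al i u = al i t * c powi 2" unfolding u_def XT_D(2)[OF alpha_XT[OF i] t L(1)[OF cc(2)]] alpha_av[OF i i cc(2)] a_diag[OF i] ..
  hence "al i u = of_real 1" using cc al by (simp add: power2_eq_square)
  hence nu: "n i**u**minv (n i) = u" using Ty[OF i u, of 1] L(3) by simp
  have "alv i c**n i = n i**minv (alv i c)"
  proof -
   have iv: "invertible (alv i c)" using sgT(1)[OF L(1)[OF cc(2)]] .
   have "alv i c**n i**alv i c**minv (alv i c) = n i**minv (alv i c)" using av_n[OF i cc(2)] by simp
   thus ?thesis by (simp add: mm_assoc minv[OF iv])
  qed
  moreover have "n i**t = (n i**u**minv (n i))**n i**minv (alv i c)" using minv(1)[OF sgT(1)[OF L(1)[OF cc(2)]]] by (simp add: u_def mm_assoc minv_cancel[OF n_inv[OF i]])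
  ultimately have "n i**t = u**alv i c**n i" unfolding nu by (simp add: mm_assoc)
  hence "n i**t**minv (n i) = u**alv i c" by (simp add: mm_assoc minv[OF n_inv[OF i]])
  thus ?thesis using sgT(3)[OF u L(1)[OF cc(2)]] L(2)[OF cc(2,2)] by (simp add: u_def mm_assoc cc)
 qed
 show "n i**t**minv (n i) = t**alv i (inverse (al i t))" "n i**t**minv (n i):T" by (rule conjunct1[OF A[OF t]], rule conjunct2[OF A[OF t]])
 have n2: "n i**n i:T" using av_one(2)[OF i] L(1)[of "of_real (-1)"] by simp
 hence "(n i**n i)**(n i**t) = n i**t**(n i**n i)"
 proof -
  have "t'**(n i**n i) = (n i**n i)**t'" if "t':T" for t' using T_comm[OF that n2] .
  from this[of t] t have "n i**(t**(n i**n i)) = n i**((n i**n i)**t)" by simp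
  thus ?thesis by (simp only: mm_assoc)
 qed
 hence "n i**(n i**n i**t) = n i**(t**(n i**n i))" by (simp only: mm_assoc)
 hence "minv (n i)**(n i**(n i**n i**t)) = minv (n i)**(n i**(t**(n i**n i)))" by simp
 hence "n i**n i**t = t**(n i**n i)" by (simp only: minv_cancel[OF n_inv[OF i]])
 hence "minv (n i)**(n i**n i**t)**minv (n i) = minv (n i)**(t**(n i**n i))**minv (n i)" by simp
 hence eq: "n i**t**minv (n i) = minv (n i)**t**n i" by (simp add: mm_assoc minv_cancel[OF n_inv[OF i]] minv[OF n_inv[OF i]])
 show "minv (n i)**t**n i:T" using conjunct2[OF A[OF t]] unfolding eq .
qed

definition "NT = {g:G. (ALL t:T. g**t**minv g:T & minv g**t**g:T)}"

lemma NT_normalizer: "g:normalizer (grp G) T \<longleftrightarrow> g:NT"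
proof -
 have sG: "subgroup G GL" using cl_G by (simp add: closed_subgroup_def)
 have "(%t. g**t**minv g) ` T = T \<longleftrightarrow> (ALL t:T. g**t**minv g:T & minv g**t**g:T)" if "g:G"
 proof -
  note ig = sgG(1)[OF that]
  have e: "minv g**(g**t**minv g)**g = t" "g**(minv g**t**g)**minv g = t" for t by (simp_all add: mm_assoc minv_cancel[OF ig] minv[OF ig])
  show ?thesis
  proof (intro iffI ballI conjI)
   fix t assume eq: "(%t. g**t**minv g) ` T = T" and t: "t:T"
   show "g**t**minv g:T" using imageI[OF t, of "%t. g**t**minv g"] unfolding eq .
   have "t:(%t. g**t**minv g) ` T" using t unfolding eq .
   then obtain u where "u:T" "t = g**u**minv g" by (rule imageE)
   thus "minv g**t**g:T" using e(1) by simp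
  next
   assume A: "ALL t:T. g**t**minv g:T & minv g**t**g:T"
   have "t:(%t. g**t**minv g) ` T" if "t:T" for t by (rule image_eqI[of _ _ "minv g**t**g"]) (use A that e(2) in auto)
   thus "(%t. g**t**minv g) ` T = T" using A by auto
  qed
 qed
 thus ?thesis unfolding normalizer_iff[OF sG T_Bp(2)] NT_def by auto
qed

lemma NT: "mat 1:NT" "g:NT ==> k:NT ==> g**k:NT" "i:I ==> n i:NT" "t:T ==> t:NT"
proof -
 show "mat 1:NT" using sgG(2) by (simp add: NT_def)
 show "g**k:NT" if gk: "g:NT" "k:NT" for g k
 proof -
  have i: "invertible g" "invertible k" using gk sgG(1) by (auto simp: NT_def)
  have e: "g**k**t**minv (g**k) = g**(k**t**minv k)**minv g"
   "minv (g**k)**t**(g**k) = minv k**(minv g**t**g)**k" for t by (simp_all add: minv_mult i mm_assoc)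
  show ?thesis using gk sgG(3) unfolding NT_def mem_Collect_eq e by blast
 qed
 show "n i:NT" if i: "i:I" for i using n_T(2,3)[OF i] sl(5)[OF i, of 0 0 "-1" 1] n_sl(1)[OF i] by (simp add: NT_def real_points_def)
 show "t:NT" if "t:T" for t using that T_Bp(2) sgT by (auto simp: NT_def)
qed

definition "cst g = (%t. t**g) ` T"

lemma cst: assumes g: "g:NT" shows "k:cst g \<longleftrightarrow> (EX t:T. k = g**t)" "g:cst g"
proof -
 have ig: "invertible g" using g sgG(1) by (simp add: NT_def)
 have 1: "t**g = g**(minv g**t**g)" "g**t = (g**t**minv g)**g" for t by (simp_all add: mm_assoc minv_cancel[OF ig] minv[OF ig])
 show "k:cst g \<longleftrightarrow> (EX t:T. k = g**t)"
 proof
  assume "k:cst g"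
  then obtain t where t: "t:T" "k = t**g" by (auto simp: cst_def)
  have "k = g**(minv g**t**g)" unfolding t(2) by (rule 1(1))
  thus "EX t:T. k = g**t" by (rule bexI) (use t(1) g in \<open>unfold NT_def, blast\<close>)
 next
  assume "EX t:T. k = g**t"
  then obtain t where t: "t:T" "k = g**t" by blast
  have "k = (g**t**minv g)**g" unfolding t(2) by (rule 1(2))
  thus "k:cst g" using t g unfolding cst_def NT_def by blast
 qed
 show "g:cst g" unfolding cst_def by (rule image_eqI[of _ _ "mat 1"]) (simp_all add: sgT(2))
qed

text \<open>An element inducing the same automorphism of \<open>T\<close> as \<open>n i\<close>
  differs from it by an element centralizing \<open>T\<close>, hence by an element of
  \<open>T\<close>.\<close>

lemma refl_cst: assumes i: "i:I" shows "reflection G T (al i) (alv i) = cst (n i)"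
proof -
 note ii = n_inv[OF i]
 have "m:reflection G T (al i) (alv i) \<longleftrightarrow> m:NT & (ALL t:T. m**t**minv m = n i**t**minv (n i))" for m
  unfolding reflection_def mem_Collect_eq NT_normalizer by (intro conj_cong ball_cong refl) (simp only: n_T(1)[OF i])
 moreover have "m:NT & (ALL t:T. m**t**minv m = n i**t**minv (n i)) \<longleftrightarrow> m:cst (n i)" for m
 proof
  assume "m:NT & (ALL t:T. m**t**minv m = n i**t**minv (n i))"
  hence m: "m:G" "!!t. t:T ==> m**t**minv m = n i**t**minv (n i)" by (auto simp: NT_def)
  note im = sgG(1)[OF m(1)]
  have "m**minv (n i):T"
  proof (rule cent)
   show "m**minv (n i):G" using m(1) NT(3)[OF i] sgG(3,4) by (auto simp: NT_def)
   fix t assume t: "t:T"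
   have "m**(minv (n i)**t**n i)**minv m = n i**(minv (n i)**t**n i)**minv (n i)" by (rule m(2)[OF n_T(3)[OF i t]])
   hence "m**(minv (n i)**t**n i)**minv m**m = t**m" by (simp add: mm_assoc minv_cancel[OF ii] minv[OF ii])
   hence "m**minv (n i)**t**n i**minv (n i) = t**m**minv (n i)" by (simp add: mm_assoc minv[OF im])
   thus "m**minv (n i)**t = t**(m**minv (n i))" by (simp add: mm_assoc minv[OF ii])
  qed
  thus "m:cst (n i)" unfolding cst_def by (rule image_eqI[rotated]) (simp add: mm_assoc minv[OF ii])
 next
  assume "m:cst (n i)"
  then obtain t where t: "t:T" "m = t**n i" by (auto simp: cst_def)
  have it: "invertible t" using sgT(1)[OF t(1)] .
  have "m**u**minv m = n i**u**minv (n i)" if u: "u:T" for u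
  proof -
   have "m**u**minv m = t**(n i**u**minv (n i))**minv t" by (simp add: t minv_mult it ii mm_assoc)
   also have "... = (n i**u**minv (n i))**t**minv t" using T_comm[OF t(1) n_T(2)[OF i u]] by simp
   finally show ?thesis by (simp add: mm_assoc minv[OF it])
  qed
  thus "m:NT & (ALL t:T. m**t**minv m = n i**t**minv (n i))" using NT(2-4) t i by auto
 qed
 ultimately show ?thesis by blast
qed

lemma word_cst: assumes "us:lists I" "!!i. i:I ==> s i = reflection G T (al i) (alv i)" shows "word_product (weyl_group G T) s us = cst (mx (C.nw us)) & mx (C.nw us):NT" using assms(1)
proof (induction us)
 case Nil
 thus ?case using NT(1) by (simp add: word_product_def weyl_group_def FactGroup_def cst_def)
next
 case (Cons i us)
 hence i: "i:I" and N: "mx (C.nw us):NT" by auto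
 let ?g = "mx (C.nw us)"
 have "word_product (weyl_group G T) s (i # us) = {h**k |h k. h:cst (n i) & k:cst ?g}"
  using Cons assms(2)[OF i] refl_cst[OF i] by (auto simp: word_product_def weyl_group_def FactGroup_def set_mult_def GL_def)
 also have "... = cst (n i**?g)"
 proof (rule equalityI; rule subsetI)
  fix m assume "m:{h**k |h k. h:cst (n i) & k:cst ?g}"
  then obtain h k where hk: "h:cst (n i)" "k:cst ?g" "m = h**k" by blast obtain t where t: "t:T" "h = t**n i" using hk(1) by (auto simp: cst_def)
  obtain u where u: "u:T" "k = ?g**u" using hk(2) cst(1)[OF N] by blast
  have "n i**?g**u:cst (n i**?g)" using cst(1)[OF NT(2)[OF NT(3)[OF i] N]] u(1) by blast
  then obtain u' where u': "u':T" "n i**?g**u = u'**(n i**?g)" by (auto simp: cst_def)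
  have "m = t**(n i**?g**u)" by (simp add: hk t u mm_assoc)
  also have "... = (t**u')**(n i**?g)" unfolding u' by (simp only: mm_assoc)
  finally show "m:cst (n i**?g)" unfolding cst_def by (rule image_eqI) (rule sgT(3)[OF t(1) u'(1)])
 next
  fix m assume "m:cst (n i**?g)"
  then obtain t where t: "t:T" "m = t**(n i**?g)" by (auto simp: cst_def)
  hence "m = (t**n i)**?g" by (simp only: mm_assoc)
  moreover have "t**n i:cst (n i)" using t(1) by (simp add: cst_def)
  ultimately show "m:{h**k |h k. h:cst (n i) & k:cst ?g}" using cst(2)[OF N] by blast
 qed
 finally show ?case using NT(2)[OF NT(3)[OF i] N] by (simp add: mxs(4)[OF i])
qed

text \<open>Lifts that differ by an element of \<open>T\<close> represent the same Weyl group
  element, so the minimality of \<open>ws\<close> among words for \<open>w0\<close> becomes the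
  shortness hypothesis of \<open>longest_reduced\<close> with \<open>T\<close> as the torus.\<close>

lemma longest_red: assumes s: "!!i. i:I ==> s i = reflection G T (al i) (alv i)" and w0: "is_longest (weyl_group G T) I s w0" "reduced_expression (weyl_group G T) I s w0 ws" shows "C.red ws"
proof -
 note W = word_cst[OF _ s]
 have ws: "ws:lists I" "word_product (weyl_group G T) s ws = w0" "length ws = word_length (weyl_group G T) I s w0" using w0(2) by (auto simp: reduced_expression_def)
 show ?thesis
 proof (rule C.longest_reduced[of ws "{g. mx g:T}"])
  show "ws:lists I" by (rule ws)
  show "C.HH<={g. mx g:T}" unfolding C.HH_def by (rule ggen_least) (use sgT av_T in \<open>auto simp: mxs\<close>)
  show "length ws<=length us" if us: "us:lists I" "t:{g. mx g:T}" "C.nw us = C.nw ws + t" for us t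
  proof -
   have e: "mx (C.nw us) = mx (C.nw ws)**mx t" using us(3) by simp
   have "mx (C.nw us):cst (mx (C.nw ws))" using cst(1)[OF conjunct2[OF W[OF ws(1)]]] us(2) e by blast
   then obtain u where u: "u:T" "mx (C.nw us) = u**mx (C.nw ws)" by (auto simp: cst_def)
   have "cst (mx (C.nw us)) = cst (mx (C.nw ws))"
   proof (rule equalityI; rule subsetI)
    fix m assume "m:cst (mx (C.nw us))"
    then obtain t where "t:T" "m = t**mx (C.nw us)" by (auto simp: cst_def)
    thus "m:cst (mx (C.nw ws))" unfolding cst_def u(2) using sgT(3)[OF _ u(1)] by (auto simp: mm_assoc[symmetric])
   next
    fix m assume "m:cst (mx (C.nw ws))"
    then obtain t where t: "t:T" "m = t**mx (C.nw ws)" by (auto simp: cst_def)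
    have "m = (t**minv u)**mx (C.nw us)" by (simp add: t u(2) mm_assoc minv_cancel[OF sgT(1)[OF u(1)]])
    thus "m:cst (mx (C.nw us))" unfolding cst_def using sgT(3)[OF t(1) sgT(4)[OF u(1)]] by blast
   qed
   hence "word_product (weyl_group G T) s us = w0" using W us(1) ws by metis
   thus ?thesis unfolding ws(3) word_length_def using us(1) by (intro Least_le) auto
  qed
 qed
qed

end

subsection \<open>Conjugate Borel subgroups\<close>

lemma csolv_conj:
 fixes H G :: "(complex^'n^'n) set" assumes H: "closed_subgroup H" "zariski_connected H" "solvable (grp H)" "H<=G" and G: "subgroup G GL" "g:G"
 shows "closed_subgroup (conj_set g H)" "zariski_connected (conj_set g H)" "solvable (grp (conj_set g H))" "conj_set g H<=G"
proof -
 note sH = subgroupD[OF conjunct1[OF H(1)[unfolded closed_subgroup_def]]] and sG = subgroupD[OF G(1)]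
 have sub: "subgroup H GL" "zclosed H" using H(1) by (auto simp: closed_subgroup_def)
 have ig: "invertible g" using sG(1)[OF G(2)] .
 have mem: "A:conj_set g H \<longleftrightarrow> invertible A & minv g**A**g:H" for A
 proof
  assume "A:conj_set g H"
  then obtain h where "h:H" "A = g**h**minv g" by (auto simp: conj_set_def)
  thus "invertible A & minv g**A**g:H" using sH(1) ig by (auto simp: mm_assoc minv_cancel[OF ig] minv[OF ig] intro!: invertible_mult invertible_minv)
 next
  assume "invertible A & minv g**A**g:H"
  thus "A:conj_set g H" unfolding conj_set_def by (intro image_eqI[of _ _ "minv g**A**g"]) (auto simp: mm_assoc minv_cancel[OF ig] minv[OF ig])
 qed
 have sub': "subgroup (conj_set g H) GL"
 proof (rule subgroupI)
  show "A**B:conj_set g H" if "A:conj_set g H" "B:conj_set g H" for A B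
  proof -
   have "minv g**(A**B)**g = (minv g**A**g)**(minv g**B**g)" by (simp add: mm_assoc minv_cancel[OF ig])
   thus ?thesis using that sH(3) invertible_mult unfolding mem by metis
  qed
  show "minv A:conj_set g H" if "A:conj_set g H" for A
  proof -
   have iA: "invertible A" "minv g**A**g:H" using that mem by auto
   have "minv (minv g**A**g) = minv g**minv A**g" by (simp add: minv_mult minv_minv iA ig invertible_mult invertible_minv mm_assoc)
   thus ?thesis using sH(4)[OF iA(2)] iA(1) by (simp add: mem invertible_minv)
  qed
  show "mat 1:conj_set g H" using sH(2) by (simp add: mem invertible_1 minv[OF ig])
 qed (simp add: mem)
 have "zclosed {A. invertible A & minv g**A**g:H}" by (rule zclosed_vimage[OF sub(2)]) (intro reg_mm reg_const reg_coord invertible_mult invertible_minv ig | assumption)+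
 hence zc: "zclosed (conj_set g H)" using mem by (metis (no_types, lifting) Collect_cong Collect_mem_eq)
 thus "closed_subgroup (conj_set g H)" using sub' by (simp add: closed_subgroup_def)
 have zH: "zconn H" using H(2) zconn_closed[OF sub(2)] by simp
 hence "zconn ((%h. g**h**minv g) ` H)" by (rule zconn_image[OF _ sH(1)]) (intro reg_mm reg_const reg_coord invertible_mult invertible_minv ig | assumption)+
 thus "zariski_connected (conj_set g H)" using zconn_closed[OF zc] by (simp add: conj_set_def) obtain Q :: "complex^'n^'n" and q where Q: "invertible Q" "bij_betw q UNIV {..<CARD('n)}"
  "!!h. h:H ==> minv Q**h**Q:lev q 0" using solvable_flag[OF sub(1) zH H(3)] by blast
 have "minv (g**Q)**A**(g**Q):lev q 0" if "A:conj_set g H" for A using Q(3)[of "minv g**A**g"] that by (simp add: mem minv_mult ig Q(1) mm_assoc)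
 thus "solvable (grp (conj_set g H))" by (rule triangular_solvable[OF sub' invertible_mult[OF ig Q(1)] Q(2)])
 show "conj_set g H<=G" using H(4) sG(3,4) G(2) by (auto simp: conj_set_def)
qed

lemma conj_set_comp: "invertible g ==> invertible k ==> conj_set g (conj_set k H) = conj_set (g**k) H"
 for g k :: "complex^'n^'n" by (force simp: conj_set_def image_image minv_mult mm_assoc)
lemma conj_set_1: "conj_set (mat 1) H = H" for H :: "(complex^'n^'n) set" by (simp add: conj_set_def)

lemma flag_conj:
 fixes G B :: "(complex^'n^'n) set" assumes sG: "subgroup G GL" and B: "borel_subgroup G B" "zariski_closed \<real> B" and g: "g:real_points G"
 shows "conj_set g (real_points B):flag_manifold G"
proof -
 have Bs: "closed_subgroup B" "zariski_connected B" "solvable (grp B)" "B<=G"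
  "!!B'. closed_subgroup B' ==> zariski_connected B' ==> solvable (grp B') ==> B'<=G ==> B<=B' ==> B' = B" using B(1) unfolding borel_subgroup_def Let_def by blast+
 note sgB = subgroupD[OF conjunct1[OF Bs(1)[unfolded closed_subgroup_def]]]
 have gG: "g:G" "cnjm g = g" "invertible g" using g subgroupD(1)[OF sG] by (auto simp: real_points_iff)
 have ig: "cnjm (minv g) = minv g" using cnjm_inv(2)[OF gG(3)] gG(2) by simp
 have bk: "conj_set (minv g) (conj_set g H) = H" "conj_set g (conj_set (minv g) H) = H" for H by (simp_all add: conj_set_comp gG(3) invertible_minv minv[OF gG(3)] conj_set_1)
 have "B' = conj_set g B" if B': "closed_subgroup B'" "zariski_connected B'" "solvable (grp B')" "B'<=G" "conj_set g B<=B'" for B'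
 proof -
  have "conj_set (minv g) (conj_set g B)<=conj_set (minv g) B'" unfolding conj_set_def[of "minv g"] by (rule image_mono[OF B'(5)])
  hence "conj_set (minv g) B' = B" using csolv_conj[OF B'(1-4) sG subgroupD(4)[OF sG gG(1)]] by (intro Bs(5)) (simp_all add: bk)
  thus ?thesis using bk(2)[of B'] by simp
 qed
 hence bor: "borel_subgroup G (conj_set g B)" unfolding borel_subgroup_def Let_def using csolv_conj[OF Bs(1-4) sG gG(1)] by blast
 have real: "zariski_closed \<real> (conj_set g B)"
 proof -
  obtain S where S: "S<=polyfun \<real>" "B = {A. invertible A & (ALL p:S. p A = 0)}" using B(2) unfolding zariski_closed_def by blast
  have re: "A$k$l:\<real>" if "cnjm A = A" for A :: "complex^'n^'n" and k l using that by (simp add: cnjm_real)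
  have co: "(%A. (minv g**A**g)$k$l):polyfun \<real>" for k l unfolding mm_nth by (intro pf_sum polyfun.mult polyfun.const polyfun.coord re ig gG(2) finite) simp_all
  have sub: "p:polyfun \<real> ==> (%A. p (minv g**A**g)):polyfun \<real>" for p by (induction rule: polyfun.induct) (auto intro: polyfun.intros co)
  have "A:conj_set g B \<longleftrightarrow> invertible A & minv g**A**g:B" for A
  proof
   assume "A:conj_set g B"
   then obtain h where "h:B" "A = g**h**minv g" by (auto simp: conj_set_def)
   thus "invertible A & minv g**A**g:B" using sgB(1) gG(3) by (auto simp: mm_assoc minv_cancel[OF gG(3)] minv[OF gG(3)] intro!: invertible_mult invertible_minv)
  next
   assume "invertible A & minv g**A**g:B"
   thus "A:conj_set g B" unfolding conj_set_def by (intro image_eqI[of _ _ "minv g**A**g"]) (auto simp: mm_assoc minv_cancel[OF gG(3)] minv[OF gG(3)])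
  qed
  moreover have "minv g**A**g:B \<longleftrightarrow> (ALL p:S. p (minv g**A**g) = 0)" if "invertible A" for A using that gG(3) by (auto simp: S(2) intro!: invertible_mult invertible_minv)
  ultimately have "conj_set g B = {A. invertible A & (ALL p:(%p A. p (minv g**A**g)) ` S. p A = 0)}" by auto
  thus ?thesis unfolding zariski_closed_def using S(1) sub by (intro exI[of _ "(%p A. p (minv g**A**g)) ` S"]) auto
 qed
 have "real_points (conj_set g B) = conj_set g (real_points B)"
 proof (rule equalityI; rule subsetI)
  fix A assume "A:real_points (conj_set g B)"
  then obtain h where h: "h:B" "A = g**h**minv g" "cnjm A = A" by (auto simp: real_points_iff conj_set_def)
  have "h = minv g**A**g" by (simp add: h(2) mm_assoc minv_cancel[OF gG(3)] minv[OF gG(3)])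
  hence "cnjm h = h" by (simp add: cnjm_mult ig gG(2) h(3))
  thus "A:conj_set g (real_points B)" using h by (auto simp: conj_set_def real_points_iff)
 next
  fix A assume "A:conj_set g (real_points B)"
  thus "A:real_points (conj_set g B)" by (auto simp: conj_set_def real_points_iff cnjm_mult ig gG(2))
 qed
 thus ?thesis using bor real unfolding flag_manifold_def by blast
qed

context pin
begin

lemma flagI: "g:GR ==> conj_set g BR:flag_manifold G" using flag_conj[OF _ borel_Bp] cl_G by (simp add: closed_subgroup_def)

end

subsection \<open>Coordinates on the fibre\<close>

context pin
begin

lemma foldr_mx: "us:lists I ==> length ps = length us ==>
 foldr (%(i, a) A. y i a**A) (zip us ps) (mat 1) = mx (C.ypr us ps) & mx (C.ypr us ps):GR"
proof (induction us arbitrary: ps)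
 case Nil thus ?case using sgGR(2) by (simp add: C.ypr_def)
next
 case (Cons i us)
 then obtain p qs where "ps = p # qs" "length qs = length us" by (cases ps) auto
 thus ?case using Cons sgGR(3)[OF real_xy(2)] by (auto simp: C.ypr_def mxs(2))
qed

lemma U_pos_mx: assumes "us:lists I" shows "U_pos y us = mx ` C.Upos us"
proof -
 have "U_pos y us = {mx (C.ypr us ps) |ps. length ps = length us & (ALL p:set ps. 0 < p)}" unfolding U_pos_def using foldr_mx[OF assms] by (metis (no_types, lifting))
 thus ?thesis unfolding C.Upos_def by blast
qed

definition "D us g = om (minv (mx (C.nw us))**g)"

lemma D: "m:NR ==> D us (g**m) = D us g * om0 m" "D us (mx u) = C.Dm us u" "continuous_on S (D us)"
proof -
 show "m:NR ==> D us (g**m) = D us g * om0 m" unfolding D_def mm_assoc[symmetric] by (rule om_NR)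
 show "D us (mx u) = C.Dm us u" by (simp add: D_def C.Dm_def)
 have "(%g. om (minv (mx (C.nw us))**g)):PF" using dd_transl[OF om_PF] by blast
 thus "continuous_on S (D us)" using continuous_on_subset[OF pf_continuous] by (auto simp: D_def[abs_def])
qed

lemma ypr_Cons: "C.ypr (i # vs) (p # ps) = Y i p + C.ypr vs ps" by (simp add: C.ypr_def)

text \<open>Domain and coordinates are invariant under \<open>NR\<close> on the right, so they
  descend to flags. The values \<open>q j\<close> with \<open>j\<close> at least the length of the
  word are left free.\<close>

definition "coords vs \<Omega> q \<longleftrightarrow> openin (top_of_set GR) \<Omega> & (ALL g:\<Omega>. ALL m:NR. g**m:\<Omega> & (ALL j::nat. q j (g**m) = (q j g :: real))) &
  (ALL j. continuous_on \<Omega> (q j)) & (ALL ps. length ps = length vs & (ALL p:set ps. 0 < p) -->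
   mx (C.ypr vs ps):\<Omega> & (ALL j<length vs. q j (mx (C.ypr vs ps)) = ps ! j))"

lemma coordsD: assumes "coords vs \<Omega> q" shows "openin (top_of_set GR) \<Omega>" "g:\<Omega> ==> m:NR ==> g**m:\<Omega> & (ALL j. q j (g**m) = q j g)"
  "continuous_on \<Omega> (q j)" "length ps = length vs ==> ALL p:set ps. 0 < p ==>
   mx (C.ypr vs ps):\<Omega> & (ALL j<length vs. q j (mx (C.ypr vs ps)) = ps ! j)" using assms unfolding coords_def by simp_all

text \<open>The first coordinate is a root of a ratio of the functions \<open>D\<close>; removing the corresponding
 factor reduces to the shorter word.\<close>

lemma coordinates: assumes "C.red vs" shows "EX E q. coords vs E q" using assms
proof (induction vs)
 case Nil
 have "g**m:GR" if "g:GR" "m:NR" for g m using sgGR(3) that by (simp add: NR_def)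
 thus ?case using sgGR(2) unfolding coords_def by (intro exI[of _ GR] exI[of _ "%_ _. 0"]) (auto simp: C.ypr_def)
next
 case (Cons i vs)
 hence red: "C.red vs" "i:I" using C.red_Cons by auto obtain E q where "coords vs E q" using Cons.IH[OF red(1)] by blast
 note E = coordsD[OF this]
 have cell: "C.ypr vs ps:C.cell vs" if "length ps = length vs" "ALL p:set ps. 0 < p" for ps by (rule C.Upos_cell[OF red(1)]) (use that in \<open>auto simp: C.Upos_def\<close>)
 define w where "w = C.wt i vs"
 have w: "0 < w" using C.Dm_step(4)[OF Cons.prems, of 1 "C.ypr vs (replicate (length vs) 1)"] cell by (simp add: w_def)
 define A0 where "A0 = GR Int D vs -` (- {0})"
 define R where "R g = Re (D (i # vs) g / D vs g)" for g
 define A1 where "A1 = A0 Int R -` {0<..}"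
 define \<rho> where "\<rho> g = root w (R g)" for g
 define \<phi> where "\<phi> g = y i (- \<rho> g)**g" for g
 define q' where "q' j = (case j of 0 => \<rho> | Suc j => q j \<circ> \<phi>)" for j
 have A0: "openin (top_of_set GR) A0" unfolding A0_def by (rule continuous_openin_preimage_gen[OF D(3)]) (rule open_Compl[OF closed_singleton])
 have cR: "continuous_on A0 R" unfolding R_def by (intro continuous_intros D(3)) (auto simp: A0_def)
 have "openin (top_of_set A0) A1" unfolding A1_def by (rule continuous_openin_preimage_gen[OF cR]) simp
 hence A1: "openin (top_of_set GR) A1" using A0 by (rule openin_trans)
 have A1_GR: "A1<=GR" by (auto simp: A1_def A0_def)
 have c\<rho>: "continuous_on A1 \<rho>" unfolding \<rho>_def by (intro continuous_on_real_root continuous_on_subset[OF cR]) (auto simp: A1_def)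
 have c\<phi>: "continuous_on A1 \<phi>" unfolding continuous_on_def \<phi>_def
 proof
  fix g assume "g:A1"
  hence "(\<rho> \<longlongrightarrow> \<rho> g) (at g within A1)" using c\<rho> by (simp add: continuous_on_def)
  hence "((%g. - \<rho> g) \<longlongrightarrow> - \<rho> g) (at g within A1)" by (rule tendsto_minus)
  hence "((%g. y i (- \<rho> g)) \<longlongrightarrow> y i (- \<rho> g)) (at g within A1)" by (rule rpol_tendsto[OF x_poly(2)[OF red(2)]])
  thus "((%g. y i (- \<rho> g)**g) \<longlongrightarrow> y i (- \<rho> g)**g) (at g within A1)" by (intro mm_tendsto tendsto_ident_at)
 qed
 have \<phi>_GR: "\<phi>:A1 \<rightarrow> GR" using sgGR(3)[OF real_xy(2)[OF red(2)]] A1_GR by (auto simp: \<phi>_def)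
 define E' where "E' = A1 Int \<phi> -` E"
 have "openin (top_of_set A1) E'" unfolding E'_def by (rule continuous_openin_preimage[OF c\<phi> \<phi>_GR E(1)])
 hence E': "openin (top_of_set GR) E'" using A1 by (rule openin_trans)
 have inv: "g**m:E' & (ALL j. q' j (g**m) = q' j g)" if g: "g:E'" and m: "m:NR" for g m
 proof -
  have nz: "om0 m~=0" by (rule om0_nz[OF m])
  have R: "R (g**m) = R g" using nz by (simp add: R_def D(1)[OF m])
  hence \<rho>: "\<rho> (g**m) = \<rho> g" by (simp add: \<rho>_def)
  hence \<phi>: "\<phi> (g**m) = \<phi> g**m" by (simp add: \<phi>_def mm_assoc)
  have "g**m:GR" using sgGR(3) g m A1_GR by (auto simp: NR_def E'_def)
  hence "g**m:A1" using g R nz by (simp add: E'_def A1_def A0_def D(1)[OF m])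
  thus ?thesis using E(2)[of "\<phi> g" m] g m \<phi> \<rho> by (auto simp: E'_def q'_def split: nat.split)
 qed
 have cont: "continuous_on E' (q' j)" for j
 proof (cases j)
  case 0 thus ?thesis using continuous_on_subset[OF c\<rho>, of E'] by (simp add: q'_def E'_def)
 next
  case (Suc j')
  have "continuous_on E' (q j' \<circ> \<phi>)" by (rule continuous_on_compose[OF continuous_on_subset[OF c\<phi>] continuous_on_subset[OF E(3)]]) (auto simp: E'_def)
  thus ?thesis by (simp add: q'_def Suc)
 qed
 have val: "mx (C.ypr (i # vs) ps):E' & (ALL j<length (i # vs). q' j (mx (C.ypr (i # vs) ps)) = ps ! j)"
  if ps: "length ps = length (i # vs)" "ALL p:set ps. 0 < p" for ps
 proof -
  obtain p ps' where p: "ps = p # ps'" "length ps' = length vs" "0 < p" "ALL p:set ps'. 0 < p" using ps by (cases ps) auto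
  let ?u = "C.ypr vs ps'" and ?v = "C.ypr (i # vs) ps"
  have v: "?v = Y i p + ?u" by (simp add: p(1) ypr_Cons)
  have pn: "p~=0" using p(3) by simp
  note st = C.Dm_step[OF Cons.prems pn cell[OF p(2,4)], folded v w_def]
  have R: "R (mx ?v) = p ^ w" using st(2) by (simp add: R_def D(2) st(1,3))
  hence \<rho>: "\<rho> (mx ?v) = p" using w p(3) by (simp add: \<rho>_def real_root_power_cancel)
  have "y i (- p)**y i p = mat 1" using xy_add(2)[OF red(2), of "- p" p] xy_add(5)[OF red(2)] by simp
  moreover have "\<phi> (mx ?v) = (y i (- p)**y i p)**mx ?u" unfolding \<phi>_def \<rho> by (simp add: v mxs(2)[OF red(2)] mm_assoc)
  ultimately have \<phi>: "\<phi> (mx ?v) = mx ?u" by simp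
  have "mx ?v:GR" using foldr_mx[OF C.red_lists[OF Cons.prems] ps(1)] by blast
  hence "mx ?v:A1" using R st(1,2) p(3) by (simp add: A1_def A0_def D(2))
  thus ?thesis using E(4)[OF p(2,4)] \<phi> \<rho> by (auto simp: E'_def q'_def p(1) nth_Cons split: nat.split)
 qed
 show ?case by (rule exI[of _ E'], rule exI[of _ q'], unfold coords_def, intro conjI ballI allI impI) (use E' inv cont val in auto)
qed

lemma conj_set_eq_iff: assumes "g:GR" "k:GR" "conj_set g BR = conj_set k BR" shows "minv k**g:NR"
proof -
 note i = sgGR(1)[OF assms(1)] sgGR(1)[OF assms(2)]
 have "conj_set (minv k**g) BR = conj_set (minv k) (conj_set g BR)" by (simp add: conj_set_comp i invertible_minv)
 also have "... = BR" unfolding assms(3) by (simp add: conj_set_comp i invertible_minv minv conj_set_1)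
 finally show ?thesis using sgGR(3)[OF sgGR(4)[OF assms(2)] assms(1)] by (simp add: NR_def)
qed

text \<open>The parametrization is continuous through the projection from \<open>GR\<close>. Its
  inverse \<open>H\<close> reads the coordinates from an arbitrarily chosen representative
  \<open>sec B\<close>; \<open>NR\<close>-invariance makes the choice immaterial. As flags carry a
  quotient topology, continuity of \<open>H\<close> is checked on preimages in
  \<open>GR\<close>.\<close>

lemma fibre_homeomorphic: assumes red: "C.red ws" and J: "J<=I" and P: "P:partial_flag_pos G Bp y ws J" shows "EX k::nat. subtopology (flag_topology G Bp) (pos_fibre Bp y ws P)
      homeomorphic_space product_topology (%_. top_of_set {0::real<..}) {..<k}"
proof -
 have ws: "ws:lists I" by (rule C.red_lists[OF red]) obtain g1 where g1: "g1:GR" "P = conj_set g1 (standard_parabolic Bp y J)" "pos_fibre Bp y ws P~={}"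
  using P by (auto simp: partial_flag_pos_def partial_flag_manifold_def)
 define SP where "SP = standard_parabolic Bp y J"
 have "BR Un {y j a |j a. j:J}<=carrier GL" using sgBR(1) sgGR(1)[OF real_xy(2)] J by (auto simp: GL_def)
 hence "subgroup SP GL" unfolding SP_def standard_parabolic_def by (rule group.generate_is_subgroup[OF group_GL])
 note sgS = subgroupD[OF this]
 have i1: "invertible g1" by (rule sgGR(1)[OF g1(1)])
 define Pt where "Pt = {g. mx g:P}"
 define BT where "BT = {g. mx g:BR}"
 have Pm: "mx g:P \<longleftrightarrow> minv g1**mx g**g1:SP" for g
 proof
  assume "mx g:P"
  then obtain h where "h:SP" "mx g = g1**h**minv g1" unfolding g1(2) SP_def conj_set_def by blast
  thus "minv g1**mx g**g1:SP" by (simp add: mm_assoc minv_cancel[OF i1] minv[OF i1])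
 next
  assume "minv g1**mx g**g1:SP"
  thus "mx g:P" unfolding g1(2) SP_def[symmetric] conj_set_def by (intro image_eqI[of _ _ "minv g1**mx g**g1"]) (simp_all add: mm_assoc minv_cancel[OF i1] minv[OF i1])
 qed
 have Pt: "0:Pt" "g:Pt ==> k:Pt ==> g + k:Pt" "g:Pt ==> - g:Pt" for g k
 proof -
  show "0:Pt" using sgS(2) by (simp add: Pt_def Pm minv[OF i1])
  have "minv g1**(mx g**mx k)**g1 = (minv g1**mx g**g1)**(minv g1**mx k**g1)" by (simp add: mm_assoc minv_cancel[OF i1])
  thus "g:Pt ==> k:Pt ==> g + k:Pt" using sgS(3) by (simp add: Pt_def Pm)
  have "minv (minv g1**mx g**g1) = minv g1**minv (mx g)**g1" by (simp add: minv_mult minv_minv i1 invertible_mult invertible_minv mm_assoc)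
  thus "g:Pt ==> - g:Pt" using sgS(4)[of "minv g1**mx g**g1"] by (simp add: Pt_def Pm)
 qed
 have sub: "conj_set (mx u) BR<=P \<longleftrightarrow> (ALL b:BT. cj u b:Pt)" for u
 proof
  assume "conj_set (mx u) BR<=P"
  thus "ALL b:BT. cj u b:Pt" by (auto simp: BT_def Pt_def mx_cj conj_set_def)
 next
  assume A: "ALL b:BT. cj u b:Pt"
  show "conj_set (mx u) BR<=P"
  proof
   fix m assume "m:conj_set (mx u) BR"
   then obtain b where b: "b:BR" "m = mx u**b**minv (mx u)" by (auto simp: conj_set_def)
   hence "mx (Gl b) = b" using sgBR(1) by simp
   thus "m:P" using bspec[OF A, of "Gl b"] b by (simp add: BT_def Pt_def mx_cj)
  qed
 qed
 have BB: "C.BB<=BT" using Bb_Bc by (auto simp: C.BB_def BT_def)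
 have fib: "pos_fibre Bp y ws P = (%u. conj_set (mx u) BR) ` {u:C.Upos ws. ALL b:BT. cj u b:Pt}" unfolding pos_fibre_def flag_pos_def U_pos_mx[OF ws] using sub by auto
 then obtain u0 where u0: "u0:C.Upos ws" "!!b. b:BT ==> cj u0 b:Pt" using g1(3) by auto obtain us vs a0 where uv: "C.braid ws (us @ vs)" "a0:C.Upos us"
  "{u:C.Upos ws. ALL b:BT. cj u b:Pt} = {a0 + b |b. b:C.Upos vs}" by (rule C.fibre_description[OF red Pt BB u0])
 have "C.red (us @ vs)" by (rule C.braid_red[OF uv(1) red])
 hence usI: "us:lists I" "vs:lists I" and rv: "C.red vs"
 proof -
  show "us:lists I" "vs:lists I" using C.red_lists[OF `C.red (us @ vs)`] by auto
  show "C.red vs" using `C.red (us @ vs)` by (induction us) (auto simp: C.red_Cons)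
 qed
 define k where "k = length vs"
 define a where "a = mx a0"
 have aG: "a:GR" using uv(2) foldr_mx[OF usI(1)] by (auto simp: a_def C.Upos_def)
 have ia: "invertible a" by (rule sgGR(1)[OF aG]) obtain E and q where "coords vs E q" using coordinates[OF rv] by blast
 note E = coordsD[OF this, folded k_def]
 have EG: "E<=GR" using openin_imp_subset[OF E(1)] .
 let ?X = "product_topology (%_. top_of_set {0::real<..}) {..<k}"
 let ?FT = "flag_topology G Bp" and ?S = "pos_fibre Bp y ws P"
 define L where "L p = map p [0..<k]" for p :: "nat => real"
 define V where "V p = mx (C.ypr vs (L p))" for p
 define F where "F p = conj_set (a**V p) BR" for p
 define sec where "sec B = (SOME g. g:GR & conj_set g BR = B)" for B
 define H where "H B = (\<lambda>j\<in>{..<k}. q j (minv a**sec B))" for B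
 have tX: "p:topspace ?X \<longleftrightarrow> p:extensional {..<k} & (ALL j<k. 0 < p j)" for p by (auto simp: PiE_iff)
 have L: "length (L p) = k & (ALL x:set (L p). 0 < x)" if "p:topspace ?X" for p using that tX by (auto simp: L_def)
 have VE: "V p:E" "j < k ==> q j (V p) = p j" if "p:topspace ?X" for p j using E(4)[of "L p"] L[OF that] by (auto simp: V_def L_def)
 have aV: "a**g:GR" if "g:E" for g using sgGR(3)[OF aG] EG that by blast
 have S: "?S = F ` topspace ?X"
 proof -
  have "?S = (%u. conj_set (mx u) BR) ` {a0 + b |b. b:C.Upos vs}" unfolding fib uv(3) ..
  also have "... = {conj_set (a**mx (C.ypr vs ps)) BR |ps. length ps = k & (ALL p:set ps. 0 < p)}" by (auto simp: C.Upos_def a_def k_def image_iff) (metis mx_simps(2))+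
  also have "... = F ` topspace ?X"
  proof (rule equalityI; rule subsetI)
   fix B assume "B:{conj_set (a**mx (C.ypr vs ps)) BR |ps. length ps = k & (ALL p:set ps. 0 < p)}"
   then obtain ps where ps: "length ps = k" "ALL p:set ps. 0 < p" "B = conj_set (a**mx (C.ypr vs ps)) BR" by blast
   define p where "p = (\<lambda>j\<in>{..<k}. ps ! j)"
   have "L p = ps" by (rule nth_equalityI) (use ps(1) in \<open>auto simp: L_def p_def\<close>)
   moreover have "p:topspace ?X" using ps(1,2) unfolding tX by (auto simp: p_def)
   ultimately show "B:F ` topspace ?X" using ps(3) by (auto simp: F_def V_def)
  next
   fix B assume "B:F ` topspace ?X"
   thus "B:{conj_set (a**mx (C.ypr vs ps)) BR |ps. length ps = k & (ALL p:set ps. 0 < p)}" using L by (auto simp: F_def V_def)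
  qed
  finally show ?thesis .
 qed
 have sec: "sec (conj_set g BR):GR" "conj_set (sec (conj_set g BR)) BR = conj_set g BR" if "g:GR" for g
  using someI[of "%h. h:GR & conj_set h BR = conj_set g BR" g] that by (auto simp: sec_def)
 have qsec: "minv a**sec (conj_set (a**g) BR):E & (ALL j. q j (minv a**sec (conj_set (a**g) BR)) = q j g)"
  if g: "g:E" for g
 proof -
  let ?s = "sec (conj_set (a**g) BR)"
  have ig: "invertible g" using sgGR(1) EG g by blast
  have m: "minv (a**g)**?s:NR" by (rule conj_set_eq_iff[OF sec(1)[OF aV[OF g]] aV[OF g] sec(2)[OF aV[OF g]]])
  have "minv a**?s = g**(minv (a**g)**?s)" by (simp add: minv_mult ia ig mm_assoc minv_cancel[OF ig])
  thus ?thesis using E(2)[OF g m] by simp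
 qed
 have HF: "H (F p) = p" if "p:topspace ?X" for p
 proof (rule extensionalityI[of _ "{..<k}"])
  show "H (F p) j = p j" if "j:{..<k}" for j using qsec[OF VE(1)[OF `p:topspace ?X`]] VE(2)[OF `p:topspace ?X`] that by (simp add: H_def F_def)
 qed (use tX that in \<open>auto simp: H_def\<close>)
 have tFT: "flag_manifold G<=topspace ?FT"
 proof -
  have "{g:GR. conj_set g BR:flag_manifold G} = GR" using flagI by blast
  hence "openin ?FT (flag_manifold G)" unfolding openin_flag_topology by simp
  thus ?thesis by (rule openin_subset)
 qed
 have \<pi>: "continuous_map (top_of_set GR) ?FT (%g. conj_set g BR)" unfolding continuous_map_def using flagI tFT by (auto simp: openin_flag_topology)
 have cV: "continuous_map ?X (top_of_set GR) (%p. a**V p)"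
 proof -
  \<comment> \<open>The offset \<open>l\<close> generalizes the claim to a suffix of the word, whose
    parameters start at index \<open>l\<close>.\<close>
  have "((%p. mx (C.ypr vs' (map p [l..<l + length vs']))) \<longlongrightarrow> mx (C.ypr vs' (map p0 [l..<l + length vs']))) (atin ?X p0)"
   if "vs':lists I" "l + length vs'<=k" "p0:topspace ?X" for vs' l p0 using that(1,2)
  proof (induction vs' arbitrary: l)
   case (Cons i vs')
   have i: "i:I" and l: "l < k" using Cons by auto
   have "continuous_map ?X (top_of_set {0<..}) (%p. p l)" by (rule continuous_map_product_projection) (use l in simp)
   hence "continuous_map ?X euclideanreal (%p. p l)" using continuous_map_into_fulltopology by blast
   hence "((%p. p l) \<longlongrightarrow> p0 l) (atin ?X p0)" using `p0:topspace ?X` unfolding continuous_map_atin by simp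
   hence "((%p. y i (p l)) \<longlongrightarrow> y i (p0 l)) (atin ?X p0)" by (rule rpol_tendsto[OF x_poly(2)[OF i]])
   moreover have "((%p. mx (C.ypr vs' (map p [Suc l..<Suc l + length vs']))) \<longlongrightarrow> mx (C.ypr vs' (map p0 [Suc l..<Suc l + length vs']))) (atin ?X p0)"
    by (rule Cons.IH) (use Cons.prems in auto)
   ultimately have "((%p. y i (p l)**mx (C.ypr vs' (map p [Suc l..<Suc l + length vs']))) \<longlongrightarrow> y i (p0 l)**mx (C.ypr vs' (map p0 [Suc l..<Suc l + length vs']))) (atin ?X p0)"
    by (rule mm_tendsto)
   moreover have "mx (C.ypr (i # vs') (map p [l..<l + length (i # vs')])) = y i (p l)**mx (C.ypr vs' (map p [Suc l..<Suc l + length vs']))" for p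
   proof -
    have "[l..<l + length (i # vs')] = l # [Suc l..<Suc l + length vs']" by (subst upt_conv_Cons) simp_all
    thus ?thesis by (simp only: list.map ypr_Cons mx_simps mxs(2)[OF i])
   qed
   ultimately show ?case by (simp only:)
  qed (simp add: C.ypr_def)
  from this[OF usI(2), of 0] have "(V \<longlongrightarrow> V p0) (atin ?X p0)" if "p0:topspace ?X" for p0 using that by (simp add: V_def[abs_def] L_def k_def)
  hence "continuous_map ?X euclidean (%p. a**V p)" unfolding continuous_map_atin by (auto intro!: mm_tendsto)
  thus ?thesis using VE(1) aV by (intro continuous_map_into_subtopology) auto
 qed
 have "continuous_map ?X ?FT F" using continuous_map_compose[OF cV \<pi>] by (simp add: F_def[abs_def] o_def)
 hence cF: "continuous_map ?X (subtopology ?FT ?S) F" using S by (intro continuous_map_into_subtopology) auto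
 have tS: "topspace (subtopology ?FT ?S) = ?S" using S continuous_map_image_subset_topspace[OF `continuous_map ?X ?FT F`] by auto
 have HS: "H B:topspace ?X" "F (H B) = B" if "B:?S" for B using that HF unfolding S by auto
 have comp: "continuous_map (subtopology ?FT ?S) (top_of_set {0<..}) (%B. H B j)" if j: "j < k" for j unfolding continuous_map_def
 proof (intro conjI allI impI)
  show "(%B. H B j):topspace (subtopology ?FT ?S) \<rightarrow> topspace (top_of_set {0<..})" using HS(1) tX j tS by auto
  fix O' :: "real set" assume "openin (top_of_set {0<..}) O'"
  then obtain W :: "real set" where W: "open W" "O' = {0<..} Int W" by (auto simp: openin_open)
  define A where "A = E Int q j -` W"
  have "openin (top_of_set E) A" unfolding A_def by (rule continuous_openin_preimage_gen[OF E(3) W(1)])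
  hence A: "openin (top_of_set GR) A" using E(1) by (rule openin_trans)
  define U where "U = (%g. conj_set (a**g) BR) ` A"
  have AE: "A<=E" by (auto simp: A_def)
  \<comment> \<open>Since \<open>A\<close> is saturated under \<open>NR\<close>, the elements of
    \<open>GR\<close> whose flag lies in \<open>U\<close> form exactly the translate of
    \<open>A\<close> by \<open>a\<close>.\<close>
  have pre: "{g:GR. conj_set g BR:U} = GR Int (%g. minv a**g) -` A"
  proof (rule equalityI; rule subsetI)
   fix g assume "g:{g:GR. conj_set g BR:U}"
   then obtain b where b: "g:GR" "b:A" "conj_set g BR = conj_set (a**b) BR" by (auto simp: U_def)
   have bE: "b:E" using b(2) AE by blast
   have ib: "invertible b" using sgGR(1) EG bE by blast
   have m: "minv (a**b)**g:NR" by (rule conj_set_eq_iff[OF b(1) aV[OF bE] b(3)])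
   have "minv a**g = b**(minv (a**b)**g)" by (simp add: minv_mult ia ib mm_assoc minv_cancel[OF ib])
   hence "minv a**g:A" using E(2)[OF bE m] b(2) by (simp add: A_def)
   thus "g:GR Int (%g. minv a**g) -` A" using b(1) by simp
  next
   fix g assume g: "g:GR Int (%g. minv a**g) -` A"
   have "g = a**(minv a**g)" by (simp add: minv_cancel[OF ia])
   hence "conj_set g BR = conj_set (a**(minv a**g)) BR" by simp
   thus "g:{g:GR. conj_set g BR:U}" using g by (auto simp: U_def)
  qed
  have "continuous_on GR (%g. minv a**g)" unfolding continuous_on_def by (auto intro!: mm_tendsto tendsto_ident_at)
  hence "openin (top_of_set GR) (GR Int (%g. minv a**g) -` A)" by (rule continuous_openin_preimage[OF _ _ A]) (use sgGR(3)[OF sgGR(4)[OF aG]] in auto)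
  moreover have "U<=flag_manifold G" using flagI aV AE by (auto simp: U_def)
  ultimately have "openin ?FT U" unfolding openin_flag_topology pre by simp
  moreover have "{B:topspace (subtopology ?FT ?S). H B j:O'} = ?S Int U"
  proof (rule equalityI; rule subsetI)
   fix B assume "B:{B:topspace (subtopology ?FT ?S). H B j:O'}"
   then obtain p where p: "p:topspace ?X" "B = F p" "H B j:W" "B:?S" using tS S W(2) by auto
   hence "V p:A" using VE[OF p(1)] HF[OF p(1)] j by (simp add: A_def)
   thus "B:?S Int U" using p by (auto simp: U_def F_def)
  next
   fix B assume B: "B:?S Int U"
   then obtain g where g: "g:A" "B = conj_set (a**g) BR" by (auto simp: U_def)
   hence "H B j:W" using qsec[of g] j by (auto simp: A_def H_def)
   moreover have "0 < H B j" using HS(1)[of B] B tX j by auto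
   ultimately show "B:{B:topspace (subtopology ?FT ?S). H B j:O'}" using B tS W(2) by simp
  qed
  ultimately show "openin (subtopology ?FT ?S) {B:topspace (subtopology ?FT ?S). H B j:O'}" unfolding openin_subtopology by (intro exI[of _ U]) auto
 qed
 have cH: "continuous_map (subtopology ?FT ?S) ?X H" unfolding continuous_map_componentwise using comp by (auto simp: H_def)
 have "homeomorphic_maps (subtopology ?FT ?S) ?X H F" unfolding homeomorphic_maps_def using cF cH HF HS(2) tS by auto
 thus ?thesis unfolding homeomorphic_space_def by blast
qed

end

text \<open>If the word is nonempty, then \<open>w0\<close> is a coset of \<open>T\<close> that is stable under the centralizer of \<open>T\<close>,
 because the latter acts on the first factor.\<close>

lemma centralizer_torus: assumes pin: "pinning G Bp Bm T I al alv x y" and ss: "semisimple G" and s: "!!i. i:I ==> s i = reflection G T (al i) (alv i)"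
  and w0: "is_longest (weyl_group G T) I s w0" "reduced_expression (weyl_group G T) I s w0 ws" and ws: "ws~=[]" and g: "g:G" "!!t. t:T ==> g**t = t**g" shows "g:T"
proof -
 interpret pinning G Bp Bm T I al alv x y by (rule pin)
 have clG: "subgroup G GL" using ss by (simp add: semisimple_def closed_subgroup_def)
 have torT: "subgroup T GL" "T<=G" using split_T maximal_torus_T by (auto simp: split_torus_def torus_def closed_subgroup_def maximal_torus_def)
 note sG = subgroupD[OF clG] and sT = subgroupD[OF torT(1)] obtain i us where wi: "ws = i # us" using ws by (cases ws) auto
 let ?W = "weyl_group G T"
 have w: "w0:carrier ?W" "word_product ?W s ws = w0" "i:I" using w0 wi by (auto simp: is_longest_def reduced_expression_def)
 have ig: "invertible g" using sG(1)[OF g(1)] .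
 have gr: "g**m:s i" if m: "m:s i" for m
 proof -
  have m1: "m:G" "(%t. m**t**minv m) ` T = T" "!!t. t:T ==> m**t**minv m = t**alv i (inverse (al i t))" using m unfolding s[OF w(3)] reflection_def normalizer_iff[OF clG torT(2)] by auto
  have im: "invertible m" using sG(1)[OF m1(1)] .
  have e: "(g**m)**t**minv (g**m) = m**t**minv m" if t: "t:T" for t
  proof -
   have "m**t**minv m:T" using m1(2) t by blast
   hence "g**(m**t**minv m)**minv g = (m**t**minv m)**g**minv g" using g(2) by simp
   thus ?thesis by (simp add: minv_mult ig im mm_assoc minv[OF ig])
  qed
  hence "(%t. (g**m)**t**minv (g**m)) ` T = T" using m1(2) by (simp cong: image_cong)
  thus ?thesis using sG(3)[OF g(1) m1(1)] e m1(3) unfolding s[OF w(3)] reflection_def normalizer_iff[OF clG torT(2)] by simp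
 qed
 have w0p: "w0 = {h**k |h k. h:s i & k:word_product ?W s us}" using w(2) by (auto simp: wi word_product_def weyl_group_def FactGroup_def set_mult_def GL_def)
 obtain c where c: "c:G" "w0 = (%t. t**c) ` T" using w(1) normalizer_iff[OF clG torT(2)] by (auto simp: weyl_group_def FactGroup_def RCOSETS_def r_coset_def GL_def)
 have ic: "invertible c" using sG(1)[OF c(1)] .
 have "c:w0" unfolding c(2) by (rule image_eqI[of _ _ "mat 1"]) (simp_all add: sT(2))
 then obtain h k where hk: "h:s i" "k:word_product ?W s us" "c = h**k" unfolding w0p by blast
 have "g**c = (g**h)**k" by (simp add: hk(3) mm_assoc)
 hence "g**c:w0" unfolding w0p using gr[OF hk(1)] hk(2) by blast
 then obtain t where t: "t:T" "g**c = t**c" unfolding c(2) by blast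
 hence "g**c**minv c = t**c**minv c" by simp
 hence "g = t" by (simp add: mm_assoc minv[OF ic])
 thus ?thesis using t(1) by simp
qed

text \<open>With the empty word the only positive flag is \<open>Bp\<close> itself, so the fibre is
  a point and matches the empty product.\<close>

lemma fibre_Nil: assumes pin: "pinning G Bp Bm T I al alv x y" and sG: "subgroup G GL" and ne: "pos_fibre Bp y [] P~={}" shows "subtopology (flag_topology G Bp) (pos_fibre Bp y [] P)
      homeomorphic_space product_topology (%_. top_of_set {0::real<..}) {..<0::nat}"
proof -
 interpret pinning G Bp Bm T I al alv x y by (rule pin)
 have "flag_pos Bp y [] = {real_points Bp}" by (auto simp: flag_pos_def U_pos_def conj_set_def)
 hence S: "pos_fibre Bp y [] P = {real_points Bp}" using ne by (auto simp: pos_fibre_def)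
 have "real_points Bp:flag_manifold G" unfolding flag_manifold_def using borel_Bp by blast
 moreover have "{g:real_points G. conj_set g (real_points Bp):flag_manifold G} = real_points G" using flag_conj[OF sG borel_Bp] by blast
 hence "openin (flag_topology G Bp) (flag_manifold G)" unfolding openin_flag_topology by simp
 ultimately have "real_points Bp:topspace (flag_topology G Bp)" using openin_subset by blast
 hence t: "topspace (subtopology (flag_topology G Bp) {real_points Bp}) = {real_points Bp}" by auto
 have "homeomorphic_maps (subtopology (flag_topology G Bp) {real_points Bp}) (product_topology (%_. top_of_set {0::real<..}) {..<0::nat})
   (%_ _. undefined) (%_. real_points Bp)" unfolding homeomorphic_maps_def continuous_map_const t by auto
 thus ?thesis unfolding S homeomorphic_space_def by blast
qed

theorem mainTheorem4:
  fixes G Bp Bm T :: "(complex^'n^'n) set"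
    and I J :: "'i set"
    and \<alpha> :: "'i \<Rightarrow> complex^'n^'n \<Rightarrow> complex"
    and \<alpha>v :: "'i \<Rightarrow> complex \<Rightarrow> complex^'n^'n"
    and x y :: "'i \<Rightarrow> real \<Rightarrow> complex^'n^'n"
    and s :: "'i \<Rightarrow> (complex^'n^'n) set"
    and w0 :: "(complex^'n^'n) set"
    and ws :: "'i list"
    and P :: "(complex^'n^'n) set"
  assumes "algebraic_group_over_reals G"
    and "zariski_connected G"
    and "semisimple G"
    and "split_group G"
    and "pinning G Bp Bm T I \<alpha> \<alpha>v x y"
    and "simply_connected_group G T"
    and "simply_laced_group G T Bp"
    and "\<And>i. i \<in> I \<Longrightarrow> s i = reflection G T (\<alpha> i) (\<alpha>v i)"
    and "is_longest (weyl_group G T) I s w0"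
    and "reduced_expression (weyl_group G T) I s w0 ws"
    and "J \<subseteq> I"
    and "P \<in> partial_flag_pos G Bp y ws J"
  shows "\<exists>k::nat. subtopology (flag_topology G Bp) (pos_fibre Bp y ws P)
           homeomorphic_space product_topology (\<lambda>_. top_of_set {0::real<..}) {..<k}"
proof (cases "ws = []")
  case True
  have "pos_fibre Bp y [] P \<noteq> {}" using assms(12) by (simp add: True partial_flag_pos_def)
  moreover have "subgroup G GL" using assms(3) by (simp add: semisimple_def closed_subgroup_def)
  ultimately show ?thesis using fibre_Nil[OF assms(5)] unfolding True by blast
next
  case False
  interpret pinning G Bp Bm T I \<alpha> \<alpha>v x y by (rule assms(5))
  interpret pin G Bp Bm T I \<alpha> \<alpha>v x y
  proof
    show "zariski_closed \<real> G" using assms(1) by (simp add: algebraic_group_over_reals_def)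
    show "g \<in> T" if "g \<in> G" "\<And>t. t \<in> T \<Longrightarrow> g ** t = t ** g" for g
      using centralizer_torus[OF assms(5,3,8,9,10) False that] by blast
  qed (rule assms(3,7))+
  show ?thesis by (rule fibre_homeomorphic[OF longest_red[OF assms(8,9,10)] assms(11,12)])
qed

end
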